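(* Let $\mathbb{F}$ be a field, and let $\mathrm{AR}(T_k)$ denote the asymptotic rank over $\mathbb{F}$ of the tensor $T_k$ defined below. For every $k \in \mathbb{N}$ and every $\varepsilon > 0$, there is a randomized algorithm for the Balanced Tripartitioning problem (on a universe of size $3n$) with running time \[\left( \frac{(\mathrm{AR}(T_k) + \varepsilon)\cdot 27^k}{\binom{3k}{k}\binom{2k}{k}} \right)^{n/k}.\]
   Context: Balanced Tripartitioning: given $n$ and families $\mathcal{F}_1, \mathcal{F}_2, \mathcal{F}_3 \subseteq \binom{[3n]}{n}$ (subsets of $[3n]=\{1,\dots,3n\}$ of size exactly $n$), decide whether there exist $S_i \in \mathcal{F}_i$ ($i=1,2,3$) with $S_1 \cup S_2 \cup S_3 = [3n]$. A randomized algorithm here may err with bounded probability (e.g. always rejects "no" instances and accepts "yes" instances with constant probability). Arithmetic on $n$-bit elements of the prime field of $\mathbb{F}$ is assumed to take $\mathrm{poly}(n)$ time. A tensor of dimension $N$ is a trilinear form $T:\mathbb{F}^N\times\mathbb{F}^N\times\mathbb{F}^N\to\mathbb{F}$, written as $\sum_{i,j,k} a_{ijk}X_iY_jZ_k$. $T$ has rank one if $T = (\sum a_iX_i)(\sum b_jY_j)(\sum c_kZ_k)$; the tensor rank $\mathbf{R}(T)$ is the minimum $r$ such that $T$ is an $\mathbb{F}$-linear combination of $r$ rank-one tensors. The Kronecker product of $T=\sum a_{ijk}X_iY_jZ_k$ and $T'=\sum b_{i'j'k'}X_{i'}Y_{j'}Z_{k'}$ is $T\otimes T' = \sum a_{ijk}b_{i'j'k'}X_{(i,i')}Y_{(j,j')}Z_{(k,k')}$,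 and $T^{\otimes r}$ is the $r$-fold Kronecker power. The asymptotic rank is $\mathrm{AR}(T) := \lim_{r\to\infty}\mathbf{R}(T^{\otimes r})^{1/r}$. For $k \in \mathbb{N}$, $T_k$ is the tensor with variables indexed by $\binom{[3k]}{k}$: \[T_k := \sum_{\substack{S,T,U \in \binom{[3k]}{k}\\ S\cup T\cup U = [3k]}} X_S Y_T Z_U.\] *)

theory Defs
  imports
    "HOL-Probability.Probability"
    "HOL-Library.Nat_Bijection"
    "HOL-Library.Log_Nat"
    "HOL-Library.Ramsey"
begin

section \<open>Tensors, tensor rank, asymptotic rank\<close>

text \<open>
  A tensor \<open>\<Sum> a\<^sub>i\<^sub>j\<^sub>l X\<^sub>i Y\<^sub>j Z\<^sub>l\<close> is given by its coefficients over an index set; the values of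
  \<open>coeff\<close> outside the index set are irrelevant to every notion below.
\<close>

record ('i, 'f) tensor =
  indices :: "'i set"
  coeff :: "'i \<Rightarrow> 'i \<Rightarrow> 'i \<Rightarrow> 'f"

definition rank_one :: "('i, 'f::field) tensor \<Rightarrow> bool" where
  "rank_one T \<longleftrightarrow> (\<exists>a b c. \<forall>i\<in>indices T. \<forall>j\<in>indices T. \<forall>l\<in>indices T.
     coeff T i j l = a i * b j * c l)"

definition lin_comb_of_rank_ones :: "('i, 'f::field) tensor \<Rightarrow> nat \<Rightarrow> bool" where
  "lin_comb_of_rank_ones T r \<longleftrightarrow>
     (\<exists>(w :: nat \<Rightarrow> 'f) (S :: nat \<Rightarrow> ('i, 'f) tensor).
        (\<forall>q<r. indices (S q) = indices T \<and> rank_one (S q)) \<and>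
        (\<forall>i\<in>indices T. \<forall>j\<in>indices T. \<forall>l\<in>indices T.
           coeff T i j l = (\<Sum>q<r. w q * coeff (S q) i j l)))"

definition tensor_rank :: "('i, 'f::field) tensor \<Rightarrow> nat" where
  "tensor_rank T = (LEAST r. lin_comb_of_rank_ones T r)"

definition kronecker ::
  "('i, 'f::field) tensor \<Rightarrow> ('j, 'f) tensor \<Rightarrow> ('i \<times> 'j, 'f) tensor" where
  "kronecker T T' =
     \<lparr> indices = indices T \<times> indices T',
       coeff = (\<lambda>(i, i') (j, j') (l, l'). coeff T i j l * coeff T' i' j' l') \<rparr>"

text \<open>
  The nested index pairs \<open>(i\<^sub>1, (i\<^sub>2, \<dots>))\<close> of an \<open>r\<close>-fold Kronecker product are renamed to lists
  of length \<open>r\<close>, so that all powers of a tensor have the same type.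
\<close>

primrec kronecker_power :: "('i, 'f::field) tensor \<Rightarrow> nat \<Rightarrow> ('i list, 'f) tensor" where
  "kronecker_power T 0 = \<lparr> indices = {[]}, coeff = (\<lambda>_ _ _. 1) \<rparr>"
| "kronecker_power T (Suc r) =
     (let P = kronecker T (kronecker_power T r) in
      \<lparr> indices = (\<lambda>(i, is). i # is) ` indices P,
        coeff = (\<lambda>x y z. coeff P (hd x, tl x) (hd y, tl y) (hd z, tl z)) \<rparr>)"

definition asymptotic_rank :: "('i, 'f::field) tensor \<Rightarrow> real" where
  "asymptotic_rank T = lim (\<lambda>r. root r (real (tensor_rank (kronecker_power T r))))"

definition tripartition_tensor :: "nat \<Rightarrow> (nat set, 'f::field) tensor" where
  "tripartition_tensor k =
     \<lparr> indices = nsets {1..3 * k} k,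
       coeff = (\<lambda>S T U. if S \<union> T \<union> U = {1..3 * k} then 1 else 0) \<rparr>"


section \<open>Randomized random access machines\<close>

text \<open>
  The machine model is a RAM with fair coin flips under the logarithmic cost criterion. Programs
  are structured and use finitely many named memories, each a zero-initialized array of natural
  numbers of unbounded length; a scalar variable is cell 0 of a memory. (Interleaving the finitely
  many memories into a single one changes costs by a constant factor only.) A program is a finite
  object, hence uniform in the input.
\<close>

datatype binop = ADD | SUB | MUL | DIV | MOD | LESS | EQ

datatype aexp = NUM nat | MEM string aexp | OP binop aexp aexp

datatype com =
    SKIP
  | ASSIGN string aexp aexp  \<comment> \<open>\<open>ASSIGN X a b\<close> is \<open>X[a] := b\<close>\<close>
  | FLIP string aexp         \<comment> \<open>\<open>FLIP X a\<close> sets \<open>X[a]\<close> to a fresh fair random bit\<close>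
  | SEQ com com
  | IF aexp com com          \<comment> \<open>a condition holds iff its value is nonzero\<close>
  | WHILE aexp com

type_synonym state = "string \<Rightarrow> nat \<Rightarrow> nat"

fun apply_op :: "binop \<Rightarrow> nat \<Rightarrow> nat \<Rightarrow> nat" where
  "apply_op ADD x y = x + y"
| "apply_op SUB x y = x - y"
| "apply_op MUL x y = x * y"
| "apply_op DIV x y = x div y"
| "apply_op MOD x y = x mod y"
| "apply_op LESS x y = of_bool (x < y)"
| "apply_op EQ x y = of_bool (x = y)"

definition bit_len :: "nat \<Rightarrow> nat" where
  "bit_len x = max 1 (floorlog 2 x)"

primrec aval :: "aexp \<Rightarrow> state \<Rightarrow> nat" where
  "aval (NUM x) s = x"
| "aval (MEM X a) s = s X (aval a s)"
| "aval (OP f a b) s = apply_op f (aval a s) (aval b s)"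

text \<open>Every operation is charged the bit lengths of its operands, memory addresses included.\<close>

primrec acost :: "aexp \<Rightarrow> state \<Rightarrow> nat" where
  "acost (NUM x) s = bit_len x"
| "acost (MEM X a) s = acost a s + bit_len (aval a s) + bit_len (s X (aval a s))"
| "acost (OP f a b) s = acost a s + acost b s + bit_len (aval a s) + bit_len (aval b s)"

definition store :: "string \<Rightarrow> nat \<Rightarrow> nat \<Rightarrow> state \<Rightarrow> state" where
  "store X a x s = s(X := (s X)(a := x))"

text \<open>One small step: the remaining program, the new state, and the cost of the step.\<close>

primrec step :: "com \<Rightarrow> state \<Rightarrow> (com \<times> state \<times> nat) pmf" where
  "step SKIP s = return_pmf (SKIP, s, 0)"
| "step (ASSIGN X a b) s =
     return_pmf (SKIP, store X (aval a s) (aval b s) s,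
       acost a s + acost b s + bit_len (aval a s) + bit_len (aval b s))"
| "step (FLIP X a) s =
     map_pmf (\<lambda>b. (SKIP, store X (aval a s) (of_bool b) s, acost a s + bit_len (aval a s) + 1))
       (bernoulli_pmf (1/2))"
| "step (SEQ c d) s =
     (if c = SKIP then return_pmf (d, s, 1)
      else map_pmf (\<lambda>(c', s', t). (SEQ c' d, s', t)) (step c s))"
| "step (IF a c d) s =
     return_pmf (if aval a s \<noteq> 0 then c else d, s, acost a s + bit_len (aval a s))"
| "step (WHILE a c) s = return_pmf (IF a (SEQ c (WHILE a c)) SKIP, s, 1)"

text \<open>The distribution after \<open>m\<close> steps, with accumulated cost. \<open>SKIP\<close> is the halted program.\<close>

primrec run :: "nat \<Rightarrow> com \<Rightarrow> state \<Rightarrow> (com \<times> state \<times> nat) pmf" where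
  "run 0 c s = return_pmf (c, s, 0)"
| "run (Suc m) c s =
     do {
       (c', s', t) \<leftarrow> step c s;
       (c'', s'', t') \<leftarrow> run m c' s';
       return_pmf (c'', s'', t + t')
     }"

text \<open>
  On every outcome of the coin flips the program halts with cost at most \<open>B\<close>, and with
  probability at least 2/3 it answers correctly; it accepts by leaving 1 in the cell \<open>out[0]\<close>.
\<close>

definition decides_within :: "com \<Rightarrow> state \<Rightarrow> bool \<Rightarrow> real \<Rightarrow> bool" where
  "decides_within c s answer B \<longleftrightarrow>
     (\<exists>m. (\<forall>(c', s', t) \<in> set_pmf (run m c s). c' = SKIP \<and> real t \<le> B) \<and>
          measure_pmf.prob (run m c s) {(c', s', t). (s' ''out'' 0 = 1) = answer} \<ge> 2/3)"


section \<open>Balanced Tripartitioning\<close>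

definition balanced_tripartition ::
  "nat \<Rightarrow> nat set set \<Rightarrow> nat set set \<Rightarrow> nat set set \<Rightarrow> bool" where
  "balanced_tripartition n F1 F2 F3 \<longleftrightarrow>
     (\<exists>S1\<in>F1. \<exists>S2\<in>F2. \<exists>S3\<in>F3. S1 \<union> S2 \<union> S3 = {1..3 * n})"

text \<open>
  A family is presented as a list of its members without repetitions, in an arbitrary order.
  Its length is in cell 0 and its members are in the following cells, each as a bit mask of
  \<open>3n + 1\<close> bits (\<open>set_encode S\<close> is the sum of \<open>2^i\<close> over \<open>i \<in> S\<close>).
\<close>

definition array_of :: "nat list \<Rightarrow> nat \<Rightarrow> nat" where
  "array_of xs i = (if i < length xs then xs ! i else 0)"

definition family_array :: "nat set list \<Rightarrow> nat \<Rightarrow> nat" where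
  "family_array L = array_of (length L # map set_encode L)"

definition instance_state ::
  "nat \<Rightarrow> nat set list \<Rightarrow> nat set list \<Rightarrow> nat set list \<Rightarrow> state" where
  "instance_state n L1 L2 L3 =
     (\<lambda>_ _. 0)(''n'' := array_of [n], ''F1'' := family_array L1,
               ''F2'' := family_array L2, ''F3'' := family_array L3)"

definition lists_family :: "nat \<Rightarrow> nat set list \<Rightarrow> nat set set \<Rightarrow> bool" where
  "lists_family n L F \<longleftrightarrow> distinct L \<and> set L = F \<and> F \<subseteq> nsets {1..3 * n} n"

text \<open>Running time \<open>f\<close> is understood up to a constant factor that is uniform in all instances.\<close>

definition solves_balanced_tripartitioning_in_time :: "com \<Rightarrow> (nat \<Rightarrow> real) \<Rightarrow> bool" where
  "solves_balanced_tripartitioning_in_time c f \<longleftrightarrow>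
     (\<exists>C::real. \<forall>n F1 F2 F3 L1 L2 L3.
        lists_family n L1 F1 \<longrightarrow> lists_family n L2 F2 \<longrightarrow> lists_family n L3 F3 \<longrightarrow>
        decides_within c (instance_state n L1 L2 L3) (balanced_tripartition n F1 F2 F3) (C * f n))"

end

theory Submission
  imports Defs "HOL-Computational_Algebra.Polynomial" "HOL-Combinatorics.Multiset_Permutations"
begin

text \<open>
  Choose \<open>r\<close> such that the rank \<open>R\<close> of the \<open>r\<close>-th Kronecker power of \<open>T\<^sub>k\<close> is at most \<open>(AR + \<epsilon>/2)\<^sup>r\<close>;
  the limit exists by Fekete's lemma. The coefficients of an optimal decomposition generate a
  subring of the field, and a finitely generated subring of a field has a proper ideal of finite
  index (for \<open>A[a]\<close>, divide modulo a suitable polynomial with leading coefficient a unit modulo an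
  ideal of \<open>A\<close>). Since \<open>T\<^sub>k\<close> has coefficients 0 and 1, the decomposition survives in the finite
  quotient ring, whose operations are tables of constant size.

  Pad the universe to \<open>3krm\<close> elements with \<open>krm > n\<close>. A uniformly random permutation splits a
  given solution evenly in every block of \<open>3k\<close> slots with probability at least
  \<open>(binom(3k,k) binom(2k,k) / 27\<^sup>k)\<^sup>r\<^sup>m\<close>. A repetition draws a permutation, keeps every candidate set
  that is a member of its family with probability 1/2, and evaluates the \<open>m\<close>-th Kronecker power of the
  decomposed tensor on the resulting 0/1 vectors by Yates's algorithm, in about \<open>R\<^sup>m\<close> steps. Without
  a solution the value is 0. If a solution is split evenly, the alternating sum of the values over
  the eight choices of its three weights is 1, so the value is nonzero with probability at least 1/8.
  Polynomial factors, and the size of the input, are absorbed by the remaining \<open>\<epsilon>/2\<close>, because flattening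
  gives \<open>R \<ge> binom(3k,k)\<^sup>r\<close>.
\<close>

section \<open>Residual finiteness of finitely generated subrings of fields\<close>

text \<open>The field may be uncountable or lack computable arithmetic, so a program cannot
  calculate with the coefficients of a decomposition. Only a finite image of the ring that they
  generate fits into a program text.

  Without weights the value could vanish although solutions exist, because the number of solutions
  may be zero in the finite ring. The random weights isolate a single solution instead of counting
  all of them.

  Disjointness never has to be tested: three n-sets that cover 3n points are disjoint. Each family
  gets dummies of its own, so the padded sets keep this property.

  Constants: reducing random bits modulo a factorial to obtain a permutation loses a factor 2, and
  the three weights lose 8, hence 16 in all. Repeating 32 times the inverse of the bound on the
  splitting probability pushes the failure probability below exp(-2), which is less than 1/3.

  All coins are flipped before any of them is read. What follows is deterministic and can be treated
  by a Hoare-style calculus with costs; probability enters only as counting of bit lists.\<close>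

definition subring_of :: "'f::field set \<Rightarrow> bool" where
  "subring_of A \<longleftrightarrow> 1 \<in> A \<and> (\<forall>x\<in>A. \<forall>y\<in>A. x - y \<in> A \<and> x * y \<in> A)"

lemma subring_of_one: "subring_of A \<Longrightarrow> 1 \<in> A"
  and subring_of_diff: "subring_of A \<Longrightarrow> x \<in> A \<Longrightarrow> y \<in> A \<Longrightarrow> x - y \<in> A"
  and subring_of_mult: "subring_of A \<Longrightarrow> x \<in> A \<Longrightarrow> y \<in> A \<Longrightarrow> x * y \<in> A"
  by (auto simp: subring_of_def)

lemma subring_of_zero: "subring_of A \<Longrightarrow> 0 \<in> A"
  using subring_of_diff[of A 1 1] by (simp add: subring_of_one)

lemma subring_of_uminus: "subring_of A \<Longrightarrow> x \<in> A \<Longrightarrow> - x \<in> A"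
  using subring_of_diff[of A 0 x] by (simp add: subring_of_zero)

lemma subring_of_add: "subring_of A \<Longrightarrow> x \<in> A \<Longrightarrow> y \<in> A \<Longrightarrow> x + y \<in> A"
  using subring_of_diff[of A x "- y"] by (simp add: subring_of_uminus)

lemma subring_of_sum: "subring_of A \<Longrightarrow> (\<And>i. i \<in> S \<Longrightarrow> f i \<in> A) \<Longrightarrow> sum f S \<in> A"
  by (induction S rule: infinite_finite_induct) (auto simp: subring_of_zero subring_of_add)

lemma subring_of_power: "subring_of A \<Longrightarrow> x \<in> A \<Longrightarrow> x ^ n \<in> A"
  by (induction n) (auto simp: subring_of_one subring_of_mult)

definition ideal_of :: "'f::field set \<Rightarrow> 'f set \<Rightarrow> bool" where
  "ideal_of I A \<longleftrightarrow> I \<subseteq> A \<and> 0 \<in> I \<and> (\<forall>x\<in>I. \<forall>y\<in>I. x - y \<in> I) \<and> (\<forall>x\<in>A. \<forall>y\<in>I. x * y \<in> I)"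

lemma ideal_ofD:
  assumes "ideal_of I A"
  shows "x \<in> I \<Longrightarrow> x \<in> A" "0 \<in> I" "x \<in> I \<Longrightarrow> y \<in> I \<Longrightarrow> x - y \<in> I"
    "x \<in> I \<Longrightarrow> y \<in> I \<Longrightarrow> x + y \<in> I" "x \<in> I \<Longrightarrow> - x \<in> I"
    "x \<in> A \<Longrightarrow> y \<in> I \<Longrightarrow> x * y \<in> I" "y \<in> A \<Longrightarrow> x \<in> I \<Longrightarrow> x * y \<in> I"
proof -
  note I = assms[unfolded ideal_of_def]
  show "x \<in> I \<Longrightarrow> x \<in> A" "0 \<in> I" "x \<in> I \<Longrightarrow> y \<in> I \<Longrightarrow> x - y \<in> I"
    "x \<in> A \<Longrightarrow> y \<in> I \<Longrightarrow> x * y \<in> I" using I by auto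
  show "y \<in> A \<Longrightarrow> x \<in> I \<Longrightarrow> x * y \<in> I" using I by (metis mult.commute)
  have m: "- y \<in> I" if "y \<in> I" for y using I that by (metis diff_0)
  thus "x \<in> I \<Longrightarrow> - x \<in> I" .
  show "x \<in> I \<Longrightarrow> y \<in> I \<Longrightarrow> x + y \<in> I" using I m by (metis diff_minus_eq_add)
qed

lemma ideal_of_sum: "ideal_of I A \<Longrightarrow> (\<And>i. i \<in> S \<Longrightarrow> f i \<in> I) \<Longrightarrow> sum f S \<in> I"
  by (induction S rule: infinite_finite_induct) (auto simp: ideal_ofD)

definition finite_quotient :: "'f::field set \<Rightarrow> 'f set \<Rightarrow> bool" where
  "finite_quotient A I \<longleftrightarrow> (\<exists>T. finite T \<and> T \<subseteq> A \<and> (\<forall>x\<in>A. \<exists>y\<in>T. x - y \<in> I))"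

text \<open>A prescribed nonzero \<open>b\<close> has to become a unit, which is more than staying
  nonzero: the induction over generators divides by polynomials whose leading coefficient must be
  invertible modulo the ideal. The case \<open>b = 1\<close> yields the proper ideal of finite index
  that is finally used.\<close>

definition residually_finite :: "'f::field set \<Rightarrow> bool" where
  "residually_finite A \<longleftrightarrow> (\<forall>b\<in>A. b \<noteq> 0 \<longrightarrow>
     (\<exists>I. ideal_of I A \<and> finite_quotient A I \<and> 1 \<notin> I \<and> (\<exists>b'\<in>A. b * b' - 1 \<in> I)))"

section \<open>Polynomials over a subring and division modulo an ideal\<close>

abbreviation polys_over :: "'f::field set \<Rightarrow> 'f poly set" where
  "polys_over A \<equiv> {p. \<forall>i. poly.coeff p i \<in> A}"

definition adjoin :: "'f::field set \<Rightarrow> 'f \<Rightarrow> 'f set" where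
  "adjoin A a = (\<lambda>p. poly p a) ` polys_over A"

lemma polys_over_closed:
  assumes "subring_of A"
  shows "p \<in> polys_over A \<Longrightarrow> q \<in> polys_over A \<Longrightarrow> p - q \<in> polys_over A"
    "p \<in> polys_over A \<Longrightarrow> q \<in> polys_over A \<Longrightarrow> p + q \<in> polys_over A"
    "p \<in> polys_over A \<Longrightarrow> q \<in> polys_over A \<Longrightarrow> p * q \<in> polys_over A"
    "c \<in> A \<Longrightarrow> monom c n \<in> polys_over A"
    "c \<in> A \<Longrightarrow> p \<in> polys_over A \<Longrightarrow> smult c p \<in> polys_over A"
    "1 \<in> polys_over A" "0 \<in> polys_over A"
    "c \<in> A \<Longrightarrow> p \<in> polys_over A \<Longrightarrow> pCons c p \<in> polys_over A"
  using assms
  by (auto simp: subring_of_diff subring_of_add subring_of_mult subring_of_zero subring_of_one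
      coeff_mult coeff_pCons intro!: subring_of_sum split: nat.splits)

lemma subring_of_adjoin:
  assumes "subring_of A"
  shows "subring_of (adjoin A a)"
proof -
  have "1 \<in> adjoin A a" unfolding adjoin_def
    using polys_over_closed(6)[OF assms] by (intro image_eqI[of _ _ 1]) auto
  moreover have "x - y \<in> adjoin A a" "x * y \<in> adjoin A a" if xy: "x \<in> adjoin A a" "y \<in> adjoin A a" for x y
  proof -
    obtain p q where pq: "x = poly p a" "p \<in> polys_over A" "y = poly q a" "q \<in> polys_over A"
      using xy unfolding adjoin_def by blast
    show "x - y \<in> adjoin A a" unfolding adjoin_def
      using polys_over_closed(1)[OF assms pq(2,4)] by (intro image_eqI[of _ _ "p - q"]) (auto simp: pq)
    show "x * y \<in> adjoin A a" unfolding adjoin_def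
      using polys_over_closed(3)[OF assms pq(2,4)] by (intro image_eqI[of _ _ "p * q"]) (auto simp: pq)
  qed
  ultimately show ?thesis by (auto simp: subring_of_def)
qed

lemma adjoin_superset: "subring_of A \<Longrightarrow> A \<subseteq> adjoin A a"
proof
  fix x assume "subring_of A" "x \<in> A"
  thus "x \<in> adjoin A a" unfolding adjoin_def
    using polys_over_closed(4)[of A x 0] by (intro image_eqI[of _ _ "monom x 0"]) (auto simp: poly_monom)
qed

lemma adjoin_mem: "subring_of A \<Longrightarrow> a \<in> adjoin A a"
  unfolding adjoin_def
  using polys_over_closed(4)[of A 1 1]
  by (intro image_eqI[of _ _ "monom 1 1"]) (auto simp: poly_monom subring_of_one)

text \<open>The ideal \<open>I A[X] + g A[X]\<close>. Its image under evaluation at \<open>a\<close>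
  is the ideal of \<open>A[a]\<close> that is wanted; properness is settled here, before evaluation,
  where degrees are available.\<close>

definition poly_ideal :: "'f::field set \<Rightarrow> 'f set \<Rightarrow> 'f poly \<Rightarrow> 'f poly set" where
  "poly_ideal A I g = {p + g * q | p q. p \<in> polys_over I \<and> q \<in> polys_over A}"

lemma poly_ideal_mono_base: 
  assumes "subring_of A" "p \<in> polys_over I" shows "p \<in> poly_ideal A I g"
  unfolding poly_ideal_def using assms polys_over_closed(7)[OF assms(1)]
  by (intro CollectI exI[of _ p] exI[of _ 0]) auto

lemma polys_over_ideal_mult:
  assumes "ideal_of I A" "p \<in> polys_over A" "q \<in> polys_over I"
  shows "p * q \<in> polys_over I"
  using assms by (auto simp: coeff_mult ideal_ofD intro!: ideal_of_sum)

text \<open>Modulo \<open>I\<close> the leading coefficient of \<open>g\<close> is a unit, so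
  multiplying by \<open>g\<close> raises degrees. If \<open>n\<close> is the degree of
  \<open>q\<close> modulo \<open>I\<close>, then \<open>g * q\<close> has a coefficient outside
  \<open>I\<close> at the positive degree \<open>degree g + n\<close>, where \<open>1 - p\<close>
  has its coefficient in \<open>I\<close>.\<close>

lemma one_notin_poly_ideal:
  assumes A: "subring_of A" and I: "ideal_of I A" "1 \<notin> I"
    and g: "g \<in> polys_over A" "degree g \<ge> 1" "t \<in> A" "lead_coeff g * t - 1 \<in> I"
  shows "1 \<notin> poly_ideal A I g"
proof
  assume "1 \<in> poly_ideal A I g"
  then obtain p q where pq: "1 = p + g * q" "p \<in> polys_over I" "q \<in> polys_over A"
    by (auto simp: poly_ideal_def)
  show False
  proof (cases "q \<in> polys_over I")
    case True
    have "poly.coeff p 0 + poly.coeff (g * q) 0 \<in> I"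
      using pq(2) polys_over_ideal_mult[OF I(1) g(1) True] by (intro ideal_ofD(4)[OF I(1)]) auto
    also have "poly.coeff p 0 + poly.coeff (g * q) 0 = poly.coeff 1 0"
      unfolding pq(1) by (rule coeff_add[symmetric])
    finally show False using I(2) by simp
  next
    case False
    define n where "n = Max {j. poly.coeff q j \<notin> I}"
    have fin: "finite {j. poly.coeff q j \<notin> I}"
      by (rule finite_subset[of _ "{..degree q}"]) (auto simp: ideal_ofD[OF I(1)] intro: le_degree)
    have n: "poly.coeff q n \<notin> I" using Max_in[OF fin] False unfolding n_def by auto
    have gt: "poly.coeff q j \<in> I" if "j > n" for j using Max_ge[OF fin, of j] that unfolding n_def by auto
    let ?d = "degree g"
    have sub: "{..?d + n} = insert ?d ({..?d + n} - {?d})" by auto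
    have "poly.coeff (g * q) (?d + n) = (\<Sum>i\<le>?d + n. poly.coeff g i * poly.coeff q (?d + n - i))"
      by (rule coeff_mult)
    also have "\<dots> = lead_coeff g * poly.coeff q n + (\<Sum>i\<in>{..?d + n} - {?d}. poly.coeff g i * poly.coeff q (?d + n - i))"
      by (subst sub, subst sum.insert) auto
    finally have eq: "poly.coeff (g * q) (?d + n) - (\<Sum>i\<in>{..?d + n} - {?d}. poly.coeff g i * poly.coeff q (?d + n - i))
       = lead_coeff g * poly.coeff q n" by simp
    have "(\<Sum>i\<in>{..?d + n} - {?d}. poly.coeff g i * poly.coeff q (?d + n - i)) \<in> I"
    proof (rule ideal_of_sum[OF I(1)])
      fix i assume "i \<in> {..?d + n} - {?d}"
      hence "i < ?d \<or> i > ?d" by auto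
      thus "poly.coeff g i * poly.coeff q (?d + n - i) \<in> I"
      proof
        assume "i < ?d"
        hence "poly.coeff q (?d + n - i) \<in> I" by (intro gt) auto
        thus ?thesis using g by (auto simp: ideal_ofD[OF I(1)])
      next
        assume "i > ?d"
        thus ?thesis by (simp add: coeff_eq_0 ideal_ofD[OF I(1)])
      qed
    qed
    moreover have "poly.coeff (g * q) (?d + n) \<in> I"
    proof -
      have "poly.coeff (p + g * q) (?d + n) = 0"
        using g(2) by (simp add: pq(1)[symmetric] coeff_eq_0)
      hence "poly.coeff (g * q) (?d + n) = - poly.coeff p (?d + n)" by (simp add: add_eq_0_iff)
      thus ?thesis using pq by (simp add: ideal_ofD[OF I(1)])
    qed
    ultimately have "lead_coeff g * poly.coeff q n \<in> I"
      unfolding eq[symmetric] by (rule ideal_ofD(3)[OF I(1), rotated])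
    hence "t * (lead_coeff g * poly.coeff q n) \<in> I" by (rule ideal_ofD(6)[OF I(1) g(3)])
    moreover have "(lead_coeff g * t - 1) * poly.coeff q n \<in> I"
      using pq(3) by (intro ideal_ofD(7)[OF I(1) _ g(4)]) auto
    ultimately have "t * (lead_coeff g * poly.coeff q n) - (lead_coeff g * t - 1) * poly.coeff q n \<in> I"
      by (rule ideal_ofD(3)[OF I(1)])
    also have "t * (lead_coeff g * poly.coeff q n) - (lead_coeff g * t - 1) * poly.coeff q n = poly.coeff q n"
      by (simp add: algebra_simps)
    finally show False using n by blast
  qed
qed

lemma poly_ideal_closed:
  assumes A: "subring_of A" and I: "ideal_of I A"
  shows "p \<in> poly_ideal A I g \<Longrightarrow> q \<in> poly_ideal A I g \<Longrightarrow> p - q \<in> poly_ideal A I g"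
    "p \<in> poly_ideal A I g \<Longrightarrow> q \<in> poly_ideal A I g \<Longrightarrow> p + q \<in> poly_ideal A I g"
    "p \<in> polys_over A \<Longrightarrow> q \<in> poly_ideal A I g \<Longrightarrow> p * q \<in> poly_ideal A I g"
    "q \<in> polys_over A \<Longrightarrow> g * q \<in> poly_ideal A I g"
proof -
  note c = polys_over_closed[OF A]
  have "p - q \<in> poly_ideal A I g \<and> p + q \<in> poly_ideal A I g"
    if pq: "p \<in> poly_ideal A I g" "q \<in> poly_ideal A I g" for p q
  proof -
    from pq obtain p1 p2 q1 q2 where *: "p = p1 + g * p2" "p1 \<in> polys_over I" "p2 \<in> polys_over A"
      "q = q1 + g * q2" "q1 \<in> polys_over I" "q2 \<in> polys_over A"
      unfolding poly_ideal_def by blast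
    have "p - q = (p1 - q1) + g * (p2 - q2)" "p + q = (p1 + q1) + g * (p2 + q2)"
      by (simp_all add: * algebra_simps)
    moreover have "p1 - q1 \<in> polys_over I" "p1 + q1 \<in> polys_over I"
      using * by (auto simp: ideal_ofD[OF I])
    ultimately show ?thesis using c(1,2)[OF *(3,6)] unfolding poly_ideal_def by blast
  qed
  thus "p \<in> poly_ideal A I g \<Longrightarrow> q \<in> poly_ideal A I g \<Longrightarrow> p - q \<in> poly_ideal A I g"
    "p \<in> poly_ideal A I g \<Longrightarrow> q \<in> poly_ideal A I g \<Longrightarrow> p + q \<in> poly_ideal A I g" by auto
  show "p * q \<in> poly_ideal A I g" if "p \<in> polys_over A" "q \<in> poly_ideal A I g"
  proof -
    from that obtain q1 q2 where *: "q = q1 + g * q2" "q1 \<in> polys_over I" "q2 \<in> polys_over A"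
      unfolding poly_ideal_def by blast
    have "p * q = p * q1 + g * (p * q2)" by (simp add: * algebra_simps)
    with polys_over_ideal_mult[OF I that(1) *(2)] c(3)[OF that(1) *(3)] show ?thesis
      unfolding poly_ideal_def by blast
  qed
  show "g * q \<in> poly_ideal A I g" if "q \<in> polys_over A"
  proof -
    have "0 \<in> polys_over I" using ideal_ofD(2)[OF I] by simp
    with that show ?thesis unfolding poly_ideal_def by (intro CollectI exI[of _ 0] exI[of _ q]) auto
  qed
qed

text \<open>Division with remainder, although the leading coefficient of \<open>g\<close> is
  invertible only modulo \<open>I\<close>: every step may also discard a monomial with coefficient
  in \<open>I\<close>.\<close>

lemma poly_ideal_reduce:
  assumes A: "subring_of A" and I: "ideal_of I A"
    and g: "g \<in> polys_over A" "degree g \<ge> 1" "t \<in> A" "lead_coeff g * t - 1 \<in> I"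
    and p: "p \<in> polys_over A"
  shows "\<exists>r\<in>polys_over A. p - r \<in> poly_ideal A I g \<and> degree r < degree g"
  using p
proof (induction "degree p" arbitrary: p rule: less_induct)
  case less
  show ?case
  proof (cases "degree p < degree g")
    case True
    have "p - p \<in> poly_ideal A I g" 
      using poly_ideal_mono_base[OF A, of 0 I g] ideal_ofD(2)[OF I] by simp
    with True less.prems show ?thesis by blast
  next
    case False
    let ?e = "degree p - degree g"
    let ?h = "monom (t * lead_coeff p) ?e"
    \<comment> \<open>Subtracting \<open>g * ?h\<close> leaves
      \<open>(1 - lead_coeff g * t) * lead_coeff p\<close> as top coefficient. It lies in
      \<open>I\<close>; adding \<open>?i\<close> makes it exactly 0, so the degree really
      drops.\<close>
    let ?i = "monom ((lead_coeff g * t - 1) * lead_coeff p) (degree p)"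
    have h: "?h \<in> polys_over A" using less.prems g by (intro polys_over_closed[OF A] subring_of_mult[OF A]) auto
    have i: "?i \<in> polys_over I" using less.prems g by (auto simp: ideal_ofD[OF I])
    let ?p' = "p - g * ?h + ?i"
    have iA: "?i \<in> polys_over A" using i ideal_ofD(1)[OF I] by blast
    have p'A: "?p' \<in> polys_over A"
      by (intro polys_over_closed[OF A] less.prems g h iA)
    have ch: "poly.coeff (g * ?h) j = (if j < ?e then 0 else poly.coeff g (j - ?e) * (t * lead_coeff p))" for j
      by (subst mult.commute[of g], subst coeff_monom_mult) (simp only: mult.commute)
    have "poly.coeff ?p' j = 0" if "j \<ge> degree p" for j
    proof (cases "j = degree p")
      case True
      hence "j - ?e = degree g" using False by simp
      with True show ?thesis by (simp add: ch algebra_simps)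
    next
      case j: False
      hence "j > degree p" using that by simp
      moreover hence "j - ?e > degree g" using False by linarith
      ultimately show ?thesis by (simp add: ch coeff_eq_0)
    qed
    hence deg: "degree ?p' < degree p"
    proof (cases "?p' = 0")
      case True
      thus ?thesis using False g(2) by simp
    next
      case ne: False
      with \<open>\<And>j. j \<ge> degree p \<Longrightarrow> poly.coeff ?p' j = 0\<close> show ?thesis
        by (metis leading_coeff_0_iff linorder_not_less)
    qed
    from less.hyps[OF deg p'A] obtain r where r: "r \<in> polys_over A" "?p' - r \<in> poly_ideal A I g"
      "degree r < degree g" by blast
    have "p - r = (?p' - r) + (g * ?h - ?i)" by simp
    moreover have "g * ?h - ?i \<in> poly_ideal A I g"
      by (rule poly_ideal_closed(1)[OF A I poly_ideal_closed(4)[OF A I h] poly_ideal_mono_base[OF A i]])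
    ultimately have "p - r \<in> poly_ideal A I g" using poly_ideal_closed(2)[OF A I r(2)] by metis
    with r show ?thesis by blast
  qed
qed

lemma poly_ideal_subset:
  assumes A: "subring_of A" and I: "ideal_of I A" and g: "g \<in> polys_over A"
  shows "poly_ideal A I g \<subseteq> polys_over A"
proof
  fix x assume "x \<in> poly_ideal A I g"
  then obtain p q where *: "x = p + g * q" "p \<in> polys_over I" "q \<in> polys_over A"
    unfolding poly_ideal_def by blast
  have "p \<in> polys_over A" using * ideal_ofD(1)[OF I] by auto
  from polys_over_closed(2)[OF A this polys_over_closed(3)[OF A g *(3)]]
  show "x \<in> polys_over A" unfolding *(1) .
qed

text \<open>Remainders have fewer than \<open>degree g\<close> possibly nonzero coefficients, each
  of which can be replaced by one of finitely many representatives of \<open>A\<close> modulo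
  \<open>I\<close>.\<close>

lemma finite_quotient_adjoin:
  fixes a :: "'f::field"
  assumes A: "subring_of A" and I: "ideal_of I A" "finite_quotient A I"
    and g: "g \<in> polys_over A" "degree g \<ge> 1" "t \<in> A" "lead_coeff g * t - 1 \<in> I"
  defines "J \<equiv> (\<lambda>p. poly p a) ` poly_ideal A I g"
  shows "ideal_of J (adjoin A a)" "finite_quotient (adjoin A a) J"
proof -
  note c = polys_over_closed[OF A]
  have sub: "poly_ideal A I g \<subseteq> polys_over A" by (rule poly_ideal_subset[OF A I(1) g(1)])
  have 0: "0 \<in> poly_ideal A I g"
    using poly_ideal_mono_base[OF A, of 0 I g] ideal_ofD(2)[OF I(1)] by simp
  show "ideal_of J (adjoin A a)"
    unfolding ideal_of_def
  proof (intro conjI ballI)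
    show "J \<subseteq> adjoin A a" unfolding J_def adjoin_def by (rule image_mono[OF sub])
    show "0 \<in> J" unfolding J_def using 0 by (intro image_eqI[of _ _ 0]) auto
    show "x - y \<in> J" if xy: "x \<in> J" "y \<in> J" for x y
    proof -
      from xy obtain p q where *: "x = poly p a" "p \<in> poly_ideal A I g" "y = poly q a" "q \<in> poly_ideal A I g"
        unfolding J_def by blast
      show ?thesis unfolding J_def using poly_ideal_closed(1)[OF A I(1) *(2,4)]
        by (intro image_eqI[of _ _ "p - q"]) (auto simp: *)
    qed
    show "x * y \<in> J" if xy: "x \<in> adjoin A a" "y \<in> J" for x y
    proof -
      from xy obtain p q where *: "x = poly p a" "p \<in> polys_over A" "y = poly q a" "q \<in> poly_ideal A I g"
        unfolding J_def adjoin_def by blast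
      show ?thesis unfolding J_def using poly_ideal_closed(3)[OF A I(1) *(2,4)]
        by (intro image_eqI[of _ _ "p * q"]) (auto simp: *)
    qed
  qed
  from I(2) obtain T where T: "finite T" "T \<subseteq> A" "\<And>x. x \<in> A \<Longrightarrow> \<exists>y\<in>T. x - y \<in> I"
    unfolding finite_quotient_def by blast
  then obtain rep where rep: "\<And>x. x \<in> A \<Longrightarrow> rep x \<in> T \<and> x - rep x \<in> I" by metis
  let ?d = "degree g"
  define T' where "T' = (\<lambda>f. poly (\<Sum>i<?d. monom (f i) i) a) ` ({..<?d} \<rightarrow>\<^sub>E T)"
  have "finite T'" unfolding T'_def using T(1) by (intro finite_imageI finite_PiE) auto
  moreover have "T' \<subseteq> adjoin A a"
  proof -
    have "(\<Sum>i<?d. monom (f i) i) \<in> polys_over A" if "f \<in> {..<?d} \<rightarrow>\<^sub>E T" for f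
    proof -
      have "poly.coeff (\<Sum>i<?d. monom (f i) i) j \<in> A" for j
        unfolding coeff_sum using that T(2)
        by (intro subring_of_sum[OF A]) (auto simp: subring_of_zero[OF A])
      thus ?thesis by (intro CollectI allI)
    qed
    thus ?thesis unfolding T'_def adjoin_def by (intro image_subsetI imageI)
  qed
  moreover have "\<exists>y\<in>T'. x - y \<in> J" if "x \<in> adjoin A a" for x
  proof -
    from that obtain p where p: "x = poly p a" "p \<in> polys_over A" unfolding adjoin_def by blast
    from poly_ideal_reduce[OF A I(1) g p(2)] obtain r where r: "r \<in> polys_over A"
      "p - r \<in> poly_ideal A I g" "degree r < ?d" by blast
    let ?s = "\<Sum>i<?d. monom (rep (poly.coeff r i)) i"
    have "poly.coeff (r - ?s) j \<in> I" for j
    proof (cases "j < ?d")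
      case True
      hence "poly.coeff ?s j = rep (poly.coeff r j)" by (simp add: coeff_sum)
      thus ?thesis using rep r by simp
    next
      case False
      hence "poly.coeff ?s j = 0" by (auto simp: coeff_sum intro!: sum.neutral)
      moreover have "poly.coeff r j = 0" using r False by (simp add: coeff_eq_0)
      ultimately show ?thesis by (simp add: ideal_ofD(2)[OF I(1)])
    qed
    hence "r - ?s \<in> poly_ideal A I g" by (intro poly_ideal_mono_base[OF A] CollectI allI)
    from poly_ideal_closed(2)[OF A I(1) r(2) this] have "p - ?s \<in> poly_ideal A I g" by simp
    hence "x - poly ?s a \<in> J" unfolding J_def p(1) by (intro image_eqI[of _ _ "p - ?s"]) auto
    moreover have "poly ?s a \<in> T'" unfolding T'_def
    proof (rule image_eqI)
      show "restrict (\<lambda>i. rep (poly.coeff r i)) {..<?d} \<in> {..<?d} \<rightarrow>\<^sub>E T" using rep r by auto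
      show "poly ?s a = poly (\<Sum>i<?d. monom (restrict (\<lambda>i. rep (poly.coeff r i)) {..<?d} i) i) a"
        by (intro arg_cong[of _ _ "\<lambda>p. poly p a"] sum.cong) auto
    qed
    ultimately show ?thesis by blast
  qed
  ultimately show "finite_quotient (adjoin A a) J" unfolding finite_quotient_def by blast
qed

text \<open>For the situations in which no ideal has been chosen yet and the leading coefficient
  cannot be inverted: each division step is paid for by one more factor \<open>lead_coeff g\<close>.
  These factors are cleared later, as nonzero field elements or as units modulo an ideal.\<close>

lemma pseudo_division:
  assumes A: "subring_of A" and g: "g \<in> polys_over A" "g \<noteq> 0" and p: "p \<in> polys_over A"
  shows "\<exists>N. \<exists>q\<in>polys_over A. \<exists>r\<in>polys_over A. smult (lead_coeff g ^ N) p = g * q + r \<and>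
     (r = 0 \<or> degree r < degree g)"
  using p
proof (induction "degree p" arbitrary: p rule: less_induct)
  case less
  show ?case
  proof (cases "p = 0 \<or> degree p < degree g")
    case True
    have "smult (lead_coeff g ^ 0) p = g * 0 + p" by simp
    with True less.prems polys_over_closed(7)[OF A] show ?thesis by blast
  next
    case False
    let ?e = "degree p - degree g"
    let ?h = "monom (lead_coeff p) ?e"
    let ?p' = "smult (lead_coeff g) p - g * ?h"
    have h: "?h \<in> polys_over A" using less.prems by (intro polys_over_closed[OF A]) auto
    have p'A: "?p' \<in> polys_over A" using g less.prems h by (intro polys_over_closed[OF A]) auto
    have ch: "poly.coeff (g * ?h) j = (if j < ?e then 0 else poly.coeff g (j - ?e) * lead_coeff p)" for j
      by (subst mult.commute[of g], subst coeff_monom_mult) (simp only: mult.commute)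
    have z: "poly.coeff ?p' j = 0" if "j \<ge> degree p" for j
    proof (cases "j = degree p")
      case True
      hence "j - ?e = degree g" using False by simp
      with True show ?thesis by (simp add: ch)
    next
      case j: False
      hence "j > degree p" using that by simp
      moreover hence "j - ?e > degree g" using False by linarith
      ultimately show ?thesis by (simp add: ch coeff_eq_0)
    qed
    show ?thesis
    proof (cases "?p' = 0")
      case True
      hence "smult (lead_coeff g ^ 1) p = g * ?h + 0" by simp
      with h polys_over_closed(7)[OF A] show ?thesis by blast
    next
      case ne: False
      hence "degree ?p' < degree p" using z by (metis leading_coeff_0_iff linorder_not_less)
      from less.hyps[OF this p'A] obtain N q r where r: "q \<in> polys_over A" "r \<in> polys_over A"
        "smult (lead_coeff g ^ N) ?p' = g * q + r" "r = 0 \<or> degree r < degree g" by blast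
      have "smult (lead_coeff g ^ Suc N) p = smult (lead_coeff g ^ N) ?p' + smult (lead_coeff g ^ N) (g * ?h)"
        by (simp add: smult_diff_right mult.commute)
      also have "\<dots> = g * (q + smult (lead_coeff g ^ N) ?h) + r"
        unfolding r(3) by (simp add: algebra_simps)
      finally have "smult (lead_coeff g ^ Suc N) p = g * (q + smult (lead_coeff g ^ N) ?h) + r" .
      moreover have "q + smult (lead_coeff g ^ N) ?h \<in> polys_over A"
        using g by (intro polys_over_closed(2,5)[OF A] r h subring_of_power[OF A]) auto
      ultimately show ?thesis using r by blast
    qed
  qed
qed

section \<open>Adjoining an element and finitely generated subrings\<close>

lemma power_unit_mod_ideal:
  assumes A: "subring_of A" and I: "ideal_of I A" and x: "x \<in> A" "x - 1 \<in> I"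
  shows "x ^ n - 1 \<in> I"
proof (induction n)
  case (Suc n)
  have "x * (x ^ n - 1) + (x - 1) \<in> I"
    by (intro ideal_ofD(4)[OF I] ideal_ofD(6)[OF I x(1) Suc] x(2))
  thus ?case by (simp add: algebra_simps)
qed (simp add: ideal_ofD(2)[OF I])

text \<open>If \<open>a\<close> is transcendental over \<open>A\<close>, evaluation at
  \<open>a\<close> is injective on \<open>polys_over A\<close>, and properness passes from
  polynomials to \<open>A[a]\<close> directly. If \<open>a\<close> is algebraic, one works modulo a
  polynomial \<open>f\<close> of least degree vanishing at \<open>a\<close>; elimination between
  \<open>f\<close> and a polynomial for \<open>b\<close> shows that \<open>b\<close> divides a
  nonzero element \<open>r\<close> of \<open>A\<close> in \<open>A[a]\<close>, so it suffices to
  make \<open>r\<close> and the leading coefficient of \<open>f\<close> units.\<close>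

lemma residually_finite_adjoin:
  assumes A: "subring_of A" and rf: "residually_finite A"
  shows "residually_finite (adjoin A a)"
  unfolding residually_finite_def
proof (intro ballI impI)
  fix b assume "b \<in> adjoin A a" and b0: "b \<noteq> 0"
  then obtain \<beta> where \<beta>: "b = poly \<beta> a" "\<beta> \<in> polys_over A" unfolding adjoin_def by blast
  have \<beta>0: "\<beta> \<noteq> 0" using b0 \<beta>(1) by auto
  note c = polys_over_closed[OF A]
  let ?goal = "\<exists>J. ideal_of J (adjoin A a) \<and> finite_quotient (adjoin A a) J \<and> 1 \<notin> J \<and>
    (\<exists>b'\<in>adjoin A a. b * b' - 1 \<in> J)"
  show ?goal
  proof (cases "\<exists>p\<in>polys_over A. p \<noteq> 0 \<and> poly p a = 0")
    case False
    have "lead_coeff \<beta> \<in> A" "lead_coeff \<beta> \<noteq> 0" using \<beta> \<beta>0 by auto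
    then obtain I t where I: "ideal_of I A" "finite_quotient A I" "1 \<notin> I" "t \<in> A" "lead_coeff \<beta> * t - 1 \<in> I"
      using rf unfolding residually_finite_def by blast
    \<comment> \<open>The modulus \<open>1 + X * \<beta>\<close> has the leading coefficient of
      \<open>\<beta>\<close> and forces \<open>\<beta> * (- X)\<close> to be 1, so
      \<open>- a\<close> inverts \<open>b\<close>.\<close>
    define g where "g = pCons 1 \<beta>"
    have g: "g \<in> polys_over A" unfolding g_def by (intro c(8) subring_of_one[OF A] \<beta>)
    have g1: "degree g \<ge> 1" "lead_coeff g * t - 1 \<in> I" using \<beta>0 I by (simp_all add: g_def)
    let ?J = "(\<lambda>p. poly p a) ` poly_ideal A I g"
    note J = finite_quotient_adjoin[OF A I(1,2) g g1(1) I(4) g1(2), of a]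
    have "1 \<notin> ?J"
    proof
      assume "1 \<in> ?J"
      then obtain p where p: "p \<in> poly_ideal A I g" "poly p a = 1" by auto
      have "p - 1 \<in> polys_over A" using p poly_ideal_subset[OF A I(1) g] by (intro c) auto
      moreover have "poly (p - 1) a = 0" using p by simp
      ultimately have "p - 1 = 0" using False by (metis (no_types, lifting))
      hence "p = 1" by simp
      with p(1) one_notin_poly_ideal[OF A I(1,3) g g1(1) I(4) g1(2)] show False by simp
    qed
    moreover have "b * (- a) - 1 \<in> ?J"
    proof (rule image_eqI)
      have "0 - 1 \<in> polys_over A" by (rule c(1)[OF c(7,6)])
      from poly_ideal_closed(4)[OF A I(1) this] show "g * (0 - 1) \<in> poly_ideal A I g" .
      show "b * - a - 1 = poly (g * (0 - 1)) a" by (simp add: g_def \<beta>(1))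
    qed
    moreover have "- a \<in> adjoin A a"
      by (rule subring_of_uminus[OF subring_of_adjoin[OF A] adjoin_mem[OF A]])
    ultimately show ?goal using J by blast
  next
    case True
    define F where "F = {p. p \<in> polys_over A \<and> p \<noteq> 0 \<and> poly p a = 0}"
    define f where "f = (ARG_MIN degree p. p \<in> F)"
    from True obtain p0 where "p0 \<in> F" unfolding F_def by blast
    from arg_min_natI[of "\<lambda>p. p \<in> F", OF this, of degree] have fF: "f \<in> F" unfolding f_def .
    hence f: "f \<in> polys_over A" "f \<noteq> 0" "poly f a = 0" unfolding F_def by blast+
    have fmin: "degree f \<le> degree p" if "p \<in> polys_over A" "p \<noteq> 0" "poly p a = 0" for p
      unfolding f_def using arg_min_nat_le[of "\<lambda>p. p \<in> F" p degree] that unfolding F_def by blast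
    have fdeg: "degree f \<ge> 1"
    proof (rule ccontr)
      assume "\<not> degree f \<ge> 1"
      then obtain k where "f = [:k:]" by (metis degree_eq_zeroE less_one linorder_not_less)
      thus False using f(2,3) by simp
    qed
    \<comment> \<open>A substitute for the gcd over the fraction field: a nonzero combination
      \<open>d\<close> of \<open>\<beta>\<close> and \<open>f\<close> of least degree divides every
      such combination up to a power of its leading coefficient.\<close>
    define D where "D = {p. p \<noteq> 0 \<and> (\<exists>u\<in>polys_over A. \<exists>v\<in>polys_over A. p = u * \<beta> + v * f)}"
    define d where "d = (ARG_MIN degree p. p \<in> D)"
    have "\<beta> = 1 * \<beta> + 0 * f" by simp
    hence \<beta>D: "\<beta> \<in> D" unfolding D_def using \<beta>0 c(6,7) by blast
    from arg_min_natI[of "\<lambda>p. p \<in> D", OF this, of degree] have dD: "d \<in> D" unfolding d_def .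
    then obtain u v where d: "d \<noteq> 0" "u \<in> polys_over A" "v \<in> polys_over A" "d = u * \<beta> + v * f"
      unfolding D_def by blast
    have dmin: "degree d \<le> degree p" if "p \<in> D" for p
      unfolding d_def using arg_min_nat_le[of "\<lambda>p. p \<in> D" p degree] that by blast
    have dA: "d \<in> polys_over A" unfolding d(4) by (intro c(2,3) d \<beta> f)
    have div: "\<exists>N. \<exists>q\<in>polys_over A. smult (lead_coeff d ^ N) p = d * q"
      if p: "p = u' * \<beta> + v' * f" "u' \<in> polys_over A" "v' \<in> polys_over A" for p u' v'
    proof -
      have "p \<in> polys_over A" unfolding p by (intro c(2,3) p \<beta> f)
      from pseudo_division[OF A dA d(1) this] obtain N q r where q: "q \<in> polys_over A" "r \<in> polys_over A"
        "smult (lead_coeff d ^ N) p = d * q + r" "r = 0 \<or> degree r < degree d" by blast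
      let ?l = "lead_coeff d ^ N"
      have l: "?l \<in> A" using dA by (intro subring_of_power[OF A]) auto
      have "r = (smult ?l u' - q * u) * \<beta> + (smult ?l v' - q * v) * f"
      proof -
        have "r = smult ?l p - d * q" using q(3) by simp
        thus ?thesis unfolding p(1) d(4) by (simp add: algebra_simps smult_add_right)
      qed
      moreover have "smult ?l u' - q * u \<in> polys_over A" by (rule c(1)[OF c(5)[OF l p(2)] c(3)[OF q(1) d(2)]])
      moreover have "smult ?l v' - q * v \<in> polys_over A" by (rule c(1)[OF c(5)[OF l p(3)] c(3)[OF q(1) d(3)]])
      ultimately have "r = 0 \<or> r \<in> D" unfolding D_def by blast
      hence "r = 0" using q(4) dmin[of r] by auto
      thus ?thesis using q(1,3) by auto
    qed
    \<comment> \<open>If \<open>d\<close> were not constant, its cofactor in a multiple of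
      \<open>f\<close> would have smaller degree than \<open>f\<close> and thus not vanish at
      \<open>a\<close>; so \<open>d\<close> vanishes at \<open>a\<close>, and since \<open>d\<close>
      also divides a multiple of \<open>\<beta>\<close>, this gives \<open>b = 0\<close>.\<close>
    have "degree d = 0"
    proof (rule ccontr)
      assume dd: "degree d \<noteq> 0"
      have "f = 0 * \<beta> + 1 * f" by simp
      from div[OF this c(7,6)] obtain N q where q: "q \<in> polys_over A" "smult (lead_coeff d ^ N) f = d * q" by blast
      have nz: "lead_coeff d ^ N \<noteq> 0" using d(1) by simp
      hence "d * q \<noteq> 0" unfolding q(2)[symmetric] using f(2) by simp
      hence q0: "q \<noteq> 0" by auto
      have "degree f = degree (d * q)" by (simp only: q(2)[symmetric] degree_smult_eq nz if_False)
      also have "\<dots> = degree d + degree q" using d(1) q0 by (rule degree_mult_eq)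
      finally have "degree q < degree f" using dd by simp
      hence "poly q a \<noteq> 0" using fmin[OF q(1) q0] by auto
      moreover have "poly d a * poly q a = 0"
        using arg_cong[OF q(2), of "\<lambda>p. poly p a"] f(3) by simp
      ultimately have da: "poly d a = 0" by simp
      have "\<beta> = 1 * \<beta> + 0 * f" by simp
      from div[OF this c(6,7)] obtain N q where q: "smult (lead_coeff d ^ N) \<beta> = d * q" by blast
      have "lead_coeff d ^ N * b = 0"
        using arg_cong[OF q, of "\<lambda>p. poly p a"] da \<beta>(1) by simp
      thus False using b0 d(1) by simp
    qed
    then obtain r where r: "d = [:r:]" by (rule degree_eq_zeroE)
    have r0: "r \<noteq> 0" "r \<in> A" using d(1) dA r by (auto dest: spec[of _ 0])
    have rb: "r = poly u a * b"
      using arg_cong[OF d(4), of "\<lambda>p. poly p a"] f(3) r \<beta>(1) by simp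
    define s where "s = lead_coeff f"
    have s: "s \<in> A" "s \<noteq> 0" using f unfolding s_def by auto
    \<comment> \<open>One ideal has to serve two purposes: \<open>s\<close> must be a unit in order
      to divide by \<open>f\<close>, and \<open>r\<close> must be a unit in order to invert
      \<open>b\<close>.\<close>
    hence "s * r \<in> A" "s * r \<noteq> 0" using r0 subring_of_mult[OF A] by auto
    then obtain I t where I: "ideal_of I A" "finite_quotient A I" "1 \<notin> I" "t \<in> A" "s * r * t - 1 \<in> I"
      using rf unfolding residually_finite_def by blast
    have rt: "r * t \<in> A" using r0 I subring_of_mult[OF A] by auto
    have fu: "lead_coeff f * (r * t) - 1 \<in> I" using I(5) by (simp add: s_def mult.assoc)
    let ?J = "(\<lambda>p. poly p a) ` poly_ideal A I f"
    note J = finite_quotient_adjoin[OF A I(1,2) f(1) fdeg rt fu, of a]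
    \<comment> \<open>Evaluation now has a kernel. If \<open>p\<close> in
      \<open>poly_ideal A I f\<close> evaluates to 1, then \<open>1 - p\<close> is, up to a power of
      \<open>s\<close>, a multiple of \<open>f\<close>; so that power of \<open>s\<close> lies in
      \<open>poly_ideal A I f\<close>, and as \<open>s\<close> is a unit modulo \<open>I\<close>, so
      does 1.\<close>
    have "1 \<notin> ?J"
    proof
      assume "1 \<in> ?J"
      then obtain p where p: "p \<in> poly_ideal A I f" "poly p a = 1" by auto
      have hA: "1 - p \<in> polys_over A" using p poly_ideal_subset[OF A I(1) f(1)] by (intro c) auto
      from pseudo_division[OF A f(1,2) hA] obtain N q r' where q: "q \<in> polys_over A" "r' \<in> polys_over A"
        "smult (s ^ N) (1 - p) = f * q + r'" "r' = 0 \<or> degree r' < degree f" unfolding s_def by blast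
      have "s ^ N * (1 - poly p a) = poly f a * poly q a + poly r' a"
        using arg_cong[OF q(3), of "\<lambda>p. poly p a"]
        by (simp only: poly_smult poly_diff poly_1 poly_add poly_mult)
      hence r'0: "poly r' a = 0" by (simp only: f(3) p(2)) simp
      have "r' = 0"
      proof (rule ccontr)
        assume "r' \<noteq> 0"
        with fmin[OF q(2) this r'0] q(4) show False by linarith
      qed
      hence "smult (s ^ N) 1 - smult (s ^ N) p = f * q"
        using q(3) by (simp only: smult_diff_right add_0_right)
      hence "smult (s ^ N) 1 = f * q + smult (s ^ N) p" by (simp only: diff_eq_eq)
      also have "smult (s ^ N) p = monom (s ^ N) 0 * p" by (simp add: monom_0)
      also have "f * q + monom (s ^ N) 0 * p \<in> poly_ideal A I f"
        by (intro poly_ideal_closed[OF A I(1)] c q p subring_of_power[OF A s(1)])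
      finally have "monom ((r * t) ^ N) 0 * smult (s ^ N) 1 \<in> poly_ideal A I f"
        by (intro poly_ideal_closed(3)[OF A I(1)] c(4) subring_of_power[OF A rt])
      also have "monom ((r * t) ^ N) 0 * smult (s ^ N) 1 = monom ((s * r * t) ^ N) 0"
        by (simp add: monom_0 power_mult_distrib mult_ac)
      finally have "monom ((s * r * t) ^ N) 0 \<in> poly_ideal A I f" .
      moreover have "monom ((s * r * t) ^ N - 1) 0 \<in> poly_ideal A I f"
      proof (rule poly_ideal_mono_base[OF A])
        have "(s * r * t) ^ N - 1 \<in> I"
          using s r0 I by (intro power_unit_mod_ideal[OF A I(1)] subring_of_mult[OF A]) auto
        thus "monom ((s * r * t) ^ N - 1) 0 \<in> polys_over I" by (auto simp: ideal_ofD(2)[OF I(1)])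
      qed
      ultimately have "monom ((s * r * t) ^ N) 0 - monom ((s * r * t) ^ N - 1) 0 \<in> poly_ideal A I f"
        by (rule poly_ideal_closed(1)[OF A I(1)])
      also have "monom ((s * r * t) ^ N) 0 - monom ((s * r * t) ^ N - 1) 0 = 1"
        by (simp add: diff_monom)
      finally show False using one_notin_poly_ideal[OF A I(1,3) f(1) fdeg rt fu] by simp
    qed
    moreover have "b * (poly u a * (s * t)) - 1 \<in> ?J"
    proof (rule image_eqI)
      have "monom (s * r * t - 1) 0 \<in> polys_over I" using I(5) by (auto simp: ideal_ofD(2)[OF I(1)])
      thus "monom (s * r * t - 1) 0 \<in> poly_ideal A I f" by (rule poly_ideal_mono_base[OF A])
      show "b * (poly u a * (s * t)) - 1 = poly (monom (s * r * t - 1) 0) a"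
        by (simp add: poly_monom rb mult_ac)
    qed
    moreover have "poly u a * (s * t) \<in> adjoin A a"
    proof -
      have "poly u a \<in> adjoin A a" unfolding adjoin_def using d(2) by (rule imageI)
      moreover have "s * t \<in> adjoin A a" using adjoin_superset[OF A] s I subring_of_mult[OF A] by blast
      ultimately show ?thesis by (rule subring_of_mult[OF subring_of_adjoin[OF A]])
    qed
    ultimately show ?goal using J by blast
  qed
qed

text \<open>In characteristic 0 the multiples of any prime that does not divide the given integer
  will do. In positive characteristic the prime is the characteristic, and the ideal is zero because
  the ring is already a finite field.\<close>

lemma residually_finite_prime_ring: "residually_finite (range of_int :: 'f::field set)"
  unfolding residually_finite_def
proof (intro ballI impI)
  fix b :: 'f assume "b \<in> range of_int" and b0: "b \<noteq> 0"
  then obtain m where m: "b = of_int m" by auto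
  have m0: "\<not> int CHAR('f) dvd m" using b0 m by (simp add: of_int_eq_0_iff_char_dvd)
  have "\<exists>p. prime (p :: nat) \<and> \<not> int p dvd m \<and> (CHAR('f) = 0 \<or> CHAR('f) = p)"
  proof (cases "CHAR('f) = 0")
    case True
    obtain p :: nat where p: "prime p" "p > nat \<bar>m\<bar>" using bigger_prime by blast
    have "m \<noteq> 0" using m0 True by auto
    hence "\<not> int p dvd m" using p by (auto dest: dvd_imp_le_int)
    with p True show ?thesis by blast
  next
    case False
    hence "prime CHAR('f)" by (intro prime_CHAR_semidom) simp
    with m0 show ?thesis by blast
  qed
  then obtain p where p: "prime (p :: nat)" "\<not> int p dvd m" "CHAR('f) = 0 \<or> CHAR('f) = p" by blast
  let ?I = "range (\<lambda>z. of_int (int p * z) :: 'f)"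
  have "ideal_of ?I (range of_int)"
    unfolding ideal_of_def
  proof (intro conjI ballI)
    show "?I \<subseteq> range of_int" by blast
    show "0 \<in> ?I" by (intro image_eqI[of _ _ 0]) auto
    show "x - y \<in> ?I" if "x \<in> ?I" "y \<in> ?I" for x y
    proof -
      from that obtain z z' where "x = of_int (int p * z)" "y = of_int (int p * z')" by blast
      thus ?thesis by (intro image_eqI[of _ _ "z - z'"]) (auto simp: algebra_simps)
    qed
    show "x * y \<in> ?I" if "x \<in> range of_int" "y \<in> ?I" for x y
    proof -
      from that obtain z z' where "x = of_int z" "y = of_int (int p * z')" by blast
      thus ?thesis by (intro image_eqI[of _ _ "z * z'"]) (auto simp: algebra_simps)
    qed
  qed
  moreover have "finite_quotient (range of_int) ?I"
    unfolding finite_quotient_def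
  proof (intro exI[of _ "(of_int :: int \<Rightarrow> 'f) ` {0..<int p}"] conjI ballI)
    fix x :: 'f assume "x \<in> range of_int"
    then obtain z where z: "x = of_int z" by blast
    have "x - of_int (z mod int p) = of_int (int p * (z div int p))"
      unfolding z of_int_diff[symmetric] by (simp only: minus_mod_eq_mult_div)
    moreover have "z mod int p \<in> {0..<int p}" using p(1) prime_gt_0_nat by simp
    ultimately show "\<exists>y\<in>(of_int :: int \<Rightarrow> 'f) ` {0..<int p}. x - y \<in> ?I" by blast
  qed auto
  moreover have "1 \<notin> ?I"
  proof
    assume "1 \<in> ?I"
    then obtain z where "(1 :: 'f) = of_int (int p * z)" by blast
    hence "(of_int (int p * z - 1) :: 'f) = 0" by simp
    hence *: "int CHAR('f) dvd int p * z - 1" by (simp add: of_int_eq_0_iff_char_dvd del: of_int_diff of_int_mult)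
    have pz: "int p dvd int p * z - 1"
      using p(3)
    proof
      assume "CHAR('f) = 0"
      with * show ?thesis by simp
    qed (use * in simp)
    have "int p dvd int p * z - (int p * z - 1)" by (rule dvd_diff[OF dvd_triv_left pz])
    hence "int p dvd 1" by (simp only: diff_diff_eq2) simp
    thus False using p(1) prime_gt_1_nat[of p] by simp
  qed
  moreover have "\<exists>b'\<in>range of_int. b * b' - 1 \<in> ?I"
  proof -
    have "coprime m (int p)" using prime_imp_coprime[of "int p" m] p(1,2) by (simp add: coprime_commute)
    then obtain x y where "x * m + y * int p = 1" using bezout_int[of m "int p"] by auto
    hence "m * x - 1 = int p * (- y)" by (simp add: algebra_simps)
    hence "b * of_int x - 1 = of_int (int p * (- y))" unfolding m
      by (metis of_int_1 of_int_diff of_int_mult)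
    thus ?thesis by blast
  qed
  ultimately show "\<exists>I. ideal_of I (range of_int) \<and> finite_quotient (range of_int) I \<and> 1 \<notin> I \<and>
    (\<exists>b'\<in>range of_int. b * b' - 1 \<in> I)" by blast
qed

lemma finitely_generated_residually_finite:
  assumes "finite (S :: 'f::field set)"
  shows "\<exists>A. subring_of A \<and> S \<subseteq> A \<and> residually_finite A"
  using assms
proof (induction S)
  case empty
  have "subring_of (range of_int :: 'f set)"
    unfolding subring_of_def by (auto intro: range_eqI[of _ _ 1] simp flip: of_int_diff of_int_mult)
  thus ?case using residually_finite_prime_ring by blast
next
  case (insert a S)
  then obtain A where A: "subring_of A" "S \<subseteq> A" "residually_finite A" by blast
  have "insert a S \<subseteq> adjoin A a" using adjoin_superset[OF A(1)] adjoin_mem[OF A(1)] A(2) by blast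
  thus ?case using subring_of_adjoin[OF A(1)] residually_finite_adjoin[OF A(1,3)] by blast
qed

text \<open>Numbering the classes modulo the ideal turns the arithmetic into two functions on
  numbers below \<open>Q\<close>, which can be compiled into a program as tables. They are read off
  from chosen class members \<open>rep\<close>; the ideal property makes the choice
  immaterial.\<close>

lemma finite_ring_code:
  assumes "finite (S :: 'f::field set)"
  shows "\<exists>A (code :: 'f \<Rightarrow> nat) Q add mul. subring_of A \<and> S \<subseteq> A \<and> (\<forall>x\<in>A. code x < Q) \<and>
    (\<forall>x\<in>A. \<forall>y\<in>A. code (x + y) = add (code x) (code y) \<and> code (x * y) = mul (code x) (code y)) \<and>
    code 1 \<noteq> code 0"
proof -
  obtain A where A: "subring_of A" "S \<subseteq> A" "residually_finite A"
    using finitely_generated_residually_finite[OF assms] by blast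
  obtain I where I: "ideal_of I A" "finite_quotient A I" "1 \<notin> I"
    using A(3) subring_of_one[OF A(1)] unfolding residually_finite_def using one_neq_zero by blast
  define cl where "cl x = {y \<in> A. x - y \<in> I}" for x
  have cl: "cl x = cl y \<longleftrightarrow> x - y \<in> I" if xy: "x \<in> A" "y \<in> A" for x y
  proof
    assume "cl x = cl y"
    moreover have "y \<in> cl y" using xy ideal_ofD(2)[OF I(1)] by (simp add: cl_def)
    ultimately show "x - y \<in> I" unfolding cl_def by blast
  next
    assume d: "x - y \<in> I"
    have "x - z \<in> I \<longleftrightarrow> y - z \<in> I" for z
      using ideal_ofD(4)[OF I(1) d, of "y - z"] ideal_ofD(3)[OF I(1) _ d, of "x - z"] by auto
    thus "cl x = cl y" unfolding cl_def by blast
  qed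
  from I(2) obtain T where T: "finite T" "T \<subseteq> A" "\<And>x. x \<in> A \<Longrightarrow> \<exists>y\<in>T. x - y \<in> I"
    unfolding finite_quotient_def by blast
  have "cl ` A \<subseteq> cl ` T"
  proof
    fix z assume "z \<in> cl ` A"
    then obtain x where x: "z = cl x" "x \<in> A" by blast
    then obtain y where "y \<in> T" "x - y \<in> I" using T(3) by blast
    with x cl[of x y] T(2) show "z \<in> cl ` T" by blast
  qed
  hence "finite (cl ` A)" using T(1) finite_surj by blast
  then obtain h :: "'f set \<Rightarrow> nat" where h: "bij_betw h (cl ` A) {0..<card (cl ` A)}"
    using ex_bij_betw_finite_nat by blast
  define code where "code x = h (cl x)" for x
  have code: "code x = code y \<longleftrightarrow> x - y \<in> I" if "x \<in> A" "y \<in> A" for x y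
    unfolding code_def cl[OF that, symmetric]
    using bij_betw_imp_inj_on[OF h] that by (auto dest: inj_onD)
  have lt: "code x < card (cl ` A)" if "x \<in> A" for x
    using bij_betwE[OF h] that unfolding code_def by fastforce
  define rep where "rep n = (SOME x. x \<in> A \<and> code x = n)" for n
  have rep: "rep (code x) \<in> A" "code (rep (code x)) = code x" if "x \<in> A" for x
    using someI[of "\<lambda>y. y \<in> A \<and> code y = code x" x] that unfolding rep_def by auto
  have add: "code (x + y) = code (rep (code x) + rep (code y))" if xy: "x \<in> A" "y \<in> A" for x y
  proof (subst code)
    have "(x - rep (code x)) + (y - rep (code y)) \<in> I"
      using rep[OF xy(1)] rep[OF xy(2)] xy code by (intro ideal_ofD(4)[OF I(1)]) metis+
    thus "x + y - (rep (code x) + rep (code y)) \<in> I" by (simp add: algebra_simps)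
  qed (use xy rep in \<open>auto intro: subring_of_add[OF A(1)]\<close>)
  have mul: "code (x * y) = code (rep (code x) * rep (code y))" if xy: "x \<in> A" "y \<in> A" for x y
  proof (subst code)
    have "(x - rep (code x)) * y + rep (code x) * (y - rep (code y)) \<in> I"
      using rep[OF xy(1)] rep[OF xy(2)] xy code
      by (intro ideal_ofD(4)[OF I(1)] ideal_ofD(6,7)[OF I(1)]) metis+
    thus "x * y - rep (code x) * rep (code y) \<in> I" by (simp add: algebra_simps)
  qed (use xy rep in \<open>auto intro: subring_of_mult[OF A(1)]\<close>)
  have "code 1 \<noteq> code 0"
    using code[OF subring_of_one[OF A(1)] subring_of_zero[OF A(1)]] I(3) by simp
  with A lt add mul show ?thesis
    by (intro exI[of _ A] exI[of _ code] exI[of _ "card (cl ` A)"]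
        exI[of _ "\<lambda>m n. code (rep m + rep n)"] exI[of _ "\<lambda>m n. code (rep m * rep n)"]) auto
qed

section \<open>Kronecker powers and tensor rank\<close>

lemma kronecker_power_simps:
  "indices (kronecker_power T r) = {x. length x = r \<and> set x \<subseteq> indices T}"
  "length x = r \<Longrightarrow> length y = r \<Longrightarrow> length z = r \<Longrightarrow>
     tensor.coeff (kronecker_power T r) x y z = (\<Prod>i<r. tensor.coeff T (x ! i) (y ! i) (z ! i))"
proof (induction r arbitrary: x y z)
  case (Suc r)
  {
    case 1
    have "indices (kronecker_power T (Suc r)) =
        (\<lambda>(i, is). i # is) ` (indices T \<times> {x. length x = r \<and> set x \<subseteq> indices T})"
      by (simp add: kronecker_def Suc(1))
    also have "\<dots> = {x. length x = Suc r \<and> set x \<subseteq> indices T}"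
    proof (intro subset_antisym subsetI)
      fix x assume "x \<in> {x. length x = Suc r \<and> set x \<subseteq> indices T}"
      thus "x \<in> (\<lambda>(i, is). i # is) ` (indices T \<times> {x. length x = r \<and> set x \<subseteq> indices T})"
        by (cases x) auto
    qed auto
    finally show ?case .
  next
    case 2
    obtain i x' where x: "x = i # x'" "length x' = r" using 2(1) by (cases x) auto
    obtain j y' where y: "y = j # y'" "length y' = r" using 2(2) by (cases y) auto
    obtain l z' where z: "z = l # z'" "length z' = r" using 2(3) by (cases z) auto
    have "tensor.coeff (kronecker_power T (Suc r)) x y z =
        tensor.coeff T i j l * tensor.coeff (kronecker_power T r) x' y' z'"
      by (simp add: kronecker_def x y z)
    thus ?case unfolding Suc(2)[OF x(2) y(2) z(2)] prod.lessThan_Suc_shift by (simp add: x y z)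
  }
qed auto

lemma lin_comb_of_rank_ones_iff:
  "lin_comb_of_rank_ones T r \<longleftrightarrow> (\<exists>a b c. \<forall>i\<in>indices T. \<forall>j\<in>indices T. \<forall>l\<in>indices T.
     tensor.coeff T i j l = (\<Sum>q<r. a q i * b q j * c q l))"
proof
  assume "lin_comb_of_rank_ones T r"
  then obtain w S where S: "\<forall>q<r. indices (S q) = indices T \<and> rank_one (S q)"
    "\<forall>i\<in>indices T. \<forall>j\<in>indices T. \<forall>l\<in>indices T.
       tensor.coeff T i j l = (\<Sum>q<r. w q * tensor.coeff (S q) i j l)"
    unfolding lin_comb_of_rank_ones_def by blast
  have "\<forall>q. \<exists>a b c. q < r \<longrightarrow> (\<forall>i\<in>indices T. \<forall>j\<in>indices T. \<forall>l\<in>indices T.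
     tensor.coeff (S q) i j l = a i * b j * c l)"
    using S(1) unfolding rank_one_def by metis
  then obtain a b c where abc: "\<forall>q<r. \<forall>i\<in>indices T. \<forall>j\<in>indices T. \<forall>l\<in>indices T.
     tensor.coeff (S q) i j l = a q i * b q j * c q l" by metis
  show "\<exists>a b c. \<forall>i\<in>indices T. \<forall>j\<in>indices T. \<forall>l\<in>indices T.
     tensor.coeff T i j l = (\<Sum>q<r. a q i * b q j * c q l)"
    by (rule exI[of _ "\<lambda>q i. w q * a q i"], rule exI[of _ b], rule exI[of _ c])
      (auto simp: S(2) abc mult.assoc intro!: sum.cong)
next
  assume "\<exists>a b c. \<forall>i\<in>indices T. \<forall>j\<in>indices T. \<forall>l\<in>indices T.
     tensor.coeff T i j l = (\<Sum>q<r. a q i * b q j * c q l)"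
  then obtain a b c where abc: "\<forall>i\<in>indices T. \<forall>j\<in>indices T. \<forall>l\<in>indices T.
     tensor.coeff T i j l = (\<Sum>q<r. a q i * b q j * c q l)" by blast
  show "lin_comb_of_rank_ones T r"
    unfolding lin_comb_of_rank_ones_def
    by (rule exI[of _ "\<lambda>_. 1"], rule exI[of _ "\<lambda>q. \<lparr>indices = indices T, coeff = (\<lambda>i j l. a q i * b q j * c q l)\<rparr>"])
      (use abc in \<open>auto simp: rank_one_def\<close>)
qed

text \<open>One term per index triple. Existence of some decomposition is what gives meaning to
  \<open>LEAST\<close> in \<open>tensor_rank\<close>.\<close>

lemma lin_comb_of_rank_ones_exists:
  fixes T :: "('i, 'f::field) tensor"
  assumes "finite (indices T)"
  shows "\<exists>r. lin_comb_of_rank_ones T r"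
proof -
  define n where "n = card (indices T)"
  obtain h where h: "bij_betw h {0..<n} (indices T)"
    using ex_bij_betw_nat_finite[OF assms] unfolding n_def by blast
  let ?I = "{0..<n} \<times> {0..<n} \<times> {0..<n}"
  obtain g where g: "bij_betw g {0..<card ?I} ?I"
    using ex_bij_betw_nat_finite[of ?I] by auto
  define a where "a q i = (if i = h (fst (g q)) then 1 else 0 :: 'f)" for q i
  define b where "b q j = (if j = h (fst (snd (g q))) then 1 else 0 :: 'f)" for q j
  define c where "c q l = (if l = h (snd (snd (g q)))
     then tensor.coeff T (h (fst (g q))) (h (fst (snd (g q)))) l else 0 :: 'f)" for q l
  have "tensor.coeff T i j l = (\<Sum>q<card ?I. a q i * b q j * c q l)"
    if ijl: "i \<in> indices T" "j \<in> indices T" "l \<in> indices T" for i j l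
  proof -
    have ex: "\<exists>x'<n. x = h x'" if "x \<in> indices T" for x
      using that unfolding bij_betw_imp_surj_on[OF h, symmetric] by auto
    obtain i' j' l' where *: "i' < n" "i = h i'" "j' < n" "j = h j'" "l' < n" "l = h l'"
      using ex[OF ijl(1)] ex[OF ijl(2)] ex[OF ijl(3)] by blast
    have inj: "h x = h y \<longleftrightarrow> x = y" if "x < n" "y < n" for x y
      using bij_betw_imp_inj_on[OF h] that by (auto dest: inj_onD)
    have "(\<Sum>q<card ?I. a q i * b q j * c q l) =
        (\<Sum>p\<in>?I. (if i = h (fst p) then 1 else 0) * (if j = h (fst (snd p)) then 1 else 0) *
          (if l = h (snd (snd p)) then tensor.coeff T (h (fst p)) (h (fst (snd p))) l else 0))"
      unfolding a_def b_def c_def lessThan_atLeast0 by (rule sum.reindex_bij_betw[OF g])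
    also have "\<dots> = (\<Sum>p\<in>?I. if p = (i', j', l') then tensor.coeff T i j l else 0)"
      by (rule sum.cong) (auto simp: * inj)
    also have "\<dots> = tensor.coeff T i j l" using * by simp
    finally show ?thesis by simp
  qed
  thus ?thesis unfolding lin_comb_of_rank_ones_iff by blast
qed

lemma tensor_rank_works:
  assumes "finite (indices T)"
  shows "lin_comb_of_rank_ones T (tensor_rank T)"
  unfolding tensor_rank_def using lin_comb_of_rank_ones_exists[OF assms] by (rule LeastI_ex)

lemma tensor_rank_le: "lin_comb_of_rank_ones T r \<Longrightarrow> tensor_rank T \<le> r"
  unfolding tensor_rank_def by (rule Least_le)

lemma finite_indices_kronecker_power:
  "finite (indices T) \<Longrightarrow> finite (indices (kronecker_power T r))"
  using finite_lists_length_eq[of "indices T" r] by (simp add: kronecker_power_simps conj_commute)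

section \<open>Submultiplicativity, the limit, and a lower bound for the rank\<close>

lemma sum_lessThan_mult:
  fixes f :: "nat \<Rightarrow> 'a::comm_monoid_add"
  assumes "n > 0"
  shows "(\<Sum>q<m * n. f q) = (\<Sum>i<m. \<Sum>j<n. f (j + i * n))"
proof (induction m)
  case (Suc m)
  have "(\<Sum>q<Suc m * n. f q) = (\<Sum>q<m * n. f q) + (\<Sum>q=m*n..<m*n+n. f q)"
    by (simp add: lessThan_atLeast0 sum.atLeastLessThan_concat add.commute)
  also have "(\<Sum>q=m*n..<m*n+n. f q) = (\<Sum>j<n. f (j + m * n))"
    using sum.shift_bounds_nat_ivl[of f 0 "m * n" n] by (simp add: lessThan_atLeast0 add.commute)
  finally show ?case using Suc by simp
qed simp

lemma prod_lessThan_add: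
  fixes f :: "nat \<Rightarrow> 'a::comm_monoid_mult"
  shows "(\<Prod>i<m + n. f i) = (\<Prod>i<m. f i) * (\<Prod>i<n. f (m + i))"
  by (induction n) (auto simp: mult_ac)

text \<open>Cutting index lists at position \<open>m\<close> exhibits a Kronecker product, and the
  pairwise products of terms decompose it. A pair of term numbers is packed into one number, to be
  read off as quotient and remainder by the second rank.\<close>

lemma tensor_rank_kronecker_power_add:
  fixes T :: "('i, 'f::field) tensor"
  assumes fin: "finite (indices T)"
  shows "tensor_rank (kronecker_power T (m + n)) \<le>
    tensor_rank (kronecker_power T m) * tensor_rank (kronecker_power T n)"
proof -
  let ?M = "tensor_rank (kronecker_power T m)" and ?N = "tensor_rank (kronecker_power T n)"
  obtain a b c where 1: "\<And>x y z. x \<in> indices (kronecker_power T m) \<Longrightarrow> y \<in> indices (kronecker_power T m) \<Longrightarrow>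
      z \<in> indices (kronecker_power T m) \<Longrightarrow>
      tensor.coeff (kronecker_power T m) x y z = (\<Sum>q<?M. a q x * b q y * c q z)"
    using tensor_rank_works[OF finite_indices_kronecker_power[OF fin, of m]]
    unfolding lin_comb_of_rank_ones_iff by blast
  obtain a' b' c' where 2: "\<And>x y z. x \<in> indices (kronecker_power T n) \<Longrightarrow> y \<in> indices (kronecker_power T n) \<Longrightarrow>
      z \<in> indices (kronecker_power T n) \<Longrightarrow>
      tensor.coeff (kronecker_power T n) x y z = (\<Sum>q<?N. a' q x * b' q y * c' q z)"
    using tensor_rank_works[OF finite_indices_kronecker_power[OF fin, of n]]
    unfolding lin_comb_of_rank_ones_iff by blast
  define A where "A u v q x = u (q div ?N) (take m x) * v (q mod ?N) (drop m x)"
    for u v :: "nat \<Rightarrow> 'i list \<Rightarrow> 'f" and q x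
  have "lin_comb_of_rank_ones (kronecker_power T (m + n)) (?M * ?N)"
    unfolding lin_comb_of_rank_ones_iff
  proof (rule exI[of _ "A a a'"], rule exI[of _ "A b b'"], rule exI[of _ "A c c'"], intro ballI)
    fix x y z assume xyz: "x \<in> indices (kronecker_power T (m + n))" "y \<in> indices (kronecker_power T (m + n))"
      "z \<in> indices (kronecker_power T (m + n))"
    hence len: "length x = m + n" "length y = m + n" "length z = m + n"
      by (auto simp: kronecker_power_simps)
    have mem: "take m x \<in> indices (kronecker_power T m)" "drop m x \<in> indices (kronecker_power T n)"
      "take m y \<in> indices (kronecker_power T m)" "drop m y \<in> indices (kronecker_power T n)"
      "take m z \<in> indices (kronecker_power T m)" "drop m z \<in> indices (kronecker_power T n)"
      using xyz by (auto simp: kronecker_power_simps dest!: in_set_takeD in_set_dropD)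
    have "tensor.coeff (kronecker_power T (m + n)) x y z =
        (\<Prod>i<m + n. tensor.coeff T (x ! i) (y ! i) (z ! i))"
      using len by (rule kronecker_power_simps(2))
    also have "\<dots> = (\<Prod>i<m. tensor.coeff T (x ! i) (y ! i) (z ! i)) *
        (\<Prod>i<n. tensor.coeff T (x ! (m + i)) (y ! (m + i)) (z ! (m + i)))"
      by (rule prod_lessThan_add)
    also have "(\<Prod>i<m. tensor.coeff T (x ! i) (y ! i) (z ! i)) =
        tensor.coeff (kronecker_power T m) (take m x) (take m y) (take m z)"
      using len by (subst kronecker_power_simps(2)) auto
    also have "(\<Prod>i<n. tensor.coeff T (x ! (m + i)) (y ! (m + i)) (z ! (m + i))) =
        tensor.coeff (kronecker_power T n) (drop m x) (drop m y) (drop m z)"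
      using len by (subst kronecker_power_simps(2)) auto
    also have "tensor.coeff (kronecker_power T m) (take m x) (take m y) (take m z) *
        tensor.coeff (kronecker_power T n) (drop m x) (drop m y) (drop m z) =
        (\<Sum>p<?M. \<Sum>q<?N. (a p (take m x) * b p (take m y) * c p (take m z)) *
           (a' q (drop m x) * b' q (drop m y) * c' q (drop m z)))"
      unfolding 1[OF mem(1,3,5)] 2[OF mem(2,4,6)] by (rule sum_product)
    also have "\<dots> = (\<Sum>p<?M. \<Sum>q<?N. A a a' (q + p * ?N) x * A b b' (q + p * ?N) y * A c c' (q + p * ?N) z)"
      by (intro sum.cong) (auto simp: A_def mult_ac)
    also have "\<dots> = (\<Sum>q<?M * ?N. A a a' q x * A b b' q y * A c c' q z)"
    proof (cases "?N = 0")
      case False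
      thus ?thesis by (intro sum_lessThan_mult[symmetric]) simp
    qed simp
    finally show "tensor.coeff (kronecker_power T (m + n)) x y z =
      (\<Sum>q<?M * ?N. A a a' q x * A b b' q y * A c c' q z)" .
  qed
  thus ?thesis by (rule tensor_rank_le)
qed

text \<open>The limit is the infimum \<open>L\<close>: divide \<open>n\<close> by a nearly optimal
  \<open>m\<close>; the remainder contributes at most the constant \<open>C\<close>, which
  disappears after division by \<open>n\<close>. The lemma is applied to logarithms of
  ranks.\<close>

lemma Fekete:
  fixes u :: "nat \<Rightarrow> real"
  assumes sub: "\<And>m n. u (m + n) \<le> u m + u n" and nn: "\<And>n. 0 \<le> u n"
  shows "convergent (\<lambda>n. u n / n)"
proof -
  define L where "L = (INF n\<in>{1..}. u n / real n)"
  have bdd: "bdd_below ((\<lambda>n. u n / real n) ` {1..})"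
    using nn by (intro bdd_belowI[of _ 0]) (auto)
  have lower: "L \<le> u n / n" if "n \<ge> 1" for n
    unfolding L_def using that by (intro cINF_lower[OF bdd]) auto
  have mult: "u (q * m) \<le> q * u m" if "q \<ge> 1" for q m
    using that
  proof (induction q rule: dec_induct)
    case (step q)
    have "u (Suc q * m) \<le> u m + u (q * m)" using sub[of m "q * m"] by simp
    with step show ?case by (simp add: algebra_simps)
  qed simp
  have "(\<lambda>n. u n / n) \<longlonglongrightarrow> L"
  proof (rule LIMSEQ_I)
    fix e :: real assume e: "e > 0"
    have "\<exists>x\<in>(\<lambda>n. u n / real n) ` {1..}. x < L + e / 2"
      unfolding L_def using e by (intro cInf_lessD) (auto simp: L_def)
    then obtain m where m: "m \<ge> 1" "u m / m < L + e / 2" by auto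
    define C where "C = Max (u ` {..<m})"
    have C: "u i \<le> C" if "i < m" for i unfolding C_def using that by auto
    have C0: "0 \<le> C" using C[of 0] nn[of 0] m by auto
    obtain N :: nat where N: "N \<ge> m" "2 * C / e < N"
      by (metis reals_Archimedean2 max.cobounded1 max.cobounded2 of_nat_le_iff order_less_le_trans)
    show "\<exists>no. \<forall>n\<ge>no. norm (u n / n - L) < e"
    proof (intro exI allI impI)
      fix n assume n: "n \<ge> N"
      hence n1: "n \<ge> 1" "n \<ge> m" using N m by linarith+
      have q1: "n div m \<ge> 1" using n1 m by (simp add: Suc_leI div_greater_zero_iff)
      have "u n = u ((n div m) * m + n mod m)" by simp
      also have "\<dots> \<le> u ((n div m) * m) + u (n mod m)" by (rule sub)
      also have "\<dots> \<le> (n div m) * u m + C"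
        using mult[OF q1, of m] C[of "n mod m"] m by (intro add_mono) auto
      also have "(n div m) * u m \<le> (n / m) * u m"
        using nn by (intro mult_right_mono of_nat_div_le_of_nat) auto
      finally have "u n \<le> n * (u m / m) + C" by simp
      hence "u n / n \<le> u m / m + C / n" using n1 by (simp add: field_simps)
      moreover have "C / n < e / 2"
      proof -
        have "2 * C / e < n" using N n by linarith
        thus ?thesis using e n1 by (simp add: field_simps)
      qed
      ultimately have "u n / n < L + e" using m by linarith
      with lower[OF n1(1)] show "norm (u n / n - L) < e" by (simp add: abs_if)
    qed
  qed
  thus ?thesis by (rule convergentI)
qed

text \<open>An identity matrix has full rank. Elimination: subtracting multiples of row
  \<open>i0\<close> kills the last rank-one term at the price of one row, and the remaining rows and
  columns still form an identity matrix.\<close>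

lemma identity_decomposition_bound:
  fixes a b :: "nat \<Rightarrow> 'i \<Rightarrow> 'f::field"
  assumes "finite X" and "\<And>i j. i \<in> X \<Longrightarrow> j \<in> X \<Longrightarrow> (\<Sum>q<r. a q i * b q j) = (if i = j then 1 else 0)"
  shows "card X \<le> r"
  using assms
proof (induction r arbitrary: X a b)
  case 0
  have False if "i \<in> X" for i using 0(2)[OF that that] by simp
  then have "X = {}" by blast
  then show ?case by simp
next
  case (Suc r)
  show ?case
  proof (cases "\<exists>i0\<in>X. a r i0 \<noteq> 0")
    case False
    have "card X \<le> r"
    proof (rule Suc.IH[OF Suc.prems(1)])
      show "(\<Sum>q<r. a q i * b q j) = (if i = j then 1 else 0)" if "i \<in> X" "j \<in> X" for i j
        using Suc.prems(2)[OF that] False that by simp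
    qed
    thus ?thesis by simp
  next
    case True
    then obtain i0 where i0: "i0 \<in> X" "a r i0 \<noteq> 0" by blast
    define a' where "a' q i = a q i - a r i / a r i0 * a q i0" for q i
    have "card (X - {i0}) \<le> r"
    proof (rule Suc.IH)
      fix i j assume ij: "i \<in> X - {i0}" "j \<in> X - {i0}"
      have "(\<Sum>q<r. a' q i * b q j) = (\<Sum>q<Suc r. a' q i * b q j)"
        using i0 by (simp add: a'_def)
      also have "\<dots> = (\<Sum>q<Suc r. a q i * b q j) - a r i / a r i0 * (\<Sum>q<Suc r. a q i0 * b q j)"
        unfolding sum_distrib_left sum_subtractf[symmetric] by (intro sum.cong) (auto simp: a'_def algebra_simps)
      also have "\<dots> = (if i = j then 1 else 0)"
        using Suc.prems(2)[of i j] Suc.prems(2)[of i0 j] ij i0 by (auto simp del: sum.lessThan_Suc)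
      finally show "(\<Sum>q<r. a' q i * b q j) = (if i = j then 1 else 0)" .
    qed (use Suc.prems in auto)
    thus ?thesis using i0 Suc.prems(1) by (simp add: card_Diff_singleton)
  qed
qed

text \<open>Flattening: merge the last two indices and restrict them to the pairs
  \<open>(f j, g j)\<close>. This leaves an identity matrix, and taking Kronecker powers preserves
  that.\<close>

lemma card_indices_power_le_rank:
  assumes fin: "finite (indices T)"
    and fg: "\<And>i. i \<in> indices T \<Longrightarrow> f i \<in> indices T \<and> g i \<in> indices T"
    and diag: "\<And>i j. i \<in> indices T \<Longrightarrow> j \<in> indices T \<Longrightarrow>
      tensor.coeff T i (f j) (g j) = (if i = j then 1 else 0)"
  shows "card (indices T) ^ r \<le> tensor_rank (kronecker_power T r)"
proof -
  let ?P = "kronecker_power T r" and ?X = "indices (kronecker_power T r)"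
  have finX: "finite ?X" by (rule finite_indices_kronecker_power[OF fin])
  obtain a b c where 1: "\<And>x y z. x \<in> ?X \<Longrightarrow> y \<in> ?X \<Longrightarrow> z \<in> ?X \<Longrightarrow>
      tensor.coeff ?P x y z = (\<Sum>q<tensor_rank ?P. a q x * b q y * c q z)"
    using tensor_rank_works[OF finX] unfolding lin_comb_of_rank_ones_iff by blast
  have "card ?X \<le> tensor_rank ?P"
  proof (rule identity_decomposition_bound[OF finX])
    fix x y assume xy: "x \<in> ?X" "y \<in> ?X"
    hence m: "map f y \<in> ?X" "map g y \<in> ?X" using fg by (auto simp: kronecker_power_simps)
    have len: "length x = r" "length y = r" using xy by (auto simp: kronecker_power_simps)
    have "(\<Sum>q<tensor_rank ?P. a q x * (b q (map f y) * c q (map g y))) = tensor.coeff ?P x (map f y) (map g y)"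
      unfolding 1[OF xy(1) m] by (simp add: mult.assoc)
    also have "\<dots> = (\<Prod>i<r. tensor.coeff T (x ! i) (f (y ! i)) (g (y ! i)))"
      using len by (subst kronecker_power_simps(2)) auto
    also have "\<dots> = (\<Prod>i<r. if x ! i = y ! i then 1 else 0)"
      using xy len by (intro prod.cong diag) (auto simp: kronecker_power_simps subset_iff)
    also have "\<dots> = (if x = y then 1 else 0)"
    proof (cases "x = y")
      case False
      then obtain i where "i < r" "x ! i \<noteq> y ! i" using len nth_equalityI[of x y] by auto
      thus ?thesis using False by (auto intro!: prod_zero bexI[of _ i])
    qed simp
    finally show "(\<Sum>q<tensor_rank ?P. a q x * (b q (map f y) * c q (map g y))) = (if x = y then 1 else 0)" .
  qed
  moreover have "card ?X = card (indices T) ^ r"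
    using card_lists_length_eq[OF fin, of r] by (simp add: kronecker_power_simps conj_commute)
  ultimately show ?thesis by simp
qed

text \<open>\<open>asymptotic_rank\<close> is defined by \<open>lim\<close>, which carries
  information only once convergence is known. Ranks of at least 1 have nonnegative logarithms, as
  \<open>Fekete\<close> demands.\<close>

lemma root_rank_tendsto_asymptotic_rank:
  assumes fin: "finite (indices T)" and pos: "\<And>r. 1 \<le> tensor_rank (kronecker_power T r)"
  shows "(\<lambda>r. root r (real (tensor_rank (kronecker_power T r)))) \<longlonglongrightarrow> asymptotic_rank T"
proof -
  let ?R = "\<lambda>r. real (tensor_rank (kronecker_power T r))"
  have R1: "?R r \<ge> 1" for r using pos[of r] by simp
  have "convergent (\<lambda>r. ln (?R r) / r)"
  proof (rule Fekete)
    fix m n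
    have "?R (m + n) \<le> ?R m * ?R n"
      using tensor_rank_kronecker_power_add[OF fin, of m n] by (metis of_nat_le_iff of_nat_mult)
    hence "ln (?R (m + n)) \<le> ln (?R m * ?R n)" using R1[of "m + n"] by (intro ln_mono) auto
    also have "\<dots> = ln (?R m) + ln (?R n)" using R1[of m] R1[of n] by (intro ln_mult_pos) auto
    finally show "ln (?R (m + n)) \<le> ln (?R m) + ln (?R n)" .
  qed (use R1 in auto)
  then obtain L where "(\<lambda>r. ln (?R r) / r) \<longlonglongrightarrow> L" by (auto simp: convergent_def)
  hence "(\<lambda>r. exp (ln (?R r) / r)) \<longlonglongrightarrow> exp L" by (rule tendsto_exp)
  moreover have "eventually (\<lambda>r. exp (ln (?R r) / r) = root r (?R r)) sequentially"
    using eventually_gt_at_top[of 0]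
  proof eventually_elim
    case (elim r)
    thus ?case using R1[of r] by (simp add: root_powr_inverse powr_def divide_inverse mult.commute)
  qed
  ultimately have "(\<lambda>r. root r (?R r)) \<longlonglongrightarrow> exp L" by (rule Lim_transform_eventually)
  thus ?thesis unfolding asymptotic_rank_def using limI by fastforce
qed

section \<open>Shuffling and balanced words\<close>

lemma card_positions_eq_count: "card {i. i < length xs \<and> xs ! i = x} = count (mset xs) x"
proof -
  have "card {i. i < length xs \<and> xs ! i = x} = length (filter (\<lambda>y. y = x) xs)"
    by (rule length_filter_conv_card[symmetric])
  also have "\<dots> = count (mset xs) x" by (induction xs) auto
  finally show ?thesis .
qed

text \<open>Fisher--Yates shuffle of the first \<open>l\<close> entries, driven by the mixed radix digits of \<open>u\<close>.\<close>

primrec shuffle :: "nat \<Rightarrow> nat \<Rightarrow> (nat \<Rightarrow> 'a) \<Rightarrow> nat \<Rightarrow> 'a" where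
  "shuffle 0 u p = p"
| "shuffle (Suc l) u p =
     shuffle l (u div Suc l) (p(u mod Suc l := p l, l := p (u mod Suc l)))"

text \<open>The shuffle moves positions and never inspects entries. Hence shuffling the letters of a
  partition is the same as composing the letters with a random permutation.\<close>

lemma shuffle_comp: "shuffle l u (f \<circ> p) = f \<circ> shuffle l u p"
proof (induction l arbitrary: u p)
  case (Suc l)
  have "(f \<circ> p)(u mod Suc l := (f \<circ> p) l, l := (f \<circ> p) (u mod Suc l)) =
      f \<circ> (p(u mod Suc l := p l, l := p (u mod Suc l)))"
    by (auto simp: fun_eq_iff)
  thus ?case by (simp only: shuffle.simps Suc)
qed simp

lemma shuffle_ge: "l \<le> i \<Longrightarrow> shuffle l u p i = p i"
proof (induction l arbitrary: u p)
  case (Suc l)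
  have "u mod Suc l \<noteq> i" using Suc.prems mod_less_divisor[of "Suc l" u] by linarith
  with Suc show ?case by simp
qed simp

lemma map_swap_upt:
  assumes "v \<le> l"
  shows "map (p(v := p l, l := p v)) [0..<Suc l] = (map p [0..<Suc l])[v := p l, l := p v]"
  using assms by (intro nth_equalityI) (auto simp: nth_list_update simp del: upt_Suc)

lemma mset_map_swap:
  assumes "v \<le> l"
  shows "mset (map (p(v := p l, l := p v)) [0..<Suc l]) = mset (map p [0..<Suc l])"
proof -
  let ?xs = "map p [0..<Suc l]"
  have nth: "?xs ! l = p l" "?xs ! v = p v" using assms by (auto simp del: upt_Suc)
  have "mset (?xs[v := ?xs ! l, l := ?xs ! v]) = mset ?xs"
    using assms by (intro mset_swap) auto
  thus ?thesis unfolding map_swap_upt[OF assms] nth .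
qed

lemma map_shuffle_Suc:
  "map (shuffle (Suc l) u p) [0..<Suc l] =
    map (shuffle l (u div Suc l) (p(u mod Suc l := p l, l := p (u mod Suc l)))) [0..<l] @ [p (u mod Suc l)]"
  by (simp add: shuffle_ge)

lemma mset_shuffle: "mset (map (shuffle l u p) [0..<l]) = mset (map p [0..<l])"
proof (induction l arbitrary: u p)
  case (Suc l)
  let ?p = "p(u mod Suc l := p l, l := p (u mod Suc l))"
  have v: "u mod Suc l \<le> l" using mod_less_divisor[of "Suc l" u] by linarith
  have "mset (map (shuffle (Suc l) u p) [0..<Suc l]) = mset (map ?p [0..<l]) + {#p (u mod Suc l)#}"
    unfolding map_shuffle_Suc mset_append Suc by simp
  also have "\<dots> = mset (map ?p [0..<Suc l])" by simp
  also have "\<dots> = mset (map p [0..<Suc l])" by (rule mset_map_swap[OF v])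
  finally show ?case .
qed simp

lemma bij_betw_shuffle: "bij_betw (shuffle l u id) {..<l} {..<l}"
proof -
  have "set_mset (mset (map (shuffle l u id) [0..<l])) = set_mset (mset (map id [0..<l]))"
    by (simp only: mset_shuffle)
  hence "shuffle l u id ` {..<l} = {..<l}" by (simp add: lessThan_atLeast0)
  thus ?thesis by (simp add: bij_betw_def eq_card_imp_inj_on)
qed

text \<open>Uniformity, stated for sequences with repeated entries: all rearrangements arise from
  equally many seeds. The lowest digit of the seed decides which entry moves to the end, with as
  many choices as the multiplicity of the wanted letter; the quotient drives the rest.\<close>

lemma card_shuffle_eq:
  assumes "mset ys = mset (map p [0..<l])" "finite S" "set ys \<subseteq> S"
  shows "card {u. u < fact l \<and> map (shuffle l u p) [0..<l] = ys} = (\<Prod>x\<in>S. fact (count (mset ys) x))"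
  using assms
proof (induction l arbitrary: p ys)
  case 0
  hence "ys = []" by simp
  moreover have "{u. u < fact 0 \<and> map (shuffle 0 u p) [0..<0] = []} = {0 :: nat}" by auto
  ultimately show ?case by simp
next
  case (Suc l)
  have len: "length ys = Suc l" using arg_cong[OF Suc.prems(1), of size] by simp
  then obtain zs y where ys: "ys = zs @ [y]" "length zs = l"
    unfolding length_Suc_conv_rev by blast
  define K where "K = (\<Prod>x\<in>S. fact (count (mset zs) x) :: nat)"
  define V where "V = {v. v \<le> l \<and> p v = y}"
  define q where "q v = p(v := p l, l := p v)" for v
  have K: "card {u. u < fact l \<and> map (shuffle l u (q v)) [0..<l] = zs} = K" if v: "v \<in> V" for v
    unfolding K_def
  proof (rule Suc.IH)
    have "mset (map (q v) [0..<l]) + {#y#} = mset (map (q v) [0..<Suc l])"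
      using v by (simp add: q_def V_def)
    also have "\<dots> = mset ys" using v unfolding q_def V_def Suc.prems(1) by (intro mset_map_swap) auto
    finally show "mset zs = mset (map (q v) [0..<l])" by (simp add: ys)
  qed (use Suc.prems ys in auto)
  \<comment> \<open>A seed is split as \<open>u = v + Suc l * u'\<close> into the digit consumed by
    the first swap and the seed for the remaining ones.\<close>
  have bij: "bij_betw (\<lambda>(v, u'). v + Suc l * u') (SIGMA v:V. {u. u < fact l \<and> map (shuffle l u (q v)) [0..<l] = zs})
      {u. u < fact (Suc l) \<and> map (shuffle (Suc l) u p) [0..<Suc l] = ys}"
  proof (rule bij_betwI[where g = "\<lambda>u. (u mod Suc l, u div Suc l)"], goal_cases)
    case 1
    have "v + Suc l * u' < fact (Suc l)" if "v \<le> l" "u' < fact l" for v u'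
    proof -
      have "v + Suc l * u' < Suc l * Suc u'" using that(1) by simp
      also have "\<dots> \<le> Suc l * fact l" using that(2) by (intro mult_left_mono) auto
      finally show ?thesis by simp
    qed
    moreover have "map (shuffle (Suc l) (v + Suc l * u') p) [0..<Suc l] = ys"
      if "v \<in> V" "map (shuffle l u' (q v)) [0..<l] = zs" for v u'
    proof -
      have "(v + Suc l * u') mod Suc l = v" "(v + Suc l * u') div Suc l = u'"
        using that(1) unfolding V_def by (simp_all del: mult_Suc)
      thus ?thesis unfolding map_shuffle_Suc using that by (simp add: q_def V_def ys)
    qed
    ultimately show ?case unfolding V_def by (auto simp del: mult_Suc upt_Suc shuffle.simps fact_Suc)
  next
    case 2
    show ?case
    proof (rule funcsetI)
      fix u assume "u \<in> {u. u < fact (Suc l) \<and> map (shuffle (Suc l) u p) [0..<Suc l] = ys}"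
      hence u: "u < fact (Suc l)" "map (shuffle (Suc l) u p) [0..<Suc l] = ys" by blast+
      have "u div Suc l < fact l"
        using u(1) by (intro less_mult_imp_div_less) (simp only: fact_Suc of_nat_id mult.commute)
      moreover have "map (shuffle l (u div Suc l) (q (u mod Suc l))) [0..<l] = zs \<and> p (u mod Suc l) = y"
        using u(2) unfolding map_shuffle_Suc ys(1) append1_eq_conv q_def .
      moreover have "u mod Suc l \<le> l" using mod_less_divisor[of "Suc l" u] by linarith
      ultimately show "(u mod Suc l, u div Suc l) \<in>
          (SIGMA v:V. {u. u < fact l \<and> map (shuffle l u (q v)) [0..<l] = zs})"
        unfolding V_def mem_Sigma_iff mem_Collect_eq by blast
    qed
  next
    case (3 x)
    obtain v u' where x: "x = (v, u')" "v \<le> l" using 3 unfolding V_def by blast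
    have "(v + Suc l * u') mod Suc l = v" "(v + Suc l * u') div Suc l = u'"
      using x(2) by (simp_all del: mult_Suc)
    thus ?case unfolding x(1) by (simp only: prod.case)
  next
    case (4 u)
    show ?case by (simp only: prod.case mod_mult_div_eq)
  qed
  have "card V = count (mset ys) y"
  proof -
    have "count (mset ys) y = card {v. v < length (map p [0..<Suc l]) \<and> map p [0..<Suc l] ! v = y}"
      unfolding Suc.prems(1) by (rule card_positions_eq_count[symmetric])
    also have "{v. v < length (map p [0..<Suc l]) \<and> map p [0..<Suc l] ! v = y} = V"
      unfolding V_def by (intro Collect_cong) (auto simp del: upt_Suc)
    finally show ?thesis ..
  qed
  moreover have "card {u. u < fact (Suc l) \<and> map (shuffle (Suc l) u p) [0..<Suc l] = ys} = card V * K"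
  proof -
    have "finite V" unfolding V_def by simp
    hence "card (SIGMA v:V. {u. u < fact l \<and> map (shuffle l u (q v)) [0..<l] = zs}) =
        (\<Sum>v\<in>V. card {u. u < fact l \<and> map (shuffle l u (q v)) [0..<l] = zs})"
      by (intro card_SigmaI) (auto intro: finite_subset[of _ "{..<fact l}"])
    also have "\<dots> = card V * K" using K by simp
    finally show ?thesis using bij_betw_same_card[OF bij] by simp
  qed
  moreover have "(\<Prod>x\<in>S. fact (count (mset ys) x)) = count (mset ys) y * K"
  proof -
    have y: "y \<in> S" using Suc.prems ys by simp
    have "(\<Prod>x\<in>S. fact (count (mset ys) x)) =
        fact (count (mset ys) y) * (\<Prod>x\<in>S - {y}. fact (count (mset ys) x) :: nat)"
      by (rule prod.remove[OF Suc.prems(2) y])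
    also have "(\<Prod>x\<in>S - {y}. fact (count (mset ys) x)) = (\<Prod>x\<in>S - {y}. fact (count (mset zs) x) :: nat)"
      by (intro prod.cong) (auto simp: ys)
    also have "fact (count (mset ys) y) = count (mset ys) y * (fact (count (mset zs) y) :: nat)"
      by (simp add: ys(1))
    finally show ?thesis
      by (simp only: K_def prod.remove[OF Suc.prems(2) y, of "\<lambda>x. fact (count (mset zs) x)"] mult.assoc)
  qed
  ultimately show ?case by (simp only:)
qed

section \<open>Three-letter words as ordered tripartitions\<close>

definition three_letters :: "nat \<Rightarrow> nat multiset" where
  "three_letters n = replicate_mset n 0 + replicate_mset n 1 + replicate_mset n 2"

lemma prod_fact_three_letters: "(\<Prod>x\<in>{0, 1, 2}. fact (count (three_letters n) x)) = (fact n ^ 3 :: nat)"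
  by (simp add: three_letters_def power3_eq_cube)

lemma set_three_letters: "set_mset (three_letters n) \<subseteq> {0, 1, 2}"
  by (auto simp: three_letters_def split: if_splits)

lemma card_words: "card (permutations_of_multiset (three_letters n)) * fact n ^ 3 = fact (3 * n)"
proof -
  have "(\<Prod>x\<in>set_mset (three_letters n). fact (count (three_letters n) x)) =
      (\<Prod>x\<in>{0, 1, 2}. fact (count (three_letters n) x) :: nat)"
    using set_three_letters by (intro prod.mono_neutral_left) (auto simp: not_in_iff)
  also have "\<dots> = fact n ^ 3" by (rule prod_fact_three_letters)
  finally have "card (permutations_of_multiset (three_letters n)) * fact n ^ 3 = fact (size (three_letters n))"
    using card_permutations_of_multiset_aux[of "three_letters n"] by simp
  moreover have "size (three_letters n) = 3 * n" by (simp add: three_letters_def)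
  ultimately show ?thesis by simp
qed

lemma card_words_binomial:
  "card (permutations_of_multiset (three_letters k)) = (3 * k choose k) * (2 * k choose k)"
proof -
  have 1: "fact k * fact (2 * k) * (3 * k choose k) = (fact (3 * k) :: nat)"
    using binomial_fact_lemma[of k "3 * k"] by simp
  have 2: "fact k * fact k * (2 * k choose k) = (fact (2 * k) :: nat)"
    using binomial_fact_lemma[of k "2 * k"] by simp
  have "((3 * k choose k) * (2 * k choose k)) * fact k ^ 3 =
      fact k * (fact k * fact k * (2 * k choose k)) * (3 * k choose k)"
    by (simp add: power3_eq_cube)
  also have "\<dots> = fact (3 * k)" unfolding 2 1 ..
  finally have "((3 * k choose k) * (2 * k choose k)) * fact k ^ 3 =
      card (permutations_of_multiset (three_letters k)) * fact k ^ 3" unfolding card_words .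
  thus ?thesis by simp
qed

lemma card_words_le: "card (permutations_of_multiset (three_letters n)) \<le> 27 ^ n"
proof -
  have "permutations_of_multiset (three_letters n) \<subseteq> {xs. set xs \<subseteq> {0, 1, 2} \<and> length xs = 3 * n}"
  proof
    fix xs assume "xs \<in> permutations_of_multiset (three_letters n)"
    hence "mset xs = three_letters n" by (rule permutations_of_multisetD)
    hence "set xs = set_mset (three_letters n)" "length xs = size (three_letters n)"
      by (metis set_mset_mset, metis size_mset)
    moreover have "size (three_letters n) = 3 * n" by (simp add: three_letters_def)
    ultimately show "xs \<in> {xs. set xs \<subseteq> {0, 1, 2} \<and> length xs = 3 * n}"
      using set_three_letters[of n] by simp
  qed
  hence "card (permutations_of_multiset (three_letters n)) \<le> card {xs :: nat list. set xs \<subseteq> {0, 1, 2} \<and> length xs = 3 * n}"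
    by (rule card_mono[OF finite_lists_length_eq, rotated]) simp
  also have "\<dots> = card {0, 1, 2 :: nat} ^ (3 * n)" by (rule card_lists_length_eq) simp
  also have "card {0, 1, 2 :: nat} = 3" by simp
  also have "(3 :: nat) ^ (3 * n) = 27 ^ n" by (simp only: power_mult power3_eq_cube) simp
  finally show ?thesis .
qed

definition balanced_words :: "nat \<Rightarrow> nat \<Rightarrow> nat list set" where
  "balanced_words k m = concat ` {xss. set xss \<subseteq> permutations_of_multiset (three_letters k) \<and> length xss = m}"

lemma length_word: "xs \<in> permutations_of_multiset (three_letters k) \<Longrightarrow> length xs = 3 * k"
  by (drule permutations_of_multisetD, drule arg_cong[of _ _ size]) (simp add: three_letters_def)

lemma card_balanced_words: "card (balanced_words k m) = card (permutations_of_multiset (three_letters k)) ^ m"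
proof -
  have "inj_on concat {xss. set xss \<subseteq> permutations_of_multiset (three_letters k) \<and> length xss = m}"
  proof (rule inj_onI, rule concat_injective)
    fix xss yss assume *: "xss \<in> {xss. set xss \<subseteq> permutations_of_multiset (three_letters k) \<and> length xss = m}"
      "yss \<in> {xss. set xss \<subseteq> permutations_of_multiset (three_letters k) \<and> length xss = m}"
    show "\<forall>(x, y)\<in>set (zip xss yss). length x = length y"
    proof clarify
      fix x y assume "(x, y) \<in> set (zip xss yss)"
      hence "x \<in> set xss" "y \<in> set yss" by (auto dest: set_zip_leftD set_zip_rightD)
      with * have "x \<in> permutations_of_multiset (three_letters k)" "y \<in> permutations_of_multiset (three_letters k)"
        by auto
      thus "length x = length y" by (simp only: length_word)
    qed
    show "length xss = length yss" using * by simp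
  qed
  thus ?thesis unfolding balanced_words_def by (simp add: card_image card_lists_length_eq)
qed

lemma finite_balanced_words: "finite (balanced_words k m)"
  unfolding balanced_words_def by (intro finite_imageI finite_lists_length_eq) simp

lemma mset_balanced_word: "ys \<in> balanced_words k m \<Longrightarrow> mset ys = three_letters (k * m)"
proof -
  assume "ys \<in> balanced_words k m"
  then obtain xss where "ys = concat xss" "set xss \<subseteq> permutations_of_multiset (three_letters k)" "length xss = m"
    unfolding balanced_words_def by blast
  moreover have "mset (concat xss) = three_letters (k * length xss)"
    if "set xss \<subseteq> permutations_of_multiset (three_letters k)" for xss
    using that
  proof (induction xss)
    case (Cons xs xss)
    hence "mset xs = three_letters k" by (auto dest: permutations_of_multisetD)
    with Cons show ?case
      by (simp add: three_letters_def multiset_eq_iff)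
  qed (simp add: three_letters_def)
  ultimately show ?thesis by simp
qed

lemma nth_concat_uniform:
  assumes "\<And>xs. xs \<in> set xss \<Longrightarrow> length xs = L" "\<beta> < length xss" "i < L"
  shows "concat xss ! (\<beta> * L + i) = xss ! \<beta> ! i"
  using assms
proof (induction xss arbitrary: \<beta>)
  case (Cons xs xss)
  show ?case
  proof (cases \<beta>)
    case 0
    then show ?thesis using Cons.prems by (simp add: nth_append)
  next
    case (Suc \<gamma>)
    then show ?thesis using Cons.prems Cons.IH[of \<gamma>] by (simp add: nth_append add.assoc)
  qed
qed simp

lemma balanced_word_block:
  assumes "ys \<in> balanced_words k m" "\<beta> < m" "x < 3"
  shows "card {i. i < 3 * k \<and> ys ! (\<beta> * (3 * k) + i) = x} = k"
proof -
  obtain xss where xss: "ys = concat xss" "set xss \<subseteq> permutations_of_multiset (three_letters k)" "length xss = m"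
    using assms(1) unfolding balanced_words_def by blast
  let ?xs = "xss ! \<beta>"
  have mem: "?xs \<in> permutations_of_multiset (three_letters k)" using xss assms(2) by auto
  have "{i. i < 3 * k \<and> ys ! (\<beta> * (3 * k) + i) = x} = {i. i < length ?xs \<and> ?xs ! i = x}"
  proof (intro Collect_cong)
    fix i
    have len: "length xs = 3 * k" if "xs \<in> set xss" for xs using that xss(2) length_word by blast
    have \<beta>: "\<beta> < length xss" using assms(2) xss(3) by simp
    have "ys ! (\<beta> * (3 * k) + i) = ?xs ! i" if "i < 3 * k"
      unfolding xss(1) by (rule nth_concat_uniform[OF _ \<beta> that]) (rule len)
    thus "i < 3 * k \<and> ys ! (\<beta> * (3 * k) + i) = x \<longleftrightarrow> i < length ?xs \<and> ?xs ! i = x"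
      unfolding length_word[OF mem] by (cases "i < 3 * k") simp_all
  qed
  also have "card \<dots> = count (mset ?xs) x"
    by (rule card_positions_eq_count)
  also have "mset ?xs = three_letters k" using mem by (rule permutations_of_multisetD)
  also have "count (three_letters k) x = k"
  proof -
    have "x = 0 \<or> x = 1 \<or> x = 2" using assms(3) by linarith
    thus ?thesis unfolding three_letters_def by (elim disjE) simp_all
  qed
  finally show ?thesis .
qed

text \<open>By uniformity the proportion of good seeds is the number of balanced words divided by
  the number of all words with \<open>k * m\<close> copies of each letter. The denominator is at
  most \<open>3 ^ (3 * (k * m))\<close>, which is the source of 27. The inequality is kept free of
  division.\<close>

lemma shuffle_balanced_count:
  fixes w :: "nat \<Rightarrow> nat"
  assumes w: "mset (map w [0..<3 * (k * m)]) = three_letters (k * m)"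
  shows "((3 * k choose k) * (2 * k choose k)) ^ m * fact (3 * (k * m)) \<le>
    27 ^ (k * m) * card {u. u < fact (3 * (k * m)) \<and> map (shuffle (3 * (k * m)) u w) [0..<3 * (k * m)] \<in> balanced_words k m}"
proof -
  let ?N = "3 * (k * m)"
  have un: "{u. u < fact ?N \<and> map (shuffle ?N u w) [0..<?N] \<in> balanced_words k m} =
      (\<Union>ys\<in>balanced_words k m. {u. u < fact ?N \<and> map (shuffle ?N u w) [0..<?N] = ys})" by blast
  have "card {u. u < fact ?N \<and> map (shuffle ?N u w) [0..<?N] \<in> balanced_words k m} =
      card (\<Union>ys\<in>balanced_words k m. {u. u < fact ?N \<and> map (shuffle ?N u w) [0..<?N] = ys})"
    unfolding un ..
  also have "\<dots> = (\<Sum>ys\<in>balanced_words k m. card {u. u < fact ?N \<and> map (shuffle ?N u w) [0..<?N] = ys})"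
  proof (rule card_UN_disjoint[OF finite_balanced_words])
    have "finite {u. u < fact ?N \<and> map (shuffle ?N u w) [0..<?N] = ys}" for ys
      by (rule finite_subset[of _ "{..<fact ?N}"]) (blast, simp)
    thus "\<forall>ys\<in>balanced_words k m. finite {u. u < fact ?N \<and> map (shuffle ?N u w) [0..<?N] = ys}"
      by blast
    have "{u. u < fact ?N \<and> map (shuffle ?N u w) [0..<?N] = ys} \<inter>
        {u. u < fact ?N \<and> map (shuffle ?N u w) [0..<?N] = zs} = {}" if "ys \<noteq> zs" for ys zs
    proof (rule equals0I, elim IntE CollectE conjE)
      fix u assume "map (shuffle ?N u w) [0..<?N] = ys" "map (shuffle ?N u w) [0..<?N] = zs"
      with that show False by (rule notE[OF _ trans[OF sym]])
    qed
    thus "\<forall>ys\<in>balanced_words k m. \<forall>zs\<in>balanced_words k m. ys \<noteq> zs \<longrightarrow>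
        {u. u < fact ?N \<and> map (shuffle ?N u w) [0..<?N] = ys} \<inter>
        {u. u < fact ?N \<and> map (shuffle ?N u w) [0..<?N] = zs} = {}"
      by (intro ballI impI)
  qed
  also have "\<dots> = (\<Sum>ys\<in>balanced_words k m. fact (k * m) ^ 3)"
  proof (rule sum.cong[OF refl])
    fix ys assume ys: "ys \<in> balanced_words k m"
    note m = mset_balanced_word[OF ys]
    have sub: "set ys \<subseteq> {0, 1, 2}"
      using set_three_letters[of "k * m"] unfolding m[symmetric] set_mset_mset .
    have "card {u. u < fact ?N \<and> map (shuffle ?N u w) [0..<?N] = ys} =
        (\<Prod>x\<in>{0, 1, 2}. fact (count (mset ys) x))"
      by (rule card_shuffle_eq[OF trans[OF m w[symmetric]] _ sub]) (rule finite.intros)+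
    thus "card {u. u < fact ?N \<and> map (shuffle ?N u w) [0..<?N] = ys} = fact (k * m) ^ 3"
      unfolding m prod_fact_three_letters .
  qed
  also have "\<dots> = ((3 * k choose k) * (2 * k choose k)) ^ m * fact (k * m) ^ 3"
    by (simp only: sum_constant card_balanced_words card_words_binomial of_nat_id)
  finally have *: "card {u. u < fact ?N \<and> map (shuffle ?N u w) [0..<?N] \<in> balanced_words k m} =
      ((3 * k choose k) * (2 * k choose k)) ^ m * fact (k * m) ^ 3" .
  have "fact ?N \<le> 27 ^ (k * m) * (fact (k * m) ^ 3 :: nat)"
    unfolding card_words[of "k * m", symmetric] by (rule mult_right_mono[OF card_words_le]) (rule zero_le)
  from mult_left_mono[OF this, of "((3 * k choose k) * (2 * k choose k)) ^ m"]
  show ?thesis unfolding * by (simp only: mult.left_commute zero_le)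
qed

section \<open>Cost-aware program logic\<close>

definition bounded :: "nat \<Rightarrow> state \<Rightarrow> bool" where
  "bounded w s \<longleftrightarrow> (\<forall>X a. s X a < 2 ^ w)"

text \<open>If all cells have at most \<open>w\<close> bits, then \<open>e\<close> evaluates to at
  most \<open>w * val_size e\<close> bits, a factor that depends on the program text alone. Bit
  lengths add up under multiplication; the \<open>+ 1\<close> pays for the carry of a sum and the
  results of comparisons.\<close>

primrec val_size :: "aexp \<Rightarrow> nat" where
  "val_size (NUM x) = bit_len x"
| "val_size (MEM X a) = 1"
| "val_size (OP f a b) = val_size a + val_size b + 1"

primrec exp_cost :: "aexp \<Rightarrow> nat" where
  "exp_cost (NUM x) = bit_len x"
| "exp_cost (MEM X a) = exp_cost a + val_size a + 1"
| "exp_cost (OP f a b) = exp_cost a + exp_cost b + val_size a + val_size b"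

text \<open>A maximum instead of a sum, since a single step executes only one piece of the program:
  \<open>step_cost c * w\<close> bounds the charge for any step, and the number of charges is
  tracked separately by \<open>wp\<close>.\<close>

primrec step_cost :: "com \<Rightarrow> nat" where
  "step_cost SKIP = 1"
| "step_cost (ASSIGN X a b) = exp_cost a + exp_cost b + val_size a + val_size b"
| "step_cost (FLIP X a) = exp_cost a + val_size a + 1"
| "step_cost (SEQ c d) = max (step_cost c) (step_cost d)"
| "step_cost (IF a c d) = max (exp_cost a + val_size a) (max (step_cost c) (step_cost d))"
| "step_cost (WHILE a c) = max (exp_cost a + val_size a) (step_cost c)"

primrec mods :: "com \<Rightarrow> string set" where
  "mods SKIP = {}"
| "mods (ASSIGN X a b) = {X}"
| "mods (FLIP X a) = {X}"
| "mods (SEQ c d) = mods c \<union> mods d"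
| "mods (IF a c d) = mods c \<union> mods d"
| "mods (WHILE a c) = mods c"

lemma bit_len_pos: "1 \<le> bit_len x"
  by (simp add: bit_len_def)

lemma lt_two_power_bit_len: "x < 2 ^ bit_len x"
proof (cases "x = 0")
  case False
  have "x < 2 ^ floorlog 2 x"
    using floorlog_bounds[of x 2] False by auto
  also have "\<dots> \<le> 2 ^ bit_len x"
    by (rule power_increasing) (auto simp: bit_len_def)
  finally show ?thesis .
qed simp

lemma bit_len_le:
  assumes "x < 2 ^ v" "1 \<le> v"
  shows "bit_len x \<le> v"
proof (cases "x = 0")
  case True
  then show ?thesis using assms by (simp add: bit_len_def floorlog_def)
next
  case False
  have "2 ^ (floorlog 2 x - 1) \<le> x"
    using floorlog_bounds[of x 2] False by auto
  with assms(1) have "(2::nat) ^ (floorlog 2 x - 1) < 2 ^ v" by linarith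
  hence "floorlog 2 x - 1 < v" by simp
  thus ?thesis using assms by (auto simp: bit_len_def)
qed

lemma val_size_pos: "1 \<le> val_size e"
  by (cases e) (auto simp: bit_len_pos[simplified])

lemma step_cost_pos: "1 \<le> step_cost c"
proof (induction c)
  case (ASSIGN X a b)
  then show ?case using val_size_pos[of a] by simp
next
  case (IF a c d)
  then show ?case by simp
qed auto

lemma aval_bound:
  assumes "1 \<le> w" "bounded w s"
  shows "aval e s < 2 ^ (w * val_size e)"
proof (induction e)
  case (NUM x)
  have "x < 2 ^ bit_len x" by (rule lt_two_power_bit_len)
  also have "\<dots> \<le> 2 ^ (w * bit_len x)" using assms by (intro power_increasing) auto
  finally show ?case by simp
next
  case (MEM X a)
  then show ?case using assms by (simp add: bounded_def)
next
  case (OP f a b)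
  let ?x = "aval a s" and ?y = "aval b s"
  let ?A = "(2::nat) ^ (w * val_size a)" and ?B = "(2::nat) ^ (w * val_size b)"
  have pw: "(2::nat) \<le> 2 ^ w"
    using power_increasing[of 1 w "2::nat"] assms(1) by simp
  have eq: "2 ^ (w * val_size (OP f a b)) = ?A * ?B * 2 ^ w"
    by (simp add: power_add distrib_left)
  have A1: "?A \<ge> 1" and B1: "?B \<ge> 1" by auto
  have "?A * ?B * 2 \<le> ?A * ?B * 2 ^ w" using pw by (rule mult_left_mono) simp
  moreover have "?A + ?B \<le> ?A * ?B * 2"
  proof -
    have "?A \<le> ?A * ?B" "?B \<le> ?A * ?B" by simp_all
    thus ?thesis by linarith
  qed
  ultimately have AB: "?A + ?B \<le> ?A * ?B * 2 ^ w" by linarith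
  have mulb: "?x * ?y < ?A * ?B * 2 ^ w"
  proof -
    have "?x * ?y < ?A * ?B" using OP by (intro mult_strict_mono') auto
    also have "\<dots> \<le> ?A * ?B * 2 ^ w" by simp
    finally show ?thesis .
  qed
  have "apply_op f ?x ?y < ?A * ?B * 2 ^ w"
  proof (cases f)
    case DIV
    then show ?thesis using OP AB div_le_dividend[of ?x ?y] by (simp del: div_le_dividend)
  next
    case MOD
    then show ?thesis using OP AB mod_less_eq_dividend[of ?x ?y] by (simp del: mod_less_eq_dividend)
  next
    case LESS
    then show ?thesis using OP AB A1 B1 by (simp add: of_bool_def)
  next
    case EQ
    then show ?thesis using OP AB A1 B1 by (simp add: of_bool_def)
  qed (use OP AB mulb in simp_all)
  thus ?case by (simp only: eq aval.simps)
qed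

lemma bit_len_aval:
  assumes "1 \<le> w" "bounded w s"
  shows "bit_len (aval e s) \<le> val_size e * w"
proof -
  have "1 \<le> w * val_size e"
    using assms(1) val_size_pos[of e] by (metis mult_le_mono nat_mult_1)
  with aval_bound[OF assms, of e] have "bit_len (aval e s) \<le> w * val_size e"
    by (rule bit_len_le)
  thus ?thesis by (simp add: mult.commute)
qed

lemma acost_bound:
  assumes "1 \<le> w" "bounded w s"
  shows "acost e s \<le> exp_cost e * w"
proof (induction e)
  case (NUM x)
  then show ?case using assms by simp
next
  case (MEM X a)
  have "bit_len (s X (aval a s)) \<le> w"
    using assms by (intro bit_len_le) (auto simp: bounded_def)
  with MEM bit_len_aval[OF assms, of a] show ?case by (simp add: algebra_simps)
next
  case (OP f a b)
  with bit_len_aval[OF assms, of a] bit_len_aval[OF assms, of b] show ?case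
    by (simp add: algebra_simps)
qed

lemma cond_cost_bound:
  assumes "1 \<le> w" "bounded w s"
  shows "acost e s + bit_len (aval e s) \<le> (exp_cost e + val_size e) * w"
  using acost_bound[OF assms, of e] bit_len_aval[OF assms, of e] by (simp add: algebra_simps)

lemma bounded_store: "bounded w s \<Longrightarrow> x < 2 ^ w \<Longrightarrow> bounded w (store X a x s)"
  by (auto simp: bounded_def store_def)

section \<open>Sequencing of runs and the deterministic calculus\<close>

lemma run_SKIP: "run m SKIP s = return_pmf (SKIP, s, 0)"
  by (induction m) (auto simp: bind_return_pmf)

lemma run_add:
  "run (m + m') c s = do {
     (c', s', t) \<leftarrow> run m c s;
     (c'', s'', t') \<leftarrow> run m' c' s';
     return_pmf (c'', s'', t + t') }"
proof (induction m arbitrary: c s)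
  case 0
  then show ?case by (simp add: bind_return_pmf case_prod_beta bind_return_pmf')
next
  case (Suc m)
  show ?case
    by (simp add: Suc bind_assoc_pmf bind_return_pmf case_prod_unfold add.assoc)
qed

text \<open>Different coin outcomes may halt at different times; surplus steps are harmless because
  a halted program idles at cost 0. The additional step, charged 1, is the passage from
  \<open>SEQ SKIP d\<close> to \<open>d\<close>.\<close>

lemma run_SEQ:
  assumes "\<And>c' s' t. (c', s', t) \<in> set_pmf (run m1 c s) \<Longrightarrow> c' = SKIP"
    and "\<And>c' s' t d' s'' t'. (c', s', t) \<in> set_pmf (run m1 c s) \<Longrightarrow>
      (d', s'', t') \<in> set_pmf (run m2 d s') \<Longrightarrow> d' = SKIP"
  shows "run (m1 + 1 + m2) (SEQ c d) s = do {
     (c', s', t) \<leftarrow> run m1 c s;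
     (d', s'', t') \<leftarrow> run m2 d s';
     return_pmf (d', s'', t + 1 + t') }"
  using assms
proof (induction m1 arbitrary: c s)
  case 0
  then have "c = SKIP" by auto
  then show ?case by (simp add: bind_return_pmf)
next
  case (Suc m)
  show ?case
  proof (cases "c = SKIP")
    case True
    have "run (m2 + Suc m) d s = run m2 d s"
    proof -
      have "run (m2 + Suc m) d s = do {
        (c', s', t) \<leftarrow> run m2 d s;
        (c'', s'', t') \<leftarrow> run (Suc m) c' s';
        return_pmf (c'', s'', t + t') }" by (rule run_add)
      also have "\<dots> = bind_pmf (run m2 d s) return_pmf"
      proof (rule bind_pmf_cong)
        fix x assume x: "x \<in> set_pmf (run m2 d s)"
        obtain c' s' t where xx: "x = (c', s', t)" by (cases x) auto
        have "(SKIP, s, 0) \<in> set_pmf (run (Suc m) c s)"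
          unfolding True by (subst run_SKIP) simp
        with Suc.prems(2) x xx have "c' = SKIP" by blast
        thus "(case x of (c', s', t) \<Rightarrow> do {
            (c'', s'', t') \<leftarrow> run (Suc m) c' s'; return_pmf (c'', s'', t + t')}) = return_pmf x"
          unfolding xx by (simp only: run_SKIP prod.case bind_return_pmf) simp
      qed simp
      finally show ?thesis by (simp add: bind_return_pmf')
    qed
    hence "run (Suc m + m2) d s = run m2 d s" by (simp only: add.commute)
    moreover have "run (Suc m + 1 + m2) (SEQ c d) s = 
       do { (c'', s'', t') \<leftarrow> run (Suc m + m2) d s; return_pmf (c'', s'', 1 + t') }"
      using True by (simp del: run.simps(2) add: run.simps(2)[of "Suc (m + m2)"] bind_return_pmf)
    ultimately show ?thesis
      by (simp only: True run_SKIP bind_return_pmf prod.case) simp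
  next
    case False
    have IH: "run (m + 1 + m2) (SEQ c' d) s' = do {
     (c', s', t) \<leftarrow> run m c' s';
     (d', s'', t') \<leftarrow> run m2 d s';
     return_pmf (d', s'', t + 1 + t') }" if "(c', s', t) \<in> set_pmf (step c s)" for c' s' t
    proof (rule Suc.IH)
      fix e s1 t1 assume e: "(e, s1, t1) \<in> set_pmf (run m c' s')"
      have m: "(e, s1, t + t1) \<in> set_pmf (run (Suc m) c s)"
        unfolding run.simps set_bind_pmf UN_iff
        by (rule bexI[OF _ that], simp, rule bexI[OF _ e], simp)
      show "e = SKIP" using Suc.prems(1)[OF m] .
      fix d' s'' t' assume "(d', s'', t') \<in> set_pmf (run m2 d s1)"
      thus "d' = SKIP" using Suc.prems(2)[OF m] by blast
    qed
    have "run (Suc m + 1 + m2) (SEQ c d) s = do {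
       (c', s', t) \<leftarrow> step c s;
       (c'', s'', t') \<leftarrow> run (m + 1 + m2) (SEQ c' d) s';
       return_pmf (c'', s'', t + t') }"
      using False by (simp del: run.simps(2) add: run.simps(2)[of "Suc (m + m2)"] map_pmf_def bind_assoc_pmf bind_return_pmf case_prod_unfold)
    also have "\<dots> = do {
       (c', s', t) \<leftarrow> step c s;
       (c'', s'', t') \<leftarrow> do {
         (c', s', t) \<leftarrow> run m c' s';
         (d', s'', t') \<leftarrow> run m2 d s';
         return_pmf (d', s'', t + 1 + t') };
       return_pmf (c'', s'', t + t') }"
      by (rule bind_pmf_cong) (auto simp only: IH split: prod.splits)
    also have "\<dots> = do {
     (c', s', t) \<leftarrow> run (Suc m) c s;
     (d', s'', t') \<leftarrow> run m2 d s';
     return_pmf (d', s'', t + 1 + t') }"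
      by (simp add: bind_assoc_pmf bind_return_pmf case_prod_unfold add.assoc)
    finally show ?thesis .
  qed
qed

text \<open>Total correctness for runs with a single outcome. The postcondition is bundled with a
  frame condition and with the invariant that all cells stay below \<open>2 ^ w\<close>;
  \<open>n\<close> counts charges in units of \<open>step_cost c * w\<close>, so loop rules only
  have to add natural numbers.\<close>

definition wp :: "nat \<Rightarrow> com \<Rightarrow> nat \<Rightarrow> (state \<Rightarrow> bool) \<Rightarrow> state \<Rightarrow> bool" where
  "wp w c n Q s \<longleftrightarrow> (1 \<le> w \<longrightarrow> bounded w s \<longrightarrow>
     (\<exists>m s' t. run m c s = return_pmf (SKIP, s', t) \<and> t \<le> n * step_cost c * w \<and>
        bounded w s' \<and> (\<forall>X. X \<notin> mods c \<longrightarrow> s' X = s X) \<and> Q s'))"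

lemma wp_conseq:
  assumes "wp w c n Q s" "n \<le> n'"
    and "\<And>s'. bounded w s' \<Longrightarrow> (\<And>X. X \<notin> mods c \<Longrightarrow> s' X = s X) \<Longrightarrow> Q s' \<Longrightarrow> Q' s'"
  shows "wp w c n' Q' s"
  unfolding wp_def
proof (intro impI)
  assume w: "1 \<le> w" "bounded w s"
  with assms(1) obtain m s' t where *: "run m c s = return_pmf (SKIP, s', t)" "t \<le> n * step_cost c * w"
    "bounded w s'" "\<forall>X. X \<notin> mods c \<longrightarrow> s' X = s X" "Q s'" unfolding wp_def by blast
  have "n * step_cost c * w \<le> n' * step_cost c * w" using assms(2) by simp
  with * have "t \<le> n' * step_cost c * w" by linarith
  with * assms(3)[of s'] show "\<exists>m s' t. run m c s = return_pmf (SKIP, s', t) \<and> t \<le> n' * step_cost c * w \<and>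
        bounded w s' \<and> (\<forall>X. X \<notin> mods c \<longrightarrow> s' X = s X) \<and> Q' s'" by blast
qed

lemma wp_bounded: "(bounded w s \<Longrightarrow> wp w c n Q s) \<Longrightarrow> wp w c n Q s"
  by (auto simp: wp_def)

lemma wp_assign:
  assumes "aval b s < 2 ^ w" "Q (store X (aval a s) (aval b s) s)"
  shows "wp w (ASSIGN X a b) 1 Q s"
  unfolding wp_def
proof (intro impI)
  assume w: "1 \<le> w" "bounded w s"
  let ?t = "acost a s + acost b s + bit_len (aval a s) + bit_len (aval b s)"
  have "?t \<le> 1 * step_cost (ASSIGN X a b) * w"
    using cond_cost_bound[OF w, of a] cond_cost_bound[OF w, of b] by (simp add: algebra_simps)
  moreover have "run 1 (ASSIGN X a b) s = return_pmf (SKIP, store X (aval a s) (aval b s) s, ?t)"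
    by (simp add: bind_return_pmf)
  moreover have "\<forall>Y. Y \<notin> mods (ASSIGN X a b) \<longrightarrow> store X (aval a s) (aval b s) s Y = s Y"
    by (simp add: store_def)
  ultimately show "\<exists>m s' t. run m (ASSIGN X a b) s = return_pmf (SKIP, s', t) \<and>
      t \<le> 1 * step_cost (ASSIGN X a b) * w \<and> bounded w s' \<and>
      (\<forall>Y. Y \<notin> mods (ASSIGN X a b) \<longrightarrow> s' Y = s Y) \<and> Q s'"
    using bounded_store[OF w(2) assms(1)] assms(2) by blast
qed

lemma wp_seq:
  assumes "wp w c n1 (\<lambda>s'. wp w d n2 Q s') s"
  shows "wp w (SEQ c d) (n1 + n2 + 1) Q s"
  unfolding wp_def
proof (intro impI)
  assume w: "1 \<le> w" "bounded w s"
  with assms obtain m1 s1 t1 where 1: "run m1 c s = return_pmf (SKIP, s1, t1)" "t1 \<le> n1 * step_cost c * w"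
    "bounded w s1" "\<forall>X. X \<notin> mods c \<longrightarrow> s1 X = s X" "wp w d n2 Q s1" unfolding wp_def by blast
  with w obtain m2 s2 t2 where 2: "run m2 d s1 = return_pmf (SKIP, s2, t2)" "t2 \<le> n2 * step_cost d * w"
    "bounded w s2" "\<forall>X. X \<notin> mods d \<longrightarrow> s2 X = s1 X" "Q s2" unfolding wp_def by blast
  have "run (m1 + 1 + m2) (SEQ c d) s = return_pmf (SKIP, s2, t1 + 1 + t2)"
    by (subst run_SEQ) (auto simp: 1 2 bind_return_pmf)
  moreover have "t1 + 1 + t2 \<le> (n1 + n2 + 1) * step_cost (SEQ c d) * w"
  proof -
    let ?K = "step_cost (SEQ c d)"
    have "n1 * step_cost c * w \<le> n1 * ?K * w" "n2 * step_cost d * w \<le> n2 * ?K * w" by simp_all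
    moreover have "1 \<le> ?K * w" using w step_cost_pos[of "SEQ c d"] by (metis mult_le_mono nat_mult_1)
    ultimately have "t1 + 1 + t2 \<le> n1 * ?K * w + n2 * ?K * w + ?K * w" using 1 2 by linarith
    thus ?thesis by (simp add: algebra_simps)
  qed
  ultimately show "\<exists>m s' t. run m (SEQ c d) s = return_pmf (SKIP, s', t) \<and>
      t \<le> (n1 + n2 + 1) * step_cost (SEQ c d) * w \<and> bounded w s' \<and>
      (\<forall>X. X \<notin> mods (SEQ c d) \<longrightarrow> s' X = s X) \<and> Q s'"
    using 1 2 by (intro exI[of _ "m1 + 1 + m2"] exI[of _ s2] exI[of _ "t1 + 1 + t2"]) auto
qed

lemma wp_while_False:
  assumes "aval e s = 0" "Q s"
  shows "wp w (WHILE e c) 2 Q s"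
  unfolding wp_def
proof (intro impI)
  assume w: "1 \<le> w" "bounded w s"
  let ?t = "1 + (acost e s + bit_len (aval e s))"
  have "run 2 (WHILE e c) s = return_pmf (SKIP, s, ?t)"
    using assms by (simp add: numeral_2_eq_2 bind_return_pmf)
  moreover have "?t \<le> 2 * step_cost (WHILE e c) * w"
  proof -
    let ?K = "step_cost (WHILE e c)"
    have "1 \<le> ?K * w" using w step_cost_pos[of "WHILE e c"] by (metis mult_le_mono nat_mult_1)
    moreover have "(exp_cost e + val_size e) * w \<le> ?K * w" by (intro mult_right_mono) auto
    ultimately show ?thesis using cond_cost_bound[OF w, of e] by linarith
  qed
  ultimately show "\<exists>m s' t. run m (WHILE e c) s = return_pmf (SKIP, s', t) \<and>
      t \<le> 2 * step_cost (WHILE e c) * w \<and> bounded w s' \<and>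
      (\<forall>X. X \<notin> mods (WHILE e c) \<longrightarrow> s' X = s X) \<and> Q s'"
    using w assms by blast
qed

lemma wp_while_True:
  assumes "aval e s \<noteq> 0" "wp w c n1 (\<lambda>s'. wp w (WHILE e c) n2 Q s') s"
  shows "wp w (WHILE e c) (n1 + n2 + 3) Q s"
  unfolding wp_def
proof (intro impI)
  assume w: "1 \<le> w" "bounded w s"
  let ?K = "step_cost (WHILE e c)"
  have sc: "step_cost (SEQ c (WHILE e c)) = ?K" by simp
  from wp_seq[OF assms(2)] w obtain m s' t where *: "run m (SEQ c (WHILE e c)) s = return_pmf (SKIP, s', t)"
    "t \<le> (n1 + n2 + 1) * ?K * w" "bounded w s'"
    "\<forall>X. X \<notin> mods (SEQ c (WHILE e c)) \<longrightarrow> s' X = s X" "Q s'"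
    unfolding wp_def sc by blast
  let ?t = "1 + (acost e s + bit_len (aval e s) + t)"
  have "run (Suc (Suc m)) (WHILE e c) s = return_pmf (SKIP, s', ?t)"
    using assms(1) by (simp add: bind_return_pmf *)
  moreover have "?t \<le> (n1 + n2 + 3) * ?K * w"
  proof -
    have "1 \<le> ?K * w" using w step_cost_pos[of "WHILE e c"] by (metis mult_le_mono nat_mult_1)
    moreover have "(exp_cost e + val_size e) * w \<le> ?K * w" by (intro mult_right_mono) auto
    ultimately have "?t \<le> (n1 + n2 + 1) * ?K * w + 2 * (?K * w)"
      using cond_cost_bound[OF w, of e] *(2) by linarith
    also have "\<dots> = (n1 + n2 + 3) * ?K * w" by (simp add: algebra_simps)
    finally show ?thesis .
  qed
  ultimately show "\<exists>m s' t. run m (WHILE e c) s = return_pmf (SKIP, s', t) \<and>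
      t \<le> (n1 + n2 + 3) * ?K * w \<and> bounded w s' \<and>
      (\<forall>X. X \<notin> mods (WHILE e c) \<longrightarrow> s' X = s X) \<and> Q s'"
    using * by (intro exI[of _ "Suc (Suc m)"] exI[of _ s'] exI[of _ ?t]) auto
qed

section \<open>Scalar variables and counting loops\<close>

abbreviation var :: "string \<Rightarrow> aexp" where
  "var X \<equiv> MEM X (NUM 0)"

definition for_loop :: "string \<Rightarrow> aexp \<Rightarrow> com \<Rightarrow> com" where
  "for_loop I e c = SEQ (ASSIGN I (NUM 0) (NUM 0))
     (WHILE (OP LESS (var I) e) (SEQ c (ASSIGN I (NUM 0) (OP ADD (var I) (NUM 1)))))"

lemma mods_for_loop [simp]: "mods (for_loop I e c) = insert I (mods c)"
  by (auto simp: for_loop_def)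

text \<open>The bound is evaluated anew in every round, so its value must be fixed by cells that the
  loop leaves alone. \<open>Inv\<close> is stated for the state after the counter has been updated.
  A round costs \<open>B\<close> plus 5: the increment, two transitions of \<open>SEQ\<close>, the
  unfolding of the loop and its test.\<close>

lemma wp_for_loop:
  assumes bound: "\<And>s'. (\<And>X. X \<noteq> I \<Longrightarrow> X \<notin> mods c \<Longrightarrow> s' X = s X) \<Longrightarrow> aval e s' = n"
    and "n < 2 ^ w" and "I \<notin> mods c"
    and init: "Inv 0 (store I 0 0 s)"
    and body: "\<And>i s'. i < n \<Longrightarrow> s' I 0 = i \<Longrightarrow> bounded w s' \<Longrightarrow>
       (\<And>X. X \<noteq> I \<Longrightarrow> X \<notin> mods c \<Longrightarrow> s' X = s X) \<Longrightarrow> Inv i s' \<Longrightarrow>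
       wp w c B (\<lambda>s''. Inv (Suc i) (store I 0 (Suc i) s'')) s'"
    and post: "\<And>s'. Inv n s' \<Longrightarrow> (\<And>X. X \<noteq> I \<Longrightarrow> X \<notin> mods c \<Longrightarrow> s' X = s X) \<Longrightarrow> Q s'"
  shows "wp w (for_loop I e c) ((n + 1) * (B + 5)) Q s"
proof -
  let ?body = "SEQ c (ASSIGN I (NUM 0) (OP ADD (var I) (NUM 1)))"
  let ?W = "WHILE (OP LESS (var I) e) ?body"
  have loop: "wp w ?W ((n - i) * (B + 5) + 2) Q s'"
    if "i \<le> n" "s' I 0 = i" "\<And>X. X \<noteq> I \<Longrightarrow> X \<notin> mods c \<Longrightarrow> s' X = s X" "Inv i s'" for i s'
    using that
  proof (induction "n - i" arbitrary: i s')
    case 0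
    with bound[of s'] have "aval (OP LESS (var I) e) s' = 0" by simp
    moreover have "Q s'" using 0 post by simp
    ultimately have "wp w ?W 2 Q s'" by (rule wp_while_False)
    with 0 show ?case by (simp add: numeral_2_eq_2)
  next
    case (Suc j)
    hence i: "i < n" by simp
    have j: "n - i = Suc j" "n - Suc i = j" using Suc(2) by auto
    have ne: "aval (OP LESS (var I) e) s' \<noteq> 0" using Suc bound i by simp
    have "wp w c B (\<lambda>s''. wp w (ASSIGN I (NUM 0) (OP ADD (var I) (NUM 1))) 1
        (\<lambda>s'. wp w ?W (j * (B + 5) + 2) Q s') s'') s'"
    proof (rule wp_bounded)
      assume b: "bounded w s'"
      have bw: "wp w c B (\<lambda>s''. Inv (Suc i) (store I 0 (Suc i) s'')) s'"
        by (rule body[OF i Suc(4) b _ Suc(6)]) (rule Suc(5))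
      show ?thesis
      proof (rule wp_conseq[OF bw order_refl], goal_cases)
        case (1 s'')
        from 1(2)[OF assms(3)] Suc(4) have si: "s'' I 0 = i" by simp
        show ?case
        proof (rule wp_assign, goal_cases)
          case 1
          then show ?case using i assms(2) si by simp
        next
          case 2
          show ?case
          proof (subst j(2)[symmetric], rule Suc(1))
            show "j = n - Suc i" using j by simp
            show "Suc i \<le> n" using i by simp
          qed (use si 1 Suc in \<open>auto simp: store_def\<close>)
        qed
      qed
    qed
    from wp_while_True[OF ne wp_seq[OF this]] show ?case
      by (rule wp_conseq) (auto simp: j)
  qed
  have "wp w (for_loop I e c) (1 + (n * (B + 5) + 2) + 1) Q s"
    unfolding for_loop_def
  proof (rule wp_seq, rule wp_assign, goal_cases)
    case 2
    have "wp w ?W ((n - 0) * (B + 5) + 2) Q (store I 0 0 s)"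
      by (rule loop) (use init in \<open>auto simp: store_def\<close>)
    thus ?case by simp
  qed simp
  thus ?thesis by (rule wp_conseq) auto
qed

section \<open>Yates's algorithm\<close>

definition digit :: "nat \<Rightarrow> nat \<Rightarrow> nat \<Rightarrow> nat" where
  "digit R u t = u div R ^ t mod R"

text \<open>
  One layer of Yates's algorithm: the matrix \<open>a\<close> consumes the leading base-\<open>R\<close> digit of the
  index and the new digit is pushed in at the other end, so that all layers are alike.
\<close>

definition yates_step :: "nat \<Rightarrow> nat \<Rightarrow> (nat \<Rightarrow> nat \<Rightarrow> 'f::comm_semiring_1) \<Rightarrow> (nat \<Rightarrow> 'f) \<Rightarrow> nat \<Rightarrow> 'f" where
  "yates_step R V a f u = (\<Sum>i<R. a (u mod R) i * f (u div R + i * (V div R)))"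

lemma digit_0: "digit R u 0 = u mod R"
  by (simp add: digit_def)

lemma digit_less: "R > 0 \<Longrightarrow> digit R u t < R"
  by (simp add: digit_def)

lemma digit_push_0: "i < R \<Longrightarrow> digit R (i + w * R) 0 = i"
  by (simp add: digit_def)

lemma digit_push_Suc: "i < R \<Longrightarrow> digit R (i + w * R) (Suc t) = digit R w t"
  by (simp add: digit_def div_mult2_eq)

lemma add_mult_power_div:
  fixes R :: nat
  assumes "R > 0" "t \<le> n"
  shows "(v + i * R ^ n) div R ^ t = v div R ^ t + i * R ^ (n - t)"
proof -
  have "i * R ^ n = R ^ t * (i * R ^ (n - t))"
    using assms by (simp add: power_add[symmetric])
  thus ?thesis using assms by (simp only:) simp
qed

lemma sum_digits_Suc:
  fixes f :: "nat \<Rightarrow> 'a::comm_monoid_add"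
  assumes "R > 0"
  shows "(\<Sum>u<R ^ Suc j. f u) = (\<Sum>i<R. \<Sum>w<R ^ j. f (i + w * R))"
proof -
  have "(\<Sum>u<R ^ Suc j. f u) = (\<Sum>u<R ^ j * R. f u)" by (simp only: power_Suc mult.commute)
  also have "\<dots> = (\<Sum>w<R ^ j. \<Sum>i<R. f (i + w * R))" by (rule sum_lessThan_mult[OF assms])
  also have "\<dots> = (\<Sum>i<R. \<Sum>w<R ^ j. f (i + w * R))" by (rule sum.swap)
  finally show ?thesis .
qed

text \<open>After \<open>j\<close> layers the low \<open>j\<close> digits of \<open>u\<close> are
  output digits, the others are still digits of the input index, and the summation digits
  \<open>w\<close> occupy the leading positions from which the layers have read. Digit
  \<open>t\<close> of \<open>u\<close> meets digit \<open>t\<close> of \<open>w\<close>.\<close>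

lemma yates_iterate:
  assumes R: "R > 0" and "j \<le> m"
  shows "(yates_step R (R ^ m) a ^^ j) x u =
    (\<Sum>w<R ^ j. (\<Prod>t<j. a (digit R u t) (digit R w t)) * x (u div R ^ j + w * R ^ (m - j)))"
  using assms(2)
proof (induction j arbitrary: u)
  case (Suc j)
  let ?f = "\<lambda>u w. (\<Prod>t<j. a (digit R u t) (digit R w t)) * x (u div R ^ j + w * R ^ (m - j))"
  let ?g = "\<lambda>w. (\<Prod>t<Suc j. a (digit R u t) (digit R w t)) * x (u div R ^ Suc j + w * R ^ (m - Suc j))"
  obtain m' where m': "m = Suc m'" using Suc.prems by (cases m) auto
  have jm: "j \<le> m'" using Suc.prems m' by simp
  have V: "R ^ m div R = R ^ m'" using R by (simp add: m')
  have step: "a (u mod R) i * ?f (u div R + i * R ^ m') w = ?g (i + w * R)" if i: "i < R" for i w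
  proof -
    have 1: "digit R (u div R + i * R ^ m') t = digit R u (Suc t)" if t: "t < j" for t
    proof -
      have "i * R ^ (m' - t) = i * R ^ (m' - Suc t) * R"
        using t jm by (simp flip: power_Suc2 add: Suc_diff_Suc)
      thus ?thesis unfolding digit_def using t jm
        by (subst add_mult_power_div[OF R]) (auto simp: div_mult2_eq mult.assoc[symmetric])
    qed
    have "(u div R + i * R ^ m') div R ^ j + w * R ^ (m - j) =
        u div R ^ Suc j + i * R ^ (m' - j) + w * R ^ (m - j)"
      by (simp add: add_mult_power_div[OF R jm] div_mult2_eq)
    also have "\<dots> = u div R ^ Suc j + i * R ^ (m' - j) + w * (R * R ^ (m' - j))"
      using jm by (simp add: m' Suc_diff_le)
    also have "\<dots> =
        u div R ^ Suc j + (i + w * R) * R ^ (m - Suc j)" by (simp add: m' algebra_simps)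
    finally have 2: "(u div R + i * R ^ m') div R ^ j + w * R ^ (m - j) =
        u div R ^ Suc j + (i + w * R) * R ^ (m - Suc j)" .
    have 3: "(\<Prod>t<j. a (digit R (u div R + i * R ^ m') t) (digit R w t)) =
        (\<Prod>t<j. a (digit R u (Suc t)) (digit R w t))"
      by (rule prod.cong) (simp_all add: 1)
    show ?thesis unfolding 2 3 prod.lessThan_Suc_shift digit_push_0[OF i] digit_push_Suc[OF i] digit_0[of R u]
      by (simp only: mult.assoc)
  qed
  have "(yates_step R (R ^ m) a ^^ Suc j) x u =
      (\<Sum>i<R. a (u mod R) i * (yates_step R (R ^ m) a ^^ j) x (u div R + i * R ^ m'))"
    by (simp only: funpow.simps o_apply yates_step_def[of R _ _ "(yates_step R (R ^ m) a ^^ j) x"] V)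
  also have "\<dots> = (\<Sum>i<R. \<Sum>w<R ^ j. a (u mod R) i * ?f (u div R + i * R ^ m') w)"
    by (subst Suc.IH) (use Suc.prems in \<open>simp_all only: sum_distrib_left Suc_leD\<close>)
  also have "\<dots> = (\<Sum>i<R. \<Sum>w<R ^ j. ?g (i + w * R))"
    by (intro sum.cong refl step) simp
  also have "\<dots> = (\<Sum>w<R ^ Suc j. ?g w)" by (rule sum_digits_Suc[OF R, symmetric])
  finally show ?case .
qed simp

lemma yates_full:
  assumes "R > 0" "u < R ^ m"
  shows "(yates_step R (R ^ m) a ^^ m) x u = (\<Sum>w<R ^ m. (\<Prod>t<m. a (digit R u t) (digit R w t)) * x w)"
  using yates_iterate[OF assms(1) order_refl, of m a x u] assms(2) by simp

text \<open>The distributive law: choosing one summand from each of \<open>m\<close> factors amounts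
  to choosing a number below \<open>R ^ m\<close> by its digits.\<close>

lemma sum_prod_digits:
  fixes g :: "nat \<Rightarrow> nat \<Rightarrow> 'a::comm_semiring_1"
  assumes R: "R > 0"
  shows "(\<Sum>u<R ^ m. \<Prod>t<m. g t (digit R u t)) = (\<Prod>t<m. \<Sum>q<R. g t q)"
proof (induction m arbitrary: g)
  case (Suc m)
  have "(\<Sum>u<R ^ Suc m. \<Prod>t<Suc m. g t (digit R u t)) =
      (\<Sum>i<R. \<Sum>w<R ^ m. \<Prod>t<Suc m. g t (digit R (i + w * R) t))" by (rule sum_digits_Suc[OF R])
  also have "\<dots> = (\<Sum>i<R. \<Sum>w<R ^ m. g 0 i * (\<Prod>t<m. g (Suc t) (digit R w t)))"
  proof (intro sum.cong refl)
    fix i w assume "i \<in> {..<R}"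
    hence i: "i < R" by simp
    show "(\<Prod>t<Suc m. g t (digit R (i + w * R) t)) = g 0 i * (\<Prod>t<m. g (Suc t) (digit R w t))"
      unfolding prod.lessThan_Suc_shift digit_push_0[OF i] digit_push_Suc[OF i] ..
  qed
  also have "\<dots> = (\<Sum>i<R. g 0 i) * (\<Prod>t<m. \<Sum>q<R. g (Suc t) q)"
    by (simp only: sum_distrib_left[symmetric] sum_distrib_right[symmetric] Suc[of "\<lambda>t. g (Suc t)"])
  also have "\<dots> = (\<Prod>t<Suc m. \<Sum>q<R. g t q)" by (simp only: prod.lessThan_Suc_shift)
  finally show ?case .
qed simp

section \<open>Trilinear forms evaluated through a decomposition\<close>

definition trilinear :: "nat \<Rightarrow> (nat \<Rightarrow> nat \<Rightarrow> nat \<Rightarrow> 'f::comm_semiring_1) \<Rightarrow>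
    (nat \<Rightarrow> 'f) \<Rightarrow> (nat \<Rightarrow> 'f) \<Rightarrow> (nat \<Rightarrow> 'f) \<Rightarrow> 'f" where
  "trilinear V S x y z = (\<Sum>v1<V. \<Sum>v2<V. \<Sum>v3<V. S v1 v2 v3 * (x v1 * y v2 * z v3))"

lemma sum_product3:
  fixes f :: "'i \<Rightarrow> 'a::comm_semiring_0"
  shows "sum f A * sum g B * sum h C = (\<Sum>i\<in>A. \<Sum>j\<in>B. \<Sum>l\<in>C. f i * g j * h l)"
proof -
  have "sum f A * sum g B * sum h C = (\<Sum>i\<in>A. (\<Sum>j\<in>B. f i * g j) * sum h C)"
    unfolding sum_product[of f A g B] by (rule sum_distrib_right)
  thus ?thesis by (simp only: sum_product[of _ B h C])
qed

text \<open>After exchanging sums, for fixed \<open>v1\<close>, \<open>v2\<close>, \<open>v3\<close>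
  the sum over \<open>u\<close> factors digit by digit into the decomposition of the base tensor.
  Input and output indices both range below \<open>R ^ m\<close>, that is, the base matrices are
  taken to be square.\<close>

lemma yates_trilinear:
  fixes a b c :: "nat \<Rightarrow> nat \<Rightarrow> 'f::comm_semiring_1"
  assumes R: "R > 0"
  shows "(\<Sum>u<R ^ m. (yates_step R (R ^ m) a ^^ m) x u * (yates_step R (R ^ m) b ^^ m) y u *
      (yates_step R (R ^ m) c ^^ m) z u) =
    trilinear (R ^ m) (\<lambda>v1 v2 v3. \<Prod>t<m. \<Sum>q<R. a q (digit R v1 t) * b q (digit R v2 t) * c q (digit R v3 t)) x y z"
proof -
  let ?A = "\<lambda>a u v. \<Prod>t<m. a (digit R u t) (digit R v t) :: 'f"
  have "(\<Sum>u<R ^ m. (yates_step R (R ^ m) a ^^ m) x u * (yates_step R (R ^ m) b ^^ m) y u *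
      (yates_step R (R ^ m) c ^^ m) z u) =
    (\<Sum>u<R ^ m. (\<Sum>v1<R ^ m. ?A a u v1 * x v1) * (\<Sum>v2<R ^ m. ?A b u v2 * y v2) * (\<Sum>v3<R ^ m. ?A c u v3 * z v3))"
    by (intro sum.cong refl) (simp add: yates_full[OF R])
  also have "\<dots> = (\<Sum>u<R ^ m. \<Sum>v1<R ^ m. \<Sum>v2<R ^ m. \<Sum>v3<R ^ m.
      (?A a u v1 * ?A b u v2 * ?A c u v3) * (x v1 * y v2 * z v3))"
  proof (intro sum.cong refl)
    fix u
    have "(\<Sum>v1<R ^ m. ?A a u v1 * x v1) * (\<Sum>v2<R ^ m. ?A b u v2 * y v2) * (\<Sum>v3<R ^ m. ?A c u v3 * z v3) =
        (\<Sum>v1<R ^ m. \<Sum>v2<R ^ m. \<Sum>v3<R ^ m. (?A a u v1 * x v1) * (?A b u v2 * y v2) * (?A c u v3 * z v3))"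
      by (rule sum_product3)
    thus "(\<Sum>v1<R ^ m. ?A a u v1 * x v1) * (\<Sum>v2<R ^ m. ?A b u v2 * y v2) * (\<Sum>v3<R ^ m. ?A c u v3 * z v3) =
        (\<Sum>v1<R ^ m. \<Sum>v2<R ^ m. \<Sum>v3<R ^ m. (?A a u v1 * ?A b u v2 * ?A c u v3) * (x v1 * y v2 * z v3))"
      by (simp only: mult_ac)
  qed
  also have "\<dots> = (\<Sum>v1<R ^ m. \<Sum>u<R ^ m. \<Sum>v2<R ^ m. \<Sum>v3<R ^ m.
      (?A a u v1 * ?A b u v2 * ?A c u v3) * (x v1 * y v2 * z v3))" by (rule sum.swap)
  also have "\<dots> = (\<Sum>v1<R ^ m. \<Sum>v2<R ^ m. \<Sum>u<R ^ m. \<Sum>v3<R ^ m.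
      (?A a u v1 * ?A b u v2 * ?A c u v3) * (x v1 * y v2 * z v3))" by (intro sum.cong refl sum.swap)
  also have "\<dots> = (\<Sum>v1<R ^ m. \<Sum>v2<R ^ m. \<Sum>v3<R ^ m. \<Sum>u<R ^ m.
      (?A a u v1 * ?A b u v2 * ?A c u v3) * (x v1 * y v2 * z v3))" by (intro sum.cong refl sum.swap)
  also have "\<dots> = trilinear (R ^ m) (\<lambda>v1 v2 v3. \<Prod>t<m. \<Sum>q<R. a q (digit R v1 t) * b q (digit R v2 t) * c q (digit R v3 t)) x y z"
    unfolding trilinear_def
  proof (intro sum.cong refl)
    fix v1 v2 v3
    have "(\<Sum>u<R ^ m. (?A a u v1 * ?A b u v2 * ?A c u v3) * (x v1 * y v2 * z v3)) =
        (\<Sum>u<R ^ m. \<Prod>t<m. a (digit R u t) (digit R v1 t) * b (digit R u t) (digit R v2 t) * c (digit R u t) (digit R v3 t)) *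
        (x v1 * y v2 * z v3)" by (simp only: sum_distrib_right prod.distrib)
    also have "(\<Sum>u<R ^ m. \<Prod>t<m. a (digit R u t) (digit R v1 t) * b (digit R u t) (digit R v2 t) * c (digit R u t) (digit R v3 t)) =
        (\<Prod>t<m. \<Sum>q<R. a q (digit R v1 t) * b q (digit R v2 t) * c q (digit R v3 t))"
      by (rule sum_prod_digits[OF R, of "\<lambda>t q. a q (digit R v1 t) * b q (digit R v2 t) * c q (digit R v3 t)"])
    finally show "(\<Sum>u<R ^ m. (?A a u v1 * ?A b u v2 * ?A c u v3) * (x v1 * y v2 * z v3)) =
        (\<Prod>t<m. \<Sum>q<R. a q (digit R v1 t) * b q (digit R v2 t) * c q (digit R v3 t)) * (x v1 * y v2 * z v3)" .
  qed
  finally show ?thesis .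
qed

text \<open>By trilinearity the alternating sum is the form evaluated at the three difference
  vectors, and these are unit vectors.\<close>

lemma trilinear_cube:
  fixes S :: "nat \<Rightarrow> nat \<Rightarrow> nat \<Rightarrow> 'f::comm_ring_1"
  assumes v: "v1 < V" "v2 < V" "v3 < V"
    and x: "\<And>v. v < V \<Longrightarrow> x1 v - x0 v = (if v = v1 then 1 else 0)"
    and y: "\<And>v. v < V \<Longrightarrow> y1 v - y0 v = (if v = v2 then 1 else 0)"
    and z: "\<And>v. v < V \<Longrightarrow> z1 v - z0 v = (if v = v3 then 1 else 0)"
  shows "trilinear V S x1 y1 z1 - trilinear V S x0 y1 z1 - trilinear V S x1 y0 z1 + trilinear V S x0 y0 z1
    - trilinear V S x1 y1 z0 + trilinear V S x0 y1 z0 + trilinear V S x1 y0 z0 - trilinear V S x0 y0 z0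
    = S v1 v2 v3"
proof -
  have "trilinear V S x1 y1 z1 - trilinear V S x0 y1 z1 - trilinear V S x1 y0 z1 + trilinear V S x0 y0 z1
    - trilinear V S x1 y1 z0 + trilinear V S x0 y1 z0 + trilinear V S x1 y0 z0 - trilinear V S x0 y0 z0
    = (\<Sum>w1<V. \<Sum>w2<V. \<Sum>w3<V. S w1 w2 w3 * ((x1 w1 - x0 w1) * (y1 w2 - y0 w2) * (z1 w3 - z0 w3)))"
    unfolding trilinear_def sum_subtractf[symmetric] sum.distrib[symmetric]
    by (intro sum.cong refl) (simp add: algebra_simps)
  also have "\<dots> = (\<Sum>w1<V. \<Sum>w2<V. \<Sum>w3<V. if w3 = v3 then (if w2 = v2 then (if w1 = v1 then S v1 v2 v3 else 0) else 0) else 0)"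
    by (intro sum.cong refl) (simp add: x y z)
  also have "\<dots> = S v1 v2 v3" using v by simp
  finally show ?thesis .
qed

section \<open>The algorithm\<close>

lemma store_apply [simp]: "store X a x s Y b = (if Y = X \<and> b = a then x else s Y b)"
  by (auto simp: store_def)

lemma store_other: "Y \<noteq> X \<Longrightarrow> store X a x s Y = s Y"
  by (simp add: store_def)

lemma bounded_less: "bounded w s \<Longrightarrow> s X a < 2 ^ w"
  by (simp add: bounded_def)

lemma wp_assign1:
  assumes "1 \<le> n" "aval b s < 2 ^ w" "Q (store X (aval a s) (aval b s) s)"
  shows "wp w (ASSIGN X a b) n Q s"
  by (rule wp_conseq[OF wp_assign]) (use assms in auto)

lemma wp_assign_seq:
  assumes "2 \<le> n" "aval b s < 2 ^ w" "wp w d (n - 2) Q (store X (aval a s) (aval b s) s)"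
  shows "wp w (SEQ (ASSIGN X a b) d) n Q s"
proof -
  have "wp w (SEQ (ASSIGN X a b) d) (1 + (n - 2) + 1) Q s"
    by (rule wp_seq, rule wp_assign) (use assms in auto)
  thus ?thesis by (rule wp_conseq) (use assms in auto)
qed

lemma wp_call:
  assumes "wp w c n1 P s"
    and "\<And>s'. bounded w s' \<Longrightarrow> (\<And>X. X \<notin> mods c \<Longrightarrow> s' X = s X) \<Longrightarrow> P s' \<Longrightarrow> wp w d n2 Q s'"
  shows "wp w (SEQ c d) (n1 + n2 + 1) Q s"
  by (rule wp_seq, rule wp_conseq[OF assms(1) order_refl assms(2)])

text \<open>Tables of constant size are compiled into expressions.\<close>

primrec lookup :: "(nat \<Rightarrow> nat) \<Rightarrow> aexp \<Rightarrow> nat \<Rightarrow> aexp" where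
  "lookup f e 0 = NUM 0"
| "lookup f e (Suc n) = OP ADD (lookup f e n) (OP MUL (OP EQ e (NUM n)) (NUM (f n)))"

lemma aval_lookup [simp]: "aval (lookup f e n) s = (if aval e s < n then f (aval e s) else 0)"
  by (induction n) (auto simp: less_Suc_eq)

definition lookup2 :: "(nat \<Rightarrow> nat \<Rightarrow> nat) \<Rightarrow> nat \<Rightarrow> aexp \<Rightarrow> aexp \<Rightarrow> aexp" where
  "lookup2 f q d e = lookup (\<lambda>x. f (x div q) (x mod q)) (OP ADD (OP MUL d (NUM q)) e) (q * q)"

lemma pair_less: "x < (q :: nat) \<Longrightarrow> y < q \<Longrightarrow> x * q + y < q * q"
proof -
  assume "x < q" "y < q"
  hence "x * q + y < Suc x * q" by simp
  also have "\<dots> \<le> q * q" using \<open>x < q\<close> by (intro mult_right_mono) auto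
  finally show ?thesis .
qed

lemma aval_lookup2 [simp]:
  "aval d s < q \<Longrightarrow> aval e s < q \<Longrightarrow> aval (lookup2 f q d e) s = f (aval d s) (aval e s)"
  by (simp add: lookup2_def pair_less)

primrec sum_exp :: "(nat \<Rightarrow> aexp) \<Rightarrow> nat \<Rightarrow> aexp" where
  "sum_exp f 0 = NUM 0"
| "sum_exp f (Suc n) = OP ADD (sum_exp f n) (f n)"

lemma aval_sum_exp [simp]: "aval (sum_exp f n) s = (\<Sum>i<n. aval (f i) s)"
  by (induction n) auto

text \<open>A base-\<open>R\<close> digit \<open>d\<close> stands for a set of slots in a block of
  \<open>3 * c\<close> slots, and \<open>E d e\<close> says that slot \<open>e\<close> belongs to
  it. \<open>(qc / pc) ^ m\<close> is going to bound the splitting probability from below and so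
  determines the number of repetitions. The matrices \<open>ca\<close>, \<open>cb\<close>,
  \<open>cc\<close> live in the field; the machine only meets their codes.\<close>

locale tripartition_algorithm =
  fixes c R Q pc qc :: nat
    and A :: "'f::field set" and code :: "'f \<Rightarrow> nat" and add mul :: "nat \<Rightarrow> nat \<Rightarrow> nat"
    and ca cb cc :: "nat \<Rightarrow> nat \<Rightarrow> 'f" and E :: "nat \<Rightarrow> nat \<Rightarrow> bool"
  assumes c_pos: "c > 0" and R_pos: "R > 0"
    and A: "subring_of A"
    and code_less: "x \<in> A \<Longrightarrow> code x < Q"
    and code_add: "x \<in> A \<Longrightarrow> y \<in> A \<Longrightarrow> code (x + y) = add (code x) (code y)"
    and code_mul: "x \<in> A \<Longrightarrow> y \<in> A \<Longrightarrow> code (x * y) = mul (code x) (code y)"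
    and coeffs: "q < R \<Longrightarrow> i < R \<Longrightarrow> ca q i \<in> A" "q < R \<Longrightarrow> i < R \<Longrightarrow> cb q i \<in> A"
      "q < R \<Longrightarrow> i < R \<Longrightarrow> cc q i \<in> A"
begin

primrec ring_sum :: "(nat \<Rightarrow> aexp) \<Rightarrow> nat \<Rightarrow> aexp" where
  "ring_sum f 0 = NUM (code 0)"
| "ring_sum f (Suc n) = lookup2 add Q (ring_sum f n) (f n)"

lemma aval_ring_sum:
  assumes "\<And>i. i < n \<Longrightarrow> aval (f i) s = code (g i)" "\<And>i. i < n \<Longrightarrow> g i \<in> A"
  shows "aval (ring_sum f n) s = code (\<Sum>i<n. g i)"
  using assms
proof (induction n)
  case (Suc n)
  have IH: "aval (ring_sum f n) s = code (\<Sum>i<n. g i)" by (rule Suc.IH) (use Suc.prems in auto)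
  have "(\<Sum>i<n. g i) \<in> A" using Suc.prems by (intro subring_of_sum[OF A]) auto
  moreover have "g n \<in> A" "aval (f n) s = code (g n)" using Suc.prems by auto
  ultimately show ?case using IH by (simp add: code_less code_add)
qed simp

text \<open>The numbers that dictate the word size: a seed of \<open>N * N\<close> bits, masks of at
  most \<open>2 * N + 1\<close> bits, the powers behind the repetition count, \<open>M\<close> times
  the number of bits used by one repetition, and the ring codes.\<close>

definition fits :: "nat \<Rightarrow> nat \<Rightarrow> nat \<Rightarrow> bool" where
  "fits w m M \<longleftrightarrow> (let N = 3 * (c * m) in N * N + 2 * N + 2 \<le> w \<and> pc ^ m < 2 ^ w \<and> qc ^ m < 2 ^ w \<and>
     R ^ m < 2 ^ w \<and> M * (N * N + 3 * R ^ m) < 2 ^ w \<and> M < 2 ^ w \<and> N * N + 3 * R ^ m < 2 ^ w \<and> Q \<le> 2 ^ w)"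

lemma less_two_power: "x \<le> w \<Longrightarrow> x < 2 ^ (w :: nat)"
  using less_exp[of w] by linarith

primrec bits_value :: "(nat \<Rightarrow> nat) \<Rightarrow> nat \<Rightarrow> nat" where
  "bits_value \<beta> 0 = 0"
| "bits_value \<beta> (Suc n) = 2 * bits_value \<beta> n + \<beta> n"

lemma bits_value_less:
  assumes "\<And>i. i < n \<Longrightarrow> \<beta> i \<le> 1"
  shows "bits_value \<beta> n < 2 ^ n"
  using assms
proof (induction n)
  case (Suc n)
  have "bits_value \<beta> n < 2 ^ n" "\<beta> n \<le> 1" using Suc by auto
  thus ?case by simp
qed simp

text \<open>Repetition \<open>j\<close> owns the block of \<open>L\<close> predrawn bits that starts
  at \<open>j * L\<close>; disjoint blocks make the repetitions independent.\<close>

definition random_bit :: "aexp \<Rightarrow> aexp" where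
  "random_bit e = MEM ''rnd'' (OP ADD (OP MUL (var ''j'') (var ''L'')) e)"

lemma aval_random_bit [simp]:
  "aval (random_bit e) s = s ''rnd'' (s ''j'' 0 * s ''L'' 0 + aval e s)"
  by (simp add: random_bit_def)

text \<open>\<open>N * N\<close> bits are enough because the factorial of \<open>N\<close> is at
  most \<open>2 ^ (N * N)\<close>. The seed is not rejected when too large: the shuffle reduces it
  modulo the factorial, at the price of a factor 2 in uniformity.\<close>

definition draw :: com where
  "draw = SEQ (ASSIGN ''u'' (NUM 0) (NUM 0))
     (for_loop ''i'' (OP MUL (var ''N'') (var ''N''))
       (ASSIGN ''u'' (NUM 0) (OP ADD (OP MUL (NUM 2) (var ''u'')) (random_bit (var ''i'')))))"

lemma mods_draw: "mods draw = {''u'', ''i''}"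
  by (auto simp: draw_def)

definition the_bits :: "state \<Rightarrow> nat \<Rightarrow> nat" where
  "the_bits s i = s ''rnd'' (s ''j'' 0 * s ''L'' 0 + i)"

lemma wp_draw:
  assumes N: "s ''N'' 0 = N" "N * N < w" and \<beta>: "\<And>i. i < N * N \<Longrightarrow> the_bits s i \<le> 1"
  shows "wp w draw ((N * N + 1) * 6 + 2) (\<lambda>s'. s' ''u'' 0 = bits_value (the_bits s) (N * N)) s"
  unfolding draw_def
proof (rule wp_assign_seq)
  let ?s = "store ''u'' (aval (NUM 0) s) (aval (NUM 0) s) s"
  have "wp w (for_loop ''i'' (OP MUL (var ''N'') (var ''N''))
       (ASSIGN ''u'' (NUM 0) (OP ADD (OP MUL (NUM 2) (var ''u'')) (random_bit (var ''i'')))))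
     ((N * N + 1) * (1 + 5)) (\<lambda>s'. s' ''u'' 0 = bits_value (the_bits s) (N * N)) ?s"
  proof (rule wp_for_loop[where Inv = "\<lambda>i s'. s' ''u'' 0 = bits_value (the_bits s) i"], goal_cases)
    case (1 s')
    thus ?case using N by (simp add: store_other)
  next
    case 2
    show ?case using N(2) by (intro less_two_power) simp
  next
    case (5 i s')
    have eq: "s' ''rnd'' = s ''rnd''" "s' ''j'' = s ''j''" "s' ''L'' = s ''L''"
      using 5(4) by (simp_all add: store_other)
    have "bits_value (the_bits s) (Suc i) < 2 ^ Suc i"
      by (rule bits_value_less) (use \<beta> 5(1) in auto)
    also have "(2::nat) ^ Suc i \<le> 2 ^ w" using 5(1) N(2) by (intro power_increasing) auto
    finally have "bits_value (the_bits s) (Suc i) < 2 ^ w" .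
    thus ?case
      by (intro wp_assign1) (simp_all add: 5(2,5) eq the_bits_def)
  qed simp_all
  thus "wp w (for_loop ''i'' (OP MUL (var ''N'') (var ''N''))
       (ASSIGN ''u'' (NUM 0) (OP ADD (OP MUL (NUM 2) (var ''u'')) (random_bit (var ''i'')))))
     ((N * N + 1) * 6 + 2 - 2) (\<lambda>s'. s' ''u'' 0 = bits_value (the_bits s) (N * N)) ?s" by simp
qed simp_all

text \<open>The array \<open>p\<close> holds powers of two instead of positions, so that the mask of
  a set of slots is a plain sum of entries. The exponent is shifted by one because the universe
  starts at 1 and \<open>set_encode\<close> uses the elements as exponents.\<close>

definition permute :: com where
  "permute = SEQ
     (for_loop ''i'' (var ''N'') (ASSIGN ''p'' (var ''i'') (MEM ''P2'' (OP ADD (var ''i'') (NUM 1)))))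
     (for_loop ''i'' (var ''N'')
       (SEQ (ASSIGN ''x'' (NUM 0) (OP MOD (var ''u'') (OP SUB (var ''N'') (var ''i''))))
       (SEQ (ASSIGN ''u'' (NUM 0) (OP DIV (var ''u'') (OP SUB (var ''N'') (var ''i''))))
       (SEQ (ASSIGN ''v'' (NUM 0) (MEM ''p'' (var ''x'')))
       (SEQ (ASSIGN ''p'' (var ''x'') (MEM ''p'' (OP SUB (OP SUB (var ''N'') (var ''i'')) (NUM 1))))
       (ASSIGN ''p'' (OP SUB (OP SUB (var ''N'') (var ''i'')) (NUM 1)) (var ''v'')))))))"

lemma mods_permute: "mods permute = {''p'', ''i'', ''x'', ''u'', ''v''}"
  by (auto simp: permute_def)

lemma shuffle_step:
  "l < N \<Longrightarrow> shuffle (N - l) u p = shuffle (N - l - 1) (u div (N - l))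
     (p(u mod (N - l) := p (N - l - 1), N - l - 1 := p (u mod (N - l))))"
  by (cases "N - l") simp_all

lemma wp_permute:
  assumes N: "s ''N'' 0 = N" "N < w" and P2: "\<And>i. i \<le> N \<Longrightarrow> s ''P2'' i = 2 ^ i"
  shows "wp w permute ((N + 1) * 20 + 1)
    (\<lambda>s'. \<forall>i<N. s' ''p'' i = 2 ^ Suc (shuffle N (s ''u'' 0) id i)) s"
proof -
  have N2: "N < 2 ^ w" using N(2) by (intro less_two_power) simp
  have "wp w permute ((N + 1) * (1 + 5) + (N + 1) * (9 + 5) + 1)
    (\<lambda>s'. \<forall>i<N. s' ''p'' i = 2 ^ Suc (shuffle N (s ''u'' 0) id i)) s"
    unfolding permute_def
  proof (rule wp_call)
    show "wp w (for_loop ''i'' (var ''N'') (ASSIGN ''p'' (var ''i'') (MEM ''P2'' (OP ADD (var ''i'') (NUM 1)))))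
       ((N + 1) * (1 + 5)) (\<lambda>s'. \<forall>i<N. s' ''p'' i = 2 ^ Suc i) s"
    proof (rule wp_for_loop[where Inv = "\<lambda>i s'. \<forall>l<i. s' ''p'' l = 2 ^ Suc l"], goal_cases)
      case (5 i s')
      have P2': "s' ''P2'' = s ''P2''" using 5(4) by simp
      show ?case
      proof (rule wp_assign1)
        show "aval (MEM ''P2'' (OP ADD (var ''i'') (NUM 1))) s' < 2 ^ w"
          using 5(3) by (simp add: bounded_less)
      qed (use 5 P2 P2' in \<open>auto simp: less_Suc_eq\<close>)
    qed (use N N2 in simp_all)
  next
    fix s1 assume s1: "bounded w s1"
      "\<And>X. X \<notin> mods (for_loop ''i'' (var ''N'') (ASSIGN ''p'' (var ''i'') (MEM ''P2'' (OP ADD (var ''i'') (NUM 1))))) \<Longrightarrow> s1 X = s X"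
      "\<forall>i<N. s1 ''p'' i = 2 ^ Suc i"
    have s1': "s1 ''N'' = s ''N''" "s1 ''u'' = s ''u''" using s1(2) by simp_all
    let ?c = "(SEQ (ASSIGN ''x'' (NUM 0) (OP MOD (var ''u'') (OP SUB (var ''N'') (var ''i''))))
       (SEQ (ASSIGN ''u'' (NUM 0) (OP DIV (var ''u'') (OP SUB (var ''N'') (var ''i''))))
       (SEQ (ASSIGN ''v'' (NUM 0) (MEM ''p'' (var ''x'')))
       (SEQ (ASSIGN ''p'' (var ''x'') (MEM ''p'' (OP SUB (OP SUB (var ''N'') (var ''i'')) (NUM 1))))
       (ASSIGN ''p'' (OP SUB (OP SUB (var ''N'') (var ''i'')) (NUM 1)) (var ''v''))))))"
    let ?sh = "shuffle N (s1 ''u'' 0) (s1 ''p'')"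
    show "wp w (for_loop ''i'' (var ''N'') ?c) ((N + 1) * (9 + 5))
       (\<lambda>s'. \<forall>i<N. s' ''p'' i = 2 ^ Suc (shuffle N (s ''u'' 0) id i)) s1"
    \<comment> \<open>The invariant looks ahead: shuffling the current array with what is left of
      the seed leads to a fixed result. After \<open>N\<close> rounds nothing remains to be
      shuffled.\<close>
    proof (rule wp_for_loop[where Inv = "\<lambda>i s'. shuffle (N - i) (s' ''u'' 0) (s' ''p'') = ?sh"], goal_cases)
      case (1 s')
      then show ?case using N s1' by simp
    next
      case 2
      then show ?case by (rule N2)
    next
      case (4)
      then show ?case by (simp add: store_other)
    next
      case (5 i s')
      have sN: "s' ''N'' 0 = N" using 5(4) N s1' by simp
      let ?l = "N - i"
      have u: "s' ''u'' 0 < 2 ^ w" using 5(3) by (rule bounded_less)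
      have "s' ''u'' 0 mod ?l < 2 ^ w" using u mod_less_eq_dividend[of "s' ''u'' 0" ?l] by linarith
      moreover have "s' ''u'' 0 div ?l < 2 ^ w" using u div_le_dividend[of "s' ''u'' 0" ?l] by linarith
      moreover have "s' ''p'' a < 2 ^ w" for a using 5(3) by (rule bounded_less)
      moreover have "shuffle (N - Suc i) (s' ''u'' 0 div ?l)
          ((s' ''p'')(s' ''u'' 0 mod ?l := s' ''p'' (?l - 1), ?l - 1 := s' ''p'' (s' ''u'' 0 mod ?l))) = ?sh"
        using 5(5) shuffle_step[OF 5(1), of "s' ''u'' 0" "s' ''p''"] by simp
      moreover have "store ''i'' 0 x (store ''p'' b z (store ''p'' a y S)) ''p'' = (S ''p'')(a := y, b := z)"
        for a b x y z and S :: state by (simp add: store_def)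
      ultimately show ?case
        by (intro wp_assign_seq wp_assign1) (simp_all add: 5(2) sN store_other)
    next
      case (6 s')
      have "s' ''p'' = ?sh" using 6(1) by simp
      also have "\<dots> = s1 ''p'' \<circ> shuffle N (s1 ''u'' 0) id"
        using shuffle_comp[of N "s1 ''u'' 0" "s1 ''p''" id] by simp
      finally have p: "s' ''p'' = s1 ''p'' \<circ> shuffle N (s1 ''u'' 0) id" .
      show ?case
      proof (intro allI impI)
        fix i assume "i < N"
        hence "shuffle N (s1 ''u'' 0) id i < N" using bij_betwE[OF bij_betw_shuffle] by blast
        thus "s' ''p'' i = 2 ^ Suc (shuffle N (s ''u'' 0) id i)" using s1(3) s1' by (simp add: p)
      qed
    qed simp_all
  qed
  thus ?thesis by (rule wp_conseq) auto
qed

end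

section \<open>One repetition: candidates, transforms, accumulation\<close>

context tripartition_algorithm
begin

text \<open>For \<open>p i\<close> the power of two stored by \<open>permute\<close>, this is the
  bit mask of the elements placed in the slots that the digits of \<open>v\<close> select.\<close>

definition mask :: "nat \<Rightarrow> (nat \<Rightarrow> nat) \<Rightarrow> nat \<Rightarrow> nat" where
  "mask m p v = (\<Sum>t<m. \<Sum>e<3 * c. of_bool (E (digit R v t) e) * p (t * (3 * c) + e))"

lemma slot_less: "t < m \<Longrightarrow> e < 3 * c \<Longrightarrow> t * (3 * c) + e < 3 * (c * m)"
proof -
  assume "t < m" "e < 3 * c"
  hence "t * (3 * c) + e < Suc t * (3 * c)" by simp
  also have "\<dots> \<le> m * (3 * c)" using \<open>t < m\<close> by (intro mult_right_mono) auto
  finally show ?thesis by (simp add: mult_ac)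
qed

lemma mask_cong: "(\<And>i. i < 3 * (c * m) \<Longrightarrow> p i = p' i) \<Longrightarrow> mask m p v = mask m p' v"
  unfolding mask_def by (intro sum.cong refl) (simp add: slot_less)

lemma mask_bound:
  assumes "\<And>i. i < 3 * (c * m) \<Longrightarrow> p i \<le> 2 ^ (3 * (c * m))" "t \<le> m"
  shows "mask t p v < 2 ^ (2 * (3 * (c * m)) + 1)"
proof -
  let ?N = "3 * (c * m)"
  have "mask t p v \<le> (\<Sum>t<t. \<Sum>e<3 * c. 2 ^ ?N)"
    unfolding mask_def using assms by (intro sum_mono) (auto simp: slot_less)
  also have "\<dots> = t * (3 * c) * 2 ^ ?N" by simp
  also have "\<dots> \<le> ?N * 2 ^ ?N" using assms(2) by (intro mult_right_mono) (auto simp: mult_ac)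
  also have "\<dots> < 2 ^ ?N * 2 ^ ?N * 2" using less_exp[of ?N]
    by (intro order.strict_trans1[OF mult_right_mono[of ?N "2 ^ ?N"]]) auto
  also have "2 ^ ?N * 2 ^ ?N * 2 = (2::nat) ^ (2 * ?N + 1)" by (simp only: power_add mult_2 power_one_right)
  finally show ?thesis .
qed

text \<open>The membership test is a single access, since \<open>G\<close> is addressed by the mask
  itself. The product with a random bit is the weight; weight bits follow the \<open>N * N\<close>
  seed bits, with one stretch of length \<open>W\<close> for each of the three families. The table
  of size 2 turns the result into a ring code.\<close>

definition candidate_exp :: "string \<Rightarrow> nat \<Rightarrow> aexp" where
  "candidate_exp G k =
     lookup (\<lambda>b. code (of_bool (b = 1))) (OP MUL (MEM G (var ''s''))
       (random_bit (OP ADD (OP MUL (var ''N'') (var ''N'')) (OP ADD (OP MUL (NUM k) (var ''W'')) (var ''i''))))) 2"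

definition put_candidate :: "string \<Rightarrow> string \<Rightarrow> nat \<Rightarrow> com" where
  "put_candidate X G k = ASSIGN X (var ''i'') (candidate_exp G k)"

definition mask_loop :: com where
  "mask_loop = for_loop ''t'' (var ''m'')
     (SEQ (ASSIGN ''s'' (NUM 0) (OP ADD (var ''s'') (sum_exp (\<lambda>e. OP MUL
         (lookup (\<lambda>d. of_bool (E d e)) (OP MOD (var ''w'') (NUM R)) R)
         (MEM ''p'' (OP ADD (OP MUL (var ''t'') (NUM (3 * c))) (NUM e)))) (3 * c))))
       (ASSIGN ''w'' (NUM 0) (OP DIV (var ''w'') (NUM R))))"

definition candidates :: com where
  "candidates = for_loop ''i'' (var ''W'')
     (SEQ (ASSIGN ''w'' (NUM 0) (var ''i''))
     (SEQ (ASSIGN ''s'' (NUM 0) (NUM 0))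
     (SEQ mask_loop
     (SEQ (put_candidate ''X'' ''G1'' 0)
     (SEQ (put_candidate ''Y'' ''G2'' 1)
          (put_candidate ''Z'' ''G3'' 2))))))"

lemma mods_mask_loop [simp]: "mods mask_loop = {''t'', ''s'', ''w''}"
  by (auto simp: mask_loop_def)

lemma mods_candidates [simp]: "mods candidates = {''i'', ''w'', ''s'', ''t'', ''X'', ''Y'', ''Z''}"
  by (auto simp: candidates_def put_candidate_def)

lemma wp_mask_loop:
  assumes m: "s ''m'' 0 = m" and w: "2 * (3 * (c * m)) + 1 \<le> w"
    and p: "\<And>i. i < 3 * (c * m) \<Longrightarrow> s ''p'' i \<le> 2 ^ (3 * (c * m))"
    and s: "s ''s'' 0 = 0" "s ''w'' 0 = v"
  shows "wp w mask_loop ((m + 1) * 8) (\<lambda>s'. s' ''s'' 0 = mask m (s ''p'') v) s"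
proof -
  have "m \<le> 3 * (c * m)" using c_pos by (cases c) auto
  hence mw: "m < 2 ^ w" using w by (intro less_two_power) linarith
  have "wp w mask_loop ((m + 1) * (3 + 5)) (\<lambda>s'. s' ''s'' 0 = mask m (s ''p'') v) s"
    unfolding mask_loop_def
  proof (rule wp_for_loop[where Inv = "\<lambda>t s'. s' ''s'' 0 = mask t (s ''p'') v \<and> s' ''w'' 0 = v div R ^ t"], goal_cases)
    case 2
    show ?case by (rule mw)
  next
    case 4
    show ?case using s by (simp add: mask_def)
  next
    case (5 t s')
    have sp: "s' ''p'' = s ''p''" using 5(4) by simp
    have sum: "(\<Sum>e<3 * c. (if s' ''w'' 0 mod R < R then of_bool (E (s' ''w'' 0 mod R) e) else 0) * s' ''p'' (s' ''t'' 0 * (3 * c) + e)) =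
        (\<Sum>e<3 * c. of_bool (E (digit R v t) e) * s ''p'' (t * (3 * c) + e))"
      using R_pos 5(2,5) by (simp add: sp digit_def)
    have step: "s' ''s'' 0 + (\<Sum>e<3 * c. of_bool (E (digit R v t) e) * s ''p'' (t * (3 * c) + e)) = mask (Suc t) (s ''p'') v"
      using 5(5) by (simp add: mask_def)
    have "mask (Suc t) (s ''p'') v < 2 ^ (2 * (3 * (c * m)) + 1)" using 5(1) p by (intro mask_bound) auto
    also have "(2::nat) ^ (2 * (3 * (c * m)) + 1) \<le> 2 ^ w" using w by (intro power_increasing) auto
    finally have b: "mask (Suc t) (s ''p'') v < 2 ^ w" .
    have "s' ''w'' 0 div R < 2 ^ w"
      using bounded_less[OF 5(3), of "''w''" 0] div_le_dividend[of "s' ''w'' 0" R] by linarith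
    moreover have "s' ''w'' 0 div R = v div R ^ Suc t" using 5(5)
      by (simp add: div_mult2_eq[symmetric] mult.commute)
    ultimately show ?case
      by (intro wp_assign_seq wp_assign1) (simp_all only: aval.simps apply_op.simps aval_sum_exp aval_lookup sum step b store_apply, simp_all)
  qed (use m in simp_all)
  thus ?thesis by simp
qed

definition chosen :: "nat \<Rightarrow> (nat \<Rightarrow> nat) \<Rightarrow> (nat \<Rightarrow> nat) \<Rightarrow> (nat \<Rightarrow> nat) \<Rightarrow> nat \<Rightarrow> nat \<Rightarrow> 'f" where
  "chosen m p g \<beta> k v =
    of_bool (g (mask m p v) * \<beta> (3 * (c * m) * (3 * (c * m)) + (k * R ^ m + v)) = 1)"

lemma chosen_in_A: "chosen m p g \<beta> k v \<in> A"
  by (simp add: chosen_def subring_of_zero[OF A] subring_of_one[OF A])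

lemma wp_candidates:
  assumes m: "s ''m'' 0 = m" "s ''N'' 0 = 3 * (c * m)" "s ''W'' 0 = R ^ m"
    and w: "2 * (3 * (c * m)) + 1 \<le> w" "R ^ m < 2 ^ w" "Q \<le> 2 ^ w"
    and p: "\<And>i. i < 3 * (c * m) \<Longrightarrow> s ''p'' i \<le> 2 ^ (3 * (c * m))"
    and G: "\<And>y. s ''G1'' y \<le> 1" "\<And>y. s ''G2'' y \<le> 1" "\<And>y. s ''G3'' y \<le> 1"
    and \<beta>: "\<And>i. i < 3 * (c * m) * (3 * (c * m)) + 3 * R ^ m \<Longrightarrow> the_bits s i \<le> 1"
  shows "wp w candidates ((R ^ m + 1) * ((m + 1) * 8 + 15))
    (\<lambda>s'. \<forall>v<R ^ m. s' ''X'' v = code (chosen m (s ''p'') (s ''G1'') (the_bits s) 0 v) \<and>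
       s' ''Y'' v = code (chosen m (s ''p'') (s ''G2'') (the_bits s) 1 v) \<and>
       s' ''Z'' v = code (chosen m (s ''p'') (s ''G3'') (the_bits s) 2 v)) s"
proof -
  have codew: "code x < 2 ^ w" if "x \<in> A" for x using code_less[OF that] w(3) by linarith
  have "wp w candidates ((R ^ m + 1) * (((m + 1) * 8 + 10) + 5))
    (\<lambda>s'. \<forall>v<R ^ m. s' ''X'' v = code (chosen m (s ''p'') (s ''G1'') (the_bits s) 0 v) \<and>
       s' ''Y'' v = code (chosen m (s ''p'') (s ''G2'') (the_bits s) 1 v) \<and>
       s' ''Z'' v = code (chosen m (s ''p'') (s ''G3'') (the_bits s) 2 v)) s"
    unfolding candidates_def
  proof (rule wp_for_loop[where Inv = "\<lambda>i s'. \<forall>v<i. s' ''X'' v = code (chosen m (s ''p'') (s ''G1'') (the_bits s) 0 v) \<and>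
       s' ''Y'' v = code (chosen m (s ''p'') (s ''G2'') (the_bits s) 1 v) \<and>
       s' ''Z'' v = code (chosen m (s ''p'') (s ''G3'') (the_bits s) 2 v)"], goal_cases)
    case (1 s')
    thus ?case using m by (simp add: put_candidate_def)
  next
    case 2
    show ?case by (rule w(2))
  next
    case 3
    show ?case by (simp add: put_candidate_def)
  next
    case (5 i s')
    let ?s1 = "store ''w'' 0 i s'"
    let ?s2 = "store ''s'' 0 0 ?s1"
    have fr: "s' X = s X" if "X \<noteq> ''i''" "X \<notin> {''w'', ''s'', ''t'', ''X'', ''Y'', ''Z''}" for X
      using that by (intro 5(4)) (auto simp: put_candidate_def)
    have "wp w (SEQ mask_loop (SEQ (put_candidate ''X'' ''G1'' 0)
       (SEQ (put_candidate ''Y'' ''G2'' 1) (put_candidate ''Z'' ''G3'' 2)))) ((m + 1) * 8 + 5 + 1)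
       (\<lambda>s''. \<forall>v<Suc i. store ''i'' 0 (Suc i) s'' ''X'' v = code (chosen m (s ''p'') (s ''G1'') (the_bits s) 0 v) \<and>
       store ''i'' 0 (Suc i) s'' ''Y'' v = code (chosen m (s ''p'') (s ''G2'') (the_bits s) 1 v) \<and>
       store ''i'' 0 (Suc i) s'' ''Z'' v = code (chosen m (s ''p'') (s ''G3'') (the_bits s) 2 v)) ?s2"
    proof (rule wp_call)
      have "?s2 ''p'' = s ''p''" using fr[of "''p''"] by (simp add: store_other)
      thus "wp w mask_loop ((m + 1) * 8) (\<lambda>s'. s' ''s'' 0 = mask m (s ''p'') i) ?s2"
        using wp_mask_loop[of ?s2 m w i] m w p fr[of "''m''"] by simp
    next
      fix t assume t: "bounded w t" "\<And>X. X \<notin> mods mask_loop \<Longrightarrow> t X = ?s2 X" "t ''s'' 0 = mask m (s ''p'') i"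
      have tf: "t X = s X" if "X \<notin> {''i'', ''w'', ''s'', ''t'', ''X'', ''Y'', ''Z''}" for X
        using t(2)[of X] fr[of X] that by (simp add: store_other)
      have eq: "t ''N'' = s ''N''" "t ''W'' = s ''W''" "t ''rnd'' = s ''rnd''" "t ''j'' = s ''j''"
        "t ''L'' = s ''L''" "t ''G1'' = s ''G1''" "t ''G2'' = s ''G2''" "t ''G3'' = s ''G3''"
        by (simp_all add: tf)
      have XYZ: "t ''X'' = s' ''X''" "t ''Y'' = s' ''Y''" "t ''Z'' = s' ''Z''" "t ''i'' 0 = i"
        using t(2)[of "''X''"] t(2)[of "''Y''"] t(2)[of "''Z''"] t(2)[of "''i''"] 5(2) by (simp_all add: store_other)
      have put: "aval (candidate_exp G k) t'
         = code (chosen m (s ''p'') (s G) (the_bits s) k i)"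
        if t': "t' ''i'' = t ''i''" "t' ''s'' = t ''s''" "t' ''N'' = t ''N''" "t' ''W'' = t ''W''"
          "t' ''rnd'' = t ''rnd''" "t' ''j'' = t ''j''" "t' ''L'' = t ''L''" "t' G = s G"
          and G: "\<And>y. s G y \<le> 1" and k: "k < 3" for t' G k
      proof -
        let ?b = "s G (mask m (s ''p'') i) * the_bits s (3 * (c * m) * (3 * (c * m)) + (k * R ^ m + i))"
        have "k * R ^ m + i < 3 * R ^ m"
        proof -
          have "k * R ^ m + i < Suc k * R ^ m" using 5(1) by simp
          also have "\<dots> \<le> 3 * R ^ m" using k by (intro mult_right_mono) auto
          finally show ?thesis .
        qed
        hence "the_bits s (3 * (c * m) * (3 * (c * m)) + (k * R ^ m + i)) \<le> 1" by (intro \<beta>) simp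
        with G[of "mask m (s ''p'') i"] have "?b \<le> 1 * 1" by (rule mult_le_mono)
        hence "?b < 2" by simp
        moreover have "aval (OP MUL (MEM G (var ''s''))
         (random_bit (OP ADD (OP MUL (var ''N'') (var ''N'')) (OP ADD (OP MUL (NUM k) (var ''W'')) (var ''i''))))) t' = ?b"
          by (simp add: t' eq t(3) XYZ m the_bits_def)
        ultimately show ?thesis unfolding candidate_exp_def aval_lookup by (simp only: if_True chosen_def)
      qed
      show "wp w (SEQ (put_candidate ''X'' ''G1'' 0)
       (SEQ (put_candidate ''Y'' ''G2'' 1) (put_candidate ''Z'' ''G3'' 2))) 5
       (\<lambda>s''. \<forall>v<Suc i. store ''i'' 0 (Suc i) s'' ''X'' v = code (chosen m (s ''p'') (s ''G1'') (the_bits s) 0 v) \<and>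
       store ''i'' 0 (Suc i) s'' ''Y'' v = code (chosen m (s ''p'') (s ''G2'') (the_bits s) 1 v) \<and>
       store ''i'' 0 (Suc i) s'' ''Z'' v = code (chosen m (s ''p'') (s ''G3'') (the_bits s) 2 v)) t"
        unfolding put_candidate_def
      proof -
        let ?x = "code (chosen m (s ''p'') (s ''G1'') (the_bits s) 0 i)"
        let ?y = "code (chosen m (s ''p'') (s ''G2'') (the_bits s) 1 i)"
        let ?z = "code (chosen m (s ''p'') (s ''G3'') (the_bits s) 2 i)"
        let ?t1 = "store ''X'' i ?x t"
        let ?t2 = "store ''Y'' i ?y ?t1"
        have v1: "aval (candidate_exp ''G1'' 0) t = ?x" by (rule put) (simp_all add: eq G[simplified])
        have v2: "aval (candidate_exp ''G2'' 1) ?t1 = ?y" by (rule put) (simp_all add: eq G[simplified] store_other)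
        have v3: "aval (candidate_exp ''G3'' 2) ?t2 = ?z" by (rule put) (simp_all add: eq G[simplified] store_other)
        have i: "aval (var ''i'') t = i" "aval (var ''i'') ?t1 = i" "aval (var ''i'') ?t2 = i"
          by (simp_all add: XYZ)
        show "wp w (SEQ (ASSIGN ''X'' (var ''i'') (candidate_exp ''G1'' 0))
          (SEQ (ASSIGN ''Y'' (var ''i'') (candidate_exp ''G2'' 1))
            (ASSIGN ''Z'' (var ''i'') (candidate_exp ''G3'' 2)))) 5
          (\<lambda>s''. \<forall>v<Suc i. store ''i'' 0 (Suc i) s'' ''X'' v = code (chosen m (s ''p'') (s ''G1'') (the_bits s) 0 v) \<and>
       store ''i'' 0 (Suc i) s'' ''Y'' v = code (chosen m (s ''p'') (s ''G2'') (the_bits s) 1 v) \<and>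
       store ''i'' 0 (Suc i) s'' ''Z'' v = code (chosen m (s ''p'') (s ''G3'') (the_bits s) 2 v)) t"
        proof (rule wp_assign_seq, goal_cases)
          case 2
          show ?case unfolding v1 by (rule codew[OF chosen_in_A])
        next
          case 3
          show ?case unfolding v1 i
          proof (rule wp_assign_seq, goal_cases)
            case 2
            show ?case unfolding v2 by (rule codew[OF chosen_in_A])
          next
            case 3
            show ?case unfolding v2 i
            proof (rule wp_assign1, goal_cases)
              case 2
              show ?case unfolding v3 by (rule codew[OF chosen_in_A])
            next
              case 3
              show ?case unfolding v3 i using 5(5) by (simp add: XYZ less_Suc_eq)
            qed simp
          qed simp
        qed simp
      qed
    qed
    hence "wp w (SEQ mask_loop (SEQ (put_candidate ''X'' ''G1'' 0)
       (SEQ (put_candidate ''Y'' ''G2'' 1) (put_candidate ''Z'' ''G3'' 2)))) ((m + 1) * 8 + 10 - 2 - 2)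
       (\<lambda>s''. \<forall>v<Suc i. store ''i'' 0 (Suc i) s'' ''X'' v = code (chosen m (s ''p'') (s ''G1'') (the_bits s) 0 v) \<and>
       store ''i'' 0 (Suc i) s'' ''Y'' v = code (chosen m (s ''p'') (s ''G2'') (the_bits s) 1 v) \<and>
       store ''i'' 0 (Suc i) s'' ''Z'' v = code (chosen m (s ''p'') (s ''G3'') (the_bits s) 2 v)) ?s2" by simp
    moreover have "i < 2 ^ w" using 5(1) w(2) by simp
    ultimately show ?case
      by (intro wp_assign_seq) (simp_all add: 5(2))
  qed simp_all
  thus ?thesis by (simp add: add.assoc)
qed

text \<open>Because consumed and produced digits enter at opposite ends, the loop body is the same
  for every layer. The buffer \<open>T\<close> is necessary since a new entry depends on entries
  scattered over the old array.\<close>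

definition yates :: "string \<Rightarrow> (nat \<Rightarrow> nat \<Rightarrow> 'f) \<Rightarrow> com" where
  "yates X a = for_loop ''t'' (var ''m'')
     (SEQ (for_loop ''i'' (var ''W'') (ASSIGN ''T'' (var ''i'')
        (ring_sum (\<lambda>l. lookup2 mul Q (lookup (\<lambda>q. code (a q l)) (OP MOD (var ''i'') (NUM R)) R)
           (MEM X (OP ADD (OP DIV (var ''i'') (NUM R)) (OP MUL (NUM l) (OP DIV (var ''W'') (NUM R)))))) R)))
       (for_loop ''i'' (var ''W'') (ASSIGN X (var ''i'') (MEM ''T'' (var ''i'')))))"

lemma mods_yates [simp]: "mods (yates X a) = {''t'', ''i'', ''T'', X}"
  by (auto simp: yates_def)

lemma yates_step_in_A:
  assumes "\<And>q i. q < R \<Longrightarrow> i < R \<Longrightarrow> a q i \<in> A" "\<And>u. f u \<in> A"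
  shows "yates_step R V a f u \<in> A"
  unfolding yates_step_def using assms R_pos
  by (intro subring_of_sum[OF A] subring_of_mult[OF A]) auto

lemma yates_iterate_in_A:
  assumes "\<And>q i. q < R \<Longrightarrow> i < R \<Longrightarrow> a q i \<in> A" "\<And>u. f u \<in> A"
  shows "(yates_step R V a ^^ n) f u \<in> A"
  using assms(2) by (induction n arbitrary: u) (auto intro: yates_step_in_A[OF assms(1)])

lemma wp_yates:
  assumes m: "s ''m'' 0 = m" "s ''W'' 0 = R ^ m" "m > 0"
    and w: "m < 2 ^ w" "R ^ m < 2 ^ w" "Q \<le> 2 ^ w"
    and X: "X \<notin> {''t'', ''i'', ''T'', ''m'', ''W''}"
    and a: "\<And>q i. q < R \<Longrightarrow> i < R \<Longrightarrow> a q i \<in> A"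
    and f: "\<And>u. f u \<in> A" "\<And>u. u < R ^ m \<Longrightarrow> s X u = code (f u)"
  shows "wp w (yates X a) ((m + 1) * ((R ^ m + 1) * 12 + 6))
    (\<lambda>s'. \<forall>u<R ^ m. s' X u = code ((yates_step R (R ^ m) a ^^ m) f u)) s"
proof -
  let ?V = "R ^ m"
  have X': "X \<noteq> ''t''" "X \<noteq> ''i''" "X \<noteq> ''T''" "X \<noteq> ''m''" "X \<noteq> ''W''" using X by auto
  note X'' = X' X'[symmetric]
  have "wp w (yates X a) ((m + 1) * (((?V + 1) * (1 + 5) + (?V + 1) * (1 + 5) + 1) + 5))
    (\<lambda>s'. \<forall>u<?V. s' X u = code ((yates_step R ?V a ^^ m) f u)) s"
    unfolding yates_def
  proof (rule wp_for_loop[where Inv = "\<lambda>t s'. \<forall>u<?V. s' X u = code ((yates_step R ?V a ^^ t) f u)"], goal_cases)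
    case (5 t s')
    let ?f = "(yates_step R ?V a ^^ t) f"
    have fA: "?f u \<in> A" for u by (rule yates_iterate_in_A[OF a f(1)])
    have sW: "s' ''W'' = s ''W''" using 5(4)[of "''W''"] X'' by simp
    show ?case
    proof (rule wp_call)
      let ?e = "\<lambda>l. lookup2 mul Q (lookup (\<lambda>q. code (a q l)) (OP MOD (var ''i'') (NUM R)) R)
           (MEM X (OP ADD (OP DIV (var ''i'') (NUM R)) (OP MUL (NUM l) (OP DIV (var ''W'') (NUM R)))))"
      show "wp w (for_loop ''i'' (var ''W'') (ASSIGN ''T'' (var ''i'') (ring_sum ?e R))) ((?V + 1) * (1 + 5))
         (\<lambda>t'. \<forall>u<?V. t' ''T'' u = code (yates_step R ?V a ?f u)) s'"
      proof (rule wp_for_loop[where Inv = "\<lambda>i t'. \<forall>u<i. t' ''T'' u = code (yates_step R ?V a ?f u)"], goal_cases)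
        case (5 i t')
        note inner = 5
        have eq: "t' X = s' X" "t' ''W'' = s' ''W''" using 5(4)[of X] 5(4)[of "''W''"] X'' by simp_all
        have "aval (ring_sum ?e R) t' = code (\<Sum>l<R. a (i mod R) l * ?f (i div R + l * (?V div R)))"
        proof (rule aval_ring_sum)
          fix l assume l: "l < R"
          have aA: "a (i mod R) l \<in> A" using l R_pos by (intro a) auto
          have "i div R + l * (?V div R) < ?V"
          proof -
            have V: "?V = ?V div R * R" using m(3) R_pos by (cases m) auto
            have "i div R < ?V div R" using inner(1) V R_pos by (metis less_mult_imp_div_less)
            hence "i div R + l * (?V div R) < Suc l * (?V div R)" by simp
            also have "\<dots> \<le> R * (?V div R)" using l by (intro mult_right_mono) auto
            finally show ?thesis using V by (simp add: mult.commute)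
          qed
          hence arg: "s' X (i div R + l * (?V div R)) = code (?f (i div R + l * (?V div R)))"
            using \<open>\<forall>u<?V. s' X u = code (?f u)\<close> by blast
          have v1: "aval (lookup (\<lambda>q. code (a q l)) (OP MOD (var ''i'') (NUM R)) R) t' = code (a (i mod R) l)"
            using R_pos inner(2) by simp
          have v2: "aval (MEM X (OP ADD (OP DIV (var ''i'') (NUM R)) (OP MUL (NUM l) (OP DIV (var ''W'') (NUM R))))) t' =
              code (?f (i div R + l * (?V div R)))"
            using inner(2) m arg by (simp add: eq sW)
          show "aval (?e l) t' = code (a (i mod R) l * ?f (i div R + l * (?V div R)))"
            by (subst aval_lookup2) (simp_all only: v1 v2 code_less aA fA code_mul)
          show "a (i mod R) l * ?f (i div R + l * (?V div R)) \<in> A" by (rule subring_of_mult[OF A aA fA])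
        qed
        hence val: "aval (ring_sum ?e R) t' = code (yates_step R ?V a ?f i)" by (simp only: yates_step_def)
        have "code (yates_step R ?V a ?f i) < 2 ^ w"
          using code_less[OF yates_step_in_A[of a ?f ?V i, OF a fA]] w(3) by linarith
        thus ?case using inner(2,5)
          by (intro wp_assign1) (auto simp: val less_Suc_eq)
      qed (use m w sW in simp_all)
    next
      fix t1 assume t1: "bounded w t1"
        "\<And>Y. Y \<notin> mods (for_loop ''i'' (var ''W'') (ASSIGN ''T'' (var ''i'') (ring_sum (\<lambda>l. lookup2 mul Q (lookup (\<lambda>q. code (a q l)) (OP MOD (var ''i'') (NUM R)) R)
           (MEM X (OP ADD (OP DIV (var ''i'') (NUM R)) (OP MUL (NUM l) (OP DIV (var ''W'') (NUM R)))))) R))) \<Longrightarrow> t1 Y = s' Y"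
        "\<forall>u<?V. t1 ''T'' u = code (yates_step R ?V a ?f u)"
      have t1W: "t1 ''W'' 0 = ?V" using t1(2)[of "''W''"] sW m by simp
      show "wp w (for_loop ''i'' (var ''W'') (ASSIGN X (var ''i'') (MEM ''T'' (var ''i'')))) ((?V + 1) * (1 + 5))
        (\<lambda>s''. \<forall>u<?V. store ''t'' 0 (Suc t) s'' X u = code ((yates_step R ?V a ^^ Suc t) f u)) t1"
      proof (rule wp_for_loop[where Inv = "\<lambda>i t'. \<forall>u<i. t' X u = code (yates_step R ?V a ?f u)"], goal_cases)
        case (5 i t')
        have T: "t' ''T'' = t1 ''T''" using 5(4)[of "''T''"] X'' by simp
        have "t' ''T'' i < 2 ^ w" by (rule bounded_less[OF 5(3)])
        moreover have "t1 ''T'' i = code (yates_step R ?V a ?f i)" using t1(3) 5(1) by blast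
        ultimately show ?case using 5(2,5) X''
          by (intro wp_assign1) (auto simp: T less_Suc_eq)
      qed (use t1W w X'' in \<open>simp_all\<close>)
    qed
  qed (use m w f X'' in \<open>simp_all\<close>)
  thus ?thesis by (simp add: algebra_simps)
qed

text \<open>\<open>out\<close> is the running disjunction over all repetitions, kept in normal form
  0 or 1; the value counts as nonzero when its code differs from \<open>code 0\<close>.\<close>

definition accumulate :: com where
  "accumulate = SEQ (ASSIGN ''acc'' (NUM 0) (NUM (code 0)))
     (SEQ (for_loop ''i'' (var ''W'') (ASSIGN ''acc'' (NUM 0) (lookup2 add Q (var ''acc'')
        (lookup2 mul Q (lookup2 mul Q (MEM ''X'' (var ''i'')) (MEM ''Y'' (var ''i''))) (MEM ''Z'' (var ''i''))))))
     (ASSIGN ''out'' (NUM 0) (OP LESS (NUM 0) (OP ADD (var ''out'')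
        (OP SUB (NUM 1) (OP EQ (var ''acc'') (NUM (code 0))))))))"

lemma mods_accumulate [simp]: "mods accumulate = {''acc'', ''i'', ''out''}"
  by (auto simp: accumulate_def)

lemma wp_accumulate:
  assumes W: "s ''W'' 0 = V" "V < 2 ^ w" "Q \<le> 2 ^ w" "1 \<le> w"
    and f: "\<And>u. u < V \<Longrightarrow> f u \<in> A" "\<And>u. u < V \<Longrightarrow> s ''X'' u = code (f u)"
    and g: "\<And>u. u < V \<Longrightarrow> g u \<in> A" "\<And>u. u < V \<Longrightarrow> s ''Y'' u = code (g u)"
    and h: "\<And>u. u < V \<Longrightarrow> h u \<in> A" "\<And>u. u < V \<Longrightarrow> s ''Z'' u = code (h u)"
  shows "wp w accumulate ((V + 1) * 6 + 4)
    (\<lambda>s'. s' ''out'' 0 = of_bool (s ''out'' 0 \<noteq> 0 \<or> code (\<Sum>u<V. f u * g u * h u) \<noteq> code 0)) s"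
proof -
  have codew: "code x < 2 ^ w" if "x \<in> A" for x using code_less[OF that] W(3) by linarith
  let ?e = "lookup2 add Q (var ''acc'')
        (lookup2 mul Q (lookup2 mul Q (MEM ''X'' (var ''i'')) (MEM ''Y'' (var ''i''))) (MEM ''Z'' (var ''i'')))"
  let ?fin = "ASSIGN ''out'' (NUM 0) (OP LESS (NUM 0) (OP ADD (var ''out'')
        (OP SUB (NUM 1) (OP EQ (var ''acc'') (NUM (code 0))))))"
  let ?Q = "(\<lambda>s'. s' ''out'' 0 = of_bool (s ''out'' 0 \<noteq> 0 \<or> code (\<Sum>u<V. f u * g u * h u) \<noteq> code 0))"
  let ?s = "store ''acc'' 0 (code 0) s"
  have sumA: "(\<Sum>u<i. f u * g u * h u) \<in> A" if "i \<le> V" for i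
    using that f g h by (intro subring_of_sum[OF A] subring_of_mult[OF A]) auto
  have main: "wp w (SEQ (for_loop ''i'' (var ''W'') (ASSIGN ''acc'' (NUM 0) ?e)) ?fin) ((V + 1) * (1 + 5) + 1 + 1) ?Q ?s"
  proof (rule wp_call)
    show "wp w (for_loop ''i'' (var ''W'') (ASSIGN ''acc'' (NUM 0) ?e)) ((V + 1) * (1 + 5))
       (\<lambda>t. t ''acc'' 0 = code (\<Sum>u<V. f u * g u * h u)) ?s"
    proof (rule wp_for_loop[where Inv = "\<lambda>i t. t ''acc'' 0 = code (\<Sum>u<i. f u * g u * h u)"], goal_cases)
      case (5 i t)
      have eq: "t ''X'' = s ''X''" "t ''Y'' = s ''Y''" "t ''Z'' = s ''Z''" using 5(4) by (simp_all add: store_other)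
      have fgA: "f i * g i \<in> A" "f i * g i * h i \<in> A"
        using 5(1) f g h by (auto intro!: subring_of_mult[OF A])
      have i: "i \<le> V" using 5(1) by simp
      have "aval ?e t = code ((\<Sum>u<i. f u * g u * h u) + f i * g i * h i)"
        using 5(1,2,5) f g h fgA sumA[OF i]
        by (simp add: eq code_less code_mul[symmetric] code_add[symmetric])
      hence val: "aval ?e t = code (\<Sum>u<Suc i. f u * g u * h u)" by simp
      show ?case using sumA[of "Suc i"] 5(1)
        by (intro wp_assign1) (simp_all only: val codew Suc_le_eq store_apply, simp_all)
    qed (use W in simp_all)
  next
    fix t assume t: "bounded w t" "\<And>X. X \<notin> mods (for_loop ''i'' (var ''W'') (ASSIGN ''acc'' (NUM 0) ?e)) \<Longrightarrow> t X = ?s X"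
      "t ''acc'' 0 = code (\<Sum>u<V. f u * g u * h u)"
    have "t ''out'' = s ''out''" using t(2)[of "''out''"] by (simp add: store_other)
    moreover have "(1 :: nat) < 2 ^ w" using W(4) by (intro less_two_power) simp
    ultimately show "wp w ?fin 1 ?Q t" using t(3)
      by (intro wp_assign1) auto
  qed
  show ?thesis unfolding accumulate_def
  proof (rule wp_assign_seq)
    show "aval (NUM (code 0)) s < 2 ^ w" by (simp add: codew subring_of_zero[OF A])
    have "(V + 1) * (1 + 5) + 1 + 1 = (V + 1) * 6 + 4 - 2" by simp
    with main show "wp w (SEQ (for_loop ''i'' (var ''W'') (ASSIGN ''acc'' (NUM 0) ?e)) ?fin) ((V + 1) * 6 + 4 - 2) ?Q
        (store ''acc'' (aval (NUM 0) s) (aval (NUM (code 0)) s) s)" by simp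
  qed simp
qed

definition rep :: com where
  "rep = SEQ draw (SEQ permute (SEQ candidates (SEQ (yates ''X'' ca) (SEQ (yates ''Y'' cb)
     (SEQ (yates ''Z'' cc) accumulate)))))"

lemma mods_rep [simp]: "mods rep =
    {''u'', ''i'', ''p'', ''x'', ''v'', ''w'', ''s'', ''t'', ''X'', ''Y'', ''Z'', ''T'', ''acc'', ''out''}"
  by (auto simp: rep_def mods_draw mods_permute)

definition slot_power :: "nat \<Rightarrow> (nat \<Rightarrow> nat) \<Rightarrow> nat \<Rightarrow> nat" where
  "slot_power m \<beta> i = 2 ^ Suc (shuffle (3 * (c * m)) (bits_value \<beta> (3 * (c * m) * (3 * (c * m)))) id i)"

definition rep_value :: "nat \<Rightarrow> (nat \<Rightarrow> nat) \<Rightarrow> (nat \<Rightarrow> nat) \<Rightarrow> (nat \<Rightarrow> nat) \<Rightarrow> (nat \<Rightarrow> nat) \<Rightarrow> 'f" where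
  "rep_value m g1 g2 g3 \<beta> = (\<Sum>u<R ^ m.
     (yates_step R (R ^ m) ca ^^ m) (chosen m (slot_power m \<beta>) g1 \<beta> 0) u *
     (yates_step R (R ^ m) cb ^^ m) (chosen m (slot_power m \<beta>) g2 \<beta> 1) u *
     (yates_step R (R ^ m) cc ^^ m) (chosen m (slot_power m \<beta>) g3 \<beta> 2) u)"

lemma chosen_cong: "(\<And>i. i < 3 * (c * m) \<Longrightarrow> p i = p' i) \<Longrightarrow> chosen m p g \<beta> k v = chosen m p' g \<beta> k v"
  unfolding chosen_def using mask_cong[of m p p' v] by simp

lemma slot_power_le:
  assumes "i < 3 * (c * m)"
  shows "slot_power m \<beta> i \<le> 2 ^ (3 * (c * m))"
proof -
  have "shuffle (3 * (c * m)) (bits_value \<beta> (3 * (c * m) * (3 * (c * m)))) id i < 3 * (c * m)"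
    using bij_betwE[OF bij_betw_shuffle] assms by blast
  thus ?thesis unfolding slot_power_def by (intro power_increasing) auto
qed

definition rep_steps :: "nat \<Rightarrow> nat" where
  "rep_steps m = 150 * ((3 * (c * m) * (3 * (c * m)) + 1) * (m + 1) * (R ^ m + 1))"

text \<open>The coefficients on the left add up to 122, and every monomial there is at most the
  product on the right.\<close>

lemma rep_steps_bound:
  fixes N V :: nat
  shows "(N * N + 1) * 6 + 2 + ((N + 1) * 20 + 1 + ((V + 1) * ((m + 1) * 8 + 15) + ((m + 1) * ((V + 1) * 12 + 6) +
    ((m + 1) * ((V + 1) * 12 + 6) + ((m + 1) * ((V + 1) * 12 + 6) + ((V + 1) * 6 + 4) + 1) + 1) + 1) + 1) + 1) + 1
    \<le> 150 * ((N * N + 1) * (m + 1) * (V + 1))"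
proof -
  let ?a = "N * N + 1" and ?b = "m + 1" and ?d = "V + 1"
  let ?K = "?a * ?b * ?d"
  have 1: "?a \<le> ?K" "?d \<le> ?K" "1 \<le> ?K" by (simp_all add: algebra_simps)
  have 2: "?b * ?d \<le> ?K" by (simp add: algebra_simps)
  have "N \<le> N * N" by (cases N) auto
  hence 3: "N + 1 \<le> ?K" using 1(1) by linarith
  have 4: "?b \<le> ?b * ?d" by simp
  have 5: "?d * (?b * 8 + 15) = 8 * (?b * ?d) + 15 * ?d" by (simp add: algebra_simps)
  have 6: "?b * (?d * 12 + 6) = 12 * (?b * ?d) + 6 * ?b" by (simp add: algebra_simps)
  have "a * 6 + 2 + (n * 20 + 1 + (8 * e + 15 * d + (12 * e + 6 * b + (12 * e + 6 * b +
      (12 * e + 6 * b + (d * 6 + 4) + 1) + 1) + 1) + 1) + 1) + 1 \<le> 150 * K"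
    if "a \<le> K" "d \<le> K" "1 \<le> K" "e \<le> K" "n \<le> K" "b \<le> e" for a b d e n K :: nat
    using that by linarith
  from this[OF 1 2 3 4] show ?thesis unfolding 5 6 .
qed

lemma wp_rep:
  assumes s: "s ''m'' 0 = m" "s ''N'' 0 = 3 * (c * m)" "s ''W'' 0 = R ^ m" "m > 0"
    and fits: "fits w m M"
    and P2: "\<And>i. i \<le> 3 * (c * m) \<Longrightarrow> s ''P2'' i = 2 ^ i"
    and G: "\<And>y. s ''G1'' y \<le> 1" "\<And>y. s ''G2'' y \<le> 1" "\<And>y. s ''G3'' y \<le> 1"
    and \<beta>: "\<And>i. i < 3 * (c * m) * (3 * (c * m)) + 3 * R ^ m \<Longrightarrow> the_bits s i \<le> 1"
  shows "wp w rep (rep_steps m)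
    (\<lambda>s'. s' ''out'' 0 = of_bool (s ''out'' 0 \<noteq> 0 \<or>
       code (rep_value m (s ''G1'') (s ''G2'') (s ''G3'') (the_bits s)) \<noteq> code 0)) s"
proof -
  let ?N = "3 * (c * m)" and ?V = "R ^ m"
  let ?p = "slot_power m (the_bits s)"
  let ?x = "chosen m ?p (s ''G1'') (the_bits s) 0"
  let ?y = "chosen m ?p (s ''G2'') (the_bits s) 1"
  let ?z = "chosen m ?p (s ''G3'') (the_bits s) 2"
  have w: "?N * ?N + 2 * ?N + 2 \<le> w" "?V < 2 ^ w" "Q \<le> 2 ^ w" using fits unfolding fits_def Let_def by blast+
  have "m \<le> ?N" using c_pos by (cases c) auto
  hence mw: "m < 2 ^ w" using w(1) by (intro less_two_power) linarith
  let ?keep = "\<lambda>Y. Y \<in> {''m'', ''N'', ''W'', ''P2'', ''G1'', ''G2'', ''G3'', ''rnd'', ''j'', ''L'', ''out''}"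
  have "wp w rep ((?N * ?N + 1) * 6 + 2 + ((?N + 1) * 20 + 1 + ((?V + 1) * ((m + 1) * 8 + 15) + ((m + 1) * ((?V + 1) * 12 + 6) +
    ((m + 1) * ((?V + 1) * 12 + 6) + ((m + 1) * ((?V + 1) * 12 + 6) + ((?V + 1) * 6 + 4) + 1) + 1) + 1) + 1) + 1) + 1)
    (\<lambda>s'. s' ''out'' 0 = of_bool (s ''out'' 0 \<noteq> 0 \<or>
       code (rep_value m (s ''G1'') (s ''G2'') (s ''G3'') (the_bits s)) \<noteq> code 0)) s"
    unfolding rep_def
  proof (rule wp_call[OF wp_draw], goal_cases)
    case (4 s1)
    have k1: "s1 Y = s Y" if "?keep Y" for Y using that 4(2)[of Y] by (auto simp: mods_draw)
    show ?case
    proof (rule wp_call[OF wp_permute], goal_cases)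
      case (4 s2)
      have k2: "s2 Y = s Y" if "?keep Y" for Y using that 4(2)[of Y] k1[of Y] by (auto simp: mods_permute)
      have p2: "s2 ''p'' i = ?p i" if "i < ?N" for i
        using 4(3) \<open>s1 ''u'' 0 = _\<close> that by (simp add: slot_power_def)
      have b2: "the_bits s2 = the_bits s" by (intro ext) (simp add: the_bits_def k2)
      have ch: "chosen m (s2 ''p'') g \<beta> k v = chosen m ?p g \<beta> k v" for g \<beta> k v
        by (rule chosen_cong) (rule p2)
      show ?case
      proof (rule wp_call[OF wp_candidates], goal_cases)
        case (12 s3)
        have k3: "s3 Y = s Y" if "?keep Y" for Y using that 12(2)[of Y] k2[of Y] by auto
        have X3: "s3 ''X'' v = code (?x v)" "s3 ''Y'' v = code (?y v)" "s3 ''Z'' v = code (?z v)" if "v < ?V" for v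
          using 12(3) that by (simp_all add: ch b2 k2)
        show ?case
        proof (rule wp_call[OF wp_yates[where f = ?x]], goal_cases)
          case (11 s4)
          have k4: "s4 Y = s Y" if "?keep Y" for Y using that 11(2)[of Y] k3[of Y] by auto
          have Y4: "s4 ''Y'' = s3 ''Y''" "s4 ''Z'' = s3 ''Z''" using 11(2) by simp_all
          show ?case
          proof (rule wp_call[OF wp_yates[where f = ?y]], goal_cases)
            case (11 s5)
            have k5: "s5 Y = s Y" if "?keep Y" for Y using that 11(2)[of Y] k4[of Y] by auto
            have Y5: "s5 ''X'' = s4 ''X''" "s5 ''Z'' = s3 ''Z''" using 11(2) Y4 by simp_all
            show ?case
            proof (rule wp_call[OF wp_yates[where f = ?z]], goal_cases)
              case (11 s6)
              have k6: "s6 Y = s Y" if "?keep Y" for Y using that 11(2)[of Y] k5[of Y] by auto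
              have Y6: "s6 ''X'' = s4 ''X''" "s6 ''Y'' = s5 ''Y''" using 11(2) Y5 by simp_all
              show ?case
              proof (rule wp_conseq[OF wp_accumulate[where
                  f = "(yates_step R ?V ca ^^ m) ?x" and g = "(yates_step R ?V cb ^^ m) ?y" and
                  h = "(yates_step R ?V cc ^^ m) ?z" and V = ?V] order_refl], goal_cases)
                case (11 s7)
                thus ?case by (simp add: rep_value_def k6)
              next
                case (6 u)
                show ?case using \<open>\<forall>u<?V. s4 ''X'' u = _ u\<close> 6 by (simp add: Y6)
              next
                case (8 u)
                show ?case using \<open>\<forall>u<?V. s5 ''Y'' u = _ u\<close> 8 by (simp add: Y6)
              next
                case (10 u)
                show ?case using \<open>\<forall>u<?V. s6 ''Z'' u = _ u\<close> 10 by simp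
              next
                case (5 u)
                show ?case by (rule yates_iterate_in_A[OF coeffs(1) chosen_in_A])
              next
                case (7 u)
                show ?case by (rule yates_iterate_in_A[OF coeffs(2) chosen_in_A])
              next
                case (9 u)
                show ?case by (rule yates_iterate_in_A[OF coeffs(3) chosen_in_A])
              qed (use w s k6 in simp_all)
            qed (use w mw s k5 X3 Y5 chosen_in_A coeffs in simp_all)
          qed (use w mw s k4 X3 Y4 chosen_in_A coeffs in simp_all)
        qed (use w mw s k3 X3 chosen_in_A coeffs in simp_all)
      qed (use w s k2 p2 slot_power_le G \<beta> b2 in simp_all)
    qed (use w s k1 P2 in simp_all)
  qed (use w s \<beta> in simp_all)
  thus ?thesis unfolding rep_steps_def by (rule wp_conseq) (rule rep_steps_bound, simp)
qed

end

section \<open>Flipping all coins in advance\<close>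

definition bits_of :: "bool list \<Rightarrow> nat \<Rightarrow> nat" where
  "bits_of xs i = (if i < length xs then of_bool (xs ! i) else 0)"

lemma bits_of_le: "bits_of xs i \<le> 1"
  by (simp add: bits_of_def)

definition flip_loop :: com where
  "flip_loop = for_loop ''i'' (var ''ML'') (FLIP ''rnd'' (var ''i''))"

lemma pair_pmf_of_set:
  assumes "finite A" "A \<noteq> {}" "finite B" "B \<noteq> {}"
  shows "pair_pmf (pmf_of_set A) (pmf_of_set B) = pmf_of_set (A \<times> B)"
proof (rule pmf_eqI)
  fix x :: "'a \<times> 'b"
  obtain a b where x: "x = (a, b)" by (cases x)
  have "A \<times> B \<noteq> {}" "finite (A \<times> B)" using assms by auto
  with assms show "pmf (pair_pmf (pmf_of_set A) (pmf_of_set B)) x = pmf (pmf_of_set (A \<times> B)) x"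
    by (simp add: x pmf_pair card_cartesian_product indicator_def)
qed

lemma pmf_of_set_lists_Suc:
  "pmf_of_set {bs :: bool list. length bs = Suc n} =
    bernoulli_pmf (1/2) \<bind> (\<lambda>b. map_pmf ((#) b) (pmf_of_set {bs. length bs = n}))"
proof -
  have fin: "finite {bs :: bool list. length bs = n}" for n
    using finite_lists_length_eq[of "UNIV :: bool set" n] by simp
  have ne: "{bs :: bool list. length bs = n} \<noteq> {}" for n
    using length_replicate[of n True] by blast
  have "bernoulli_pmf (1/2) \<bind> (\<lambda>b. map_pmf ((#) b) (pmf_of_set {bs. length bs = n})) =
      map_pmf (\<lambda>(b, bs). b # bs) (pair_pmf (pmf_of_set UNIV) (pmf_of_set {bs. length bs = n}))"
    by (simp add: pair_pmf_def map_bind_pmf map_pmf_def bind_assoc_pmf bind_return_pmf bernoulli_pmf_half_conv_pmf_of_set)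
  also have "pair_pmf (pmf_of_set (UNIV :: bool set)) (pmf_of_set {bs :: bool list. length bs = n}) =
      pmf_of_set (UNIV \<times> {bs. length bs = n})"
    by (rule pair_pmf_of_set) (use fin ne in auto)
  also have "map_pmf (\<lambda>(b, bs). b # bs) \<dots> = pmf_of_set ((\<lambda>(b, bs). b # bs) ` (UNIV \<times> {bs :: bool list. length bs = n}))"
    by (rule map_pmf_of_set_inj) (use fin ne in \<open>auto simp: inj_on_def\<close>)
  also have "(\<lambda>(b, bs). b # bs) ` (UNIV \<times> {bs :: bool list. length bs = n}) = {bs. length bs = Suc n}"
    by (auto simp: length_Suc_conv image_iff)
  finally show ?thesis ..
qed

definition flipped :: "nat \<Rightarrow> nat \<Rightarrow> bool list \<Rightarrow> state \<Rightarrow> state" where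
  "flipped i n bs s = s(''i'' := (s ''i'')(0 := i + n),
     ''rnd'' := (\<lambda>a. if i \<le> a \<and> a < i + n then of_bool (bs ! (a - i)) else s ''rnd'' a))"

lemma flipped_Suc:
  "flipped (Suc i) n bs (store ''i'' 0 (Suc i) (store ''rnd'' i (of_bool b) s)) = flipped i (Suc n) (b # bs) s"
proof (intro ext)
  fix X a
  show "flipped (Suc i) n bs (store ''i'' 0 (Suc i) (store ''rnd'' i (of_bool b) s)) X a =
      flipped i (Suc n) (b # bs) s X a"
    by (auto simp: flipped_def store_def nth_Cons' Suc_diff_le diff_Suc split: nat.splits)
qed

text \<open>The drawn bits never influence a charge inside this loop, so one cost \<open>T\<close>
  and one number of steps serve all outcomes and all start states with the given counter and bound.
  The result is exactly a uniformly distributed list of bits.\<close>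

lemma run_flip_while:
  assumes w: "k < 2 ^ w" "1 \<le> w" and "i + n = k"
  shows "\<exists>m T. T \<le> (n + 1) * (40 * w) \<and> (\<forall>s. s ''i'' 0 = i \<longrightarrow> s ''ML'' 0 = k \<longrightarrow>
    run m (WHILE (OP LESS (var ''i'') (var ''ML''))
       (SEQ (FLIP ''rnd'' (var ''i'')) (ASSIGN ''i'' (NUM 0) (OP ADD (var ''i'') (NUM 1))))) s =
    map_pmf (\<lambda>bs. (SKIP, flipped i n bs s, T)) (pmf_of_set {bs. length bs = n}))"
  using assms(3)
proof (induction n arbitrary: i)
  case 0
  have k: "bit_len k \<le> w" using w by (intro bit_len_le) auto
  have z: "bit_len 0 = 1" by (simp add: bit_len_def floorlog_def)
  \<comment> \<open>With no round left, counter and bound both hold \<open>k\<close>, so the cost of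
    the test may be computed in a constant state.\<close>
  let ?T = "1 + (acost (OP LESS (var ''i'') (var ''ML'')) (\<lambda>_ _. k) + 1)"
  have T: "?T \<le> (0 + 1) * (40 * w)"
    using k w(2) by (simp add: z)
  have fl: "flipped j 0 bs s = s" if "s ''i'' 0 = j" for bs s j
    using that by (intro ext) (auto simp: flipped_def)
  have "run 2 (WHILE (OP LESS (var ''i'') (var ''ML''))
       (SEQ (FLIP ''rnd'' (var ''i'')) (ASSIGN ''i'' (NUM 0) (OP ADD (var ''i'') (NUM 1))))) s =
    map_pmf (\<lambda>bs. (SKIP, flipped i 0 bs s, ?T)) (pmf_of_set {bs. length bs = 0})"
    if "s ''i'' 0 = i" "s ''ML'' 0 = k" for s
    using that 0 by (simp add: numeral_2_eq_2 bind_return_pmf fl z pmf_of_set_singleton)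
  with T show ?case by (intro exI[of _ 2] exI[of _ ?T] conjI allI impI)
next
  case (Suc n)
  have "Suc i + n = k" using Suc.prems by simp
  from Suc.IH[OF this] obtain m T where IH: "T \<le> (n + 1) * (40 * w)" "\<forall>s. s ''i'' 0 = Suc i \<longrightarrow> s ''ML'' 0 = k \<longrightarrow>
    run m (WHILE (OP LESS (var ''i'') (var ''ML''))
       (SEQ (FLIP ''rnd'' (var ''i'')) (ASSIGN ''i'' (NUM 0) (OP ADD (var ''i'') (NUM 1))))) s =
    map_pmf (\<lambda>bs. (SKIP, flipped (Suc i) n bs s, T)) (pmf_of_set {bs. length bs = n})"
    by (elim exE conjE)
  let ?W = "WHILE (OP LESS (var ''i'') (var ''ML''))
       (SEQ (FLIP ''rnd'' (var ''i'')) (ASSIGN ''i'' (NUM 0) (OP ADD (var ''i'') (NUM 1))))"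
  have ik: "i < k" using Suc.prems by simp
  have b: "bit_len k \<le> w" "bit_len i \<le> w" "bit_len (Suc i) \<le> w" using w ik by (auto intro!: bit_len_le)
  have z: "bit_len 0 = 1" "bit_len (Suc 0) = 1" by (simp_all add: bit_len_def floorlog_def compute_floorlog)
  \<comment> \<open>The exact charge of the six steps of a round: unfolding, test, flip, increment,
    and two transitions of \<open>SEQ\<close>.\<close>
  define C where "C = 1 + ((2 + bit_len i + (2 + bit_len k) + bit_len i + bit_len k + 1) +
     ((2 + bit_len i + bit_len i + 1) + (1 + ((1 + (2 + bit_len i + 1 + bit_len i + 1) + 1 + bit_len (Suc i)) + 1))))"
  have C: "C \<le> 40 * w" unfolding C_def using b w(2) by linarith
  have "run (6 + m) ?W s = map_pmf (\<lambda>bs. (SKIP, flipped i (Suc n) bs s, C + T)) (pmf_of_set {bs. length bs = Suc n})"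
    if s: "s ''i'' 0 = i" "s ''ML'' 0 = k" for s
  proof -
    let ?s = "\<lambda>b. store ''i'' 0 (Suc i) (store ''rnd'' i (of_bool b) s)"
    have "run (6 + m) ?W s = bernoulli_pmf (1/2) \<bind> (\<lambda>b. map_pmf (\<lambda>(c', s', t). (c', s', C + t)) (run m ?W (?s b)))"
      using s ik by (simp add: eval_nat_numeral bind_return_pmf map_pmf_def bind_assoc_pmf z C_def case_prod_unfold add.assoc)
    also have "\<dots> = bernoulli_pmf (1/2) \<bind> (\<lambda>b. map_pmf (\<lambda>bs. (SKIP, flipped i (Suc n) (b # bs) s, C + T)) (pmf_of_set {bs. length bs = n}))"
    proof (intro bind_pmf_cong refl)
      fix b
      have "?s b ''i'' 0 = Suc i" "?s b ''ML'' 0 = k" using s by (simp_all add: store_def)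
      from IH(2)[rule_format, of "?s b", OF this] show "map_pmf (\<lambda>(c', s', t). (c', s', C + t)) (run m ?W (?s b)) =
          map_pmf (\<lambda>bs. (SKIP, flipped i (Suc n) (b # bs) s, C + T)) (pmf_of_set {bs. length bs = n})"
        by (simp only: flipped_Suc pmf.map_comp o_def prod.case)
    qed
    also have "\<dots> = map_pmf (\<lambda>bs. (SKIP, flipped i (Suc n) bs s, C + T)) (pmf_of_set {bs. length bs = Suc n})"
      unfolding pmf_of_set_lists_Suc map_bind_pmf by (simp add: pmf.map_comp o_def)
    finally show ?thesis .
  qed
  moreover have "C + T \<le> (Suc n + 1) * (40 * w)" using C IH(1) by simp
  ultimately show ?case by (intro exI[of _ "6 + m"] exI[of _ "C + T"] conjI allI impI)
qed

lemma run_flip_loop: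
  assumes w: "k < 2 ^ w" "1 \<le> w"
  shows "\<exists>m T. T \<le> (k + 2) * (40 * w) \<and> (\<forall>s. s ''ML'' 0 = k \<longrightarrow>
    run m flip_loop s = map_pmf (\<lambda>bs. (SKIP, flipped 0 k bs s, T)) (pmf_of_set {bs. length bs = k}))"
proof -
  obtain m T where T: "T \<le> (k + 1) * (40 * w)" "\<forall>s. s ''i'' 0 = 0 \<longrightarrow> s ''ML'' 0 = k \<longrightarrow>
    run m (WHILE (OP LESS (var ''i'') (var ''ML''))
       (SEQ (FLIP ''rnd'' (var ''i'')) (ASSIGN ''i'' (NUM 0) (OP ADD (var ''i'') (NUM 1))))) s =
    map_pmf (\<lambda>bs. (SKIP, flipped 0 k bs s, T)) (pmf_of_set {bs. length bs = k})"
    using run_flip_while[OF w add_0] by (elim exE conjE)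
  have z: "bit_len 0 = 1" by (simp add: bit_len_def floorlog_def)
  have fl: "flipped 0 k bs (store ''i'' 0 0 s) = flipped 0 k bs s" for bs s
    by (intro ext) (auto simp: flipped_def store_def)
  have "run (2 + m) flip_loop s = map_pmf (\<lambda>bs. (SKIP, flipped 0 k bs s, 5 + T)) (pmf_of_set {bs. length bs = k})"
    if "s ''ML'' 0 = k" for s
    using that T(2)[rule_format, of "store ''i'' 0 0 s"]
    by (simp add: flip_loop_def for_loop_def eval_nat_numeral bind_return_pmf map_pmf_def bind_assoc_pmf z fl)
  moreover have "5 + T \<le> (k + 2) * (40 * w)" using T(1) w(2) by simp
  ultimately show ?thesis by (intro exI[of _ "2 + m"] exI[of _ "5 + T"] conjI allI impI)
qed

lemma run_halted_mono:
  assumes "run m c s = return_pmf (SKIP, s', t)"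
  shows "run (m + k) c s = return_pmf (SKIP, s', t)"
  by (simp add: run_add assms bind_return_pmf run_SKIP)

text \<open>Joins a random prefix to a suffix that is deterministic for each outcome. The suffix may
  take differently many steps on different outcomes; their maximum exists because the support is
  finite, and halted runs idle.\<close>

lemma run_SEQ_wp:
  assumes run: "run m1 c s = map_pmf (\<lambda>x. (SKIP, S x, T)) D" and fin: "finite (set_pmf D)"
    and wp: "\<And>x. x \<in> set_pmf D \<Longrightarrow> wp w d n (Q x) (S x)" and b: "\<And>x. x \<in> set_pmf D \<Longrightarrow> bounded w (S x)"
    and w: "1 \<le> w"
  shows "\<exists>m f. run m (SEQ c d) s = map_pmf f D \<and>
    (\<forall>x\<in>set_pmf D. \<exists>s' t. f x = (SKIP, s', t) \<and> t \<le> T + 1 + n * step_cost d * w \<and> Q x s')"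
proof -
  have "\<forall>x\<in>set_pmf D. \<exists>m s' t. run m d (S x) = return_pmf (SKIP, s', t) \<and> t \<le> n * step_cost d * w \<and> Q x s'"
    using wp b w unfolding wp_def by blast
  then obtain fm fs ft where f: "\<And>x. x \<in> set_pmf D \<Longrightarrow> run (fm x) d (S x) = return_pmf (SKIP, fs x, ft x)"
    "\<And>x. x \<in> set_pmf D \<Longrightarrow> ft x \<le> n * step_cost d * w" "\<And>x. x \<in> set_pmf D \<Longrightarrow> Q x (fs x)"
    by (auto simp: bchoice_iff)
  define m2 where "m2 = Max (fm ` set_pmf D)"
  have r2: "run m2 d (S x) = return_pmf (SKIP, fs x, ft x)" if x: "x \<in> set_pmf D" for x
  proof -
    have "fm x \<le> m2" unfolding m2_def using fin x by (intro Max_ge) auto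
    then obtain k where "m2 = fm x + k" using le_Suc_ex by blast
    with run_halted_mono[OF f(1)[OF x]] show ?thesis by simp
  qed
  have "run (m1 + 1 + m2) (SEQ c d) s = do {
     (c', s', t) \<leftarrow> run m1 c s;
     (d', s'', t') \<leftarrow> run m2 d s';
     return_pmf (d', s'', t + 1 + t') }"
    by (rule run_SEQ) (auto simp: run r2)
  also have "\<dots> = D \<bind> (\<lambda>x. return_pmf (SKIP, fs x, T + 1 + ft x))"
    unfolding run by (simp add: map_pmf_def bind_assoc_pmf bind_return_pmf)
      (rule bind_pmf_cong, simp_all add: r2 bind_return_pmf)
  also have "\<dots> = map_pmf (\<lambda>x. (SKIP, fs x, T + 1 + ft x)) D" by (simp add: map_pmf_def)
  finally show ?thesis using f(2,3)
    by (intro exI[of _ "m1 + 1 + m2"] exI[of _ "\<lambda>x. (SKIP, fs x, T + 1 + ft x)"]) auto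
qed

lemma run_return_SEQ:
  assumes 1: "run m1 c s = return_pmf (SKIP, s1, t1)"
    and 2: "run m2 d s1 = map_pmf (\<lambda>x. (SKIP, S x, T)) D"
  shows "run (m1 + 1 + m2) (SEQ c d) s = map_pmf (\<lambda>x. (SKIP, S x, t1 + 1 + T)) D"
proof -
  have "run (m1 + 1 + m2) (SEQ c d) s = do {
     (c', s', t) \<leftarrow> run m1 c s;
     (d', s'', t') \<leftarrow> run m2 d s';
     return_pmf (d', s'', t + 1 + t') }"
    by (rule run_SEQ) (auto simp: 1 2)
  also have "\<dots> = map_pmf (\<lambda>x. (SKIP, S x, t1 + 1 + T)) D"
    by (simp add: 1 2 bind_return_pmf map_pmf_def bind_assoc_pmf)
  finally show ?thesis .
qed

section \<open>Padding, preprocessing and the complete program\<close>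

context tripartition_algorithm
begin

text \<open>
  The universe is padded to \<open>3cm\<close> elements, where \<open>n < cm\<close>; the \<open>g\<close>-th family receives the
  dummy elements from \<open>offset m n g\<close> to \<open>offset m n (g + 1) - 1\<close>.
\<close>

definition offset :: "nat \<Rightarrow> nat \<Rightarrow> nat \<Rightarrow> nat" where
  "offset m n g = 3 * n + 1 + g * (c * m - n)"

definition offset_exp :: "nat \<Rightarrow> aexp" where
  "offset_exp g = OP ADD (OP ADD (OP MUL (NUM 3) (var ''n'')) (NUM 1))
     (OP MUL (NUM g) (OP SUB (OP MUL (NUM c) (var ''m'')) (var ''n'')))"

lemma aval_offset_exp [simp]: "aval (offset_exp g) s = offset (s ''m'' 0) (s ''n'' 0) g"
  by (simp add: offset_exp_def offset_def)

definition read_family :: "string \<Rightarrow> string \<Rightarrow> nat \<Rightarrow> com" where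
  "read_family F G g = for_loop ''i'' (var F)
     (ASSIGN G (OP ADD (MEM F (OP ADD (var ''i'') (NUM 1)))
       (OP SUB (MEM ''P2'' (offset_exp (Suc g))) (MEM ''P2'' (offset_exp g)))) (NUM 1))"

lemma mods_read_family [simp]: "mods (read_family F G g) = {''i'', G}"
  by (auto simp: read_family_def)

definition dummies :: "nat \<Rightarrow> nat \<Rightarrow> nat \<Rightarrow> nat" where
  "dummies m n g = 2 ^ offset m n (Suc g) - 2 ^ offset m n g"

lemma wp_read_family:
  assumes F: "F \<notin> {''i'', G}" and G: "G \<notin> {''i'', ''P2'', ''m'', ''n''}" "s G = (\<lambda>_. 0)"
    and len: "s F 0 = l" and w: "1 \<le> w" "bounded w s"
    and P2: "s ''P2'' (offset (s ''m'' 0) (s ''n'' 0) (Suc g)) = 2 ^ offset (s ''m'' 0) (s ''n'' 0) (Suc g)"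
      "s ''P2'' (offset (s ''m'' 0) (s ''n'' 0) g) = 2 ^ offset (s ''m'' 0) (s ''n'' 0) g"
  shows "wp w (read_family F G g) ((l + 1) * 6)
    (\<lambda>s'. \<forall>y. s' G y = of_bool (\<exists>j<l. y = s F (Suc j) + dummies (s ''m'' 0) (s ''n'' 0) g)) s"
proof -
  have F': "F \<noteq> ''i''" "F \<noteq> G" and G': "G \<noteq> ''i''" "G \<noteq> ''P2''" "G \<noteq> ''m''" "G \<noteq> ''n''"
    using F G by auto
  note ne = F' G' F'[symmetric] G'[symmetric]
  have "wp w (read_family F G g) ((l + 1) * (1 + 5))
    (\<lambda>s'. \<forall>y. s' G y = of_bool (\<exists>j<l. y = s F (Suc j) + dummies (s ''m'' 0) (s ''n'' 0) g)) s"
    unfolding read_family_def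
  proof (rule wp_for_loop[where Inv = "\<lambda>i s'. \<forall>y. s' G y = of_bool (\<exists>j<i. y = s F (Suc j) + dummies (s ''m'' 0) (s ''n'' 0) g)"], goal_cases)
    case (1 s')
    thus ?case using len ne by simp
  next
    case 2
    show ?case using bounded_less[OF w(2), of F 0] len by simp
  next
    case (5 i s')
    have eq: "s' F = s F" "s' ''P2'' = s ''P2''" "s' ''m'' = s ''m''" "s' ''n'' = s ''n''"
      using 5(4) ne by simp_all
    let ?a = "s F (Suc i) + dummies (s ''m'' 0) (s ''n'' 0) g"
    have a: "aval (OP ADD (MEM F (OP ADD (var ''i'') (NUM 1)))
       (OP SUB (MEM ''P2'' (offset_exp (Suc g))) (MEM ''P2'' (offset_exp g)))) s' = ?a"
      by (simp add: eq 5(2) P2 dummies_def)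
    have one: "aval (NUM 1) s' = 1" by simp
    show ?case
    proof (rule wp_assign1, goal_cases)
      case 2
      show ?case using w(1) unfolding one by (intro less_two_power)
    next
      case 3
      show ?case unfolding a one using 5(5) ne by (auto simp: less_Suc_eq)
    qed simp
  qed (use ne G in simp_all)
  thus ?thesis by simp
qed

definition powers :: com where
  "powers = SEQ (ASSIGN ''P2'' (NUM 0) (NUM 1))
     (for_loop ''i'' (OP ADD (var ''N'') (NUM 1))
       (ASSIGN ''P2'' (OP ADD (var ''i'') (NUM 1)) (OP MUL (NUM 2) (MEM ''P2'' (var ''i'')))))"

lemma mods_powers [simp]: "mods powers = {''P2'', ''i''}"
  by (auto simp: powers_def)

lemma wp_powers:
  assumes N: "s ''N'' 0 = N" and w: "N + 2 \<le> w"
  shows "wp w powers ((N + 2) * 6 + 2) (\<lambda>s'. \<forall>i\<le>N + 1. s' ''P2'' i = 2 ^ i) s"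
  unfolding powers_def
proof (rule wp_assign_seq, goal_cases)
  case 2
  show ?case using w by (simp add: less_two_power)
next
  case 3
  let ?s = "store ''P2'' (aval (NUM 0) s) (aval (NUM 1) s) s"
  have "wp w (for_loop ''i'' (OP ADD (var ''N'') (NUM 1))
       (ASSIGN ''P2'' (OP ADD (var ''i'') (NUM 1)) (OP MUL (NUM 2) (MEM ''P2'' (var ''i'')))))
     ((N + 1 + 1) * (1 + 5)) (\<lambda>s'. \<forall>i\<le>N + 1. s' ''P2'' i = 2 ^ i) ?s"
  proof (rule wp_for_loop[where Inv = "\<lambda>i s'. \<forall>l\<le>i. s' ''P2'' l = 2 ^ l"], goal_cases)
    case (1 s')
    thus ?case using N by (simp add: store_other)
  next
    case 2
    show ?case using w by (intro less_two_power) simp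
  next
    case (5 i s')
    have "(2::nat) ^ Suc i < 2 ^ w" using 5(1) w by (intro power_strict_increasing) auto
    thus ?case using 5(2,5) by (intro wp_assign1) (auto simp: le_Suc_eq)
  qed simp_all
  thus ?case by (simp add: algebra_simps)
qed simp

definition parameters :: com where
  "parameters = SEQ (ASSIGN ''pa'' (NUM 0) (NUM 1)) (SEQ (ASSIGN ''pb'' (NUM 0) (NUM 1)) (SEQ (ASSIGN ''W'' (NUM 0) (NUM 1))
     (SEQ (for_loop ''i'' (var ''m'')
        (SEQ (ASSIGN ''pa'' (NUM 0) (OP MUL (var ''pa'') (NUM pc)))
        (SEQ (ASSIGN ''pb'' (NUM 0) (OP MUL (var ''pb'') (NUM qc)))
             (ASSIGN ''W'' (NUM 0) (OP MUL (var ''W'') (NUM R))))))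
     (SEQ (ASSIGN ''M'' (NUM 0) (OP MUL (NUM 32) (OP ADD (OP DIV (var ''pa'') (var ''pb'')) (NUM 1))))
     (SEQ (ASSIGN ''L'' (NUM 0) (OP ADD (OP MUL (var ''N'') (var ''N'')) (OP MUL (NUM 3) (var ''W''))))
          (ASSIGN ''ML'' (NUM 0) (OP MUL (var ''M'') (var ''L''))))))))"

lemma mods_parameters [simp]: "mods parameters = {''pa'', ''pb'', ''W'', ''i'', ''M'', ''L'', ''ML''}"
  by (auto simp: parameters_def)

text \<open>One repetition detects a solution with probability at least
  \<open>qc ^ m / (16 * pc ^ m)\<close>. The factor 32 makes the expected number of detections at
  least 2; the \<open>+ 1\<close> compensates for rounding down.\<close>

definition reps :: "nat \<Rightarrow> nat" where
  "reps m = 32 * (pc ^ m div qc ^ m + 1)"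

text \<open>The seed of the permutation, followed by one weight bit for every candidate index and
  family.\<close>

definition rep_bits :: "nat \<Rightarrow> nat" where
  "rep_bits m = 3 * (c * m) * (3 * (c * m)) + 3 * R ^ m"

lemma wp_parameters:
  assumes s: "s ''m'' 0 = m" "s ''N'' 0 = 3 * (c * m)" and fits: "fits w m (reps m)"
    and pq: "pc > 0" "qc > 0"
  shows "wp w parameters ((m + 1) * 10 + 12)
    (\<lambda>s'. s' ''W'' 0 = R ^ m \<and> s' ''M'' 0 = reps m \<and> s' ''L'' 0 = rep_bits m \<and> s' ''ML'' 0 = reps m * rep_bits m) s"
proof -
  let ?c = "SEQ (ASSIGN ''pa'' (NUM 0) (OP MUL (var ''pa'') (NUM pc)))
        (SEQ (ASSIGN ''pb'' (NUM 0) (OP MUL (var ''pb'') (NUM qc)))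
             (ASSIGN ''W'' (NUM 0) (OP MUL (var ''W'') (NUM R))))"
  let ?Q = "\<lambda>s'. s' ''W'' 0 = R ^ m \<and> s' ''M'' 0 = reps m \<and> s' ''L'' 0 = rep_bits m \<and> s' ''ML'' 0 = reps m * rep_bits m"
  let ?d = "SEQ (ASSIGN ''M'' (NUM 0) (OP MUL (NUM 32) (OP ADD (OP DIV (var ''pa'') (var ''pb'')) (NUM 1))))
     (SEQ (ASSIGN ''L'' (NUM 0) (OP ADD (OP MUL (var ''N'') (var ''N'')) (OP MUL (NUM 3) (var ''W''))))
          (ASSIGN ''ML'' (NUM 0) (OP MUL (var ''M'') (var ''L''))))"
  have w: "3 * (c * m) * (3 * (c * m)) + 2 * (3 * (c * m)) + 2 \<le> w" "pc ^ m < 2 ^ w" "qc ^ m < 2 ^ w" "R ^ m < 2 ^ w"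
    "reps m < 2 ^ w" "rep_bits m < 2 ^ w" "reps m * rep_bits m < 2 ^ w"
    using fits unfolding fits_def Let_def rep_bits_def by blast+
  have "m \<le> 3 * (c * m)" using c_pos by (cases c) auto
  hence mw: "m < 2 ^ w" using w(1) by (intro less_two_power) linarith
  have one: "1 < (2::nat) ^ w" using w(1) by (intro less_two_power) linarith
  let ?s = "store ''W'' 0 1 (store ''pb'' 0 1 (store ''pa'' 0 1 s))"
  have main: "wp w (SEQ (for_loop ''i'' (var ''m'') ?c) ?d) ((m + 1) * (5 + 5) + 5 + 1) ?Q ?s"
  proof (rule wp_call)
    show "wp w (for_loop ''i'' (var ''m'') ?c) ((m + 1) * (5 + 5))
      (\<lambda>t. t ''pa'' 0 = pc ^ m \<and> t ''pb'' 0 = qc ^ m \<and> t ''W'' 0 = R ^ m) ?s"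
    proof (rule wp_for_loop[where Inv = "\<lambda>i t. t ''pa'' 0 = pc ^ i \<and> t ''pb'' 0 = qc ^ i \<and> t ''W'' 0 = R ^ i"], goal_cases)
      case (1 s')
      thus ?case using s by simp
    next
      case (5 i t)
      have mono: "x ^ Suc i < 2 ^ w" if "x ^ m < 2 ^ w" "x > 0" for x :: nat
        using power_increasing[of "Suc i" m x] 5(1) that by linarith
      have "pc ^ i * pc < 2 ^ w" "qc ^ i * qc < 2 ^ w" "R ^ i * R < 2 ^ w"
        using mono[OF w(2) pq(1)] mono[OF w(3) pq(2)] mono[OF w(4) R_pos] by (simp_all add: mult.commute)
      thus ?case using 5(5)
        by (intro wp_assign_seq wp_assign1) (simp_all add: mult.commute)
    qed (use mw in simp_all)
  next
    fix t assume t: "bounded w t" "\<And>X. X \<notin> mods (for_loop ''i'' (var ''m'') ?c) \<Longrightarrow> t X = ?s X"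
      "t ''pa'' 0 = pc ^ m \<and> t ''pb'' 0 = qc ^ m \<and> t ''W'' 0 = R ^ m"
    have N: "t ''N'' 0 = 3 * (c * m)" using t(2)[of "''N''"] s by simp
    have M: "32 * (pc ^ m div qc ^ m + 1) = reps m" by (simp add: reps_def)
    show "wp w ?d 5 ?Q t"
    proof (rule wp_assign_seq, goal_cases)
      case 2
      show ?case using w(5) t(3) by (simp add: reps_def)
    next
      case 3
      show ?case
      proof (rule wp_assign_seq, goal_cases)
        case 2
        show ?case using w(6) t(3) N by (simp add: rep_bits_def)
      next
        case 3
        show ?case using w(7) t(3) N by (intro wp_assign1) (simp_all add: reps_def rep_bits_def)
      qed simp
    qed simp
  qed
  have "wp w parameters ((m + 1) * 10 + 12) ?Q s"
    unfolding parameters_def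
  proof (rule wp_assign_seq, goal_cases)
    case 3
    show ?case
    proof (rule wp_assign_seq, goal_cases)
      case 3
      show ?case
      proof (rule wp_assign_seq, goal_cases)
        case 3
        have "(m + 1) * (5 + 5) + 5 + 1 = (m + 1) * 10 + 12 - 2 - 2 - 2" by simp
        with main show ?case by simp
      qed (use one in simp_all)
    qed (use one in simp_all)
  qed (use one in simp_all)
  thus ?thesis .
qed

definition prologue :: com where
  "prologue = SEQ (ASSIGN ''m'' (NUM 0) (OP ADD (OP DIV (var ''n'') (NUM c)) (NUM 1)))
     (SEQ (ASSIGN ''N'' (NUM 0) (OP MUL (NUM 3) (OP MUL (NUM c) (var ''m''))))
     (SEQ powers (SEQ (read_family ''F1'' ''G1'' 0) (SEQ (read_family ''F2'' ''G2'' 1)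
     (SEQ (read_family ''F3'' ''G3'' 2) parameters)))))"

definition padded :: "nat \<Rightarrow> nat \<Rightarrow> nat \<Rightarrow> nat set list \<Rightarrow> nat \<Rightarrow> nat" where
  "padded m n g L y = of_bool (\<exists>S\<in>set L. y = set_encode S + dummies m n g)"

lemma family_array_simps: "family_array L 0 = length L" "j < length L \<Longrightarrow> family_array L (Suc j) = set_encode (L ! j)"
  by (simp_all add: family_array_def array_of_def)

lemma padded_eq: "of_bool (\<exists>j<length L. y = family_array L (Suc j) + dummies m n g) = padded m n g L y"
  unfolding padded_def
  by (rule arg_cong[of _ _ of_bool]) (metis family_array_simps(2) in_set_conv_nth)

lemma instance_state_simps:
  "instance_state n L1 L2 L3 ''n'' 0 = n" "instance_state n L1 L2 L3 ''F1'' = family_array L1"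
  "instance_state n L1 L2 L3 ''F2'' = family_array L2" "instance_state n L1 L2 L3 ''F3'' = family_array L3"
  "X \<notin> {''n'', ''F1'', ''F2'', ''F3''} \<Longrightarrow> instance_state n L1 L2 L3 X = (\<lambda>_. 0)"
  by (auto simp: instance_state_def array_of_def)

lemma offset_le: "g \<le> 3 \<Longrightarrow> n \<le> c * m \<Longrightarrow> offset m n g \<le> 3 * (c * m) + 1"
proof -
  assume "g \<le> 3" "n \<le> c * m"
  have "g * (c * m - n) \<le> 3 * (c * m - n)" using \<open>g \<le> 3\<close> by (rule mult_right_mono) simp
  thus ?thesis using \<open>n \<le> c * m\<close> unfolding offset_def by linarith
qed

lemma wp_prologue:
  fixes n L1 L2 L3
  defines "m \<equiv> n div c + 1" and "s \<equiv> instance_state n L1 L2 L3"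
  assumes fits: "fits w m (reps m)" and b: "bounded w s" and pq: "pc > 0" "qc > 0"
  shows "wp w prologue (70 * (3 * (c * m) + m + length L1 + length L2 + length L3 + 1))
    (\<lambda>s'. s' ''m'' 0 = m \<and> s' ''N'' 0 = 3 * (c * m) \<and> s' ''W'' 0 = R ^ m \<and> s' ''M'' 0 = reps m \<and>
       s' ''L'' 0 = rep_bits m \<and> s' ''ML'' 0 = reps m * rep_bits m \<and> (\<forall>i\<le>3 * (c * m). s' ''P2'' i = 2 ^ i) \<and>
       s' ''G1'' = padded m n 0 L1 \<and> s' ''G2'' = padded m n 1 L2 \<and> s' ''G3'' = padded m n 2 L3) s"
    (is "wp w prologue _ ?Q s")
proof -
  let ?N = "3 * (c * m)"
  have w: "?N * ?N + 2 * ?N + 2 \<le> w" using fits unfolding fits_def Let_def by blast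
  have w1: "1 \<le> w" using w by simp
  have mN: "m \<le> ?N" using c_pos by (cases c) auto
  have Nw: "?N < 2 ^ w" using w by (intro less_two_power) linarith
  have mw: "m < 2 ^ w" using mN Nw by linarith
  have nm: "n \<le> c * m" unfolding m_def using dividend_less_times_div[OF c_pos, of n] by simp
  note off = offset_le[OF _ nm]
  let ?s2 = "store ''N'' 0 ?N (store ''m'' 0 m s)"
  have s2: "?s2 ''n'' 0 = n" "?s2 ''m'' 0 = m" "?s2 ''N'' 0 = ?N" "?s2 ''F1'' = family_array L1"
    "?s2 ''F2'' = family_array L2" "?s2 ''F3'' = family_array L3"
    "?s2 ''G1'' = (\<lambda>_. 0)" "?s2 ''G2'' = (\<lambda>_. 0)" "?s2 ''G3'' = (\<lambda>_. 0)"
    by (simp_all add: s_def store_other instance_state_simps)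
  let ?keep = "\<lambda>Y. Y \<in> {''n'', ''m'', ''N'', ''F1'', ''F2'', ''F3''}"
  let ?n = "(?N + 2) * 6 + 2 + ((length L1 + 1) * 6 + ((length L2 + 1) * 6 +
    ((length L3 + 1) * 6 + ((m + 1) * 10 + 12) + 1) + 1) + 1) + 1"
  have main: "wp w (SEQ powers (SEQ (read_family ''F1'' ''G1'' 0) (SEQ (read_family ''F2'' ''G2'' 1)
     (SEQ (read_family ''F3'' ''G3'' 2) parameters)))) ?n ?Q ?s2"
  proof (rule wp_call[OF wp_powers], goal_cases)
    case (3 s3)
    have k3: "s3 Y = ?s2 Y" if "?keep Y \<or> Y \<in> {''G1'', ''G2'', ''G3''}" for Y using that 3(2)[of Y] by auto
    have P3: "s3 ''P2'' i = 2 ^ i" if "i \<le> ?N + 1" for i using 3(3) that by blast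
    have o3: "offset (s3 ''m'' 0) (s3 ''n'' 0) g = offset m n g" for g using k3 s2 by simp
    show ?case
    proof (rule wp_call[OF wp_read_family[where l = "length L1"]], goal_cases)
      case (9 s4)
      have k4: "s4 Y = ?s2 Y" if "?keep Y \<or> Y \<in> {''G2'', ''G3''}" for Y using that 9(2)[of Y] k3[of Y] by auto
      have P4: "s4 ''P2'' = s3 ''P2''" using 9(2) by simp
      have G4: "s4 ''G1'' = padded m n 0 L1" using 9(3) k3 s2 by (intro ext) (simp add: padded_eq)
      have o4: "offset (s4 ''m'' 0) (s4 ''n'' 0) g = offset m n g" for g using k4 s2 by simp
      show ?case
      proof (rule wp_call[OF wp_read_family[where l = "length L2"]], goal_cases)
        case (9 s5)
        have k5: "s5 Y = ?s2 Y" if "?keep Y \<or> Y \<in> {''G3''}" for Y using that 9(2)[of Y] k4[of Y] by auto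
        have P5: "s5 ''P2'' = s3 ''P2''" "s5 ''G1'' = s4 ''G1''" using 9(2) P4 by simp_all
        have G5: "s5 ''G2'' = padded m n 1 L2" using 9(3) k4 s2 by (intro ext) (simp add: padded_eq)
        have o5: "offset (s5 ''m'' 0) (s5 ''n'' 0) g = offset m n g" for g using k5 s2 by simp
        show ?case
        proof (rule wp_call[OF wp_read_family[where l = "length L3"]], goal_cases)
          case (9 s6)
          have k6: "s6 Y = ?s2 Y" if "?keep Y" for Y using that 9(2)[of Y] k5[of Y] by auto
          have P6: "s6 ''P2'' = s3 ''P2''" "s6 ''G1'' = s4 ''G1''" "s6 ''G2'' = s5 ''G2''" using 9(2) P5 by simp_all
          have G6: "s6 ''G3'' = padded m n 2 L3" using 9(3) k5 s2 by (intro ext) (simp add: padded_eq)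
          show ?case
          proof (rule wp_conseq[OF wp_parameters order_refl], goal_cases)
            case (6 s7)
            have "s7 Y = s6 Y" if "Y \<in> {''m'', ''N'', ''P2'', ''G1'', ''G2'', ''G3''}" for Y
              using that 6(2)[of Y] by auto
            thus ?case using 6(3) k6 s2 P6 G4 G5 G6 P3 by simp
          qed (use k6 s2 fits pq in simp_all)
        qed (use k5 s2 w1 P5 P3 o5 off 9 in \<open>simp_all add: family_array_simps\<close>)
      qed (use k4 s2 w1 P4 P3 o4 off 9 in \<open>simp_all add: family_array_simps\<close>)
    qed (use k3 s2 w1 P3 o3 off 3 in \<open>simp_all add: family_array_simps\<close>)
  qed (use s2 w in simp_all)
  have "wp w prologue (?n + 4) ?Q s"
    unfolding prologue_def
  proof (rule wp_assign_seq, goal_cases)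
    case 2
    show ?case using mw by (simp add: s_def instance_state_simps m_def)
  next
    case 3
    show ?case
    proof (rule wp_assign_seq, goal_cases)
      case 2
      show ?case using Nw by (simp add: s_def instance_state_simps m_def)
    next
      case 3
      have "store ''N'' (aval (NUM 0) (store ''m'' (aval (NUM 0) s) (aval (OP ADD (OP DIV (var ''n'') (NUM c)) (NUM 1)) s) s))
           (aval (OP MUL (NUM 3) (OP MUL (NUM c) (var ''m''))) (store ''m'' (aval (NUM 0) s) (aval (OP ADD (OP DIV (var ''n'') (NUM c)) (NUM 1)) s) s))
           (store ''m'' (aval (NUM 0) s) (aval (OP ADD (OP DIV (var ''n'') (NUM c)) (NUM 1)) s) s) = ?s2"
        by (simp add: s_def instance_state_simps m_def)
      with main show ?case by (simp only: diff_add_inverse2 numeral_Bit0 diff_add_inverse add_diff_cancel_right') simp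
    qed simp
  qed simp
  thus ?thesis
    by (rule wp_conseq) simp_all
qed

text \<open>Only \<open>flip_loop\<close> is random. The state that it leaves behind contains every
  coin, so the repetitions are an ordinary deterministic loop that falls under
  \<open>wp\<close>.\<close>

definition program :: com where
  "program = SEQ (SEQ prologue flip_loop) (for_loop ''j'' (var ''M'') rep)"

definition accepts :: "nat \<Rightarrow> (nat \<Rightarrow> nat) \<Rightarrow> (nat \<Rightarrow> nat) \<Rightarrow> (nat \<Rightarrow> nat) \<Rightarrow> bool list \<Rightarrow> bool" where
  "accepts m g1 g2 g3 bs \<longleftrightarrow> code (rep_value m g1 g2 g3 (bits_of bs)) \<noteq> code 0"

lemma bits_value_cong: "(\<And>i. i < n \<Longrightarrow> \<beta> i = \<beta>' i) \<Longrightarrow> bits_value \<beta> n = bits_value \<beta>' n"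
  by (induction n) auto

lemma rep_value_cong:
  assumes "\<And>i. i < rep_bits m \<Longrightarrow> \<beta> i = \<beta>' i"
  shows "rep_value m g1 g2 g3 \<beta> = rep_value m g1 g2 g3 \<beta>'"
proof -
  have p: "slot_power m \<beta> = slot_power m \<beta>'"
    unfolding slot_power_def
    using bits_value_cong[of "3 * (c * m) * (3 * (c * m))" \<beta> \<beta>'] assms by (simp add: rep_bits_def)
  have ch: "chosen m p g \<beta> k v = chosen m p g \<beta>' k v" if "k < 3" "v < R ^ m" for p g k v
  proof -
    have "k * R ^ m + v < Suc k * R ^ m" using that by simp
    also have "\<dots> \<le> 3 * R ^ m" using that by (intro mult_right_mono) auto
    finally have "\<beta> (3 * (c * m) * (3 * (c * m)) + (k * R ^ m + v)) = \<beta>' (3 * (c * m) * (3 * (c * m)) + (k * R ^ m + v))"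
      by (intro assms) (simp add: rep_bits_def)
    thus ?thesis by (simp only: chosen_def)
  qed
  have y: "(yates_step R (R ^ m) a ^^ m) (chosen m p g \<beta> k) u = (yates_step R (R ^ m) a ^^ m) (chosen m p g \<beta>' k) u"
    if "k < 3" "u < R ^ m" for a p g k u
    unfolding yates_full[OF R_pos that(2)] by (intro sum.cong refl) (simp add: ch that)
  show ?thesis unfolding rep_value_def p by (intro sum.cong refl) (simp add: y)
qed

lemma run_program:
  fixes n L1 L2 L3
  defines "m \<equiv> n div c + 1" and "s \<equiv> instance_state n L1 L2 L3"
  defines "B \<equiv> reps m * rep_bits m"
  assumes fits: "fits w m (reps m)" and b: "bounded w s" and pq: "pc > 0" "qc > 0"
  shows "\<exists>mm f. run mm program s = map_pmf f (pmf_of_set {bs. length bs = B}) \<and>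
    (\<forall>bs. length bs = B \<longrightarrow> (\<exists>s' t. f bs = (SKIP, s', t) \<and>
       t \<le> 70 * (3 * (c * m) + m + length L1 + length L2 + length L3 + 1) * step_cost prologue * w + 1
         + (B + 2) * (40 * w) + 1 + ((reps m + 1) * (rep_steps m + 5)) * step_cost (for_loop ''j'' (var ''M'') rep) * w \<and>
       s' ''out'' 0 = of_bool (\<exists>j<reps m. accepts m (padded m n 0 L1) (padded m n 1 L2) (padded m n 2 L3)
         (take (rep_bits m) (drop (j * rep_bits m) bs)))))"
proof -
  let ?g1 = "padded m n 0 L1" and ?g2 = "padded m n 1 L2" and ?g3 = "padded m n 2 L3"
  let ?N = "3 * (c * m)"
  have w: "?N * ?N + 2 * ?N + 2 \<le> w" "B < 2 ^ w" "reps m < 2 ^ w"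
    using fits unfolding fits_def Let_def rep_bits_def B_def by blast+
  hence w1: "1 \<le> w" by simp
  have m0: "m > 0" by (simp add: m_def)
  from wp_prologue[OF fits[unfolded m_def] b[unfolded s_def] pq, folded m_def s_def] w1 b
  obtain m1 s1 t1 where 1: "run m1 prologue s = return_pmf (SKIP, s1, t1)"
    "t1 \<le> 70 * (?N + m + length L1 + length L2 + length L3 + 1) * step_cost prologue * w" "bounded w s1"
    "\<forall>X. X \<notin> mods prologue \<longrightarrow> s1 X = s X"
    and s1: "s1 ''m'' 0 = m" "s1 ''N'' 0 = ?N" "s1 ''W'' 0 = R ^ m" "s1 ''M'' 0 = reps m"
       "s1 ''L'' 0 = rep_bits m" "s1 ''ML'' 0 = B" "\<forall>i\<le>?N. s1 ''P2'' i = 2 ^ i"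
       "s1 ''G1'' = ?g1" "s1 ''G2'' = ?g2" "s1 ''G3'' = ?g3"
    unfolding wp_def B_def by blast
  have rnd: "s1 ''rnd'' = (\<lambda>_. 0)" "s1 ''out'' = (\<lambda>_. 0)"
    using 1(4) by (simp_all add: prologue_def s_def instance_state_simps)
  from run_flip_loop[OF w(2) w1] s1(6) obtain m2 T where
    2: "T \<le> (B + 2) * (40 * w)" "run m2 flip_loop s1 = map_pmf (\<lambda>bs. (SKIP, flipped 0 B bs s1, T)) (pmf_of_set {bs. length bs = B})"
    by blast
  let ?D = "pmf_of_set {bs :: bool list. length bs = B}"
  have fin: "finite {bs :: bool list. length bs = B}"
    using finite_lists_length_eq[of "UNIV :: bool set" B] by simp
  have ne: "{bs :: bool list. length bs = B} \<noteq> {}" using length_replicate[of B True] by blast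
  have set: "set_pmf ?D = {bs. length bs = B}" using fin ne by simp
  let ?S = "\<lambda>bs. flipped 0 B bs s1"
  let ?Q = "\<lambda>bs s'. s' ''out'' 0 = of_bool (\<exists>j<reps m. accepts m ?g1 ?g2 ?g3 (take (rep_bits m) (drop (j * rep_bits m) bs)))"
  have S: "?S bs X = s1 X" if "X \<noteq> ''i''" "X \<noteq> ''rnd''" for bs X using that by (simp add: flipped_def)
  have Srnd: "?S bs ''rnd'' = bits_of bs" if "length bs = B" for bs
    using that by (intro ext) (simp add: flipped_def bits_of_def rnd)
  have bS: "bounded w (?S bs)" for bs
  proof -
    have "(1::nat) < 2 ^ w" using w1 by (intro less_two_power) simp
    thus ?thesis using 1(3) w(2) by (auto simp: bounded_def flipped_def)
  qed
  have wp: "wp w (for_loop ''j'' (var ''M'') rep) ((reps m + 1) * (rep_steps m + 5)) (?Q bs) (?S bs)"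
    if bs: "length bs = B" for bs
  proof (rule wp_for_loop[where Inv = "\<lambda>i s'. s' ''out'' 0 = of_bool (\<exists>j<i. accepts m ?g1 ?g2 ?g3 (take (rep_bits m) (drop (j * rep_bits m) bs)))"], goal_cases)
    case (1 s')
    have "s' ''M'' = ?S bs ''M''" by (rule 1) auto
    thus ?case using S s1 by simp
  next
    case 4
    show ?case using S rnd by simp
  next
    case (5 i s')
    have k: "s' X = ?S bs X" if "X \<in> {''m'', ''N'', ''W'', ''L'', ''P2'', ''G1'', ''G2'', ''G3'', ''rnd''}" for X
      using that 5(4)[of X] by auto
    have eq: "s' ''m'' 0 = m" "s' ''N'' 0 = ?N" "s' ''W'' 0 = R ^ m" "s' ''L'' 0 = rep_bits m"
      "s' ''P2'' = s1 ''P2''" "s' ''G1'' = ?g1" "s' ''G2'' = ?g2" "s' ''G3'' = ?g3" "s' ''rnd'' = bits_of bs"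
      using k S s1 Srnd[OF bs] by simp_all
    have tb: "the_bits s' l = bits_of bs (i * rep_bits m + l)" for l
      by (simp add: the_bits_def eq 5(2))
    have cong: "rep_value m ?g1 ?g2 ?g3 (the_bits s') =
        rep_value m ?g1 ?g2 ?g3 (bits_of (take (rep_bits m) (drop (i * rep_bits m) bs)))"
    proof (rule rep_value_cong)
      fix l assume l: "l < rep_bits m"
      have "i * rep_bits m + l < Suc i * rep_bits m" using l by simp
      also have "\<dots> \<le> B" unfolding B_def using 5(1) by (intro mult_right_mono) auto
      finally have il: "i * rep_bits m + l < length bs" using bs by simp
      hence "l < length bs - i * rep_bits m" by linarith
      with il show "the_bits s' l = bits_of (take (rep_bits m) (drop (i * rep_bits m) bs)) l"
        using l by (simp add: tb bits_of_def)
    qed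
    have "wp w rep (rep_steps m)
      (\<lambda>t. t ''out'' 0 = of_bool (s' ''out'' 0 \<noteq> 0 \<or>
         code (rep_value m (s' ''G1'') (s' ''G2'') (s' ''G3'') (the_bits s')) \<noteq> code 0)) s'"
    proof (rule wp_rep[of s', OF eq(1,2,3) m0 fits])
      show "the_bits s' l \<le> 1" for l unfolding tb by (rule bits_of_le)
      show "s' ''P2'' l = 2 ^ l" if "l \<le> ?N" for l using s1(7) that by (simp add: eq)
    qed (simp_all add: eq padded_def)
    thus ?case
    proof (rule wp_conseq[OF _ order_refl], goal_cases)
      case (1 t)
      have ac: "code (rep_value m (s' ''G1'') (s' ''G2'') (s' ''G3'') (the_bits s')) \<noteq> code 0 \<longleftrightarrow>
          accepts m ?g1 ?g2 ?g3 (take (rep_bits m) (drop (i * rep_bits m) bs))"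
        unfolding eq cong accepts_def ..
      show ?case using 1(3) 5(5) unfolding ac by (auto simp: less_Suc_eq)
    qed
  qed (use w in simp_all)
  have "run (m1 + 1 + m2) (SEQ prologue flip_loop) s = map_pmf (\<lambda>bs. (SKIP, ?S bs, t1 + 1 + T)) ?D"
    by (rule run_return_SEQ[OF 1(1) 2(2)])
  from run_SEQ_wp[OF this, of w "for_loop ''j'' (var ''M'') rep" "(reps m + 1) * (rep_steps m + 5)" ?Q]
  obtain mm f where f: "run mm program s = map_pmf f ?D"
    "\<forall>bs\<in>set_pmf ?D. \<exists>s' t. f bs = (SKIP, s', t) \<and>
       t \<le> t1 + 1 + T + 1 + (reps m + 1) * (rep_steps m + 5) * step_cost (for_loop ''j'' (var ''M'') rep) * w \<and> ?Q bs s'"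
    unfolding program_def using fin set wp bS w1 by auto
  show ?thesis
  proof (intro exI[of _ mm] exI[of _ f] conjI allI impI)
    show "run mm program s = map_pmf f ?D" by (rule f(1))
    fix bs :: "bool list" assume "length bs = B"
    hence "bs \<in> set_pmf ?D" using set by simp
    with f(2) obtain s' t where *: "f bs = (SKIP, s', t)"
       "t \<le> t1 + 1 + T + 1 + (reps m + 1) * (rep_steps m + 5) * step_cost (for_loop ''j'' (var ''M'') rep) * w" "?Q bs s'"
      by blast
    have "t \<le> 70 * (?N + m + length L1 + length L2 + length L3 + 1) * step_cost prologue * w + 1
         + (B + 2) * (40 * w) + 1 + ((reps m + 1) * (rep_steps m + 5)) * step_cost (for_loop ''j'' (var ''M'') rep) * w"
      using *(2) 1(2) 2(1) by linarith
    with * show "\<exists>s' t. f bs = (SKIP, s', t) \<and>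
       t \<le> 70 * (?N + m + length L1 + length L2 + length L3 + 1) * step_cost prologue * w + 1
         + (B + 2) * (40 * w) + 1 + ((reps m + 1) * (rep_steps m + 5)) * step_cost (for_loop ''j'' (var ''M'') rep) * w \<and> ?Q bs s'"
      by blast
  qed
qed

end

section \<open>Correctness\<close>

text \<open>The digits that the shuffle reads have radices \<open>l\<close>, \<open>l - 1\<close>,
  down to 1, and the product of these is the factorial.\<close>

lemma shuffle_mod_fact: "shuffle l (u mod fact l) p = shuffle l u p"
proof (induction l arbitrary: u p)
  case (Suc l)
  have 1: "u mod fact (Suc l) mod Suc l = u mod Suc l"
    by (rule mod_mod_cancel) (simp only: fact_Suc of_nat_id dvd_triv_left)
  have "u mod (Suc l * fact l) = Suc l * (u div Suc l mod fact l) + u mod Suc l" by (rule mod_mult2_eq)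
  hence 2: "u mod fact (Suc l) div Suc l = u div Suc l mod fact l"
    unfolding fact_Suc of_nat_id by (metis add.commute div_mult_self2 div_less mod_less_divisor zero_less_Suc add_0 nat.distinct(1))
  show ?case unfolding shuffle.simps 1 2 Suc ..
qed simp

lemma digits_exist:
  assumes "\<And>t. t < m \<Longrightarrow> d t < R"
  shows "\<exists>v<R ^ m. \<forall>t<m. digit R v t = d t"
  using assms
proof (induction m arbitrary: d)
  case (Suc m)
  obtain v where v: "v < R ^ m" "\<And>t. t < m \<Longrightarrow> digit R v t = d (Suc t)"
    using Suc.IH[of "\<lambda>t. d (Suc t)"] Suc.prems by auto
  have d0: "d 0 < R" using Suc.prems by simp
  have "d 0 + v * R < Suc v * R" using d0 by simp
  also have "\<dots> \<le> R ^ m * R" using v(1) by (intro mult_right_mono) auto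
  finally have "d 0 + v * R < R ^ Suc m" by (simp add: mult.commute)
  moreover have "digit R (d 0 + v * R) t = d t" if "t < Suc m" for t
    using that v(2) by (cases t) (simp_all add: digit_push_0[OF d0] digit_push_Suc[OF d0])
  ultimately show ?case by blast
qed simp

section \<open>Seeds as bit strings, candidates as sets\<close>

primrec to_bits :: "nat \<Rightarrow> nat \<Rightarrow> bool list" where
  "to_bits 0 u = []"
| "to_bits (Suc n) u = to_bits n (u div 2) @ [odd u]"

lemma length_to_bits [simp]: "length (to_bits n u) = n"
  by (induction n arbitrary: u) auto

lemma finite_bool_lists [simp]: "finite {bs :: bool list. length bs = n}"
  using finite_lists_length_eq[of "UNIV :: bool set" n] by simp

lemma card_bool_lists: "card {bs :: bool list. length bs = n} = 2 ^ n"
  using card_lists_length_eq[of "UNIV :: bool set" n] by simp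

lemma fact_le_two_power: "fact n \<le> (2::nat) ^ (n * n)"
proof -
  have "fact n \<le> n ^ n" using fact_le_power[of n, where 'a = nat] by simp
  also have "\<dots> \<le> (2 ^ n) ^ n" by (rule power_mono[OF less_imp_le[OF less_exp]]) simp
  finally show ?thesis by (simp add: power_mult)
qed

text \<open>The bias of reduction modulo \<open>f\<close>: every residue is hit at least
  \<open>X div f\<close> times, which is at least half of the fair share \<open>X / f\<close>
  because \<open>f\<close> is at most \<open>X\<close>.\<close>

lemma card_residues_ge:
  fixes U :: "nat set"
  assumes U: "U \<subseteq> {..<f}" and f: "0 < f" "f \<le> X"
  shows "X * card U \<le> 2 * f * card {u. u < X \<and> u mod f \<in> U}"
proof -
  have finU: "finite U" by (rule finite_subset[OF U]) simp
  have "card (U \<times> {..<X div f}) \<le> card {u. u < X \<and> u mod f \<in> U}"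
  proof (rule card_inj_on_le[where f = "\<lambda>(x, q). x + q * f"])
    show "inj_on (\<lambda>(x, q). x + q * f) (U \<times> {..<X div f})"
    proof (rule inj_onI, clarify)
      fix x q x' q' assume *: "x \<in> U" "x' \<in> U" "x + q * f = x' + q' * f"
      have lt: "x < f" "x' < f" using * U by auto
      have "(x + q * f) mod f = x" "(x' + q' * f) mod f = x'" using lt by simp_all
      with *(3) have "x = x'" by simp
      with *(3) f(1) show "x = x' \<and> q = q'" by simp
    qed
    show "(\<lambda>(x, q). x + q * f) ` (U \<times> {..<X div f}) \<subseteq> {u. u < X \<and> u mod f \<in> U}"
    proof (rule image_subsetI)
      fix z assume "z \<in> U \<times> {..<X div f}"
      then obtain x q where *: "x \<in> U" "q \<in> {..<X div f}" and z: "z = (x, q)" by blast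
      have lt: "x < f" using * U by auto
      have "x + q * f < Suc q * f" using lt by simp
      also have "\<dots> \<le> X div f * f" using *(2) by (intro mult_right_mono) auto
      also have "\<dots> \<le> X" by simp
      finally show "(case z of (x, q) \<Rightarrow> x + q * f) \<in> {u. u < X \<and> u mod f \<in> U}"
        using lt *(1) by (simp add: z)
    qed
  qed simp
  hence 1: "card U * (X div f) \<le> card {u. u < X \<and> u mod f \<in> U}"
    by (simp add: card_cartesian_product)
  have "X \<le> 2 * f * (X div f)"
  proof -
    have q: "1 \<le> X div f" using f by (simp add: Suc_leI div_greater_zero_iff)
    have "X = X div f * f + X mod f" by simp
    moreover have "X mod f < f" using f(1) by simp
    moreover have "f \<le> X div f * f" using q by simp
    ultimately have "X \<le> 2 * (X div f * f)" by linarith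
    thus ?thesis by (simp add: mult_ac)
  qed
  hence "X * card U \<le> 2 * f * (X div f) * card U" by (rule mult_right_mono) simp
  also have "\<dots> = 2 * f * (card U * (X div f))" by (simp only: mult_ac)
  also have "\<dots> \<le> 2 * f * card {u. u < X \<and> u mod f \<in> U}" using 1 by (rule mult_left_mono) simp
  finally show ?thesis .
qed

context tripartition_algorithm
begin

lemma bits_value_to_bits: "u < 2 ^ n \<Longrightarrow> bits_value (bits_of (to_bits n u @ zs)) n = u"
proof (induction n arbitrary: u zs)
  case (Suc n)
  have "u div 2 < 2 ^ n" using Suc.prems by (simp add: less_mult_imp_div_less mult.commute)
  from Suc.IH[OF this, of "odd u # zs"]
  have "bits_value (bits_of (to_bits (Suc n) u @ zs)) n = u div 2" by simp
  moreover have "bits_of (to_bits (Suc n) u @ zs) n = u mod 2"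
    by (simp add: bits_of_def nth_append mod2_eq_if)
  ultimately show ?case by simp
qed simp

lemma card_bits_value_ge:
  assumes "W \<subseteq> {..<2 ^ n}"
  shows "card W * 2 ^ l \<le> card {xs. length xs = n + l \<and> bits_value (bits_of xs) n \<in> W}"
proof -
  have finW: "finite W" by (rule finite_subset[OF assms]) simp
  have "card (W \<times> {zs :: bool list. length zs = l}) \<le> card {xs. length xs = n + l \<and> bits_value (bits_of xs) n \<in> W}"
  proof (rule card_inj_on_le[where f = "\<lambda>(u, zs). to_bits n u @ zs"])
    show "inj_on (\<lambda>(u, zs). to_bits n u @ zs) (W \<times> {zs. length zs = l})"
    proof (rule inj_onI, clarify)
      fix u zs u' zs' assume *: "u \<in> W" "u' \<in> W" "to_bits n u @ zs = to_bits n u' @ zs'"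
      have lt: "u < 2 ^ n" "u' < 2 ^ n" using * assms by auto
      from *(3) have "zs = zs'" by (simp add: append_eq_append_conv)
      moreover have "u = u'"
        using bits_value_to_bits[OF lt(1), of zs] bits_value_to_bits[OF lt(2), of zs'] *(3) by simp
      ultimately show "u = u' \<and> zs = zs'" by simp
    qed
    show "(\<lambda>(u, zs). to_bits n u @ zs) ` (W \<times> {zs. length zs = l}) \<subseteq> {xs. length xs = n + l \<and> bits_value (bits_of xs) n \<in> W}"
      using assms by (auto simp: bits_value_to_bits subset_iff)
    show "finite {xs :: bool list. length xs = n + l \<and> bits_value (bits_of xs) n \<in> W}"
      by (rule finite_subset[OF _ finite_bool_lists[of "n + l"]]) blast
  qed
  thus ?thesis by (simp add: card_cartesian_product card_bool_lists)
qed

definition slots :: "nat \<Rightarrow> nat \<Rightarrow> nat set" where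
  "slots m v = {i. i < 3 * (c * m) \<and> E (digit R v (i div (3 * c))) (i mod (3 * c))}"

lemma mask_eq_sum: "mask m p v = sum p (slots m v)"
proof -
  have "mask m p v = (\<Sum>t<m. \<Sum>e<3 * c. (\<lambda>i. of_bool (E (digit R v (i div (3 * c))) (i mod (3 * c))) * p i) (e + t * (3 * c)))"
    unfolding mask_def by (intro sum.cong refl) (simp add: add.commute)
  also have "\<dots> = (\<Sum>i<m * (3 * c). of_bool (E (digit R v (i div (3 * c))) (i mod (3 * c))) * p i)"
    using c_pos by (intro sum_lessThan_mult[symmetric]) simp
  also have "m * (3 * c) = 3 * (c * m)" by simp
  also have "(\<Sum>i<3 * (c * m). of_bool (E (digit R v (i div (3 * c))) (i mod (3 * c))) * p i) =
      (\<Sum>i<3 * (c * m). if i \<in> slots m v then p i else 0)"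
    by (intro sum.cong refl) (simp add: slots_def)
  also have "\<dots> = sum p ({..<3 * (c * m)} \<inter> slots m v)" by (rule sum.inter_restrict[symmetric]) simp
  also have "{..<3 * (c * m)} \<inter> slots m v = slots m v" by (auto simp: slots_def)
  finally show ?thesis .
qed

definition permutation :: "nat \<Rightarrow> (nat \<Rightarrow> nat) \<Rightarrow> nat \<Rightarrow> nat" where
  "permutation m \<beta> = shuffle (3 * (c * m)) (bits_value \<beta> (3 * (c * m) * (3 * (c * m)))) id"

lemma bij_permutation: "bij_betw (permutation m \<beta>) {..<3 * (c * m)} {..<3 * (c * m)}"
  unfolding permutation_def by (rule bij_betw_shuffle)

definition candidate_set :: "nat \<Rightarrow> (nat \<Rightarrow> nat) \<Rightarrow> nat \<Rightarrow> nat set" where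
  "candidate_set m \<beta> v = (\<lambda>i. Suc (permutation m \<beta> i)) ` slots m v"

lemma finite_slots: "finite (slots m v)"
  by (rule finite_subset[of _ "{..<3 * (c * m)}"]) (auto simp: slots_def)

text \<open>A permutation is injective, so distinct slots contribute distinct powers of two and the
  sum has no carries.\<close>

lemma mask_slot_power: "mask m (slot_power m \<beta>) v = set_encode (candidate_set m \<beta> v)"
proof -
  have "inj_on (permutation m \<beta>) {..<3 * (c * m)}" using bij_permutation by (rule bij_betw_imp_inj_on)
  hence inj: "inj_on (\<lambda>i. Suc (permutation m \<beta> i)) (slots m v)"
    by (auto simp: inj_on_def slots_def)
  have "mask m (slot_power m \<beta>) v = (\<Sum>i\<in>slots m v. 2 ^ Suc (permutation m \<beta> i))"
    unfolding mask_eq_sum slot_power_def permutation_def ..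
  also have "\<dots> = set_encode (candidate_set m \<beta> v)"
    unfolding set_encode_def candidate_set_def sum.reindex[OF inj] o_def ..
  finally show ?thesis .
qed

lemma sum_two_power_interval: "(\<Sum>i=a..<b. 2 ^ i) = 2 ^ b - (2 :: nat) ^ a" if "a \<le> b"
  using that
proof (induction b rule: dec_induct)
  case (step b)
  have "(2::nat) ^ a \<le> 2 ^ b" using step(1) by (intro power_increasing) auto
  with step show ?case by simp
qed simp

definition dummy_set :: "nat \<Rightarrow> nat \<Rightarrow> nat \<Rightarrow> nat set" where
  "dummy_set m n g = {offset m n g..<offset m n (Suc g)}"

text \<open>Addressing by masks confuses no two sets because \<open>set_encode\<close> is injective
  on finite sets; adding the mask of the dummies is a disjoint union because they lie above
  \<open>3 * n\<close>.\<close>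

lemma padded_set_encode:
  assumes "set L \<subseteq> nsets {1..3 * n} n" "finite Z"
  shows "padded m n g L (set_encode Z) = of_bool (\<exists>S\<in>set L. Z = S \<union> dummy_set m n g)"
proof -
  have off: "offset m n g \<le> offset m n (Suc g)" "3 * n < offset m n g" by (simp_all add: offset_def)
  have "set_encode S + dummies m n g = set_encode (S \<union> dummy_set m n g)"
    and "finite (S \<union> dummy_set m n g)" if "S \<in> set L" for S
  proof -
    have S: "S \<subseteq> {1..3 * n}" "finite S" using assms(1) that by (auto simp: nsets_def)
    show "finite (S \<union> dummy_set m n g)" using S by (simp add: dummy_set_def)
    have "S \<inter> dummy_set m n g = {}" using S(1) off(2) unfolding dummy_set_def by fastforce
    thus "set_encode S + dummies m n g = set_encode (S \<union> dummy_set m n g)"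
      unfolding set_encode_def dummies_def sum_two_power_interval[OF off(1), symmetric]
      using S(2) by (subst sum.union_disjoint) (simp_all add: dummy_set_def)
  qed
  thus ?thesis unfolding padded_def using inj_on_eq_iff[OF inj_on_set_encode] assms(2)
    by (intro arg_cong[of _ _ of_bool]) (metis mem_Collect_eq)
qed

end

text \<open>Digits below \<open>N1\<close> number the indices of the \<open>r\<close>-th Kronecker
  power; the digits from \<open>N1\<close> up to \<open>R\<close> are filling on which the tensor is
  zero. \<open>surj\<close> says that each set of slots with exactly \<open>k\<close> elements in
  every subblock of \<open>3 * k\<close> slots is the set of some digit.\<close>

locale tripartition_tensor_algorithm = tripartition_algorithm +
  fixes k r N1 :: nat
  assumes k_pos: "k > 0" and r_pos: "r > 0" and c_eq: "c = k * r"
    and pc_eq: "pc = 27 ^ c" and qc_eq: "qc = ((3 * k choose k) * (2 * k choose k)) ^ r"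
    and code_one: "code 1 \<noteq> code 0"
    and N1_le: "N1 \<le> R"
    and tensor: "\<lbrakk>i < R; j < R; l < R\<rbrakk> \<Longrightarrow> (\<Sum>q<R. ca q i * cb q j * cc q l) =
      of_bool (i < N1 \<and> j < N1 \<and> l < N1 \<and> (\<forall>e<3 * c. E i e \<or> E j e \<or> E l e))"
    and surj: "\<lbrakk>\<And>\<rho>. \<rho> < r \<Longrightarrow> card {i. i < 3 * k \<and> B (\<rho> * (3 * k) + i)} = k\<rbrakk> \<Longrightarrow>
      \<exists>d<N1. \<forall>e<3 * c. E d e \<longleftrightarrow> B e"
begin

section \<open>Soundness\<close>

definition covers :: "nat \<Rightarrow> nat \<Rightarrow> nat \<Rightarrow> nat \<Rightarrow> bool" where
  "covers m v1 v2 v3 \<longleftrightarrow> (\<forall>t<m. digit R v1 t < N1 \<and> digit R v2 t < N1 \<and> digit R v3 t < N1 \<and>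
     (\<forall>e<3 * c. E (digit R v1 t) e \<or> E (digit R v2 t) e \<or> E (digit R v3 t) e))"

lemma rep_value_trilinear:
  "rep_value m g1 g2 g3 \<beta> = trilinear (R ^ m) (\<lambda>v1 v2 v3. of_bool (covers m v1 v2 v3))
     (chosen m (slot_power m \<beta>) g1 \<beta> 0) (chosen m (slot_power m \<beta>) g2 \<beta> 1) (chosen m (slot_power m \<beta>) g3 \<beta> 2)"
proof -
  have "(\<Prod>t<m. \<Sum>q<R. ca q (digit R v1 t) * cb q (digit R v2 t) * cc q (digit R v3 t)) = of_bool (covers m v1 v2 v3)"
    for v1 v2 v3
  proof -
    have "(\<Prod>t<m. \<Sum>q<R. ca q (digit R v1 t) * cb q (digit R v2 t) * cc q (digit R v3 t)) =
        (\<Prod>t<m. of_bool (digit R v1 t < N1 \<and> digit R v2 t < N1 \<and> digit R v3 t < N1 \<and>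
           (\<forall>e<3 * c. E (digit R v1 t) e \<or> E (digit R v2 t) e \<or> E (digit R v3 t) e)))"
      by (intro prod.cong refl tensor) (simp_all add: digit_less R_pos)
    also have "\<dots> = of_bool (covers m v1 v2 v3)"
      unfolding covers_def by (induction m) (auto simp: less_Suc_eq)
    finally show ?thesis .
  qed
  thus ?thesis unfolding rep_value_def yates_trilinear[OF R_pos] by (simp only:)
qed

lemma covers_slots:
  assumes "covers m v1 v2 v3"
  shows "slots m v1 \<union> slots m v2 \<union> slots m v3 = {..<3 * (c * m)}"
proof (intro equalityI subsetI)
  fix i assume i: "i \<in> {..<3 * (c * m)}"
  have "i div (3 * c) < m" using i by (intro less_mult_imp_div_less) (simp add: mult_ac)
  moreover have "i mod (3 * c) < 3 * c" using c_pos by simp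
  ultimately show "i \<in> slots m v1 \<union> slots m v2 \<union> slots m v3"
    using assms i unfolding covers_def slots_def by auto
qed (auto simp: slots_def)

lemma covers_candidate_sets:
  assumes "covers m v1 v2 v3"
  shows "candidate_set m \<beta> v1 \<union> candidate_set m \<beta> v2 \<union> candidate_set m \<beta> v3 = {1..3 * (c * m)}"
proof -
  have "candidate_set m \<beta> v1 \<union> candidate_set m \<beta> v2 \<union> candidate_set m \<beta> v3 =
      Suc ` permutation m \<beta> ` (slots m v1 \<union> slots m v2 \<union> slots m v3)"
    unfolding candidate_set_def by (simp only: image_Un image_image)
  also have "permutation m \<beta> ` (slots m v1 \<union> slots m v2 \<union> slots m v3) = {..<3 * (c * m)}"
    unfolding covers_slots[OF assms] by (rule bij_betw_imp_surj_on[OF bij_permutation])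
  also have "Suc ` {..<3 * (c * m)} = {1..3 * (c * m)}"
    by (simp add: lessThan_atLeast0 atLeastLessThanSuc_atLeastAtMost)
  finally show ?thesis .
qed

text \<open>The error is one-sided: a nonzero value needs a nonzero term, that is, three members
  whose padded versions cover the padded universe. Dummies lie outside the original universe, so the
  members themselves cover it.\<close>

lemma accepts_sound:
  assumes L: "set L1 \<subseteq> nsets {1..3 * n} n" "set L2 \<subseteq> nsets {1..3 * n} n" "set L3 \<subseteq> nsets {1..3 * n} n"
    and n: "n \<le> c * m"
    and acc: "accepts m (padded m n 0 L1) (padded m n 1 L2) (padded m n 2 L3) bs"
  shows "balanced_tripartition n (set L1) (set L2) (set L3)"
proof -
  let ?\<beta> = "bits_of bs"
  let ?ch = "\<lambda>g L. chosen m (slot_power m ?\<beta>) (padded m n g L) ?\<beta> g"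
  have "rep_value m (padded m n 0 L1) (padded m n 1 L2) (padded m n 2 L3) ?\<beta> \<noteq> 0"
    using acc unfolding accepts_def by auto
  hence "\<exists>v1 v2 v3. of_bool (covers m v1 v2 v3) * (?ch 0 L1 v1 * ?ch 1 L2 v2 * ?ch 2 L3 v3) \<noteq> (0 :: 'a)"
    unfolding rep_value_trilinear trilinear_def by (metis (no_types, lifting) sum.neutral)
  then obtain v1 v2 v3 where cov: "covers m v1 v2 v3"
    and ch: "?ch 0 L1 v1 \<noteq> 0" "?ch 1 L2 v2 \<noteq> 0" "?ch 2 L3 v3 \<noteq> 0" by auto
  have ex: "\<exists>S\<in>set L. candidate_set m ?\<beta> v = S \<union> dummy_set m n g"
    if "?ch g L v \<noteq> 0" "set L \<subseteq> nsets {1..3 * n} n" for g L v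
  proof -
    have "padded m n g L (set_encode (candidate_set m ?\<beta> v)) \<noteq> 0"
      using that(1) unfolding chosen_def mask_slot_power by (cases "padded m n g L (set_encode (candidate_set m ?\<beta> v)) = 0") auto
    moreover have "finite (candidate_set m ?\<beta> v)" unfolding candidate_set_def using finite_slots by simp
    ultimately show ?thesis using padded_set_encode[OF that(2)] by auto
  qed
  obtain S1 S2 S3 where S: "S1 \<in> set L1" "candidate_set m ?\<beta> v1 = S1 \<union> dummy_set m n 0"
    "S2 \<in> set L2" "candidate_set m ?\<beta> v2 = S2 \<union> dummy_set m n 1"
    "S3 \<in> set L3" "candidate_set m ?\<beta> v3 = S3 \<union> dummy_set m n 2"
    using ex[OF ch(1) L(1)] ex[OF ch(2) L(2)] ex[OF ch(3) L(3)] by blast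
  have un: "(S1 \<union> dummy_set m n 0) \<union> (S2 \<union> dummy_set m n 1) \<union> (S3 \<union> dummy_set m n 2) = {1..3 * (c * m)}"
    using covers_candidate_sets[OF cov, of ?\<beta>] unfolding S .
  have dum: "dummy_set m n g \<inter> {1..3 * n} = {}" for g
    unfolding dummy_set_def offset_def by auto
  have sub: "S1 \<subseteq> {1..3 * n}" "S2 \<subseteq> {1..3 * n}" "S3 \<subseteq> {1..3 * n}"
    using S(1,3,5) L by (auto simp: nsets_def)
  have "{1..3 * n} \<subseteq> {1..3 * (c * m)}" using n by auto
  hence "S1 \<union> S2 \<union> S3 = {1..3 * n}" using un dum sub by blast
  thus ?thesis unfolding balanced_tripartition_def using S by blast
qed

end

section \<open>Completeness: a balanced split is seen by some candidates\<close>

context tripartition_tensor_algorithm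
begin

definition letter :: "nat set \<Rightarrow> nat set \<Rightarrow> nat \<Rightarrow> nat" where
  "letter Z1 Z2 e = (if Suc e \<in> Z1 then 0 else if Suc e \<in> Z2 then 1 else 2)"

lemma letter_class:
  fixes Z :: "nat \<Rightarrow> nat set"
  assumes Z: "Z 0 \<union> Z 1 \<union> Z 2 = {1..N}" "Z 0 \<inter> Z 1 = {}" "Z 0 \<inter> Z 2 = {}" "Z 1 \<inter> Z 2 = {}"
    and x: "x < 3"
  shows "Suc ` {e. e < N \<and> letter (Z 0) (Z 1) e = x} = Z x"
proof (intro equalityI subsetI)
  fix y assume "y \<in> Suc ` {e. e < N \<and> letter (Z 0) (Z 1) e = x}"
  then obtain e where e: "y = Suc e" "e < N" "letter (Z 0) (Z 1) e = x" by blast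
  have "Suc e \<in> Z 0 \<union> Z 1 \<union> Z 2" unfolding Z(1) using e(2) by simp
  with e(1,3) show "y \<in> Z x" unfolding letter_def by (auto split: if_splits simp: numeral_2_eq_2)
next
  fix y assume y: "y \<in> Z x"
  have x3: "x = 0 \<or> x = 1 \<or> x = 2" using x by linarith
  hence "y \<in> Z 0 \<union> Z 1 \<union> Z 2" using y by auto
  hence "y \<in> {1..N}" unfolding Z(1) .
  then obtain e where e: "y = Suc e" "e < N" by (cases y) auto
  have "letter (Z 0) (Z 1) e = x" using x3 y Z(2-4) unfolding letter_def e(1) by auto
  with e show "y \<in> Suc ` {e. e < N \<and> letter (Z 0) (Z 1) e = x}" by blast
qed

text \<open>A digit is responsible for \<open>r\<close> consecutive subblocks of
  \<open>3 * k\<close> slots. Each digit is found by \<open>surj\<close>, and the digits are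
  assembled into one number.\<close>

lemma slots_realize:
  assumes blocks: "\<And>\<beta>. \<beta> < m * r \<Longrightarrow> card {i. i < 3 * k \<and> B (\<beta> * (3 * k) + i)} = k"
  shows "\<exists>v<R ^ m. slots m v = {i. i < 3 * (c * m) \<and> B i} \<and> (\<forall>t<m. digit R v t < N1)"
proof -
  have "\<exists>d<N1. \<forall>e<3 * c. E d e \<longleftrightarrow> B (t * (3 * c) + e)" if t: "t < m" for t
  proof (rule surj)
    fix \<rho> assume \<rho>: "\<rho> < r"
    have "t * r + \<rho> < Suc t * r" using \<rho> by simp
    also have "\<dots> \<le> m * r" using t by (intro mult_right_mono) auto
    finally have "t * r + \<rho> < m * r" .
    from blocks[OF this] show "card {i. i < 3 * k \<and> B (t * (3 * c) + (\<rho> * (3 * k) + i))} = k"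
      by (simp add: c_eq algebra_simps)
  qed
  then obtain d where d: "\<And>t. t < m \<Longrightarrow> d t < N1" "\<And>t e. t < m \<Longrightarrow> e < 3 * c \<Longrightarrow> E (d t) e \<longleftrightarrow> B (t * (3 * c) + e)"
    by metis
  have "d t < R" if "t < m" for t using d(1)[OF that] N1_le by simp
  from digits_exist[of m d R, OF this] obtain v where v: "v < R ^ m" "\<And>t. t < m \<Longrightarrow> digit R v t = d t" by blast
  have "slots m v = {i. i < 3 * (c * m) \<and> B i}"
    unfolding slots_def
  proof (rule Collect_cong, rule conj_cong[OF refl])
    fix i assume i: "i < 3 * (c * m)"
    have t: "i div (3 * c) < m" using i by (intro less_mult_imp_div_less) (simp add: mult_ac)
    have e: "i mod (3 * c) < 3 * c" using c_pos by simp
    show "E (digit R v (i div (3 * c))) (i mod (3 * c)) \<longleftrightarrow> B i"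
      unfolding v(2)[OF t] d(2)[OF t e] by (simp only: div_mult_mod_eq)
  qed
  moreover have "\<forall>t<m. digit R v t < N1" using v(2) d(1) by simp
  ultimately show ?thesis using v(1) by blast
qed

text \<open>Pulled back along the permutation, the part \<open>Z x\<close> becomes the set of slots
  with letter \<open>x\<close>. Balance gives it \<open>k\<close> slots in each subblock, which is
  what \<open>slots_realize\<close> asks for.\<close>

lemma balanced_permutation_realizes:
  fixes Z :: "nat \<Rightarrow> nat set"
  assumes Z: "Z 0 \<union> Z 1 \<union> Z 2 = {1..3 * (c * m)}" "Z 0 \<inter> Z 1 = {}" "Z 0 \<inter> Z 2 = {}" "Z 1 \<inter> Z 2 = {}"
    and bal: "map (letter (Z 0) (Z 1) \<circ> permutation m \<beta>) [0..<3 * (c * m)] \<in> balanced_words k (m * r)"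
  shows "\<exists>v. (\<forall>x<3. v x < R ^ m \<and> candidate_set m \<beta> (v x) = Z x) \<and> covers m (v 0) (v 1) (v 2)"
proof -
  let ?N = "3 * (c * m)"
  let ?w = "letter (Z 0) (Z 1)"
  let ?B = "\<lambda>x i. ?w (permutation m \<beta> i) = x"
  have N: "?N = m * r * (3 * k)" by (simp add: c_eq mult_ac)
  have blk: "card {i. i < 3 * k \<and> ?B x (b * (3 * k) + i)} = k" if b: "b < m * r" and x: "x < 3" for x b
  proof -
    have "{i. i < 3 * k \<and> ?B x (b * (3 * k) + i)} =
        {i. i < 3 * k \<and> map (?w \<circ> permutation m \<beta>) [0..<?N] ! (b * (3 * k) + i) = x}"
    proof (rule Collect_cong, rule conj_cong[OF refl])
      fix i assume i: "i < 3 * k"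
      have "b * (3 * k) + i < Suc b * (3 * k)" using i by simp
      also have "\<dots> \<le> ?N" unfolding N using b by (intro mult_right_mono) auto
      finally have "b * (3 * k) + i < ?N" .
      thus "?B x (b * (3 * k) + i) \<longleftrightarrow> map (?w \<circ> permutation m \<beta>) [0..<?N] ! (b * (3 * k) + i) = x"
        by simp
    qed
    thus ?thesis using balanced_word_block[OF bal b x] by simp
  qed
  have "\<exists>v<R ^ m. slots m v = {i. i < ?N \<and> ?B x i} \<and> (\<forall>t<m. digit R v t < N1)" if "x < 3" for x
    by (rule slots_realize) (rule blk[OF _ that])
  hence "\<forall>x\<in>{..<3}. \<exists>v. v < R ^ m \<and> slots m v = {i. i < ?N \<and> ?B x i} \<and> (\<forall>t<m. digit R v t < N1)" by simp
  from bchoice[OF this] obtain v where v': "\<forall>x\<in>{..<3}. v x < R ^ m \<and> slots m (v x) = {i. i < ?N \<and> ?B x i} \<and>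
      (\<forall>t<m. digit R (v x) t < N1)" by (elim exE)
  have v: "\<And>x. x < 3 \<Longrightarrow> v x < R ^ m" "\<And>x. x < 3 \<Longrightarrow> slots m (v x) = {i. i < ?N \<and> ?B x i}"
    "\<And>x t. x < 3 \<Longrightarrow> t < m \<Longrightarrow> digit R (v x) t < N1" using v' by simp_all
  have "candidate_set m \<beta> (v x) = Z x" if x: "x < 3" for x
  proof -
    have 1: "candidate_set m \<beta> (v x) = Suc ` (permutation m \<beta> ` {i. i < ?N \<and> ?B x i})"
      unfolding candidate_set_def v(2)[OF x] image_image ..
    have 2: "permutation m \<beta> ` {i. i < ?N \<and> ?B x i} = {e. e < ?N \<and> ?w e = x}"
    proof (intro equalityI subsetI)
      fix e assume "e \<in> permutation m \<beta> ` {i. i < ?N \<and> ?B x i}"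
      thus "e \<in> {e. e < ?N \<and> ?w e = x}" using bij_betwE[OF bij_permutation[of m \<beta>]] by auto
    next
      fix e assume e: "e \<in> {e. e < ?N \<and> ?w e = x}"
      hence "e \<in> permutation m \<beta> ` {..<?N}" using bij_betw_imp_surj_on[OF bij_permutation[of m \<beta>]] by simp
      with e show "e \<in> permutation m \<beta> ` {i. i < ?N \<and> ?B x i}" by auto
    qed
    have 3: "Suc ` {e. e < ?N \<and> ?w e = x} = Z x" by (rule letter_class[OF Z x])
    show ?thesis unfolding 1 2 3 ..
  qed
  moreover have "covers m (v 0) (v 1) (v 2)"
    unfolding covers_def
  proof (intro allI impI conjI)
    fix t assume t: "t < m"
    show "digit R (v 0) t < N1" "digit R (v 1) t < N1" "digit R (v 2) t < N1" using v(3) t by simp_all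
    fix e assume e: "e < 3 * c"
    let ?i = "t * (3 * c) + e"
    have i: "?i < ?N" by (rule slot_less[OF t e])
    have d: "?i div (3 * c) = t" "?i mod (3 * c) = e" using e by simp_all
    have "?w (permutation m \<beta> ?i) \<in> {0, 1, 2}" unfolding letter_def by simp
    hence "?i \<in> slots m (v 0) \<or> ?i \<in> slots m (v 1) \<or> ?i \<in> slots m (v 2)" using v(2) i by auto
    thus "E (digit R (v 0) t) e \<or> E (digit R (v 1) t) e \<or> E (digit R (v 2) t) e"
      unfolding slots_def mem_Collect_eq d by blast
  qed
  ultimately show ?thesis using v(1) by blast
qed

text \<open>Codes respect sums and products, so a difference is treated as a sum with the product by
  \<open>- 1\<close>.\<close>

lemma code_kernel:
  "x \<in> A \<Longrightarrow> y \<in> A \<Longrightarrow> code x = code 0 \<Longrightarrow> code y = code 0 \<Longrightarrow> code (x + y) = code 0"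
  "x \<in> A \<Longrightarrow> y \<in> A \<Longrightarrow> code x = code 0 \<Longrightarrow> code y = code 0 \<Longrightarrow> code (x - y) = code 0"
proof -
  note z = subring_of_zero[OF A] and o = subring_of_one[OF A]
  have add: "code (x + y) = code 0" if "x \<in> A" "y \<in> A" "code x = code 0" "code y = code 0" for x y
    using code_add[OF that(1,2)] code_add[OF z z] that by simp
  show "x \<in> A \<Longrightarrow> y \<in> A \<Longrightarrow> code x = code 0 \<Longrightarrow> code y = code 0 \<Longrightarrow> code (x + y) = code 0"
    by (rule add)
  assume *: "x \<in> A" "y \<in> A" "code x = code 0" "code y = code 0"
  have m: "- 1 \<in> A" using subring_of_uminus[OF A o] .
  have "code (- 1 * y) = code 0" using code_mul[OF m *(2)] code_mul[OF m z] *(4) by simp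
  from add[OF *(1) _ *(3) this] show "code (x - y) = code 0"
    using subring_of_uminus[OF A *(2)] by simp
qed

lemma trilinear_in_A:
  assumes "\<And>v. x v \<in> A" "\<And>v. y v \<in> A" "\<And>v. z v \<in> A"
  shows "trilinear V (\<lambda>v1 v2 v3. of_bool (covers m v1 v2 v3)) x y z \<in> A"
proof -
  have "of_bool b \<in> A" for b by (cases b) (simp_all add: subring_of_zero[OF A] subring_of_one[OF A])
  thus ?thesis unfolding trilinear_def using assms
    by (intro subring_of_sum[OF A] subring_of_mult[OF A]) auto
qed

definition set3 :: "nat \<Rightarrow> nat \<Rightarrow> nat \<Rightarrow> bool \<times> bool \<times> bool \<Rightarrow> bool list \<Rightarrow> bool list" where
  "set3 a1 a2 a3 b xs = xs[a1 := fst b, a2 := fst (snd b), a3 := snd (snd b)]"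

text \<open>
  Once the permutation is balanced, the three weights of the solution decide: over the eight
  choices of these weights the alternating sum of the values is 1, so one of them is nonzero.
\<close>

lemma accepts_some_weights:
  fixes v :: "nat \<Rightarrow> nat" and Z :: "nat \<Rightarrow> nat set"
  assumes L: "set L1 \<subseteq> nsets {1..3 * n} n" "set L2 \<subseteq> nsets {1..3 * n} n" "set L3 \<subseteq> nsets {1..3 * n} n"
    and Z: "\<exists>S\<in>set L1. Z 0 = S \<union> dummy_set m n 0" "\<exists>S\<in>set L2. Z 1 = S \<union> dummy_set m n 1"
      "\<exists>S\<in>set L3. Z 2 = S \<union> dummy_set m n 2"
    and v: "\<And>x. x < 3 \<Longrightarrow> v x < R ^ m" "\<And>x. x < 3 \<Longrightarrow> candidate_set m (bits_of xs) (v x) = Z x"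
      "covers m (v 0) (v 1) (v 2)"
    and len: "length xs = rep_bits m"
  defines "NN \<equiv> 3 * (c * m) * (3 * (c * m))"
  shows "\<exists>b. accepts m (padded m n 0 L1) (padded m n 1 L2) (padded m n 2 L3)
    (set3 (NN + v 0) (NN + (R ^ m + v 1)) (NN + (2 * R ^ m + v 2)) b xs)"
proof (rule ccontr)
  let ?V = "R ^ m"
  let ?a1 = "NN + v 0" and ?a2 = "NN + (?V + v 1)" and ?a3 = "NN + (2 * ?V + v 2)"
  let ?ys = "\<lambda>b. set3 ?a1 ?a2 ?a3 b xs"
  let ?p = "slot_power m (bits_of xs)"
  let ?S = "\<lambda>v1 v2 v3. of_bool (covers m v1 v2 v3) :: 'a"
  assume "\<not> (\<exists>b. accepts m (padded m n 0 L1) (padded m n 1 L2) (padded m n 2 L3) (?ys b))"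
  hence "\<forall>b. \<not> accepts m (padded m n 0 L1) (padded m n 1 L2) (padded m n 2 L3) (?ys b)"
    by (rule iffD1[OF not_ex])
  hence no: "code (rep_value m (padded m n 0 L1) (padded m n 1 L2) (padded m n 2 L3) (bits_of (?ys b))) = code 0" for b
    unfolding accepts_def not_not by (rule spec)
  have v3: "v 0 < ?V" "v 1 < ?V" "v 2 < ?V" using v(1) by simp_all
  have lt: "?a1 < length xs" "?a2 < length xs" "?a3 < length xs" using v3 unfolding len rep_bits_def NN_def by simp_all
  have same: "bits_of (?ys b) i = bits_of xs i" if "i \<noteq> ?a1" "i \<noteq> ?a2" "i \<noteq> ?a3" for b i
    using that by (simp add: bits_of_def set3_def)
  have p: "slot_power m (bits_of (?ys b)) = ?p" for b
  proof -
    have "bits_value (bits_of (?ys b)) NN = bits_value (bits_of xs) NN"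
      by (rule bits_value_cong) (rule same, simp_all)
    thus ?thesis unfolding slot_power_def NN_def by simp
  qed
  \<comment> \<open>Changing the three weights leaves the seed alone, and each weight enters only
    the vector of its own family. So the eight values come from one trilinear form at two choices
    for each argument, as \<open>trilinear_cube\<close> requires.\<close>
  define X where "X b = chosen m ?p (padded m n 0 L1) (bits_of (?ys (b, False, False))) 0" for b
  define Y where "Y b = chosen m ?p (padded m n 1 L2) (bits_of (?ys (False, b, False))) 1" for b
  define W where "W b = chosen m ?p (padded m n 2 L3) (bits_of (?ys (False, False, b))) 2" for b
  have chX: "chosen m ?p g (bits_of (?ys (b1, b2, b3))) 0 u = chosen m ?p g (bits_of (?ys (b1, False, False))) 0 u"
    if u: "u < ?V" for g b1 b2 b3 u
  proof -
    have "bits_of (?ys (b1, b2, b3)) (NN + (0 * ?V + u)) = bits_of (?ys (b1, False, False)) (NN + (0 * ?V + u))"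
      using u v3 lt by (auto simp: bits_of_def set3_def nth_list_update)
    thus ?thesis unfolding chosen_def NN_def by simp
  qed
  have chY: "chosen m ?p g (bits_of (?ys (b1, b2, b3))) 1 u = chosen m ?p g (bits_of (?ys (False, b2, False))) 1 u"
    if u: "u < ?V" for g b1 b2 b3 u
  proof -
    have "bits_of (?ys (b1, b2, b3)) (NN + (1 * ?V + u)) = bits_of (?ys (False, b2, False)) (NN + (1 * ?V + u))"
      using u v3 lt by (auto simp: bits_of_def set3_def nth_list_update)
    thus ?thesis unfolding chosen_def NN_def by simp
  qed
  have chW: "chosen m ?p g (bits_of (?ys (b1, b2, b3))) 2 u = chosen m ?p g (bits_of (?ys (False, False, b3))) 2 u"
    if u: "u < ?V" for g b1 b2 b3 u
  proof -
    have "bits_of (?ys (b1, b2, b3)) (NN + (2 * ?V + u)) = bits_of (?ys (False, False, b3)) (NN + (2 * ?V + u))"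
      using u v3 lt by (auto simp: bits_of_def set3_def nth_list_update)
    thus ?thesis unfolding chosen_def NN_def by simp
  qed
  have val: "rep_value m (padded m n 0 L1) (padded m n 1 L2) (padded m n 2 L3) (bits_of (?ys (b1, b2, b3))) =
      trilinear ?V ?S (X b1) (Y b2) (W b3)" for b1 b2 b3
    unfolding rep_value_trilinear p trilinear_def X_def Y_def W_def
  proof (intro sum.cong refl)
    fix u1 u2 u3 assume "u1 \<in> {..<?V}" "u2 \<in> {..<?V}" "u3 \<in> {..<?V}"
    hence u: "u1 < ?V" "u2 < ?V" "u3 < ?V" by simp_all
    show "?S u1 u2 u3 * (chosen m ?p (padded m n 0 L1) (bits_of (?ys (b1, b2, b3))) 0 u1 *
        chosen m ?p (padded m n 1 L2) (bits_of (?ys (b1, b2, b3))) 1 u2 *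
        chosen m ?p (padded m n 2 L3) (bits_of (?ys (b1, b2, b3))) 2 u3) =
      ?S u1 u2 u3 * (chosen m ?p (padded m n 0 L1) (bits_of (?ys (b1, False, False))) 0 u1 *
        chosen m ?p (padded m n 1 L2) (bits_of (?ys (False, b2, False))) 1 u2 *
        chosen m ?p (padded m n 2 L3) (bits_of (?ys (False, False, b3))) 2 u3)"
      by (subst chX[OF u(1)], subst chY[OF u(2)], subst chW[OF u(3)]) (rule refl)
  qed
  have fin: "finite (candidate_set m (bits_of xs) u)" for u
    unfolding candidate_set_def using finite_slots by simp
  have pad: "padded m n 0 L1 (mask m ?p (v 0)) = 1" "padded m n 1 L2 (mask m ?p (v 1)) = 1"
    "padded m n 2 L3 (mask m ?p (v 2)) = 1"
    unfolding mask_slot_power padded_set_encode[OF L(1) fin] padded_set_encode[OF L(2) fin] padded_set_encode[OF L(3) fin]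
    using v(2) Z by simp_all
  have dX: "X True u - X False u = (if u = v 0 then 1 else 0)" if u: "u < ?V" for u
    unfolding X_def chosen_def NN_def[symmetric]
    using u v3 lt pad by (auto simp: bits_of_def set3_def nth_list_update)
  have dY: "Y True u - Y False u = (if u = v 1 then 1 else 0)" if u: "u < ?V" for u
    unfolding Y_def chosen_def NN_def[symmetric]
    using u v3 lt pad by (auto simp: bits_of_def set3_def nth_list_update)
  have dW: "W True u - W False u = (if u = v 2 then 1 else 0)" if u: "u < ?V" for u
    unfolding W_def chosen_def NN_def[symmetric]
    using u v3 lt pad by (auto simp: bits_of_def set3_def nth_list_update)
  let ?t = "\<lambda>b1 b2 b3. trilinear ?V ?S (X b1) (Y b2) (W b3)"
  have tA: "?t b1 b2 b3 \<in> A" for b1 b2 b3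
    by (rule trilinear_in_A) (simp_all add: X_def Y_def W_def chosen_in_A)
  have t0: "code (?t b1 b2 b3) = code 0" for b1 b2 b3 using no[of "(b1, b2, b3)"] unfolding val .
  have "?t True True True - ?t False True True - ?t True False True + ?t False False True
      - ?t True True False + ?t False True False + ?t True False False - ?t False False False = ?S (v 0) (v 1) (v 2)"
    by (rule trilinear_cube[OF v3 dX dY dW])
  also have "\<dots> = 1" using v(3) by simp
  finally have cube: "?t True True True - ?t False True True - ?t True False True + ?t False False True
      - ?t True True False + ?t False True False + ?t True False False - ?t False False False = 1" .
  have "code (?t True True True - ?t False True True - ?t True False True + ?t False False True
      - ?t True True False + ?t False True False + ?t True False False - ?t False False False) = code 0"
    by (intro code_kernel tA t0 subring_of_add[OF A] subring_of_diff[OF A])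
  with cube code_one show False by simp
qed

end

section \<open>Success probability\<close>

text \<open>The sizes leave no room for an overlap. This turns a cover into a partition, which can
  then be described by a word with one letter per element.\<close>

lemma three_sets_disjoint:
  assumes fin: "finite A" "finite B" "finite C"
    and card: "card A = n" "card B = n" "card C = n" "card (A \<union> B \<union> C) = 3 * n"
  shows "A \<inter> B = {}" "A \<inter> C = {}" "B \<inter> C = {}"
proof -
  have *: "X \<inter> Y = {}" if "finite X" "finite Y" "card X = n" "card Y = n" "card Z = n" "card (X \<union> Y \<union> Z) = 3 * n" for X Y Z :: "'a set"
  proof -
    have "card (X \<union> Y \<union> Z) \<le> card (X \<union> Y) + card Z" by (rule card_Un_le)
    moreover have "card X + card Y = card (X \<union> Y) + card (X \<inter> Y)" using that by (intro card_Un_Int) auto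
    ultimately have "card (X \<inter> Y) = 0" using that by linarith
    thus ?thesis using that by simp
  qed
  show "A \<inter> B = {}" using *[of A B C] assms by simp
  have "A \<union> C \<union> B = A \<union> B \<union> C" "B \<union> C \<union> A = A \<union> B \<union> C" by auto
  thus "A \<inter> C = {}" "B \<inter> C = {}" using *[of A C B] *[of B C A] assms by simp_all
qed

text \<open>Independence of the repetitions in counting form: a rejecting list is cut into its first
  block and the rest, and the first block is itself rejecting.\<close>

lemma reject_count:
  fixes acc :: "bool list \<Rightarrow> bool"
  shows "card {bs. length bs = M * L \<and> (\<forall>j<M. \<not> acc (take L (drop (j * L) bs)))} \<le>
    card {xs. length xs = L \<and> \<not> acc xs} ^ M"
proof (induction M)
  case 0
  have "{bs :: bool list. length bs = 0 * L \<and> (\<forall>j<0. \<not> acc (take L (drop (j * L) bs)))} = {[]}" by auto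
  thus ?case by simp
next
  case (Suc M)
  let ?F = "\<lambda>M. {bs. length bs = M * L \<and> (\<forall>j<M. \<not> acc (take L (drop (j * L) bs)))}"
  let ?R = "{xs. length xs = L \<and> \<not> acc xs}"
  have fin: "finite (?F M)" "finite ?R"
    by (rule finite_subset[OF _ finite_bool_lists[of "M * L"]], blast)
      (rule finite_subset[OF _ finite_bool_lists[of L]], blast)
  have "card (?F (Suc M)) \<le> card (?R \<times> ?F M)"
  proof (rule card_inj_on_le[where f = "\<lambda>bs. (take L bs, drop L bs)"])
    show "inj_on (\<lambda>bs. (take L bs, drop L bs)) (?F (Suc M))"
      by (rule inj_onI) (metis append_take_drop_id prod.inject)
    show "(\<lambda>bs. (take L bs, drop L bs)) ` ?F (Suc M) \<subseteq> ?R \<times> ?F M"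
    proof (rule image_subsetI)
      fix bs assume bs: "bs \<in> ?F (Suc M)"
      hence len: "length bs = L + M * L" and rej: "\<And>j. j < Suc M \<Longrightarrow> \<not> acc (take L (drop (j * L) bs))" by simp_all
      have "\<not> acc (take L bs)" using rej[of 0] by simp
      moreover have "\<not> acc (take L (drop (j * L) (drop L bs)))" if "j < M" for j
        using rej[of "Suc j"] that by (simp add: add.commute)
      ultimately show "(take L bs, drop L bs) \<in> ?R \<times> ?F M" using len by simp
    qed
    show "finite (?R \<times> ?F M)" using fin by simp
  qed
  also have "\<dots> = card ?R * card (?F M)" by (rule card_cartesian_product)
  also have "\<dots> \<le> card ?R * card ?R ^ M" using Suc by (rule mult_left_mono) simp
  finally show ?case by simp
qed

text \<open>With acceptance probability \<open>\<alpha>\<close> of at least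
  \<open>q / (16 * P)\<close>, the product \<open>M * \<alpha>\<close> is at least 2. All
  repetitions fail with probability at most \<open>(1 - \<alpha>) ^ M\<close>, hence at most
  \<open>exp (- 2)\<close>, and \<open>exp 2\<close> is at least \<open>1 + 2\<close>.\<close>

lemma amplification:
  fixes acc :: "bool list \<Rightarrow> bool" and P q :: nat
  assumes pos: "0 < P" "0 < q" and M: "M = 32 * (P div q + 1)"
    and acc: "q * 2 ^ L \<le> 16 * P * card {xs. length xs = L \<and> acc xs}"
  shows "2 / 3 \<le> measure_pmf.prob (pmf_of_set {bs. length bs = M * L}) {bs. \<exists>j<M. acc (take L (drop (j * L) bs))}"
proof -
  let ?A = "{xs. length xs = L \<and> acc xs}" and ?R = "{xs. length xs = L \<and> \<not> acc xs}"
  let ?O = "{bs :: bool list. length bs = M * L}"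
  let ?F = "{bs. length bs = M * L \<and> (\<forall>j<M. \<not> acc (take L (drop (j * L) bs)))}"
  let ?S = "{bs. \<exists>j<M. acc (take L (drop (j * L) bs))}"
  define \<alpha> where "\<alpha> = real (card ?A) / 2 ^ L"
  have finA: "finite ?A" "finite ?R" by (rule finite_subset[OF _ finite_bool_lists[of L]], blast)+
  have finF: "finite ?F" by (rule finite_subset[OF _ finite_bool_lists[of "M * L"]]) blast
  have "?A \<union> ?R = {xs. length xs = L}" "?A \<inter> ?R = {}" by auto
  hence "card ?A + card ?R = 2 ^ L" using card_Un_disjoint[OF finA] by (simp add: card_bool_lists)
  hence "real (card ?A) + real (card ?R) = 2 ^ L" by (metis of_nat_add of_nat_numeral of_nat_power)
  moreover have "\<alpha> * 2 ^ L = real (card ?A)" by (simp add: \<alpha>_def)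
  ultimately have R: "real (card ?R) = (1 - \<alpha>) * 2 ^ L" by (simp add: left_diff_distrib)
  have \<alpha>1: "\<alpha> \<le> 1" using R by (metis diff_ge_0_iff_ge of_nat_0_le_iff zero_le_mult_iff zero_less_numeral zero_less_power not_less)
  have "real q * 2 ^ L \<le> 16 * real P * real (card ?A)"
    using acc by (metis (no_types, lifting) of_nat_le_iff of_nat_mult of_nat_numeral of_nat_power)
  hence \<alpha>: "real q / (16 * real P) \<le> \<alpha>" unfolding \<alpha>_def using pos by (simp add: field_simps)
  have "real P / real q \<le> real (P div q) + 1"
  proof -
    have "P < (P div q + 1) * q" using pos(2) by (metis dividend_less_times_div mult.commute Suc_eq_plus1 mult_Suc_right add.commute)
    hence "real P < real ((P div q + 1) * q)" by (simp only: of_nat_less_iff)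
    hence "real P \<le> (real (P div q) + 1) * real q" by (simp add: algebra_simps)
    thus ?thesis using pos by (simp add: field_simps)
  qed
  hence "32 * (real P / real q) \<le> real M" unfolding M by simp
  hence "32 * (real P / real q) * (real q / (16 * real P)) \<le> real M * \<alpha>" using \<alpha> pos by (intro mult_mono) auto
  moreover have "32 * (real P / real q) * (real q / (16 * real P)) = 2" using pos by simp
  ultimately have two: "2 \<le> real M * \<alpha>" by simp
  have "(1 - \<alpha>) ^ M \<le> exp (- \<alpha>) ^ M"
    using \<alpha>1 exp_ge_add_one_self[of "- \<alpha>"] by (intro power_mono) auto
  also have "\<dots> = exp (- (real M * \<alpha>))" by (simp add: exp_of_nat_mult[symmetric])
  also have "\<dots> \<le> exp (- 2)" using two by simp
  also have "\<dots> \<le> 1 / 3"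
    using exp_ge_add_one_self[of 2] by (simp add: exp_minus field_simps)
  finally have third: "(1 - \<alpha>) ^ M \<le> 1 / 3" .
  have "real (card ?F) \<le> real (card ?R) ^ M"
    using reject_count[of M L acc] unfolding of_nat_power[symmetric] of_nat_le_iff .
  also have "\<dots> = (1 - \<alpha>) ^ M * 2 ^ (M * L)"
    unfolding R power_mult_distrib power_mult[symmetric] by (simp only: mult.commute)
  also have "\<dots> \<le> 1 / 3 * 2 ^ (M * L)" using third by (rule mult_right_mono) simp
  finally have F: "real (card ?F) \<le> 1 / 3 * 2 ^ (M * L)" .
  have O: "card ?O = 2 ^ (M * L)" by (rule card_bool_lists)
  have ne: "?O \<noteq> {}" using length_replicate[of "M * L" True] by blast
  have "?F \<union> (?O \<inter> ?S) = ?O" "?F \<inter> (?O \<inter> ?S) = {}" by auto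
  with card_Un_disjoint[OF finF, of "?O \<inter> ?S"] have "card ?F + card (?O \<inter> ?S) = card ?O" by simp
  hence "real (card ?F) + real (card (?O \<inter> ?S)) = 2 ^ (M * L)"
    unfolding O by (simp only: of_nat_add[symmetric]) simp
  with F have "2 / 3 * 2 ^ (M * L) \<le> real (card (?O \<inter> ?S))" by linarith
  thus ?thesis
    unfolding measure_pmf_of_set[OF ne finite_bool_lists] O by (simp add: field_simps)
qed

context tripartition_tensor_algorithm
begin

lemma permutation_cong:
  "bits_value \<beta> (3 * (c * m) * (3 * (c * m))) = bits_value \<beta>' (3 * (c * m) * (3 * (c * m))) \<Longrightarrow>
    candidate_set m \<beta> = candidate_set m \<beta>'"
  by (intro ext) (simp add: candidate_set_def permutation_def)

lemma mset_letters:
  fixes Z :: "nat \<Rightarrow> nat set"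
  assumes Z: "Z 0 \<union> Z 1 \<union> Z 2 = {1..N}" "Z 0 \<inter> Z 1 = {}" "Z 0 \<inter> Z 2 = {}" "Z 1 \<inter> Z 2 = {}"
    and card: "\<And>x. x < 3 \<Longrightarrow> card (Z x) = n"
  shows "mset (map (letter (Z 0) (Z 1)) [0..<N]) = three_letters n"
proof (rule multiset_eqI)
  fix x
  let ?w = "letter (Z 0) (Z 1)"
  have "count (mset (map ?w [0..<N])) x = card {i. i < length (map ?w [0..<N]) \<and> map ?w [0..<N] ! i = x}"
    by (rule card_positions_eq_count[symmetric])
  moreover have "{i. i < length (map ?w [0..<N]) \<and> map ?w [0..<N] ! i = x} = {e. e < N \<and> ?w e = x}" by auto
  ultimately have 1: "count (mset (map ?w [0..<N])) x = card {e. e < N \<and> ?w e = x}" by simp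
  show "count (mset (map ?w [0..<N])) x = count (three_letters n) x"
  proof (cases "x < 3")
    case True
    have "card {e. e < N \<and> ?w e = x} = card (Suc ` {e. e < N \<and> ?w e = x})" by (simp add: card_image)
    also have "\<dots> = n" unfolding letter_class[OF Z True] by (rule card[OF True])
    finally have "count (mset (map ?w [0..<N])) x = n" unfolding 1 .
    moreover have "x = 0 \<or> x = 1 \<or> x = 2" using True by linarith
    ultimately show ?thesis unfolding three_letters_def by (elim disjE) simp_all
  next
    case False
    hence "{e. e < N \<and> ?w e = x} = {}" by (auto simp: letter_def)
    thus ?thesis using False unfolding 1 three_letters_def by simp
  qed
qed

text \<open>The factor 16 is 2 for the bias of the seed times 8 for the weights. \<open>U\<close>
  collects the balanced seeds below the factorial, \<open>W\<close> their lifts to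
  \<open>N * N\<close> bits, and \<open>G\<close> the lists that begin with such a seed. Each list
  in \<open>G\<close> becomes accepting after a suitable change of three weight bits.\<close>

lemma accept_count:
  assumes L: "set L1 \<subseteq> nsets {1..3 * n} n" "set L2 \<subseteq> nsets {1..3 * n} n" "set L3 \<subseteq> nsets {1..3 * n} n"
    and n: "n \<le> c * m"
    and yes: "balanced_tripartition n (set L1) (set L2) (set L3)"
  shows "qc ^ m * 2 ^ rep_bits m \<le> 16 * pc ^ m *
    card {xs. length xs = rep_bits m \<and> accepts m (padded m n 0 L1) (padded m n 1 L2) (padded m n 2 L3) xs}"
proof -
  let ?N = "3 * (c * m)" and ?V = "R ^ m"
  let ?NN = "?N * ?N"
  let ?acc = "accepts m (padded m n 0 L1) (padded m n 1 L2) (padded m n 2 L3)"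
  let ?A = "{xs. length xs = rep_bits m \<and> ?acc xs}"
  obtain S where S: "S 0 \<in> set L1" "S 1 \<in> set L2" "S (2::nat) \<in> set L3" "S 0 \<union> S 1 \<union> S 2 = {1..3 * n}"
  proof -
    obtain S1 S2 S3 where *: "S1 \<in> set L1" "S2 \<in> set L2" "S3 \<in> set L3" "S1 \<union> S2 \<union> S3 = {1..3 * n}"
      using yes unfolding balanced_tripartition_def by blast
    show thesis by (rule that[of "\<lambda>x. if x = 0 then S1 else if x = 1 then S2 else S3"]) (use * in simp_all)
  qed
  have Sx: "S x \<subseteq> {1..3 * n}" "finite (S x)" "card (S x) = n" if "x < 3" for x
  proof -
    have "x = 0 \<or> x = 1 \<or> x = 2" using that by linarith
    hence "S x \<in> nsets {1..3 * n} n" using S(1-3) L by auto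
    thus "S x \<subseteq> {1..3 * n}" "finite (S x)" "card (S x) = n" by (auto simp: nsets_def)
  qed
  define Z where "Z x = S x \<union> dummy_set m n x" for x
  have dis: "S x \<inter> dummy_set m n x = {}" if "x < 3" for x
    using Sx(1)[OF that] unfolding dummy_set_def offset_def by fastforce
  have cZ: "card (Z x) = c * m" "finite (Z x)" if "x < 3" for x
  proof -
    have "card (dummy_set m n x) = c * m - n" by (simp add: dummy_set_def offset_def)
    moreover have "finite (dummy_set m n x)" by (simp add: dummy_set_def)
    ultimately show "card (Z x) = c * m" "finite (Z x)"
      unfolding Z_def using card_Un_disjoint[OF Sx(2)[OF that] _ dis[OF that]] Sx[OF that] n by simp_all
  qed
  have unZ: "Z 0 \<union> Z 1 \<union> Z 2 = {1..?N}"
  proof -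
    have "dummy_set m n 0 \<union> dummy_set m n 1 \<union> dummy_set m n 2 = {3 * n + 1..<3 * n + 1 + 3 * (c * m - n)}"
    proof -
      have "{a..<a + d} \<union> {a + d..<a + 2 * d} \<union> {a + 2 * d..<a + 3 * d} = {a..<a + 3 * d}" for a d :: nat
        by auto
      from this[of "3 * n + 1" "c * m - n"] show ?thesis
        unfolding dummy_set_def offset_def by (simp add: numeral_2_eq_2 numeral_3_eq_3 add.assoc)
    qed
    also have "3 * n + 1 + 3 * (c * m - n) = ?N + 1" using n by simp
    finally have "dummy_set m n 0 \<union> dummy_set m n 1 \<union> dummy_set m n 2 = {3 * n + 1..<?N + 1}" .
    moreover have "Z 0 \<union> Z 1 \<union> Z 2 = (S 0 \<union> S 1 \<union> S 2) \<union> (dummy_set m n 0 \<union> dummy_set m n 1 \<union> dummy_set m n 2)"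
      unfolding Z_def by blast
    moreover have "{1..3 * n} \<union> {3 * n + 1..<?N + 1} = {1..?N}" using n by auto
    ultimately show ?thesis unfolding S(4) by simp
  qed
  have disZ: "Z 0 \<inter> Z 1 = {}" "Z 0 \<inter> Z 2 = {}" "Z 1 \<inter> Z 2 = {}"
    using three_sets_disjoint[of "Z 0" "Z 1" "Z 2" "c * m"] cZ unZ by simp_all
  have Zex: "\<exists>S\<in>set L1. Z 0 = S \<union> dummy_set m n 0" "\<exists>S\<in>set L2. Z 1 = S \<union> dummy_set m n 1"
      "\<exists>S\<in>set L3. Z 2 = S \<union> dummy_set m n 2"
    unfolding Z_def using S(1-3) by blast+
  let ?w = "letter (Z 0) (Z 1)"
  have N: "?N = 3 * (k * (m * r))" by (simp add: c_eq mult_ac)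
  define U where "U = {u. u < fact ?N \<and> map (shuffle ?N u ?w) [0..<?N] \<in> balanced_words k (m * r)}"
  define W where "W = {u. u < 2 ^ ?NN \<and> u mod fact ?N \<in> U}"
  define G where "G = {xs. length xs = rep_bits m \<and> bits_value (bits_of xs) ?NN \<in> W}"
  have "mset (map ?w [0..<?N]) = three_letters (c * m)"
    by (rule mset_letters[OF unZ disZ]) (rule cZ(1))
  hence "mset (map ?w [0..<3 * (k * (m * r))]) = three_letters (k * (m * r))" unfolding N by (simp add: c_eq mult_ac)
  note count = shuffle_balanced_count[OF this]
  have q: "qc ^ m = ((3 * k choose k) * (2 * k choose k)) ^ (m * r)"
    by (simp only: qc_eq power_mult[symmetric] mult.commute)
  have p: "pc ^ m = 27 ^ (k * (m * r))"
    by (simp only: pc_eq c_eq power_mult[symmetric] mult_ac)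
  have U: "qc ^ m * fact ?N \<le> pc ^ m * card U"
    unfolding q p U_def N by (rule count)
  have W: "2 ^ ?NN * card U \<le> 2 * fact ?N * card W"
    unfolding W_def
  proof (rule card_residues_ge)
    show "U \<subseteq> {..<fact ?N}" unfolding U_def by blast
  qed (rule fact_gt_zero, rule fact_le_two_power)
  have G: "card W * 2 ^ (3 * ?V) \<le> card G"
    unfolding G_def rep_bits_def by (rule card_bits_value_ge) (unfold W_def, blast)
  define good where "good \<beta> v \<longleftrightarrow> (\<forall>x<3. v x < ?V \<and> candidate_set m \<beta> (v x) = Z x) \<and> covers m (v 0) (v 1) (v 2)"
    for \<beta> and v :: "nat \<Rightarrow> nat"
  define pos where "pos \<beta> = (SOME v. good \<beta> v)" for \<beta>
  have pos: "good (bits_of xs) (pos (bits_of xs))" if xs: "xs \<in> G" for xs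
  proof -
    let ?u = "bits_value (bits_of xs) ?NN"
    have "?w \<circ> permutation m (bits_of xs) = shuffle ?N ?u ?w"
      unfolding permutation_def shuffle_comp[symmetric] by simp
    also have "\<dots> = shuffle ?N (?u mod fact ?N) ?w" by (rule shuffle_mod_fact[symmetric])
    finally have "map (?w \<circ> permutation m (bits_of xs)) [0..<?N] \<in> balanced_words k (m * r)"
      using xs unfolding G_def W_def U_def by simp
    from balanced_permutation_realizes[OF unZ disZ this] show ?thesis
      unfolding pos_def good_def by (rule someI_ex)
  qed
  define ext where "ext xs b = set3 (?NN + pos (bits_of xs) 0) (?NN + (?V + pos (bits_of xs) 1))
      (?NN + (2 * ?V + pos (bits_of xs) 2)) b xs" for xs b
  define b where "b xs = (SOME b. ?acc (ext xs b))" for xs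
  have acc: "?acc (ext xs (b xs))" if xs: "xs \<in> G" for xs
  proof -
    have "\<exists>b. ?acc (ext xs b)"
      unfolding ext_def
    proof (rule accepts_some_weights[OF L Zex])
      show "length xs = rep_bits m" using xs by (simp add: G_def)
    qed (use pos[OF xs] in \<open>simp_all add: good_def\<close>)
    thus ?thesis unfolding b_def by (rule someI_ex)
  qed
  have val: "bits_value (bits_of (ext xs b)) ?NN = bits_value (bits_of xs) ?NN" for xs b
    by (rule bits_value_cong) (simp add: ext_def set3_def bits_of_def)
  have posv: "pos \<beta> = pos \<beta>'" if "bits_value \<beta> ?NN = bits_value \<beta>' ?NN" for \<beta> \<beta>'
    unfolding pos_def good_def permutation_cong[OF that] ..
  \<comment> \<open>The map is injective: the altered list still contains the seed, the seed
    determines the three positions through \<open>pos\<close>, and the recorded bits restore what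
    was overwritten there.\<close>
  have "card G \<le> card (?A \<times> (UNIV :: (bool \<times> bool \<times> bool) set))"
  proof (rule card_inj_on_le[where f = "\<lambda>xs. (ext xs (b xs), (xs ! (?NN + pos (bits_of xs) 0),
      xs ! (?NN + (?V + pos (bits_of xs) 1)), xs ! (?NN + (2 * ?V + pos (bits_of xs) 2))))"])
    show "inj_on (\<lambda>xs. (ext xs (b xs), (xs ! (?NN + pos (bits_of xs) 0),
      xs ! (?NN + (?V + pos (bits_of xs) 1)), xs ! (?NN + (2 * ?V + pos (bits_of xs) 2))))) G"
    proof (rule inj_onI)
      fix xs ys assume xs: "xs \<in> G" and ys: "ys \<in> G"
      assume eq: "(ext xs (b xs), (xs ! (?NN + pos (bits_of xs) 0),
          xs ! (?NN + (?V + pos (bits_of xs) 1)), xs ! (?NN + (2 * ?V + pos (bits_of xs) 2)))) =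
        (ext ys (b ys), (ys ! (?NN + pos (bits_of ys) 0),
          ys ! (?NN + (?V + pos (bits_of ys) 1)), ys ! (?NN + (2 * ?V + pos (bits_of ys) 2))))"
      have e: "ext xs (b xs) = ext ys (b ys)" using eq by simp
      have "bits_value (bits_of xs) ?NN = bits_value (bits_of ys) ?NN"
        using val[of xs "b xs"] val[of ys "b ys"] e by simp
      hence p: "pos (bits_of ys) = pos (bits_of xs)" by (intro posv) simp
      have len: "length xs = length ys" using xs ys by (simp add: G_def)
      show "xs = ys"
      proof (rule nth_equalityI[OF len])
        fix i assume i: "i < length xs"
        show "xs ! i = ys ! i"
        proof (cases "i \<in> {?NN + pos (bits_of xs) 0, ?NN + (?V + pos (bits_of xs) 1), ?NN + (2 * ?V + pos (bits_of xs) 2)}")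
          case True
          thus ?thesis using eq unfolding p by auto
        next
          case False
          have "ext xs (b xs) ! i = xs ! i" "ext ys (b ys) ! i = ys ! i"
            using False unfolding ext_def set3_def p by simp_all
          thus ?thesis using e by simp
        qed
      qed
    qed
    show "(\<lambda>xs. (ext xs (b xs), (xs ! (?NN + pos (bits_of xs) 0),
      xs ! (?NN + (?V + pos (bits_of xs) 1)), xs ! (?NN + (2 * ?V + pos (bits_of xs) 2))))) ` G \<subseteq> ?A \<times> UNIV"
      using acc by (auto simp: G_def ext_def set3_def)
    have "finite ?A" by (rule finite_subset[OF _ finite_bool_lists[of "rep_bits m"]]) blast
    thus "finite (?A \<times> (UNIV :: (bool \<times> bool \<times> bool) set))" by simp
  qed
  also have "\<dots> = 8 * card ?A" by (simp add: card_cartesian_product card_prod)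
  finally have A: "card G \<le> 8 * card ?A" .
  \<comment> \<open>The three counting bounds are chained after multiplication by the factorial,
    which is cancelled at the end in place of dividing.\<close>
  have "fact ?N * (qc ^ m * 2 ^ rep_bits m) = (qc ^ m * fact ?N) * (2 ^ ?NN * 2 ^ (3 * ?V))"
    by (simp add: rep_bits_def power_add)
  also have "\<dots> \<le> (pc ^ m * card U) * (2 ^ ?NN * 2 ^ (3 * ?V))" using U by (rule mult_right_mono) simp
  also have "\<dots> = (2 ^ ?NN * card U) * (pc ^ m * 2 ^ (3 * ?V))" by (simp only: mult_ac)
  also have "\<dots> \<le> (2 * fact ?N * card W) * (pc ^ m * 2 ^ (3 * ?V))" using W by (rule mult_right_mono) simp
  also have "\<dots> = (card W * 2 ^ (3 * ?V)) * (2 * fact ?N * pc ^ m)" by (simp only: mult_ac)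
  also have "\<dots> \<le> (8 * card ?A) * (2 * fact ?N * pc ^ m)"
    using order_trans[OF G A] by (rule mult_right_mono) simp
  also have "\<dots> = fact ?N * (16 * pc ^ m * card ?A)" by simp
  finally show ?thesis by simp
qed

lemma pc_qc_pos: "0 < pc" "0 < qc"
  unfolding pc_eq qc_eq by (simp_all add: zero_less_binomial_iff)

lemma decides:
  fixes n L1 L2 L3
  defines "m \<equiv> n div c + 1" and "s \<equiv> instance_state n L1 L2 L3"
  assumes fits: "fits w m (reps m)" and b: "bounded w s"
    and L: "set L1 \<subseteq> nsets {1..3 * n} n" "set L2 \<subseteq> nsets {1..3 * n} n" "set L3 \<subseteq> nsets {1..3 * n} n"
  shows "decides_within program s (balanced_tripartition n (set L1) (set L2) (set L3))
    (real (70 * (3 * (c * m) + m + length L1 + length L2 + length L3 + 1) * step_cost prologue * w + 1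
         + (reps m * rep_bits m + 2) * (40 * w) + 1
         + ((reps m + 1) * (rep_steps m + 5)) * step_cost (for_loop ''j'' (var ''M'') rep) * w))"
proof -
  let ?B = "70 * (3 * (c * m) + m + length L1 + length L2 + length L3 + 1) * step_cost prologue * w + 1
         + (reps m * rep_bits m + 2) * (40 * w) + 1
         + ((reps m + 1) * (rep_steps m + 5)) * step_cost (for_loop ''j'' (var ''M'') rep) * w"
  let ?acc = "accepts m (padded m n 0 L1) (padded m n 1 L2) (padded m n 2 L3)"
  let ?yes = "balanced_tripartition n (set L1) (set L2) (set L3)"
  let ?O = "{bs :: bool list. length bs = reps m * rep_bits m}"
  let ?S = "{bs. \<exists>j<reps m. ?acc (take (rep_bits m) (drop (j * rep_bits m) bs))}"
  have nm: "n \<le> c * m" unfolding m_def using dividend_less_times_div[OF c_pos, of n] by simp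
  from run_program[OF fits[unfolded m_def] b[unfolded s_def] pc_qc_pos, folded m_def s_def]
  obtain mm f where f: "run mm program s = map_pmf f (pmf_of_set ?O)"
    "\<forall>bs. length bs = reps m * rep_bits m \<longrightarrow> (\<exists>s' t. f bs = (SKIP, s', t) \<and> t \<le> ?B \<and>
       s' ''out'' 0 = of_bool (\<exists>j<reps m. ?acc (take (rep_bits m) (drop (j * rep_bits m) bs))))"
    by (elim exE conjE)
  have ne: "?O \<noteq> {}" using length_replicate[of "reps m * rep_bits m" True] by blast
  have set: "set_pmf (pmf_of_set ?O) = ?O" using ne by simp
  have f': "\<exists>s' t. f bs = (SKIP, s', t) \<and> t \<le> ?B \<and> s' ''out'' 0 = of_bool (bs \<in> ?S)" if "bs \<in> ?O" for bs
    using f(2)[rule_format, of bs] that by simp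
  show ?thesis
    unfolding decides_within_def
  proof (intro exI[of _ mm] conjI)
    show "\<forall>(c', s', t)\<in>set_pmf (run mm program s). c' = SKIP \<and> real t \<le> real ?B"
    proof
      fix x assume "x \<in> set_pmf (run mm program s)"
      then obtain bs where bs: "bs \<in> ?O" "x = f bs" unfolding f(1) set_map_pmf set by (elim imageE)
      from f'[OF bs(1)] obtain s' t where "f bs = (SKIP, s', t)" "t \<le> ?B" by (elim exE conjE)
      thus "case x of (c', s', t) \<Rightarrow> c' = SKIP \<and> real t \<le> real ?B" unfolding bs(2) by (simp only: prod.case of_nat_le_iff simp_thms)
    qed
    let ?E = "{(c', s', t). (s' ''out'' 0 = 1) = ?yes} :: (com \<times> state \<times> nat) set"
    have E: "f bs \<in> ?E \<longleftrightarrow> (bs \<in> ?S) = ?yes" if bs: "bs \<in> ?O" for bs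
    proof -
      from f'[OF bs] obtain s' t where "f bs = (SKIP, s', t)" "s' ''out'' 0 = of_bool (bs \<in> ?S)" by (elim exE conjE)
      thus ?thesis by (cases "bs \<in> ?S") (simp_all only: of_bool_eq mem_Collect_eq prod.case, simp_all)
    qed
    have prob: "measure_pmf.prob (run mm program s) ?E = measure_pmf.prob (pmf_of_set ?O) (f -` ?E)"
      unfolding f(1) by (rule measure_map_pmf)
    show "2 / 3 \<le> measure_pmf.prob (run mm program s) ?E"
    proof (cases ?yes)
      case True
      have "2 / 3 \<le> measure_pmf.prob (pmf_of_set ?O) ?S"
        by (rule amplification[OF _ _ _ accept_count[OF L nm True]]) (simp_all add: pc_qc_pos reps_def)
      also have "\<dots> = measure_pmf.prob (pmf_of_set ?O) (f -` ?E)"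
      proof (rule measure_prob_cong_0)
        fix bs assume "bs \<in> ?S - f -` ?E"
        hence "bs \<notin> ?O" using E[of bs] True by auto
        thus "pmf (pmf_of_set ?O) bs = 0" using ne by (simp add: pmf_of_set)
      next
        fix bs assume "bs \<in> f -` ?E - ?S"
        hence "bs \<notin> ?O" using E[of bs] True by auto
        thus "pmf (pmf_of_set ?O) bs = 0" using ne by (simp add: pmf_of_set)
      qed
      finally show ?thesis unfolding prob .
    next
      case False
      have "?O \<subseteq> f -` ?E"
      proof
        fix bs assume bs: "bs \<in> ?O"
        have "bs \<notin> ?S" using accepts_sound[OF L nm] False by blast
        with E[OF bs] False show "bs \<in> f -` ?E" by simp
      qed
      hence "measure_pmf.prob (pmf_of_set ?O) (f -` ?E) = 1"
        by (subst measure_pmf.prob_eq_1) (auto simp: AE_measure_pmf_iff set)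
      thus ?thesis unfolding prob by simp
    qed
  qed
qed

end

section \<open>Asymptotic rank and running time\<close>

lemma finite_indices_tripartition: "finite (indices (tripartition_tensor k))"
  by (simp add: tripartition_tensor_def finite_imp_finite_nsets)

lemma card_indices_tripartition: "card (indices (tripartition_tensor k)) = (3 * k choose k)"
  by (simp add: tripartition_tensor_def card_nsets)

text \<open>Complete every \<open>S\<close> to a partition \<open>S\<close>, \<open>f S\<close>,
  \<open>g S\<close> of the ground set. Then a set \<open>S'\<close> of the same size covers the
  rest together with \<open>f S\<close> and \<open>g S\<close> only if it contains \<open>S\<close>,
  hence equals it; this is the diagonal needed for flattening.\<close>

lemma binomial_power_le_rank:
  "(3 * k choose k) ^ r \<le> tensor_rank (kronecker_power (tripartition_tensor k :: (nat set, 'f::field) tensor) r)"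
proof -
  let ?T = "tripartition_tensor k :: (nat set, 'f) tensor"
  have "\<exists>T U. T \<in> indices ?T \<and> U \<in> indices ?T \<and> T \<inter> S = {} \<and> U \<inter> S = {} \<and> S \<union> T \<union> U = {1..3 * k}"
    if S: "S \<in> indices ?T" for S
  proof -
    have S': "S \<subseteq> {1..3 * k}" "finite S" "card S = k" using S by (auto simp: tripartition_tensor_def nsets_def)
    have c: "card ({1..3 * k} - S) = 2 * k" using S' by (simp add: card_Diff_subset)
    obtain T where T: "T \<subseteq> {1..3 * k} - S" "card T = k" "finite T"
      using obtain_subset_with_card_n[of k "{1..3 * k} - S"] c by auto
    let ?U = "{1..3 * k} - S - T"
    have "card ?U = k" using c T by (simp add: card_Diff_subset)
    moreover have "S \<union> T \<union> ?U = {1..3 * k}" using S' T by auto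
    ultimately show ?thesis using T
      by (intro exI[of _ T] exI[of _ ?U]) (auto simp: tripartition_tensor_def nsets_def)
  qed
  hence "\<forall>S\<in>indices ?T. \<exists>p. fst p \<in> indices ?T \<and> snd p \<in> indices ?T \<and>
      fst p \<inter> S = {} \<and> snd p \<inter> S = {} \<and> S \<union> fst p \<union> snd p = {1..3 * k}" by auto
  from bchoice[OF this] obtain p where p: "\<forall>S\<in>indices ?T. fst (p S) \<in> indices ?T \<and> snd (p S) \<in> indices ?T \<and>
      fst (p S) \<inter> S = {} \<and> snd (p S) \<inter> S = {} \<and> S \<union> fst (p S) \<union> snd (p S) = {1..3 * k}" by (elim exE)
  define f where "f S = fst (p S)" for S
  define g where "g S = snd (p S)" for S
  have fg: "f S \<in> indices ?T \<and> g S \<in> indices ?T \<and>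
      f S \<inter> S = {} \<and> g S \<inter> S = {} \<and> S \<union> f S \<union> g S = {1..3 * k}" if "S \<in> indices ?T" for S
    using p that unfolding f_def g_def by (rule bspec)
  have diag: "tensor.coeff ?T S (f S') (g S') = (if S = S' then 1 else 0)"
    if S: "S \<in> indices ?T" "S' \<in> indices ?T" for S S'
  proof -
    note F = fg[OF S(2)]
    have "S \<union> f S' \<union> g S' = {1..3 * k} \<longleftrightarrow> S = S'"
    proof
      assume "S \<union> f S' \<union> g S' = {1..3 * k}"
      hence sub: "S' \<subseteq> S" using F by blast
      have "finite S" "card S = card S'" using S by (auto simp: tripartition_tensor_def nsets_def)
      with sub show "S = S'" using card_subset_eq[of S S'] by simp
    next
      assume "S = S'"
      thus "S \<union> f S' \<union> g S' = {1..3 * k}" using F by blast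
    qed
    thus ?thesis by (simp add: tripartition_tensor_def)
  qed
  have "card (indices ?T) ^ r \<le> tensor_rank (kronecker_power ?T r)"
    by (rule card_indices_power_le_rank[OF finite_indices_tripartition, where f = f and g = g])
      (use fg diag in auto)
  thus ?thesis by (simp only: card_indices_tripartition)
qed

lemma binomial_3k_pos: "0 < (3 * k choose k)" "0 < (2 * k choose k)"
  by (simp_all add: zero_less_binomial_iff)

lemma choose_exponent:
  fixes k :: nat
  assumes "\<epsilon> > 0"
  defines "ar \<equiv> asymptotic_rank (tripartition_tensor k :: (nat set, 'f::field) tensor)"
  shows "\<exists>r>0. 0 < ar + \<epsilon> / 2 \<and>
    real (tensor_rank (kronecker_power (tripartition_tensor k :: (nat set, 'f) tensor) r)) \<le> (ar + \<epsilon> / 2) ^ r"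
proof -
  let ?R = "\<lambda>r. tensor_rank (kronecker_power (tripartition_tensor k :: (nat set, 'f) tensor) r)"
  have pos: "1 \<le> ?R r" for r
  proof -
    have "1 \<le> (3 * k choose k) ^ r" using binomial_3k_pos[of k] by (simp add: Suc_leI)
    thus ?thesis using binomial_power_le_rank[of k r, where 'f = 'f] by linarith
  qed
  have "(\<lambda>r. root r (real (?R r))) \<longlonglongrightarrow> ar"
    unfolding ar_def by (rule root_rank_tendsto_asymptotic_rank[OF finite_indices_tripartition pos])
  hence "eventually (\<lambda>r. root r (real (?R r)) < ar + \<epsilon> / 2) sequentially"
    by (rule order_tendstoD) (use assms in simp)
  then obtain N where N: "\<forall>r\<ge>N. root r (real (?R r)) < ar + \<epsilon> / 2"
    unfolding eventually_sequentially by (elim exE)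
  define r where "r = Suc N"
  have "r > 0" "N \<le> r" by (simp_all add: r_def)
  hence r: "r > 0" "root r (real (?R r)) < ar + \<epsilon> / 2" using N by blast+
  have p: "0 < root r (real (?R r))" using pos[of r] r(1) by simp
  moreover have "0 < ar + \<epsilon> / 2" using p r(2) by linarith
  moreover have "real (?R r) = root r (real (?R r)) ^ r" using r(1) by simp
  moreover have "root r (real (?R r)) ^ r \<le> (ar + \<epsilon> / 2) ^ r" using r pos[of r] by (intro power_mono) auto
  ultimately show ?thesis using r by (intro exI[of _ r]) auto
qed

text \<open>The coefficient is rewritten as a covering condition on single slots: slot
  \<open>e\<close> denotes element \<open>Suc (e mod (3 * k))\<close> of list entry
  \<open>e div (3 * k)\<close>, which is the form used by \<open>E\<close>.\<close>

lemma tripartition_power_coeff: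
  fixes x y z :: "nat set list"
  assumes "x \<in> indices (kronecker_power (tripartition_tensor k :: (nat set, 'f::field) tensor) r)"
    "y \<in> indices (kronecker_power (tripartition_tensor k :: (nat set, 'f) tensor) r)"
    "z \<in> indices (kronecker_power (tripartition_tensor k :: (nat set, 'f) tensor) r)"
    and k: "k > 0"
  shows "tensor.coeff (kronecker_power (tripartition_tensor k :: (nat set, 'f) tensor) r) x y z =
    of_bool (\<forall>e<3 * (k * r). Suc (e mod (3 * k)) \<in> x ! (e div (3 * k)) \<union> y ! (e div (3 * k)) \<union> z ! (e div (3 * k)))"
proof -
  let ?T = "tripartition_tensor k :: (nat set, 'f) tensor"
  have len: "length x = r" "length y = r" "length z = r"
    and mem: "set x \<subseteq> nsets {1..3 * k} k" "set y \<subseteq> nsets {1..3 * k} k" "set z \<subseteq> nsets {1..3 * k} k"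
    using assms(1-3) by (simp_all add: kronecker_power_simps tripartition_tensor_def)
  let ?P = "\<lambda>\<rho>. x ! \<rho> \<union> y ! \<rho> \<union> z ! \<rho> = {1..3 * k}"
  have "tensor.coeff (kronecker_power ?T r) x y z = (\<Prod>\<rho><r. of_bool (?P \<rho>))"
    unfolding kronecker_power_simps(2)[OF len] by (intro prod.cong refl) (simp add: tripartition_tensor_def)
  also have "\<dots> = of_bool (\<forall>\<rho><r. ?P \<rho>)" by (induction r) (auto simp: less_Suc_eq)
  also have "(\<forall>\<rho><r. ?P \<rho>) \<longleftrightarrow> (\<forall>e<3 * (k * r). Suc (e mod (3 * k)) \<in> x ! (e div (3 * k)) \<union> y ! (e div (3 * k)) \<union> z ! (e div (3 * k)))"
  proof
    assume P: "\<forall>\<rho><r. ?P \<rho>"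
    show "\<forall>e<3 * (k * r). Suc (e mod (3 * k)) \<in> x ! (e div (3 * k)) \<union> y ! (e div (3 * k)) \<union> z ! (e div (3 * k))"
    proof (intro allI impI)
      fix e assume e: "e < 3 * (k * r)"
      have "e div (3 * k) < r" using e by (intro less_mult_imp_div_less) (simp add: mult_ac)
      with P have "?P (e div (3 * k))" by blast
      moreover have "Suc (e mod (3 * k)) \<in> {1..3 * k}" using mod_less_divisor[of "3 * k" e] k by (simp add: Suc_le_eq)
      ultimately show "Suc (e mod (3 * k)) \<in> x ! (e div (3 * k)) \<union> y ! (e div (3 * k)) \<union> z ! (e div (3 * k))" by simp
    qed
  next
    assume Q: "\<forall>e<3 * (k * r). Suc (e mod (3 * k)) \<in> x ! (e div (3 * k)) \<union> y ! (e div (3 * k)) \<union> z ! (e div (3 * k))"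
    show "\<forall>\<rho><r. ?P \<rho>"
    proof (intro allI impI equalityI)
      fix \<rho> assume \<rho>: "\<rho> < r"
      have "x ! \<rho> \<in> nsets {1..3 * k} k" "y ! \<rho> \<in> nsets {1..3 * k} k" "z ! \<rho> \<in> nsets {1..3 * k} k"
        using mem len \<rho> by auto
      thus "x ! \<rho> \<union> y ! \<rho> \<union> z ! \<rho> \<subseteq> {1..3 * k}" by (auto simp: nsets_def)
      show "{1..3 * k} \<subseteq> x ! \<rho> \<union> y ! \<rho> \<union> z ! \<rho>"
      proof
        fix i assume "i \<in> {1..3 * k}"
        then obtain i' where i: "i = Suc i'" "i' < 3 * k" by (cases i) auto
        let ?e = "\<rho> * (3 * k) + i'"
        have "?e < Suc \<rho> * (3 * k)" using i by simp
        also have "\<dots> \<le> r * (3 * k)" using \<rho> by (intro mult_right_mono) auto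
        finally have "?e < 3 * (k * r)" by (simp add: mult_ac)
        with Q have "Suc (?e mod (3 * k)) \<in> x ! (?e div (3 * k)) \<union> y ! (?e div (3 * k)) \<union> z ! (?e div (3 * k))" by blast
        moreover have "?e mod (3 * k) = i'" "?e div (3 * k) = \<rho>" using i(2) by simp_all
        ultimately show "i \<in> x ! \<rho> \<union> y ! \<rho> \<union> z ! \<rho>" unfolding i(1) by simp
      qed
    qed
  qed
  finally show ?thesis .
qed

lemma algorithm_exists:
  fixes k r :: nat
  assumes k: "k > 0" and r: "r > 0"
  defines "R \<equiv> tensor_rank (kronecker_power (tripartition_tensor k :: (nat set, 'f::field) tensor) r)"
  shows "\<exists>Q (A :: 'f set) code add mul ca cb cc E. tripartition_tensor_algorithm (k * r) R Q (27 ^ (k * r))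
    (((3 * k choose k) * (2 * k choose k)) ^ r) A code add mul ca cb cc E k r ((3 * k choose k) ^ r)"
proof -
  let ?P = "kronecker_power (tripartition_tensor k :: (nat set, 'f) tensor) r"
  let ?I = "indices ?P"
  let ?N = "(3 * k choose k) ^ r"
  have fin: "finite ?I" by (rule finite_indices_kronecker_power[OF finite_indices_tripartition])
  have I: "?I = {x. set x \<subseteq> nsets {1..3 * k} k \<and> length x = r}"
    by (auto simp: kronecker_power_simps tripartition_tensor_def)
  have card: "card ?I = ?N"
    unfolding I by (subst card_lists_length_eq) (simp_all add: finite_imp_finite_nsets card_nsets)
  have NR: "?N \<le> R" unfolding R_def by (rule binomial_power_le_rank)
  have R0: "R > 0" using NR binomial_3k_pos(1)[of k] by (metis gr0I le_zero_eq power_not_zero not_gr_zero)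
  obtain a b c where abc: "\<forall>x\<in>?I. \<forall>y\<in>?I. \<forall>z\<in>?I. tensor.coeff ?P x y z = (\<Sum>q<R. a q x * b q y * c q z)"
    using tensor_rank_works[OF fin] unfolding lin_comb_of_rank_ones_iff R_def by blast
  obtain h where h: "bij_betw h {0..<?N} ?I" using ex_bij_betw_nat_finite[OF fin] unfolding card by blast
  have hI: "h i \<in> ?I" if "i < ?N" for i using bij_betwE[OF h] that by simp
  \<comment> \<open>There are only binomially many indices, but the transforms work with
    \<open>R\<close> by \<open>R\<close> matrices. Extending the factors by 0 makes the decomposed
    tensor vanish on the surplus digits.\<close>
  define ext where "ext u q i = (if i < ?N then u q (h i) else 0)" for u :: "nat \<Rightarrow> nat set list \<Rightarrow> 'f" and q i
  define E where "E d e \<longleftrightarrow> Suc (e mod (3 * k)) \<in> h d ! (e div (3 * k))" for d e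
  let ?S = "(\<lambda>(q, i). ext a q i) ` ({..<R} \<times> {..<R}) \<union> (\<lambda>(q, i). ext b q i) ` ({..<R} \<times> {..<R}) \<union>
    (\<lambda>(q, i). ext c q i) ` ({..<R} \<times> {..<R})"
  have "finite ?S" by simp
  from finite_ring_code[OF this] obtain A and code :: "'f \<Rightarrow> nat" and Q add mul where
    A: "subring_of A" "?S \<subseteq> A" "\<forall>x\<in>A. code x < Q"
    "\<forall>x\<in>A. \<forall>y\<in>A. code (x + y) = add (code x) (code y) \<and> code (x * y) = mul (code x) (code y)"
    "code 1 \<noteq> code 0" by (elim exE conjE)
  have "tripartition_tensor_algorithm (k * r) R Q (27 ^ (k * r))
    (((3 * k choose k) * (2 * k choose k)) ^ r) A code add mul (ext a) (ext b) (ext c) E k r ?N"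
  proof unfold_locales
    show "0 < k * r" using k r by simp
    show "subring_of A" by (rule A(1))
    show "ext a q i \<in> A" "ext b q i \<in> A" "ext c q i \<in> A" if "q < R" "i < R" for q i
      using A(2) that by auto
    show "(\<Sum>q<R. ext a q i * ext b q j * ext c q l) =
      of_bool (i < ?N \<and> j < ?N \<and> l < ?N \<and> (\<forall>e<3 * (k * r). E i e \<or> E j e \<or> E l e))" for i j l
    proof (cases "i < ?N \<and> j < ?N \<and> l < ?N")
      case True
      hence "(\<Sum>q<R. ext a q i * ext b q j * ext c q l) = tensor.coeff ?P (h i) (h j) (h l)"
        using abc hI by (simp add: ext_def)
      also have "\<dots> = of_bool (\<forall>e<3 * (k * r). E i e \<or> E j e \<or> E l e)"
        using tripartition_power_coeff[OF hI hI hI k, of i j l] True unfolding E_def by (simp add: Un_iff disj_assoc)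
      finally show ?thesis using True by simp
    next
      case False
      thus ?thesis by (auto simp: ext_def)
    qed
    show "\<exists>d<?N. \<forall>e<3 * (k * r). E d e \<longleftrightarrow> B e"
      if B: "\<And>\<rho>. \<rho> < r \<Longrightarrow> card {i. i < 3 * k \<and> B (\<rho> * (3 * k) + i)} = k" for B
    proof -
      define x where "x = map (\<lambda>\<rho>. Suc ` {i. i < 3 * k \<and> B (\<rho> * (3 * k) + i)}) [0..<r]"
      have "Suc ` {i. i < 3 * k \<and> B (\<rho> * (3 * k) + i)} \<in> nsets {1..3 * k} k" if "\<rho> < r" for \<rho>
        using B[OF that] by (auto simp: nsets_def card_image)
      hence "x \<in> ?I" unfolding I x_def by auto
      then obtain d where d: "d < ?N" "h d = x" using bij_betw_imp_surj_on[OF h] by (metis atLeastLessThan_iff imageE)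
      have "E d e \<longleftrightarrow> B e" if e: "e < 3 * (k * r)" for e
      proof -
        have "e div (3 * k) < r" using e by (intro less_mult_imp_div_less) (simp add: mult_ac)
        hence "x ! (e div (3 * k)) = Suc ` {i. i < 3 * k \<and> B (e div (3 * k) * (3 * k) + i)}" by (simp add: x_def)
        moreover have "e mod (3 * k) < 3 * k" using k by simp
        ultimately have "E d e \<longleftrightarrow> B (e div (3 * k) * (3 * k) + e mod (3 * k))"
          unfolding E_def d(2) by auto
        thus ?thesis by (simp only: div_mult_mod_eq)
      qed
      with d(1) show ?thesis by blast
    qed
  qed (use A R0 k r NR in auto)
  thus ?thesis by (intro exI)
qed

section \<open>Estimates for the running time\<close>

lemma polynomial_le_exponential:
  fixes \<rho> :: real
  assumes "\<rho> > 1"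
  shows "\<exists>K>0. \<forall>x\<ge>0. (x + 1) ^ n \<le> K * \<rho> powr x"
proof -
  \<comment> \<open>One more than the exponent, so that dividing by \<open>d\<close> is meaningful
    for \<open>n = 0\<close> as well.\<close>
  define d where "d = real n + 1"
  have d: "d > 0" "real n \<le> d" by (simp_all add: d_def)
  define l where "l = ln \<rho> / d"
  have l: "l > 0" using assms d by (simp add: l_def)
  have "(x + 1) ^ n \<le> ((1 / l) ^ n * \<rho>) * \<rho> powr x" if x: "x \<ge> 0" for x
  proof -
    have "l * (x + 1) \<le> exp (l * (x + 1))" using exp_ge_add_one_self[of "l * (x + 1)"] by linarith
    hence "x + 1 \<le> 1 / l * exp (l * (x + 1))" using l by (simp add: field_simps)
    hence "(x + 1) ^ n \<le> (1 / l * exp (l * (x + 1))) ^ n" using x by (intro power_mono) auto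
    also have "\<dots> = (1 / l) ^ n * exp (real n * (l * (x + 1)))" by (simp only: power_mult_distrib exp_of_nat_mult)
    also have "\<dots> \<le> (1 / l) ^ n * exp (ln \<rho> * (x + 1))"
    proof (rule mult_left_mono)
      have "real n * (l * (x + 1)) \<le> d * (l * (x + 1))" using d l x by (intro mult_right_mono) auto
      also have "\<dots> = ln \<rho> * (x + 1)" using d by (simp add: l_def)
      finally show "exp (real n * (l * (x + 1))) \<le> exp (ln \<rho> * (x + 1))" by simp
    qed (use l in simp)
    also have "exp (ln \<rho> * (x + 1)) = \<rho> * \<rho> powr x"
      using assms by (simp add: powr_def distrib_left exp_add mult.commute)
    finally show ?thesis by (simp only: mult.assoc)
  qed
  moreover have "(1 / l) ^ n * \<rho> > 0" using l assms by simp
  ultimately show ?thesis by blast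
qed

text \<open>A single term of the binomial expansion of \<open>(1/3 + 2/3) ^ (3 * n) = 1\<close>; the
  weights 1/3 and 2/3 are those for which this term yields the base 27/4.\<close>

lemma binomial_3n_le: "real (3 * n choose n) \<le> (27 / 4) ^ n"
proof -
  have "real (3 * n choose n) * (1 / 3) ^ n * (2 / 3) ^ (3 * n - n) \<le>
      (\<Sum>k\<le>3 * n. real (3 * n choose k) * (1 / 3) ^ k * (2 / 3) ^ (3 * n - k))"
    by (rule member_le_sum[of n]) auto
  also have "\<dots> = (1 / 3 + 2 / 3) ^ (3 * n)" by (rule binomial_ring[symmetric])
  finally have "real (3 * n choose n) * ((1 / 3) ^ n * (2 / 3) ^ (2 * n)) \<le> 1" by (simp add: mult.assoc)
  moreover have "(1 / 3 :: real) ^ n * (2 / 3) ^ (2 * n) = (4 / 27) ^ n"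
    by (simp add: power_mult power_mult_distrib[symmetric] power2_eq_square)
  ultimately have "real (3 * n choose n) * (4 / 27) ^ n \<le> 1" by simp
  hence "real (3 * n choose n) * (4 / 27) ^ n * (27 / 4) ^ n \<le> 1 * (27 / 4) ^ n" by (intro mult_right_mono) auto
  moreover have "(4 / 27 :: real) ^ n * (27 / 4) ^ n = 1" by (simp add: power_mult_distrib[symmetric])
  ultimately show ?thesis by (simp add: mult.assoc)
qed

lemma binomial_2k_le: "real (2 * k choose k) \<le> 4 ^ k"
proof -
  have "(2 * k choose k) \<le> 2 ^ (2 * k)" by (rule binomial_le_pow2)
  hence "real (2 * k choose k) \<le> real (2 ^ (2 * k))" by (simp only: of_nat_le_iff)
  thus ?thesis by (simp add: power_mult)
qed

lemma set_encode_less: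
  assumes "S \<subseteq> {1..n}"
  shows "set_encode S < 2 ^ Suc n"
proof -
  have "set_encode S \<le> (\<Sum>i=0..<Suc n. 2 ^ i)"
    unfolding set_encode_def using assms by (intro sum_mono2) auto
  also have "\<dots> = 2 ^ Suc n - 1" using sum_power2[of "Suc n"] by simp
  finally show ?thesis by (metis Suc_pred' less_Suc_eq_le zero_less_numeral zero_less_power)
qed

lemma length_family_le:
  assumes "distinct L" "set L \<subseteq> nsets {1..3 * n} n"
  shows "length L \<le> (3 * n choose n)"
proof -
  have "length L = card (set L)" using assms(1) by (rule distinct_card[symmetric])
  also have "\<dots> \<le> card (nsets {1..3 * n} n)"
    using assms(2) by (intro card_mono finite_imp_finite_nsets) auto
  also have "\<dots> = (3 * n choose n)" by (simp add: card_nsets)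
  finally show ?thesis .
qed

lemma family_array_less:
  assumes w: "3 * n + 1 \<le> w" and L: "distinct L" "set L \<subseteq> nsets {1..3 * n} n"
  shows "family_array L i < 2 ^ w"
proof -
  have w2: "(2::nat) ^ (3 * n + 1) \<le> 2 ^ w" using w by (rule power_increasing) simp
  show ?thesis
  proof (cases i)
    case 0
    have "length L \<le> 2 ^ (3 * n)"
      using length_family_le[OF L] binomial_le_pow2[of "3 * n" n] by linarith
    also have "\<dots> < 2 ^ (3 * n + 1)" by simp
    finally have "length L < 2 ^ w" using w2 by linarith
    thus ?thesis using 0 by (simp add: family_array_def array_of_def)
  next
    case (Suc j)
    show ?thesis
    proof (cases "j < length L")
      case True
      hence "L ! j \<in> nsets {1..3 * n} n" using L(2) nth_mem by blast
      hence "L ! j \<subseteq> {1..3 * n}" by (simp add: nsets_def)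
      from set_encode_less[OF this] w2 show ?thesis using Suc True by (simp add: family_array_def array_of_def)
    qed (simp add: Suc family_array_def array_of_def)
  qed
qed

context tripartition_tensor_algorithm
begin

text \<open>Quadratic in \<open>m\<close> because the seed has \<open>(3 * (c * m)) ^ 2\<close>
  bits. The remaining summands cover the lengths of powers, by the crude bound
  \<open>x ^ m <= 2 ^ (x * m)\<close>.\<close>

definition word_size :: "nat \<Rightarrow> nat" where
  "word_size m = (9 * c * c + 6 * c + pc + qc + R + Q + 20) * (m * m)"

lemma exponent_le_word_size:
  assumes "m > 0"
  shows "3 * (c * m) * (3 * (c * m)) + 2 * (3 * (c * m)) + (pc * m + qc * m + R * m + Q + 20) \<le> word_size m"
proof -
  have mm: "m \<le> m * m" "1 \<le> m * m" using assms by auto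
  have "3 * (c * m) * (3 * (c * m)) = 9 * c * c * (m * m)" by simp
  moreover have "2 * (3 * (c * m)) \<le> 6 * c * (m * m)" using mm(1) by simp
  moreover have "pc * m \<le> pc * (m * m)" "qc * m \<le> qc * (m * m)" "R * m \<le> R * (m * m)"
    using mm(1) by (intro mult_left_mono; simp)+
  moreover have "Q \<le> Q * (m * m)" "20 \<le> 20 * (m * m)" using mm(2) by simp_all
  ultimately show ?thesis unfolding word_size_def add_mult_distrib by linarith
qed

lemma power_le_two_power: "x ^ m \<le> (2::nat) ^ (x * m)"
proof -
  have "x ^ m \<le> (2 ^ x) ^ m" by (rule power_mono[OF less_imp_le[OF less_exp]]) simp
  thus ?thesis by (simp only: power_mult)
qed

lemma fits_word_size:
  assumes m: "m > 0"
  shows "fits (word_size m) m (reps m)"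
proof -
  let ?N = "3 * (c * m)" and ?w = "word_size m"
  note e = exponent_le_word_size[OF m]
  have lt: "x < 2 ^ ?w" if "x \<le> 2 ^ y" "y < ?w" for x y :: nat
  proof -
    have "(2::nat) ^ y < 2 ^ ?w" using that(2) by (rule power_strict_increasing) simp
    with that(1) show ?thesis by linarith
  qed
  have P: "pc ^ m \<le> 2 ^ (pc * m)" and q: "qc ^ m \<le> 2 ^ (qc * m)" and V: "R ^ m \<le> 2 ^ (R * m)"
    by (rule power_le_two_power)+
  have M: "reps m \<le> 2 ^ (6 + pc * m)"
  proof -
    have "pc ^ m div qc ^ m + 1 \<le> 2 ^ (pc * m) + 2 ^ (pc * m)"
      by (rule add_mono[OF order_trans[OF div_le_dividend P]]) simp
    hence "reps m \<le> 32 * (2 ^ (pc * m) + 2 ^ (pc * m))" unfolding reps_def by (rule mult_left_mono) simp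
    also have "\<dots> = 2 ^ (6 + pc * m)" by (simp add: power_add)
    finally show ?thesis .
  qed
  have B: "?N * ?N + 3 * R ^ m \<le> 2 ^ (?N * ?N + 2 + R * m)"
  proof -
    have "?N * ?N \<le> 2 ^ (?N * ?N)" by (rule less_imp_le[OF less_exp])
    also have "(2::nat) ^ (?N * ?N) \<le> 2 ^ (?N * ?N) * 2 ^ (R * m)" by simp
    finally have 1: "?N * ?N \<le> 2 ^ (?N * ?N) * 2 ^ (R * m)" .
    have "R ^ m \<le> 1 * 2 ^ (R * m)" using V by simp
    also have "\<dots> \<le> 2 ^ (?N * ?N) * 2 ^ (R * m)" by (rule mult_right_mono) simp_all
    finally have 2: "R ^ m \<le> 2 ^ (?N * ?N) * 2 ^ (R * m)" .
    have "?N * ?N + 3 * R ^ m \<le> 4 * (2 ^ (?N * ?N) * 2 ^ (R * m))" using 1 2 by linarith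
    also have "\<dots> = 2 ^ (?N * ?N + 2 + R * m)" by (simp add: power_add)
    finally show ?thesis .
  qed
  have MB: "reps m * (?N * ?N + 3 * R ^ m) \<le> 2 ^ ((6 + pc * m) + (?N * ?N + 2 + R * m))"
    unfolding power_add[of 2 "6 + pc * m"] by (rule mult_le_mono[OF M B])
  have "Q \<le> 2 ^ ?w" using e less_exp[of Q] lt[of Q Q] by linarith
  moreover have "pc ^ m < 2 ^ ?w" by (rule lt[OF P]) (use e in linarith)
  moreover have "qc ^ m < 2 ^ ?w" by (rule lt[OF q]) (use e in linarith)
  moreover have "R ^ m < 2 ^ ?w" by (rule lt[OF V]) (use e in linarith)
  moreover have "reps m < 2 ^ ?w" by (rule lt[OF M]) (use e in linarith)
  moreover have "?N * ?N + 3 * R ^ m < 2 ^ ?w" by (rule lt[OF B]) (use e in linarith)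
  moreover have "reps m * (?N * ?N + 3 * R ^ m) < 2 ^ ?w" by (rule lt[OF MB]) (use e in linarith)
  moreover have "?N * ?N + 2 * ?N + 2 \<le> ?w" using e by linarith
  ultimately show ?thesis unfolding fits_def Let_def by blast
qed

lemma bounded_instance:
  assumes "lists_family n L1 F1" "lists_family n L2 F2" "lists_family n L3 F3"
  shows "bounded (word_size (n div c + 1)) (instance_state n L1 L2 L3)"
proof -
  let ?m = "n div c + 1"
  have "n \<le> c * ?m" using dividend_less_times_div[OF c_pos, of n] by simp
  hence w: "3 * n + 1 \<le> word_size ?m" using exponent_le_word_size[of ?m] by linarith
  have n: "n < 2 ^ word_size ?m" using w by (intro less_two_power) linarith
  have fam: "distinct L1 \<and> set L1 \<subseteq> nsets {1..3 * n} n" "distinct L2 \<and> set L2 \<subseteq> nsets {1..3 * n} n"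
    "distinct L3 \<and> set L3 \<subseteq> nsets {1..3 * n} n" using assms by (auto simp: lists_family_def)
  show ?thesis unfolding bounded_def instance_state_def
    using n family_array_less[OF w, of L1] family_array_less[OF w, of L2] family_array_less[OF w, of L3] fam
    by (auto simp: array_of_def)
qed

text \<open>The factor per unit of \<open>m\<close>: \<open>R\<close> for evaluating the transforms
  and \<open>pc / qc\<close> for the number of repetitions.\<close>

definition growth :: real where
  "growth = real R * real pc / real qc"

lemma qc_le_pc: "qc \<le> pc"
proof -
  have "(3 * k choose k) * (2 * k choose k) \<le> 27 ^ k"
    using card_words_le[of k] unfolding card_words_binomial .
  hence "qc \<le> (27 ^ k) ^ r" unfolding qc_eq by (rule power_mono) simp
  thus ?thesis by (simp add: pc_eq c_eq power_mult)
qed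

lemma reps_le: "real (reps m) \<le> 64 * (real pc / real qc) ^ m"
proof -
  have "real (pc ^ m div qc ^ m) \<le> real (pc ^ m) / real (qc ^ m)" by (rule of_nat_div_le_of_nat)
  also have "\<dots> = (real pc / real qc) ^ m" by (simp add: power_divide)
  finally have 1: "real (pc ^ m div qc ^ m) \<le> (real pc / real qc) ^ m" .
  have "1 \<le> real pc / real qc" using qc_le_pc pc_qc_pos by (simp add: field_simps)
  hence "1 \<le> (real pc / real qc) ^ m" by (rule one_le_power)
  with 1 show ?thesis by (simp add: reps_def)
qed

text \<open>The lower bound on \<open>R\<close> cancels one binomial coefficient of
  \<open>qc\<close>, and the other one is at most \<open>4 ^ k\<close>. Since a family has at most
  \<open>(27 / 4) ^ n\<close> members, the time for reading the input stays below
  \<open>growth ^ m\<close>.\<close>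

lemma growth_ge:
  assumes "(3 * k choose k) ^ r \<le> R"
  shows "(27 / 4) ^ c \<le> growth"
proof -
  let ?a = "real (3 * k choose k)" and ?b = "real (2 * k choose k)"
  have pos: "?a > 0" "?b > 0" using binomial_3k_pos[of k] by simp_all
  have "(27 / 4 :: real) ^ c = 27 ^ c / (4 ^ k) ^ r" by (simp add: power_divide c_eq power_mult)
  also have "\<dots> \<le> 27 ^ c / ?b ^ r"
    using binomial_2k_le[of k] pos by (intro divide_left_mono power_mono) auto
  also have "\<dots> = ?a ^ r * 27 ^ c / (?a * ?b) ^ r" using pos by (simp add: power_mult_distrib)
  also have "\<dots> \<le> real R * 27 ^ c / (?a * ?b) ^ r"
  proof (intro divide_right_mono mult_right_mono)
    have "real ((3 * k choose k) ^ r) \<le> real R" using assms by (simp only: of_nat_le_iff)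
    thus "?a ^ r \<le> real R" by simp
  qed (use pos in auto)
  also have "\<dots> = growth" unfolding growth_def by (simp add: pc_eq qc_eq)
  finally show ?thesis .
qed

text \<open>The exponent 5 comes from the repetitions: up to constants each takes
  \<open>m ^ 3 * R ^ m\<close> charges, from the factors \<open>N * N\<close> and
  \<open>m + 1\<close> in \<open>rep_steps\<close>, and a charge is proportional to the word size,
  which contributes \<open>m ^ 2\<close>.\<close>

lemma cost_bound:
  assumes NR: "(3 * k choose k) ^ r \<le> R"
  shows "\<exists>K\<ge>0. \<forall>n l1 l2 l3. l1 \<le> (3 * n choose n) \<longrightarrow> l2 \<le> (3 * n choose n) \<longrightarrow> l3 \<le> (3 * n choose n) \<longrightarrow>
    (let m = n div c + 1; w = word_size m in
     real (70 * (3 * (c * m) + m + l1 + l2 + l3 + 1) * s1 * w + 1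
         + (reps m * rep_bits m + 2) * (40 * w) + 1 + ((reps m + 1) * (rep_steps m + 5)) * s2 * w)
       \<le> K * (real m ^ 5 * growth ^ m))"
proof -
  define \<kappa> where "\<kappa> = real (9 * c * c + 6 * c + pc + qc + R + Q + 20)"
  define K where "K = 70 * (3 * real c + 5) * real s1 * \<kappa> + 2 + (64 * (9 * real c * real c + 3) + 2) * (40 * \<kappa>)
    + (65 * (300 * (9 * real c * real c + 1) * 2 + 5)) * real s2 * \<kappa>"
  have \<kappa>0: "\<kappa> \<ge> 0" by (simp add: \<kappa>_def)
  have K0: "K \<ge> 0" unfolding K_def using \<kappa>0 by simp
  have main: "real (70 * (3 * (c * m) + m + l1 + l2 + l3 + 1) * s1 * w + 1
         + (reps m * rep_bits m + 2) * (40 * w) + 1 + ((reps m + 1) * (rep_steps m + 5)) * s2 * w)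
       \<le> K * (real m ^ 5 * growth ^ m)"
    if m: "m = n div c + 1" and w: "w = word_size m"
      and l: "l1 \<le> (3 * n choose n)" "l2 \<le> (3 * n choose n)" "l3 \<le> (3 * n choose n)" for n l1 l2 l3 m w
  proof -
    define x where "x = real m"
    define p where "p = (real pc / real qc) ^ m"
    define V where "V = real R ^ m"
    define g where "g = growth ^ m"
    define C where "C = real c"
    have x1: "x \<ge> 1" by (simp add: x_def m)
    have p1: "p \<ge> 1"
    proof -
      have "1 \<le> real pc / real qc" using qc_le_pc pc_qc_pos by (simp add: field_simps)
      thus ?thesis unfolding p_def by (rule one_le_power)
    qed
    have V1: "V \<ge> 1" unfolding V_def using R_pos by (intro one_le_power) simp
    have g: "g = p * V" unfolding g_def p_def V_def growth_def
      by (simp add: power_mult_distrib[symmetric] mult.commute[of "real R"])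
    have g1: "g \<ge> 1" unfolding g using mult_mono[OF p1 V1] p1 by simp
    have C0: "C \<ge> 0" by (simp add: C_def)
    have nm: "n \<le> c * m" unfolding m using dividend_less_times_div[OF c_pos, of n] by simp
    have "real (3 * n choose n) \<le> (27 / 4) ^ n" by (rule binomial_3n_le)
    also have "\<dots> \<le> (27 / 4) ^ (c * m)" using nm by (rule power_increasing) simp
    also have "\<dots> = ((27 / 4) ^ c) ^ m" by (rule power_mult)
    also have "\<dots> \<le> g" unfolding g_def using growth_ge[OF NR] by (rule power_mono) simp
    finally have bg: "real (3 * n choose n) \<le> g" .
    have lg: "real l1 \<le> g" "real l2 \<le> g" "real l3 \<le> g"
      using l bg by (meson of_nat_mono order_trans)+
    have W: "real w = \<kappa> * x ^ 2" by (simp add: w word_size_def \<kappa>_def x_def power2_eq_square)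
    have M: "real (reps m) \<le> 64 * p" unfolding p_def by (rule reps_le)
    have x2: "1 \<le> x ^ 2" "x \<le> x ^ 2" "x ^ 2 \<le> x ^ 3" "x ^ 3 \<le> x ^ 5" "x ^ 4 \<le> x ^ 5"
      using x1 power_increasing[of 1 2 x] power_increasing[of 2 3 x] power_increasing[of 3 5 x] power_increasing[of 4 5 x]
      by simp_all
    have pow: "x ^ 2 * x ^ 3 = x ^ 5" "x ^ 2 * x ^ 2 = x ^ 4" "x * x ^ 2 = x ^ 3" by (simp_all add: power_add[symmetric] flip: power_Suc)
    have T1: "real (70 * (3 * (c * m) + m + l1 + l2 + l3 + 1) * s1 * w) \<le> 70 * (3 * C + 5) * real s1 * \<kappa> * (x ^ 5 * g)"
    proof -
      have "real (3 * (c * m) + m + l1 + l2 + l3 + 1) \<le> 3 * C * x + x + g + g + g + 1"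
        using lg by (simp add: C_def x_def)
      also have "\<dots> \<le> (3 * C + 5) * (x * g)"
      proof -
        have xg: "x \<le> x * g" "g \<le> x * g" "1 \<le> x * g" using x1 g1 mult_mono[OF x1 g1] by (simp_all add: mult_le_cancel_left1 mult_le_cancel_right1)
        have "3 * C * x \<le> 3 * C * (x * g)" using C0 xg by (intro mult_left_mono) auto
        with xg show ?thesis by (simp add: distrib_right)
      qed
      finally have "real (3 * (c * m) + m + l1 + l2 + l3 + 1) \<le> (3 * C + 5) * (x * g)" .
      hence "70 * real (3 * (c * m) + m + l1 + l2 + l3 + 1) * real s1 * (\<kappa> * x ^ 2) \<le> 70 * ((3 * C + 5) * (x * g)) * real s1 * (\<kappa> * x ^ 2)"
        using \<kappa>0 x1 by (intro mult_right_mono mult_left_mono) auto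
      also have "\<dots> = 70 * (3 * C + 5) * real s1 * \<kappa> * ((x * x ^ 2) * g)" by (simp only: mult_ac)
      also have "\<dots> \<le> 70 * (3 * C + 5) * real s1 * \<kappa> * (x ^ 5 * g)"
        unfolding pow using x2 g1 C0 \<kappa>0 by (intro mult_left_mono mult_right_mono) auto
      finally show ?thesis by (simp only: of_nat_mult W of_nat_numeral)
    qed
    have T2: "real ((reps m * rep_bits m + 2) * (40 * w)) \<le> (64 * (9 * C * C + 3) + 2) * (40 * \<kappa>) * (x ^ 5 * g)"
    proof -
      have "real (rep_bits m) = 9 * C * C * x ^ 2 + 3 * V"
        by (simp add: rep_bits_def C_def x_def V_def power2_eq_square)
      also have "\<dots> \<le> (9 * C * C + 3) * (x ^ 2 * V)"
      proof -
        have "x ^ 2 \<le> x ^ 2 * V" "V \<le> x ^ 2 * V" using x2 V1 by (simp_all add: mult_le_cancel_left1 mult_le_cancel_right1)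
        moreover from this(1) have "9 * C * C * x ^ 2 \<le> 9 * C * C * (x ^ 2 * V)" using C0 by (intro mult_left_mono) auto
        ultimately show ?thesis by (simp add: distrib_right)
      qed
      finally have b: "real (rep_bits m) \<le> (9 * C * C + 3) * (x ^ 2 * V)" .
      have "real (reps m) * real (rep_bits m) \<le> 64 * p * ((9 * C * C + 3) * (x ^ 2 * V))"
        using M b p1 by (intro mult_mono) auto
      also have "\<dots> = 64 * (9 * C * C + 3) * (x ^ 2 * g)" by (simp only: g mult_ac)
      finally have "real (reps m) * real (rep_bits m) + 2 \<le> 64 * (9 * C * C + 3) * (x ^ 2 * g) + 2 * (x ^ 2 * g)"
        using mult_mono[OF x2(1) g1] x2 by simp
      hence "real (reps m) * real (rep_bits m) + 2 \<le> (64 * (9 * C * C + 3) + 2) * (x ^ 2 * g)" by (simp only: distrib_right)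
      hence "(real (reps m) * real (rep_bits m) + 2) * (40 * (\<kappa> * x ^ 2)) \<le> ((64 * (9 * C * C + 3) + 2) * (x ^ 2 * g)) * (40 * (\<kappa> * x ^ 2))"
        using \<kappa>0 by (intro mult_right_mono) auto
      also have "\<dots> = (64 * (9 * C * C + 3) + 2) * (40 * \<kappa>) * ((x ^ 2 * x ^ 2) * g)" by (simp only: mult_ac)
      also have "\<dots> \<le> (64 * (9 * C * C + 3) + 2) * (40 * \<kappa>) * (x ^ 5 * g)"
        unfolding pow using x2 g1 C0 \<kappa>0 by (intro mult_left_mono mult_right_mono) auto
      finally show ?thesis by (simp only: of_nat_mult of_nat_add W of_nat_numeral)
    qed
    have T3: "real (((reps m + 1) * (rep_steps m + 5)) * s2 * w) \<le> (65 * (300 * (9 * C * C + 1) * 2 + 5)) * real s2 * \<kappa> * (x ^ 5 * g)"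
    proof -
      have a: "9 * C * C * x ^ 2 + 1 \<le> (9 * C * C + 1) * x ^ 2" using x2 by (simp add: distrib_right)
      have "real (rep_steps m) = 150 * ((9 * C * C * x ^ 2 + 1) * (x + 1) * (V + 1))"
        by (simp add: rep_steps_def C_def x_def V_def power2_eq_square algebra_simps)
      also have "\<dots> \<le> 150 * (((9 * C * C + 1) * x ^ 2) * (2 * x) * (2 * V))"
        using a x1 V1 C0 by (intro mult_left_mono mult_mono) auto
      also have "\<dots> = 300 * (9 * C * C + 1) * 2 * ((x * x ^ 2) * V)" by simp
      finally have "real (rep_steps m) + 5 \<le> 300 * (9 * C * C + 1) * 2 * (x ^ 3 * V) + 5 * (x ^ 3 * V)"
        unfolding pow using mult_mono[of 1 "x ^ 3" 1 V] x2 V1 x1 by simp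
      hence b: "real (rep_steps m) + 5 \<le> (300 * (9 * C * C + 1) * 2 + 5) * (x ^ 3 * V)" by (simp only: distrib_right)
      have "(real (reps m) + 1) * (real (rep_steps m) + 5) \<le> (65 * p) * ((300 * (9 * C * C + 1) * 2 + 5) * (x ^ 3 * V))"
        using M b p1 by (intro mult_mono) auto
      hence "(real (reps m) + 1) * (real (rep_steps m) + 5) * real s2 * (\<kappa> * x ^ 2) \<le>
          (65 * p) * ((300 * (9 * C * C + 1) * 2 + 5) * (x ^ 3 * V)) * real s2 * (\<kappa> * x ^ 2)"
        using \<kappa>0 by (intro mult_right_mono) auto
      also have "\<dots> = (65 * (300 * (9 * C * C + 1) * 2 + 5)) * real s2 * \<kappa> * ((x ^ 2 * x ^ 3) * g)"
        unfolding g by (simp only: mult_ac)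
      finally show ?thesis unfolding pow by (simp only: of_nat_mult of_nat_add W of_nat_numeral of_nat_1)
    qed
    have T0: "2 \<le> 2 * (x ^ 5 * g)" using mult_mono[of 1 "x ^ 5" 1 g] x2 g1 x1 by simp
    have "real (70 * (3 * (c * m) + m + l1 + l2 + l3 + 1) * s1 * w + 1
         + (reps m * rep_bits m + 2) * (40 * w) + 1 + ((reps m + 1) * (rep_steps m + 5)) * s2 * w) =
      real (70 * (3 * (c * m) + m + l1 + l2 + l3 + 1) * s1 * w) + 2 + real ((reps m * rep_bits m + 2) * (40 * w))
        + real (((reps m + 1) * (rep_steps m + 5)) * s2 * w)"
      by (simp only: of_nat_add of_nat_1)
    also have "\<dots> \<le> 70 * (3 * C + 5) * real s1 * \<kappa> * (x ^ 5 * g) + 2 * (x ^ 5 * g) +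
        (64 * (9 * C * C + 3) + 2) * (40 * \<kappa>) * (x ^ 5 * g) +
        (65 * (300 * (9 * C * C + 1) * 2 + 5)) * real s2 * \<kappa> * (x ^ 5 * g)"
      by (intro add_mono T0 T1 T2 T3)
    also have "\<dots> = K * (x ^ 5 * g)" unfolding K_def C_def by (simp only: distrib_right)
    finally show ?thesis unfolding x_def g_def .
  qed
  show ?thesis
    unfolding Let_def by (intro exI[of _ K] conjI allI impI K0, rule main[OF refl refl])
qed

end

lemma decides_within_mono: "decides_within c s a B \<Longrightarrow> B \<le> B' \<Longrightarrow> decides_within c s a B'"
  unfolding decides_within_def by (elim exE, rule exI) (auto intro: order_trans)

theorem theorem1p9:
  fixes k :: nat and \<epsilon> :: real
  assumes "k \<ge> 1" and "\<epsilon> > 0"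
  shows "\<exists>algorithm. solves_balanced_tripartitioning_in_time algorithm
    (\<lambda>n. ((asymptotic_rank (tripartition_tensor k :: (nat set, 'f::field) tensor) + \<epsilon>) * 27 ^ k
           / (real (3 * k choose k) * real (2 * k choose k))) powr (real n / real k))"
proof -
  let ?T = "tripartition_tensor k :: (nat set, 'f) tensor"
  define ar where "ar = asymptotic_rank ?T"
  define b where "b = real (3 * k choose k) * real (2 * k choose k)"
  have b0: "b > 0" unfolding b_def using binomial_3k_pos[of k] by simp
  from choose_exponent[OF assms(2), of k, where 'f = 'f] obtain r where r: "r > 0" "0 < ar + \<epsilon> / 2"
    "real (tensor_rank (kronecker_power ?T r)) \<le> (ar + \<epsilon> / 2) ^ r"
    unfolding ar_def by blast
  define R where "R = tensor_rank (kronecker_power ?T r)"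
  have k: "k > 0" using assms(1) by simp
  from algorithm_exists[OF k r(1), where 'f = 'f, folded R_def]
  obtain Q and A :: "'f set" and code add mul ca cb cc E where
    loc: "tripartition_tensor_algorithm (k * r) R Q (27 ^ (k * r))
      (((3 * k choose k) * (2 * k choose k)) ^ r) A code add mul ca cb cc E k r ((3 * k choose k) ^ r)"
    by (elim exE)
  interpret tripartition_tensor_algorithm "k * r" R Q "27 ^ (k * r)"
    "((3 * k choose k) * (2 * k choose k)) ^ r" A code add mul ca cb cc E k r "(3 * k choose k) ^ r"
    by (rule loc)
  define g where "g = (ar + \<epsilon> / 2) * 27 ^ k / b"
  define h where "h = (ar + \<epsilon>) * 27 ^ k / b"
  have gh: "0 < g" "g < h" unfolding g_def h_def using r(2) b0 assms(2) by (auto intro!: divide_strict_right_mono)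
  have "growth \<le> g ^ r"
  proof -
    have "growth = real R * (27 ^ k) ^ r / b ^ r" unfolding growth_def b_def by (simp add: power_mult)
    also have "\<dots> \<le> (ar + \<epsilon> / 2) ^ r * (27 ^ k) ^ r / b ^ r"
      using r(3) b0 unfolding R_def by (intro divide_right_mono mult_right_mono) auto
    also have "\<dots> = g ^ r" unfolding g_def by (simp add: power_divide power_mult_distrib)
    finally show ?thesis .
  qed
  have NR: "(3 * k choose k) ^ r \<le> R" by (rule N1_le)
  have "1 \<le> (27 / 4 :: real) ^ (k * r)" by (rule one_le_power) simp
  with growth_ge[OF NR] have G1: "1 \<le> growth" by linarith
  \<comment> \<open>Needed to enlarge exponents of \<open>g\<close> below; it follows since
    \<open>g ^ r\<close> is at least \<open>growth\<close>, which is at least a power of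
    27/4.\<close>
  have g1: "1 \<le> g"
  proof (rule ccontr)
    assume "\<not> 1 \<le> g"
    hence "g ^ r < 1 ^ r" using gh(1) r(1) by (intro power_strict_mono) simp_all
    hence "g ^ r < 1" by simp
    with G1 \<open>growth \<le> g ^ r\<close> show False by linarith
  qed
  \<comment> \<open>\<open>g\<close> spends half of \<open>\<epsilon>\<close> and \<open>h\<close>
    all of it, so the ratio exceeds 1 and its powers can pay for \<open>m ^ 5\<close>.\<close>
  define \<rho> where "\<rho> = h / g"
  have \<rho>: "\<rho> > 1" unfolding \<rho>_def using gh by simp
  from polynomial_le_exponential[OF \<rho>, of 5] obtain K1 where K1: "K1 > 0" "\<And>x. x \<ge> 0 \<Longrightarrow> (x + 1) ^ 5 \<le> K1 * \<rho> powr x"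
    by blast
  from cost_bound[OF NR, of "step_cost prologue" "step_cost (for_loop ''j'' (var ''M'') rep)"] obtain K2 where K2: "K2 \<ge> 0"
    "\<forall>n l1 l2 l3. l1 \<le> (3 * n choose n) \<longrightarrow> l2 \<le> (3 * n choose n) \<longrightarrow> l3 \<le> (3 * n choose n) \<longrightarrow>
    (let m = n div (k * r) + 1; w = word_size m in
     real (70 * (3 * ((k * r) * m) + m + l1 + l2 + l3 + 1) * step_cost prologue * w + 1
         + (reps m * rep_bits m + 2) * (40 * w) + 1 + ((reps m + 1) * (rep_steps m + 5)) * step_cost (for_loop ''j'' (var ''M'') rep) * w)
       \<le> K2 * (real m ^ 5 * growth ^ m))"
    by (elim exE conjE)
  have time: "real m ^ 5 * growth ^ m \<le> (K1 * g ^ r) * h powr (real n / real k)" if m: "m = n div (k * r) + 1" for n m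
  proof -
    let ?x = "real n / real k"
    have x0: "?x \<ge> 0" by simp
    have "real (n div (k * r)) \<le> real n / real (k * r)" by (rule of_nat_div_le_of_nat)
    hence q: "real (n div (k * r)) * real r \<le> ?x" using k r(1) by (simp add: field_simps)
    have "real (n div (k * r)) * 1 \<le> real (n div (k * r)) * real r" using r(1) by (intro mult_left_mono) auto
    hence "real m \<le> ?x + 1" using q by (simp add: m)
    hence "real m ^ 5 \<le> (?x + 1) ^ 5" by (rule power_mono) simp
    also have "\<dots> \<le> K1 * \<rho> powr ?x" by (rule K1(2)[OF x0])
    finally have 1: "real m ^ 5 \<le> K1 * \<rho> powr ?x" .
    have "growth ^ m \<le> (g ^ r) ^ m" using \<open>growth \<le> g ^ r\<close> G1 by (intro power_mono) auto
    also have "\<dots> = g powr (real r * real m)" using gh(1) by (simp add: power_mult[symmetric] powr_realpow[symmetric] powr_powr)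
    \<comment> \<open>Rounding up in \<open>m\<close> makes \<open>r * m\<close> exceed
      \<open>n / k\<close> by at most \<open>r\<close>, which costs only the constant factor
      \<open>g ^ r\<close>.\<close>
    also have "\<dots> \<le> g powr (real r + ?x)"
      using q g1 by (intro powr_mono) (simp_all add: m distrib_left mult.commute)
    also have "\<dots> = g ^ r * g powr ?x" using gh(1) by (simp add: powr_add powr_realpow)
    finally have 2: "growth ^ m \<le> g ^ r * g powr ?x" .
    have "real m ^ 5 * growth ^ m \<le> (K1 * \<rho> powr ?x) * (g ^ r * g powr ?x)"
      using 1 2 G1 K1(1) by (intro mult_mono) auto
    also have "\<dots> = (K1 * g ^ r) * (\<rho> powr ?x * g powr ?x)" by (simp only: mult_ac)
    also have "\<rho> powr ?x * g powr ?x = (\<rho> * g) powr ?x" using gh \<rho> by (simp add: powr_mult)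
    also have "\<rho> * g = h" unfolding \<rho>_def using gh(1) by simp
    finally show ?thesis .
  qed
  have "solves_balanced_tripartitioning_in_time program (\<lambda>n. h powr (real n / real k))"
    unfolding solves_balanced_tripartitioning_in_time_def
  proof (intro exI[of _ "K2 * (K1 * g ^ r)"] allI impI)
    fix n F1 F2 F3 L1 L2 L3
    assume F: "lists_family n L1 F1" "lists_family n L2 F2" "lists_family n L3 F3"
    let ?m = "n div (k * r) + 1"
    have L: "set L1 = F1" "set L2 = F2" "set L3 = F3" "distinct L1" "distinct L2" "distinct L3"
      "set L1 \<subseteq> nsets {1..3 * n} n" "set L2 \<subseteq> nsets {1..3 * n} n" "set L3 \<subseteq> nsets {1..3 * n} n"
      using F by (auto simp: lists_family_def)
    have "decides_within program (instance_state n L1 L2 L3) (balanced_tripartition n (set L1) (set L2) (set L3))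
      (real (70 * (3 * (k * r * ?m) + ?m + length L1 + length L2 + length L3 + 1) * step_cost prologue * word_size ?m + 1
         + (reps ?m * rep_bits ?m + 2) * (40 * word_size ?m) + 1
         + ((reps ?m + 1) * (rep_steps ?m + 5)) * step_cost (for_loop ''j'' (var ''M'') rep) * word_size ?m))"
      by (rule decides[OF fits_word_size bounded_instance[OF F] L(7,8,9)]) simp
    moreover have "real (70 * (3 * (k * r * ?m) + ?m + length L1 + length L2 + length L3 + 1) * step_cost prologue * word_size ?m + 1
         + (reps ?m * rep_bits ?m + 2) * (40 * word_size ?m) + 1
         + ((reps ?m + 1) * (rep_steps ?m + 5)) * step_cost (for_loop ''j'' (var ''M'') rep) * word_size ?m)
       \<le> K2 * (real ?m ^ 5 * growth ^ ?m)"
      using K2(2)[rule_format, OF length_family_le[OF L(4,7)] length_family_le[OF L(5,8)] length_family_le[OF L(6,9)]]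
      unfolding Let_def .
    moreover have "K2 * (real ?m ^ 5 * growth ^ ?m) \<le> K2 * ((K1 * g ^ r) * h powr (real n / real k))"
      using time[OF refl] K2(1) by (rule mult_left_mono)
    ultimately show "decides_within program (instance_state n L1 L2 L3) (balanced_tripartition n F1 F2 F3)
        (K2 * (K1 * g ^ r) * h powr (real n / real k))"
      unfolding L(1-3) mult.assoc[of K2] by (meson decides_within_mono order_trans)
  qed
  thus ?thesis unfolding h_def b_def ar_def by blast
qed

end
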